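(* Let $r>1$ be real and let $f:I\to I$ be a $\mathcal{C}^r$ map with $h_{\rm top}(f)>\frac{R(f)}{r}$. Let $(f_k)$ be a sequence of $\mathcal{C}^r$ maps $I\to I$ with $f_k\to f$, $\mathcal{C}^r$-weakly, and let $(\nu_k)_{k\in\mathbb{N}}$ be a sequence of measures, with $\nu_k$ being $f_k$-invariant, that approximates $f$ in entropy. Then the weak-$*$ limit $\mu$ of $(\nu_k)$ is a measure of maximal entropy for $f$ and $$\lim_{k\to\infty}\lambda_{f_k}(\nu_k)=\lambda_f(\mu).$$
   Context: $I$ denotes the interval $[0,1]$ or the circle $\mathbb{S}^1$. For real $r>1$, a map $g:I\to I$ is $\mathcal{C}^r$ if it is $\mathcal{C}^{\lfloor r\rfloor}$ and $g^{(\lfloor r\rfloor)}$ is $(r-\lfloor r\rfloor)$-Hölder. A sequence of $\mathcal{C}^r$ maps $(f_k)$ converges $\mathcal{C}^r$-weakly to $f$ if it converges to $f$ in the $\mathcal{C}^1$-topology and is bounded in the $\mathcal{C}^r$-norm. All measures are Borel probability measures. $\|\cdot\|_\infty$ is the supremum over $I$, and $\log^+=\max\{0,\log\}$. For a $\mathcal{C}^r$ map $g$: $\lambda_g(x):=\limsup_{n\to\infty}\frac1n\sum_{i=0}^{n-1}\log|g'(g^ix)|$; $\lambda_g(\nu):=\int\lambda_g(x)\,d\nu(x)$ for $g$-invariant $\nu$ (this equals $\int\log|g'|\,d\nu$); $R(g):=\lim_{n\to\infty}\frac1n\log^+\|(g^n)'\|_\infty$; $h_g(\nu)$ is metric entropy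 and $h_{\rm top}(g)$ topological entropy. A measure of maximal entropy for $f$ is an $f$-invariant probability $\nu$ with $h_f(\nu)=h_{\rm top}(f)$. A sequence $(\nu_k)$ of $f_k$-invariant measures approximates $f$ in entropy if each $\nu_k$ is ergodic for $f_k$, $\nu_k$ converges in the weak-$*$ topology to some $\mu$, and $\lim_{k\to\infty}h_{f_k}(\nu_k)=h_{\rm top}(f)$. *)

theory Defs
  imports "HOL-Probability.Probability"
begin

section \<open>The interval and the circle\<close>

datatype one_dim = Interval | Circle

text \<open>
  Both spaces are realised inside the complex plane: the segment from 0 to 1 and the unit circle.
  Each is parametrised by a real coordinate \<open>t\<close> in a coordinate domain, which is the whole line
  (the universal cover) for the circle. Derivatives are taken with respect to \<open>t\<close>.
\<close>

fun coord_dom :: "one_dim \<Rightarrow> real set" where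
  "coord_dom Interval = {0..1}"
| "coord_dom Circle = UNIV"

fun param :: "one_dim \<Rightarrow> real \<Rightarrow> complex" where
  "param Interval t = complex_of_real t"
| "param Circle t = cis (2 * pi * t)"

definition points :: "one_dim \<Rightarrow> complex set" where
  "points I = param I ` coord_dom I"

lemma points_Interval: "points Interval = complex_of_real ` {0..1}"
  by (simp add: points_def image_def)

lemma points_Circle: "points Circle = sphere 0 1"
proof
  show "points Circle \<subseteq> sphere 0 1"
    by (auto simp: points_def)
  show "sphere 0 1 \<subseteq> points Circle"
  proof
    fix z :: complex
    assume "z \<in> sphere 0 1"
    then have "norm z = 1" and "z \<noteq> 0"
      by auto
    then have "cis (Arg z) = z"
      by (simp add: cis_Arg sgn_eq)
    then have "param Circle (Arg z / (2 * pi)) = z"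
      by simp
    then show "z \<in> points Circle"
      unfolding points_def by (metis UNIV_I coord_dom.simps(2) imageI)
  qed
qed

section \<open>Smooth maps\<close>

text \<open>
  A continuous lift of \<open>g\<close> to the coordinate domain. For the circle it exists for continuous \<open>g\<close>
  and is unique up to an additive integer, so its derivatives of order at least 1 do not depend
  on the choice. For the interval it is \<open>g\<close> itself on \<open>[0,1]\<close>.
\<close>

definition is_lift :: "one_dim \<Rightarrow> (complex \<Rightarrow> complex) \<Rightarrow> (real \<Rightarrow> real) \<Rightarrow> bool" where
  "is_lift I g G \<longleftrightarrow> continuous_on (coord_dom I) G \<and> G \<in> coord_dom I \<rightarrow> coord_dom I \<and>
     (\<forall>t\<in>coord_dom I. param I (G t) = g (param I t))"

definition lift_of :: "one_dim \<Rightarrow> (complex \<Rightarrow> complex) \<Rightarrow> real \<Rightarrow> real" where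
  "lift_of I g = (SOME G. is_lift I g G)"

text \<open>The derivatives are one-sided at the endpoints of \<open>[0,1]\<close>.\<close>

definition nderiv_within :: "real set \<Rightarrow> nat \<Rightarrow> (real \<Rightarrow> real) \<Rightarrow> real \<Rightarrow> real" where
  "nderiv_within D k G = ((\<lambda>H t. vector_derivative H (at t within D)) ^^ k) G"

text \<open>The \<open>k\<close>-th derivative of \<open>g\<close> (for \<open>k \<ge> 1\<close>) at the point with coordinate \<open>t\<close>.\<close>

definition coord_deriv :: "one_dim \<Rightarrow> nat \<Rightarrow> (complex \<Rightarrow> complex) \<Rightarrow> real \<Rightarrow> real" where
  "coord_deriv I k g = nderiv_within (coord_dom I) k (lift_of I g)"

definition map_deriv :: "one_dim \<Rightarrow> (complex \<Rightarrow> complex) \<Rightarrow> complex \<Rightarrow> real" where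
  "map_deriv I g x = coord_deriv I 1 g (inv_into (coord_dom I) (param I) x)"

text \<open>
  For integer \<open>r\<close> the Hoelder exponent is 0 and the condition only says that the top derivative
  has bounded oscillation. For the circle, Hoelder continuity in the coordinate \<open>t\<close> is equivalent
  to Hoelder continuity for the metric of the circle, by periodicity.
\<close>

definition top_deriv_hoelder :: "one_dim \<Rightarrow> real \<Rightarrow> real \<Rightarrow> (complex \<Rightarrow> complex) \<Rightarrow> bool" where
  "top_deriv_hoelder I r C g \<longleftrightarrow>
     (\<forall>s\<in>coord_dom I. \<forall>t\<in>coord_dom I.
        \<bar>coord_deriv I (nat \<lfloor>r\<rfloor>) g s - coord_deriv I (nat \<lfloor>r\<rfloor>) g t\<bar>
          \<le> C * \<bar>s - t\<bar> powr (r - of_int \<lfloor>r\<rfloor>))"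

definition Cr_map :: "one_dim \<Rightarrow> real \<Rightarrow> (complex \<Rightarrow> complex) \<Rightarrow> bool" where
  "Cr_map I r g \<longleftrightarrow>
     g \<in> points I \<rightarrow> points I \<and> continuous_on (points I) g \<and>
     (\<forall>k < nat \<lfloor>r\<rfloor>. \<forall>t\<in>coord_dom I.
        coord_deriv I k g differentiable (at t within coord_dom I)) \<and>
     continuous_on (coord_dom I) (coord_deriv I (nat \<lfloor>r\<rfloor>) g) \<and>
     (\<exists>C. top_deriv_hoelder I r C g)"

text \<open>
  The \<open>C\<^sup>r\<close> norm of \<open>g\<close> is at most \<open>C\<close>. The term of order 0 is omitted: \<open>g\<close> takes its
  values in the compact space \<open>I\<close>, so this term is always bounded.
\<close>

definition Cr_norm_le :: "one_dim \<Rightarrow> real \<Rightarrow> real \<Rightarrow> (complex \<Rightarrow> complex) \<Rightarrow> bool" where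
  "Cr_norm_le I r C g \<longleftrightarrow>
     (\<forall>k\<in>{1..nat \<lfloor>r\<rfloor>}. \<forall>t\<in>coord_dom I. \<bar>coord_deriv I k g t\<bar> \<le> C) \<and>
     top_deriv_hoelder I r C g"

definition Cr_weakly_converges ::
    "one_dim \<Rightarrow> real \<Rightarrow> (nat \<Rightarrow> complex \<Rightarrow> complex) \<Rightarrow> (complex \<Rightarrow> complex) \<Rightarrow> bool" where
  "Cr_weakly_converges I r fs f \<longleftrightarrow>
     uniform_limit (points I) fs f sequentially \<and>
     uniform_limit (points I) (\<lambda>k. map_deriv I (fs k)) (map_deriv I f) sequentially \<and>
     (\<exists>C. \<forall>k. Cr_norm_le I r C (fs k))"

text \<open>The growth rate \<open>R(g)\<close>; the limit exists by submultiplicativity.\<close>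

definition growth_rate :: "one_dim \<Rightarrow> (complex \<Rightarrow> complex) \<Rightarrow> real" where
  "growth_rate I g =
     lim (\<lambda>n. max 0 (ln (SUP x\<in>points I. \<bar>map_deriv I (g ^^ n) x\<bar>)) / real n)"

section \<open>Invariant measures and entropy\<close>

definition borel_prob_on :: "'a::topological_space set \<Rightarrow> 'a measure \<Rightarrow> bool" where
  "borel_prob_on X M \<longleftrightarrow> prob_space M \<and> sets M = sets (restrict_space borel X)"

definition invariant_measure :: "('a \<Rightarrow> 'a) \<Rightarrow> 'a measure \<Rightarrow> bool" where
  "invariant_measure T M \<longleftrightarrow> T \<in> measurable M M \<and> distr M M T = M"

definition ergodic_measure :: "('a \<Rightarrow> 'a) \<Rightarrow> 'a measure \<Rightarrow> bool" where
  "ergodic_measure T M \<longleftrightarrow> invariant_measure T M \<and>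
     (\<forall>A\<in>sets M. T -` A \<inter> space M = A \<longrightarrow> measure M A = 0 \<or> measure M A = 1)"

definition weak_star_converges ::
    "'a::topological_space set \<Rightarrow> (nat \<Rightarrow> 'a measure) \<Rightarrow> 'a measure \<Rightarrow> bool" where
  "weak_star_converges X Ms M \<longleftrightarrow>
     (\<forall>\<phi>::'a \<Rightarrow> real. continuous_on X \<phi> \<longrightarrow>
        (\<lambda>k. integral\<^sup>L (Ms k) \<phi>) \<longlonglongrightarrow> integral\<^sup>L M \<phi>)"

definition measurable_partition :: "'a measure \<Rightarrow> 'a set set \<Rightarrow> bool" where
  "measurable_partition M P \<longleftrightarrow> finite P \<and> P \<subseteq> sets M \<and> partition_on (space M) P"

text \<open>The convention \<open>0 log 0 = 0\<close> is automatic here.\<close>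

definition partition_entropy :: "'a measure \<Rightarrow> 'a set set \<Rightarrow> real" where
  "partition_entropy M P = - (\<Sum>A\<in>P. measure M A * ln (measure M A))"

text \<open>
  The join of the preimages of \<open>P\<close> under \<open>T^0, \<dots>, T^(n-1)\<close>. It may contain the empty set, which
  contributes nothing to the entropy.
\<close>

fun iterated_join :: "'a measure \<Rightarrow> ('a \<Rightarrow> 'a) \<Rightarrow> 'a set set \<Rightarrow> nat \<Rightarrow> 'a set set" where
  "iterated_join M T P 0 = {space M}"
| "iterated_join M T P (Suc n) =
     {A \<inter> (T -` B \<inter> space M) | A B. A \<in> P \<and> B \<in> iterated_join M T P n}"

text \<open>The sequence below converges by subadditivity, so the upper limit is the limit.\<close>

definition metric_entropy :: "('a \<Rightarrow> 'a) \<Rightarrow> 'a measure \<Rightarrow> ereal" where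
  "metric_entropy T M =
     (SUP P\<in>{P. measurable_partition M P}.
        limsup (\<lambda>n. ereal (partition_entropy M (iterated_join M T P n) / real n)))"

text \<open>Topological entropy, by the Bowen--Dinaburg definition with separated sets.\<close>

definition separated_set ::
    "'a::metric_space set \<Rightarrow> ('a \<Rightarrow> 'a) \<Rightarrow> nat \<Rightarrow> real \<Rightarrow> 'a set \<Rightarrow> bool" where
  "separated_set X T n \<epsilon> E \<longleftrightarrow> E \<subseteq> X \<and>
     (\<forall>x\<in>E. \<forall>y\<in>E. x \<noteq> y \<longrightarrow> (\<exists>i<n. \<epsilon> < dist ((T ^^ i) x) ((T ^^ i) y)))"

definition topological_entropy :: "'a::metric_space set \<Rightarrow> ('a \<Rightarrow> 'a) \<Rightarrow> ereal" where
  "topological_entropy X T =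
     (SUP \<epsilon>\<in>{0<..}. limsup (\<lambda>n.
        SUP E\<in>{E. finite E \<and> separated_set X T n \<epsilon> E}. ereal (ln (real (card E)) / real n)))"

definition max_entropy_measure ::
    "'a::metric_space set \<Rightarrow> ('a \<Rightarrow> 'a) \<Rightarrow> 'a measure \<Rightarrow> bool" where
  "max_entropy_measure X T M \<longleftrightarrow>
     borel_prob_on X M \<and> invariant_measure T M \<and> metric_entropy T M = topological_entropy X T"

definition approximates_in_entropy ::
    "'a::metric_space set \<Rightarrow> (nat \<Rightarrow> 'a \<Rightarrow> 'a) \<Rightarrow> ('a \<Rightarrow> 'a) \<Rightarrow> (nat \<Rightarrow> 'a measure) \<Rightarrow> bool" where
  "approximates_in_entropy X fs f Ms \<longleftrightarrow>
     (\<forall>k. borel_prob_on X (Ms k) \<and> ergodic_measure (fs k) (Ms k)) \<and>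
     (\<exists>M. borel_prob_on X M \<and> weak_star_converges X Ms M) \<and>
     (\<lambda>k. metric_entropy (fs k) (Ms k)) \<longlonglongrightarrow> topological_entropy X f"

section \<open>Lyapunov exponents\<close>

text \<open>Exponents take the value \<open>-\<infinity>\<close> at orbits meeting critical points, hence type \<open>ereal\<close>.\<close>

definition log_abs :: "real \<Rightarrow> ereal" where
  "log_abs y = (if y = 0 then -\<infinity> else ereal (ln \<bar>y\<bar>))"

definition lyapunov_at :: "one_dim \<Rightarrow> (complex \<Rightarrow> complex) \<Rightarrow> complex \<Rightarrow> ereal" where
  "lyapunov_at I g x =
     limsup (\<lambda>n. (\<Sum>i<n. log_abs (map_deriv I g ((g ^^ i) x))) / ereal (real n))"

text \<open>
  The integral of \<open>lyapunov_at I g\<close>, as the difference of the integrals of its positive and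
  negative parts. The first one is finite for \<open>C\<^sup>1\<close> maps \<open>g\<close> and probability measures.
\<close>

definition lyapunov_exponent :: "one_dim \<Rightarrow> (complex \<Rightarrow> complex) \<Rightarrow> complex measure \<Rightarrow> ereal" where
  "lyapunov_exponent I g M =
     enn2ereal (\<integral>\<^sup>+ x. e2ennreal (lyapunov_at I g x) \<partial>M) -
     enn2ereal (\<integral>\<^sup>+ x. e2ennreal (- lyapunov_at I g x) \<partial>M)"

end

theory Submission
 imports Defs "HOL-Real_Asymp.Real_Asymp"
begin

text \<open>
 The entropy of \<open>\<nu>\<^sub>k\<close> is estimated by coding orbits of \<open>f\<^sub>k\<close>, lifted to the line, in pieces on which the
 iterates are injective. As long as only moderate contractions occur, nearby orbits stay at a fixed
 scale \<open>\<epsilon>\<close> and are coded by Bowen balls of \<open>f\<close> (or by a partition with small cells). When the derivative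
 drops to \<open>exp (- d)\<close> with \<open>d\<close> large, the code records \<open>d\<close>, a grid cell of size about \<open>exp (- d / (r - 1))\<close> and
 a bounded index: Rolle's theorem and the bound on the \<open>C\<^sup>r\<close> norm allow only boundedly many oscillations
 of the derivative on such a cell. The contraction by \<open>exp (- d)\<close> then opens a bad time interval,
 which lasts until expansion restores the scale \<open>\<epsilon>\<close> and during which nothing else has to be coded. Weighing the
 number of cells against the length of the interval, the cost is at most \<open>R(f) / r\<close> per unit of bad time.

 By Gibbs' inequality all this may be done in expectation: if \<open>b\<close> is the frequency of bad times, the
 entropy of \<open>\<nu>\<^sub>k\<close> is at most about \<open>(1 - b) h\<^sub>t\<^sub>o\<^sub>p(f) + b R(f) / r\<close>. Since it tends to \<open>h\<^sub>t\<^sub>o\<^sub>p(f) > R(f) / r\<close>,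
 \<open>b\<close> tends to zero. Hence deep contractions contribute little to the exponent of \<open>\<nu>\<^sub>k\<close>, which makes the exponents
 converge, and partitions of diameter \<open>\<epsilon>\<close> capture almost all of its entropy, so that the entropy
 passes to the limit \<open>\<mu>\<close>.
\<close>

section \<open>Entropy of simple functions\<close>

text \<open>R(f) / r comes from one inequality. Recording a contraction by exp (- a) on a grid of
  mesh exp (- a / (r - 1)) costs at most about c = a / (r - 1), and less if the current piece is
  already small; it makes the piece smaller by a factor of about exp (- (c + a)). As (r - 1) * c
  \<le> a, the cost is at most the r-th part of c + a, and this deficit is repaid at rate at most
  R(f) in bad time.

  The obstacle is that the constants chase each other. The scale \<epsilon> must suit the distortion
  bound, which holds only where the derivative exceeds exp (- a1); the block length \<open>m\<close>
  depends on \<epsilon>; and the threshold \<open>a0\<close> of deep contractions must be large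
  compared with \<open>m\<close>, or interrupted blocks would be too frequent. Contractions between
  \<open>a1\<close> and \<open>a0\<close> neither have bounded distortion nor open bad intervals.
  They are affordable only because \<open>a1\<close> can be fixed so that their total contribution
  is small for all large k, whatever \<open>a0\<close>.

  Only these constants must be uniform in k. The orbit length n tends to infinity for each k
  separately, so no rate in the ergodic theorem is needed.\<close>

lemma ln_le_of_le_exp:
 fixes x y :: real
 assumes "0 < x" "x \<le> exp y"
 shows "ln x \<le> y" using assms ln_le_cancel_iff[of x "exp y"] by simp

text \<open>Steps of length \<open>m\<close> cost \<open>a m\<close> each; the constant absorbs all
  values below \<open>m\<close>.\<close>

lemma subadditive_le:
 fixes a :: "nat \<Rightarrow> real"
 assumes nonneg: "\<And>n. a n \<ge> 0" and sub: "\<And>m n. a (m + n) \<le> a m + a n" and m: "m > 0"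
 obtains C where "\<And>n. a n \<le> real n * (a m / real m) + C"
proof -
 define v where "v = a m / real m"
 define C where "C = (\<Sum>t<m. a t)"
 have "a n \<le> real n * v + C" for n
 proof (induction n rule: less_induct)
  case (less n)
  show ?case
  proof (cases "n < m")
   case True
   then have "a n \<le> C" unfolding C_def using nonneg by (intro member_le_sum) auto
   moreover have "0 \<le> real n * v" using nonneg by (simp add: v_def)
   ultimately show ?thesis by simp
  next
   case False
   have "a n \<le> a m + a (n - m)" using sub[of m "n - m"] False by simp
   also have "a m = real m * v" using m by (simp add: v_def)
   also have "a (n - m) \<le> real (n - m) * v + C" using less.IH[of "n - m"] m False by simp
   finally show ?thesis using False by (simp add: of_nat_diff algebra_simps)
  qed
 qed
 then show ?thesis using that unfolding v_def by blast
qed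

text \<open>Entropy of the partition into the fibres of \<open>F\<close>. With functions in place of
  partitions, joins become pairs and refinement becomes factorisation.\<close>

definition ent :: "'a measure \<Rightarrow> ('a \<Rightarrow> 'b) \<Rightarrow> real" where
 "ent M F = - (\<Sum>y\<in>F ` space M. measure M (F -` {y} \<inter> space M) * ln (measure M (F -` {y} \<inter> space M)))"

text \<open>The itinerary of \<open>x\<close> up to time \<open>n\<close>; its fibres are the atoms
  of the iterated join.\<close>

definition names :: "('a \<Rightarrow> 'b) \<Rightarrow> ('a \<Rightarrow> 'a) \<Rightarrow> nat \<Rightarrow> 'a \<Rightarrow> 'b list" where
 "names F T n x = map (\<lambda>i. F ((T ^^ i) x)) [0..<n]"

lemma names_eq_iff: "names F T n x = names F T n y \<longleftrightarrow> (\<forall>i<n. F ((T ^^ i) x) = F ((T ^^ i) y))"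
 by (auto simp: names_def list_eq_iff_nth_eq)

lemma names_Suc: "names F T (Suc n) x = F x # names F T n (T x)"
proof -
 have "[0..<Suc n] = 0 # map Suc [0..<n]" by (simp add: map_Suc_upt upt_conv_Cons del: upt_Suc)
 then show ?thesis unfolding names_def by (simp add: o_def funpow_Suc_right del: upt_Suc funpow.simps)
qed

lemma simple_function_comp:
 assumes "simple_function M F" "T \<in> measurable N M"
 shows "simple_function N (\<lambda>x. F (T x))" unfolding simple_function_def
proof safe
 have "(\<lambda>x. F (T x)) ` space N \<subseteq> F ` space M" using assms(2) by (auto dest: measurable_space)
 then show "finite ((\<lambda>x. F (T x)) ` space N)" using assms(1) finite_subset by (auto simp: simple_function_def)
next
 fix x assume "x \<in> space N"
 have "(\<lambda>x. F (T x)) -` {F (T x)} \<inter> space N = T -` (F -` {F (T x)} \<inter> space M) \<inter> space N"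
  using assms(2) by (auto dest: measurable_space)
 also have "\<dots> \<in> sets N" using assms \<open>x \<in> space N\<close> by (intro measurable_sets[OF assms(2)])
   (auto simp: simple_function_def dest: measurable_space)
 finally show "(\<lambda>x. F (T x)) -` {F (T x)} \<inter> space N \<in> sets N" .
qed

lemma funpow_measurable:
 assumes "T \<in> measurable M M"
 shows "(T ^^ n) \<in> measurable M M" by (induction n) (use assms in \<open>auto intro: measurable_comp\<close>)

lemma simple_function_map:
 assumes "\<And>i. i \<in> set is \<Longrightarrow> simple_function M (F i)"
 shows "simple_function M (\<lambda>x. map (\<lambda>i. F i x) is)" using assms
proof (induction "is")
 case (Cons i js)
 have "simple_function M (\<lambda>x. (F i x, map (\<lambda>i. F i x) js))" using Cons by (intro simple_function_Pair) auto
 then have "simple_function M ((\<lambda>(a, b). a # b) \<circ> (\<lambda>x. (F i x, map (\<lambda>i. F i x) js)))" by (rule simple_function_compose)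
 then show ?case by (simp add: o_def)
qed simp

lemma simple_function_names:
 assumes "T \<in> measurable M M" "simple_function M F"
 shows "simple_function M (names F T n)" unfolding names_def [abs_def]
 by (intro simple_function_map) (rule simple_function_comp[OF assms(2) funpow_measurable[OF assms(1)]])

context prob_space
begin

lemma integral_simple_function:
 fixes c :: "'b \<Rightarrow> real"
 assumes "simple_function M F"
 shows "integrable M (\<lambda>x. c (F x))"
  and "(\<integral>x. c (F x) \<partial>M) = (\<Sum>y\<in>F ` space M. prob (F -` {y} \<inter> space M) * c y)"
proof -
 have fin: "finite (F ` space M)" using assms by (simp add: simple_function_def)
 have meas [measurable]: "F -` {y} \<inter> space M \<in> sets M" for y using assms simple_functionD(2) by metis
 have eq: "c (F x) = (\<Sum>y\<in>F ` space M. c y * indicator (F -` {y} \<inter> space M) x)"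
  if "x \<in> space M" for x
 proof -
  have "(\<Sum>y\<in>F ` space M. c y * indicator (F -` {y} \<inter> space M) x)
    = (\<Sum>y\<in>F ` space M. if y = F x then c y else 0)" using that by (intro sum.cong) (auto simp: indicator_def)
  also have "\<dots> = c (F x)" using fin that by simp
  finally show ?thesis by simp
 qed
 have int: "integrable M (\<lambda>x. \<Sum>y\<in>F ` space M. c y * indicator (F -` {y} \<inter> space M) x)"
  by (intro Bochner_Integration.integrable_sum integrable_mult_right) (simp add: emeasure_eq_measure)
 show "integrable M (\<lambda>x. c (F x))" using int eq by (subst Bochner_Integration.integrable_cong[OF refl eq]) auto
 have "(\<integral>x. c (F x) \<partial>M) = (\<integral>x. (\<Sum>y\<in>F ` space M. c y * indicator (F -` {y} \<inter> space M) x) \<partial>M)"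
  using eq by (intro Bochner_Integration.integral_cong) auto
 also have "\<dots> = (\<Sum>y\<in>F ` space M. (\<integral>x. c y * indicator (F -` {y} \<inter> space M) x \<partial>M))"
  by (intro Bochner_Integration.integral_sum integrable_mult_right) (simp add: emeasure_eq_measure)
 also have "\<dots> = (\<Sum>y\<in>F ` space M. prob (F -` {y} \<inter> space M) * c y)"
  by (intro sum.cong) (auto simp: Int_absorb2 mult.commute)
 finally show "(\<integral>x. c (F x) \<partial>M) = (\<Sum>y\<in>F ` space M. prob (F -` {y} \<inter> space M) * c y)" .
qed

lemma factor_through_kernel:
 assumes "\<And>x y. x \<in> space M \<Longrightarrow> y \<in> space M \<Longrightarrow> F x = F y \<Longrightarrow> G x = G y"
 shows "\<exists>h. \<forall>x\<in>space M. h (F x) = G x"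
proof (intro exI ballI)
 fix x assume x: "x \<in> space M"
 have "(SOME y. y \<in> space M \<and> F y = F x) \<in> space M \<and> F (SOME y. y \<in> space M \<and> F y = F x) = F x"
  using x by (intro someI[where P = "\<lambda>y. y \<in> space M \<and> F y = F x"]) auto
 then show "(\<lambda>v. G (SOME y. y \<in> space M \<and> F y = v)) (F x) = G x" using assms x by blast
qed

lemma simple_function_kernel:
 assumes "simple_function M F"
  and "\<And>x y. x \<in> space M \<Longrightarrow> y \<in> space M \<Longrightarrow> F x = F y \<Longrightarrow> G x = G y"
 shows "simple_function M G"
proof -
 have "\<exists>h. \<forall>x\<in>space M. h (F x) = G x" using assms(2) by (rule factor_through_kernel)
 then obtain h where h: "\<And>x. x \<in> space M \<Longrightarrow> h (F x) = G x" by blast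
 have "simple_function M (h \<circ> F)" using assms(1) by (rule simple_function_compose)
 moreover have "simple_function M (h \<circ> F) \<longleftrightarrow> simple_function M G" by (rule simple_function_cong) (use h in auto)
 ultimately show ?thesis by blast
qed

text \<open>Each fibre of \<open>F\<close> lies in a fibre of \<open>G\<close>, so the information
  function of \<open>G\<close> is pointwise at most that of \<open>F\<close>.\<close>

lemma ent_mono_kernel:
 assumes F: "simple_function M F"
  and ker: "\<And>x y. x \<in> space M \<Longrightarrow> y \<in> space M \<Longrightarrow> F x = F y \<Longrightarrow> G x = G y"
 shows "ent M G \<le> ent M F"
proof -
 define q where "q y = prob (G -` {y} \<inter> space M)" for y
 define p where "p y = prob (F -` {y} \<inter> space M)" for y
 have "\<exists>h. \<forall>x\<in>space M. h (F x) = G x" using ker by (rule factor_through_kernel)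
 then obtain h where h: "\<And>x. x \<in> space M \<Longrightarrow> h (F x) = G x" by blast
 have G: "simple_function M G" using F ker by (rule simple_function_kernel)
 have "ent M G = - (\<integral>x. ln (q (G x)) \<partial>M)"
  using integral_simple_function(2)[OF G, of "\<lambda>y. ln (q y)"] by (simp add: ent_def q_def)
 also have "(\<integral>x. ln (q (G x)) \<partial>M) = (\<integral>x. ln (q (h (F x))) \<partial>M)"
  by (intro Bochner_Integration.integral_cong) (auto simp: h)
 also have "\<dots> = (\<Sum>y\<in>F ` space M. p y * ln (q (h y)))"
  using integral_simple_function(2)[OF F, of "\<lambda>y. ln (q (h y))"] by (simp add: p_def)
 also have "- (\<Sum>y\<in>F ` space M. p y * ln (q (h y))) \<le> - (\<Sum>y\<in>F ` space M. p y * ln (p y))"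
 proof (intro le_imp_neg_le sum_mono)
  fix v assume "v \<in> F ` space M"
  then obtain x where x: "x \<in> space M" "v = F x" by auto
  have "F -` {v} \<inter> space M \<subseteq> G -` {h v} \<inter> space M"
  proof
   fix y assume "y \<in> F -` {v} \<inter> space M"
   then show "y \<in> G -` {h v} \<inter> space M" using ker[of y x] x h[of x] by auto
  qed
  then have "p v \<le> q (h v)" unfolding p_def q_def by (intro finite_measure_mono simple_functionD(2)[OF G])
  then show "p v * ln (p v) \<le> p v * ln (q (h v))"
   by (cases "p v = 0") (auto simp: p_def intro!: mult_left_mono ln_mono simp: zero_less_measure_iff)
 qed
 finally show ?thesis by (simp add: ent_def p_def)
qed

lemma ent_cong_kernel:
 assumes "simple_function M F"
  and "\<And>x y. x \<in> space M \<Longrightarrow> y \<in> space M \<Longrightarrow> F x = F y \<longleftrightarrow> G x = G y"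
 shows "ent M G = ent M F" using assms simple_function_kernel[OF assms(1), of G] by (intro antisym ent_mono_kernel) auto

text \<open>For each value y of \<open>F\<close>, \<open>q y\<close> is a subprobability on the
  values of \<open>Z\<close>, that is, a code with lengths \<open>- ln q\<close>; the inequality ln
  t \<le> t - 1 bounds the conditional entropy by the mean code length. This is what allows costs to
  be averaged instead of maximised. Positivity of \<open>q\<close> is demanded where the pair has
  positive probability, because there the convention \<open>ln 0 = 0\<close> would hide an infinite
  length.\<close>

lemma gibbs_conditional:
 fixes q :: "'b \<Rightarrow> 'c \<Rightarrow> real"
 assumes F: "simple_function M F" and Z: "simple_function M Z"
  and nonneg: "\<And>y z. q y z \<ge> 0"
  and pos: "\<And>x. x \<in> space M \<Longrightarrow> prob ((\<lambda>x. (F x, Z x)) -` {(F x, Z x)} \<inter> space M) > 0 \<Longrightarrow> q (F x) (Z x) > 0"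
  and sum: "\<And>y. y \<in> F ` space M \<Longrightarrow> (\<Sum>z\<in>Z ` (F -` {y} \<inter> space M). q y z) \<le> 1"
 shows "ent M (\<lambda>x. (F x, Z x)) \<le> ent M F + (\<integral>x. - ln (q (F x) (Z x)) \<partial>M)"
proof -
 define W where "W = (\<lambda>x. (F x, Z x))"
 have W: "simple_function M W" unfolding W_def using F Z by (rule simple_function_Pair)
 have finF: "finite (F ` space M)" and finZ: "finite (Z ` space M)" using F Z by (auto simp: simple_function_def)
 define p where "p w = prob (W -` {w} \<inter> space M)" for w
 define pF where "pF w = prob (F -` {w} \<inter> space M)" for w
 have img: "W ` space M = Sigma (F ` space M) (\<lambda>y. Z ` (F -` {y} \<inter> space M))"
 proof (intro set_eqI iffI)
  fix w assume "w \<in> Sigma (F ` space M) (\<lambda>y. Z ` (F -` {y} \<inter> space M))"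
  then obtain x where "x \<in> space M" "w = (F x, Z x)" by auto
  then show "w \<in> W ` space M" by (auto simp: W_def)
 qed (auto simp: W_def)
 have e1: "ent M W = - (\<Sum>w\<in>W ` space M. p w * ln (p w))" by (simp add: ent_def p_def)
 have e2: "ent M F = - (\<Sum>w\<in>W ` space M. p w * ln (pF (fst w)))"
  using integral_simple_function(2)[OF F, of "\<lambda>y. ln (pF y)"]
   integral_simple_function(2)[OF W, of "\<lambda>y. ln (pF (fst y))"] by (simp add: ent_def p_def pF_def W_def)
 have e3: "(\<integral>x. - ln (q (F x) (Z x)) \<partial>M) = (\<Sum>w\<in>W ` space M. p w * - ln (q (fst w) (snd w)))"
  using integral_simple_function(2)[OF W, of "\<lambda>y. - ln (q (fst y) (snd y))"] by (simp add: p_def W_def)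
 have e4: "(\<Sum>w\<in>W ` space M. p w) = 1"
  using integral_simple_function(2)[OF W, of "\<lambda>y. 1"] by (simp add: p_def prob_space)
 have e5: "(\<Sum>w\<in>F ` space M. pF w) = 1"
  using integral_simple_function(2)[OF F, of "\<lambda>y. 1"] by (simp add: pF_def prob_space)
 \<comment> \<open>The inequality term by term. The last two summands add up to at most 0 over all
   \<open>w\<close>, since \<open>q\<close> has total mass at most 1.\<close>
 have tm: "- (p w * ln (p w)) \<le> - (p w * ln (pF (fst w))) + p w * - ln (q (fst w) (snd w))
   + pF (fst w) * q (fst w) (snd w) - p w" if w: "w \<in> W ` space M" for w
 proof (cases "p w = 0")
  case True
  then show ?thesis by (simp add: pF_def nonneg)
 next
  case False
  then have pw: "p w > 0" by (simp add: p_def zero_less_measure_iff)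
  obtain x where x: "x \<in> space M" "w = W x" using w by auto
  have qp: "q (fst w) (snd w) > 0" using pos[OF x(1)] pw x by (simp add: W_def p_def)
  have "W -` {w} \<inter> space M \<subseteq> F -` {fst w} \<inter> space M" by (auto simp: W_def)
  then have "p w \<le> pF (fst w)" unfolding p_def pF_def using F x
   by (intro finite_measure_mono) (auto simp: simple_function_def W_def)
  with pw have pf: "pF (fst w) > 0" by linarith
  have "ln (pF (fst w) * q (fst w) (snd w) / p w) \<le> pF (fst w) * q (fst w) (snd w) / p w - 1"
   using pw qp pf by (intro ln_le_minus_one) auto
  then have "p w * ln (pF (fst w) * q (fst w) (snd w) / p w) \<le> p w * (pF (fst w) * q (fst w) (snd w) / p w - 1)"
   using pw by (intro mult_left_mono) auto
  also have "\<dots> = pF (fst w) * q (fst w) (snd w) - p w" using pw by (simp add: field_simps)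
  also have "ln (pF (fst w) * q (fst w) (snd w) / p w) = ln (pF (fst w)) + ln (q (fst w) (snd w)) - ln (p w)"
   using pw qp pf by (simp add: ln_mult ln_div)
  finally show ?thesis by (simp add: algebra_simps)
 qed
 have "ent M W \<le> ent M F + (\<integral>x. - ln (q (F x) (Z x)) \<partial>M)
   + (\<Sum>w\<in>W ` space M. pF (fst w) * q (fst w) (snd w)) - (\<Sum>w\<in>W ` space M. p w)"
  unfolding e1 e2 e3 sum_negf[symmetric] sum.distrib[symmetric] sum_subtractf[symmetric]
  using tm by (intro sum_mono) auto
 also have "(\<Sum>w\<in>W ` space M. pF (fst w) * q (fst w) (snd w))
   = (\<Sum>y\<in>F ` space M. \<Sum>z\<in>Z ` (F -` {y} \<inter> space M). pF y * q y z)" unfolding img using finF finZ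
  by (subst sum.Sigma) (auto intro: finite_subset[OF _ finZ] simp: case_prod_beta)
 also have "\<dots> = (\<Sum>y\<in>F ` space M. pF y * (\<Sum>z\<in>Z ` (F -` {y} \<inter> space M). q y z))" by (simp add: sum_distrib_left)
 also have "\<dots> \<le> (\<Sum>y\<in>F ` space M. pF y * 1)" using sum by (intro sum_mono mult_left_mono) (auto simp: pF_def)
 also have "\<dots> = 1" using e5 by simp
 finally show ?thesis using e4 by (simp add: W_def)
qed

lemma ent_const [simp]: "ent M (\<lambda>x. c) = 0"
proof -
 have "(\<lambda>x. c) ` space M = {c}" using not_empty by auto
 then show ?thesis by (simp add: ent_def prob_space)
qed

lemma ent_nonneg:
 assumes "simple_function M F"
 shows "ent M F \<ge> 0" using ent_mono_kernel[OF assms, of "\<lambda>_. ()"] by simp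

lemma gibbs:
 fixes q :: "'c \<Rightarrow> real"
 assumes Z: "simple_function M Z"
  and nonneg: "\<And>z. q z \<ge> 0"
  and pos: "\<And>x. x \<in> space M \<Longrightarrow> prob (Z -` {Z x} \<inter> space M) > 0 \<Longrightarrow> q (Z x) > 0"
  and sum: "(\<Sum>z\<in>Z ` space M. q z) \<le> 1"
 shows "ent M Z \<le> (\<integral>x. - ln (q (Z x)) \<partial>M)"
proof -
 have "ent M Z = ent M (\<lambda>x. ((), Z x))" using Z by (intro ent_cong_kernel simple_function_Pair) auto
 also have "\<dots> \<le> ent M (\<lambda>_. ()) + (\<integral>x. - ln (q (Z x)) \<partial>M)"
  by (rule gibbs_conditional) (use assms in \<open>auto simp: vimage_def\<close>)
 finally show ?thesis by simp
qed

text \<open>Gibbs' inequality with the law of \<open>Z\<close> as the code, regardless of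
  \<open>F\<close>.\<close>

lemma ent_subadditive:
 assumes F: "simple_function M F" and Z: "simple_function M Z"
 shows "ent M (\<lambda>x. (F x, Z x)) \<le> ent M F + ent M Z"
proof -
 define p where "p z = prob (Z -` {z} \<inter> space M)" for z
 have tot: "(\<Sum>w\<in>Z ` space M. p w) = 1"
  using integral_simple_function(2)[OF Z, of "\<lambda>y. 1"] by (simp add: p_def prob_space)
 have "ent M (\<lambda>x. (F x, Z x)) \<le> ent M F + (\<integral>x. - ln (p (Z x)) \<partial>M)"
 proof (rule gibbs_conditional[OF F Z])
  fix x assume x: "x \<in> space M" and "prob ((\<lambda>x. (F x, Z x)) -` {(F x, Z x)} \<inter> space M) > 0"
  moreover have "prob ((\<lambda>x. (F x, Z x)) -` {(F x, Z x)} \<inter> space M) \<le> prob (Z -` {Z x} \<inter> space M)"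
   using Z x by (intro finite_measure_mono) (auto simp: simple_function_def)
  ultimately show "p (Z x) > 0" by (simp add: p_def)
 next
  fix y assume "y \<in> F ` space M"
  have "(\<Sum>z\<in>Z ` (F -` {y} \<inter> space M). p z) \<le> (\<Sum>z\<in>Z ` space M. p z)"
   using Z by (intro sum_mono2) (auto simp: simple_function_def p_def)
  then show "(\<Sum>z\<in>Z ` (F -` {y} \<inter> space M). p z) \<le> 1" using tot by simp
 qed (simp add: p_def)
 also have "(\<integral>x. - ln (p (Z x)) \<partial>M) = ent M Z"
  using integral_simple_function(2)[OF Z, of "\<lambda>y. - ln (p y)"] by (simp add: ent_def p_def sum_negf)
 finally show ?thesis .
qed

text \<open>Gibbs' inequality with the uniform code on those values of \<open>Z\<close> that occur
  in the current fibre of \<open>F\<close>.\<close>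

lemma ent_conditional_count:
 assumes F: "simple_function M F" and Z: "simple_function M Z"
 shows "ent M (\<lambda>x. (F x, Z x)) \<le> ent M F + (\<integral>x. ln (card (Z ` (F -` {F x} \<inter> space M))) \<partial>M)"
proof -
 define c where "c y = real (card (Z ` (F -` {y} \<inter> space M)))" for y
 have fin: "finite (Z ` (F -` {y} \<inter> space M))" for y
  using Z by (auto simp: simple_function_def intro: finite_subset[of _ "Z ` space M"])
 have cpos: "c (F x) > 0" if "x \<in> space M" for x unfolding c_def using that fin by (auto simp: card_gt_0_iff)
 have "ent M (\<lambda>x. (F x, Z x)) \<le> ent M F + (\<integral>x. - ln (1 / c (F x)) \<partial>M)"
 proof (rule gibbs_conditional[OF F Z])
  fix y assume "y \<in> F ` space M"
  then have "c y > 0" using cpos by auto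
  then show "(\<Sum>z\<in>Z ` (F -` {y} \<inter> space M). 1 / c y) \<le> 1" by (simp add: c_def)
 qed (use cpos in \<open>auto simp: c_def\<close>)
 also have "(\<integral>x. - ln (1 / c (F x)) \<partial>M) = (\<integral>x. ln (c (F x)) \<partial>M)"
  using cpos by (intro Bochner_Integration.integral_cong) (auto simp: ln_div)
 finally show ?thesis by (simp add: c_def)
qed

lemma ent_le_ln_card:
 assumes Z: "simple_function M Z" and "Z ` space M \<subseteq> B" "finite B"
 shows "ent M Z \<le> ln (card B)"
proof -
 have ne: "B \<noteq> {}" using not_empty assms(2) by auto
 have "ent M Z \<le> (\<integral>x. - ln (1 / real (card B)) \<partial>M)"
 proof (rule gibbs[OF Z])
  have "(\<Sum>z\<in>Z ` space M. 1 / real (card B)) \<le> (\<Sum>z\<in>B. 1 / real (card B))" using assms by (intro sum_mono2) auto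
  also have "\<dots> = 1" using ne assms by simp
  finally show "(\<Sum>z\<in>Z ` space M. 1 / real (card B)) \<le> 1" .
 qed (use ne assms in \<open>auto simp: card_gt_0_iff\<close>)
 also have "\<dots> = ln (card B)" using ne assms by (simp add: ln_div card_gt_0_iff prob_space)
 finally show ?thesis .
qed

lemma ent_comp:
 assumes T: "T \<in> measurable M M" "distr M M T = M" and F: "simple_function M F"
 shows "ent M (\<lambda>x. F (T x)) = ent M F"
proof -
 define p where "p y = prob (F -` {y} \<inter> space M)" for y
 have FT: "simple_function M (\<lambda>x. F (T x))" using F T(1) by (rule simple_function_comp)
 have p: "p y = prob ((\<lambda>x. F (T x)) -` {y} \<inter> space M)" for y
 proof -
  have "F -` {y} \<inter> space M \<in> sets M" using F simple_functionD(2) by metis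
  then have "p y = measure (distr M M T) (F -` {y} \<inter> space M)" by (simp add: T p_def)
  also have "\<dots> = prob (T -` (F -` {y} \<inter> space M) \<inter> space M)"
   using T \<open>F -` {y} \<inter> space M \<in> sets M\<close> by (intro measure_distr) auto
  also have "T -` (F -` {y} \<inter> space M) \<inter> space M = (\<lambda>x. F (T x)) -` {y} \<inter> space M"
   using T by (auto dest: measurable_space)
  finally show ?thesis .
 qed
 have "ent M (\<lambda>x. F (T x)) = - (\<Sum>y\<in>(\<lambda>x. F (T x)) ` space M. p y * ln (p y))" by (simp add: ent_def p)
 also have "(\<Sum>y\<in>(\<lambda>x. F (T x)) ` space M. p y * ln (p y)) = (\<Sum>y\<in>F ` space M. p y * ln (p y))"
 proof (rule sum.mono_neutral_left)
  show "finite (F ` space M)" using F by (simp add: simple_function_def)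
  show "(\<lambda>x. F (T x)) ` space M \<subseteq> F ` space M" using T by (auto dest: measurable_space)
  show "\<forall>i\<in>F ` space M - (\<lambda>x. F (T x)) ` space M. p i * ln (p i) = 0"
  proof
   fix i assume i: "i \<in> F ` space M - (\<lambda>x. F (T x)) ` space M"
   then have "(\<lambda>x. F (T x)) -` {i} \<inter> space M = {}" by (auto simp: image_iff)
   then show "p i * ln (p i) = 0" using p[of i] by simp
  qed
 qed
 finally show ?thesis by (simp add: ent_def p_def)
qed

lemma names_add: "names F T (n + m) x = names F T n x @ names F T m ((T ^^ n) x)"
proof -
 have "[0..<n + m] = [0..<n] @ map (\<lambda>i. i + n) [0..<m]"
  using upt_add_eq_append[of 0 n m] map_add_upt[of n m] by (simp add: add.commute)
 then show ?thesis unfolding names_def by (simp add: o_def funpow_add)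
qed

lemma distr_funpow:
 assumes T: "T \<in> measurable M M" "distr M M T = M"
 shows "distr M M (T ^^ n) = M"
proof (induction n)
 case 0
 then show ?case by (simp add: id_def)
next
 case IH: (Suc n)
 have *: "distr M M (T ^^ Suc n) = distr (distr M M (T ^^ n)) M T"
  using T(1) funpow_measurable[OF T(1), of n] by (subst distr_distr) (auto simp: o_def)
 show ?case unfolding * IH by (rule T(2))
qed

lemma ent_names_add:
 assumes T: "T \<in> measurable M M" "distr M M T = M" and F: "simple_function M F"
 shows "ent M (names F T (n + m)) \<le> ent M (names F T n) + ent M (names F T m)"
proof -
 have Tn: "(T ^^ n) \<in> measurable M M" "distr M M (T ^^ n) = M" using T by (auto intro: funpow_measurable distr_funpow)
 have s: "simple_function M (names F T k)" for k using T F by (intro simple_function_names)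
 have s2: "simple_function M (\<lambda>x. names F T m ((T ^^ n) x))" using s Tn(1) by (rule simple_function_comp)
 have "ent M (names F T (n + m)) \<le> ent M (\<lambda>x. (names F T n x, names F T m ((T ^^ n) x)))"
  using s s2 by (intro ent_mono_kernel simple_function_Pair) (auto simp: names_add)
 also have "\<dots> \<le> ent M (names F T n) + ent M (\<lambda>x. names F T m ((T ^^ n) x))" using s s2 by (intro ent_subadditive)
 also have "ent M (\<lambda>x. names F T m ((T ^^ n) x)) = ent M (names F T m)" using Tn s by (intro ent_comp)
 finally show ?thesis .
qed

lemma ent_names_bound:
 assumes T: "T \<in> measurable M M" "distr M M T = M" and F: "simple_function M F" and m: "m > 0"
 obtains C where "\<And>n. ent M (names F T n) \<le> real n * (ent M (names F T m) / real m) + C"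
 using subadditive_le[where a = "\<lambda>n. ent M (names F T n)", OF _ _ m]
  ent_nonneg[OF simple_function_names[OF T(1) F]] ent_names_add[OF T F] by blast

end

section \<open>Metric entropy through itineraries, and sequential coding\<close>

definition fibers :: "'a measure \<Rightarrow> ('a \<Rightarrow> 'b) \<Rightarrow> 'a set set" where
 "fibers M F = (\<lambda>y. F -` {y} \<inter> space M) ` F ` space M"

text \<open>Everything recorded before time \<open>i\<close>: a starting datum and the codes of
  earlier times. It is the conditioning variable when Gibbs' inequality is applied one time step
  after the other.\<close>

definition hist :: "('a \<Rightarrow> 'b) \<Rightarrow> (nat \<Rightarrow> 'a \<Rightarrow> 'c) \<Rightarrow> nat \<Rightarrow> 'a \<Rightarrow> 'b \<times> 'c list" where
 "hist F Z i x = (F x, map (\<lambda>j. Z j x) [0..<i])"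

lemma hist_eq_iff: "hist F Z i x = hist F Z i y \<longleftrightarrow> F x = F y \<and> (\<forall>j<i. Z j x = Z j y)"
 by (auto simp: hist_def list_eq_iff_nth_eq)

lemma simple_function_hist:
 assumes "simple_function M F" "\<And>j. j < i \<Longrightarrow> simple_function M (Z j)"
 shows "simple_function M (hist F Z i)" unfolding hist_def [abs_def] using assms
 by (intro simple_function_Pair simple_function_map) auto

context prob_space
begin

lemma sum_fibers: "(\<Sum>A\<in>fibers M F. h A) = (\<Sum>y\<in>F ` space M. h (F -` {y} \<inter> space M))"
proof -
 have "inj_on (\<lambda>y. F -` {y} \<inter> space M) (F ` space M)" by (auto simp: inj_on_def)
 then show ?thesis unfolding fibers_def by (subst sum.reindex) auto
qed

text \<open>The empty set is inserted on both sides because a join may contain empty intersections,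
  whereas the fibres of attained values are nonempty.\<close>

lemma iterated_join_fibers:
 assumes T: "T \<in> measurable M M"
 shows "insert {} (iterated_join M T (fibers M F) n) = insert {} (fibers M (names F T n))"
proof (induction n)
 case 0
 have "(\<lambda>_. []) ` space M = {[] :: 'b list}" using not_empty by auto
 then show ?case by (simp add: fibers_def names_def vimage_def)
next
 case (Suc n)
 have Tx: "x \<in> space M \<Longrightarrow> T x \<in> space M" for x using T by (rule measurable_space)
 show ?case
 proof (intro set_eqI iffI)
  fix S assume "S \<in> insert {} (iterated_join M T (fibers M F) (Suc n))"
  then consider "S = {}" | A B where "A \<in> fibers M F" "B \<in> iterated_join M T (fibers M F) n"
    "S = A \<inter> (T -` B \<inter> space M)" "S \<noteq> {}" by auto
  then show "S \<in> insert {} (fibers M (names F T (Suc n)))"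
  proof cases
   case 2
   then obtain x where x: "x \<in> S" by auto
   have "B \<in> fibers M (names F T n)" using 2 x Suc by auto
   then obtain v where v: "B = names F T n -` {v} \<inter> space M" by (auto simp: fibers_def)
   obtain y where y: "A = F -` {y} \<inter> space M" using 2 by (auto simp: fibers_def)
   have "S = names F T (Suc n) -` {names F T (Suc n) x} \<inter> space M"
    using x unfolding 2(3) v y by (auto simp: names_Suc Tx)
   then show ?thesis using x 2 y by (auto simp: fibers_def)
  qed simp
 next
  fix S assume "S \<in> insert {} (fibers M (names F T (Suc n)))"
  then consider "S = {}" | x where "x \<in> space M" "S = names F T (Suc n) -` {names F T (Suc n) x} \<inter> space M"
   by (auto simp: fibers_def)
  then show "S \<in> insert {} (iterated_join M T (fibers M F) (Suc n))"
  proof cases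
   case 2
   have B: "names F T n -` {names F T n (T x)} \<inter> space M \<in> iterated_join M T (fibers M F) n"
   proof -
    have "names F T n -` {names F T n (T x)} \<inter> space M \<in> fibers M (names F T n)" using Tx 2 by (auto simp: fibers_def)
    moreover have "names F T n -` {names F T n (T x)} \<inter> space M \<noteq> {}" using Tx 2 by auto
    ultimately show ?thesis using Suc by (metis insert_iff)
   qed
   have A: "F -` {F x} \<inter> space M \<in> fibers M F" using 2 by (auto simp: fibers_def)
   have "S = (F -` {F x} \<inter> space M) \<inter> (T -` (names F T n -` {names F T n (T x)} \<inter> space M) \<inter> space M)"
    unfolding 2 by (auto simp: names_Suc Tx)
   then show ?thesis using A B by auto
  qed simp
 qed
qed

lemma partition_entropy_iterated_join:
 assumes T: "T \<in> measurable M M" and F: "simple_function M F"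
 shows "partition_entropy M (iterated_join M T (fibers M F) n) = ent M (names F T n)"
proof -
 let ?P = "iterated_join M T (fibers M F) n"
 let ?h = "\<lambda>A. prob A * ln (prob A)"
 have sf: "simple_function M (names F T n)" using T F by (rule simple_function_names)
 have fin: "finite (fibers M (names F T n))" using sf by (simp add: fibers_def simple_function_def)
 have "finite (insert {} ?P)" unfolding iterated_join_fibers[OF T] using fin by simp
 then have finP: "finite ?P" by simp
 have "(\<Sum>A\<in>?P. ?h A) = (\<Sum>A\<in>insert {} ?P. ?h A)" using finP by (cases "{} \<in> ?P") (auto simp: insert_absorb)
 also have "\<dots> = (\<Sum>A\<in>fibers M (names F T n). ?h A)"
  unfolding iterated_join_fibers[OF T] using fin by (cases "{} \<in> fibers M (names F T n)") (auto simp: insert_absorb)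
 also have "\<dots> = (\<Sum>y\<in>names F T n ` space M. ?h (names F T n -` {y} \<inter> space M))" by (rule sum_fibers)
 finally show ?thesis by (simp add: partition_entropy_def ent_def)
qed

lemma measurable_partition_fibers:
 assumes F: "simple_function M F"
 shows "measurable_partition M (fibers M F)" unfolding measurable_partition_def partition_on_def
proof (intro conjI)
 show "finite (fibers M F)" using F by (simp add: fibers_def simple_function_def)
 show "fibers M F \<subseteq> sets M" using F by (auto simp: fibers_def simple_function_def)
 show "disjoint (fibers M F)" by (auto simp: fibers_def disjoint_def)
qed (auto simp: fibers_def)

lemma measurable_partition_obtain_fibers:
 assumes P: "measurable_partition M P"
 obtains F :: "'a \<Rightarrow> 'a set" where "simple_function M F" "fibers M F = P"
proof -
 define F where "F x = (THE A. A \<in> P \<and> x \<in> A)" for x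
 have disj: "A = B" if "A \<in> P" "B \<in> P" "x \<in> A" "x \<in> B" for A B x
  using P that unfolding measurable_partition_def partition_on_def disjoint_def by (metis IntI empty_iff)
 have F: "F x = A" if "A \<in> P" "x \<in> A" for x A unfolding F_def using that disj by (intro the_equality) auto
 have cov: "\<Union>P = space M" and ne: "{} \<notin> P" and fin: "finite P" and meas: "P \<subseteq> sets M"
  using P by (auto simp: measurable_partition_def partition_on_def)
 have img: "F ` space M = P"
 proof safe
  fix x assume "x \<in> space M"
  then show "F x \<in> P" using F cov by (metis UnionE)
 next
  fix A assume A: "A \<in> P"
  then obtain x where "x \<in> A" using ne by fastforce
  then show "A \<in> F ` space M" using F[of A x] A cov by blast
 qed
 have fib: "F -` {A} \<inter> space M = A" if A: "A \<in> P" for A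
 proof safe
  fix x assume "x \<in> space M" "A = F x"
  then show "x \<in> F x" using F cov by (metis UnionE)
 qed (use A F cov in auto)
 show ?thesis
 proof (rule that)
  show "simple_function M F" unfolding simple_function_def img using fin meas fib by auto
  show "fibers M F = P" unfolding fibers_def img using fib by auto
 qed
qed

lemma metric_entropy_ge:
 assumes T: "T \<in> measurable M M" and F: "simple_function M F"
 shows "limsup (\<lambda>n. ereal (ent M (names F T n) / real n)) \<le> metric_entropy T M" unfolding metric_entropy_def
 using measurable_partition_fibers[OF F] partition_entropy_iterated_join[OF T F]
 by (intro SUP_upper2[where i = "fibers M F"]) auto

lemma metric_entropy_greaterE:
 assumes T: "T \<in> measurable M M" and c: "c < metric_entropy T M"
 obtains F :: "'a \<Rightarrow> 'a set" where "simple_function M F"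
  "c < limsup (\<lambda>n. ereal (ent M (names F T n) / real n))"
proof -
 obtain P where P: "measurable_partition M P"
  "c < limsup (\<lambda>n. ereal (partition_entropy M (iterated_join M T P n) / real n))"
  using c by (auto simp: metric_entropy_def less_SUP_iff)
 obtain F :: "'a \<Rightarrow> 'a set" where F: "simple_function M F" "fibers M F = P"
  using measurable_partition_obtain_fibers[OF P(1)] .
 show ?thesis using P(2) partition_entropy_iterated_join[OF T F(1)] F by (intro that[of F]) auto
qed

text \<open>Chain rule: the code of time i is paid with a kernel that may depend on the whole
  history, and only its expected length enters.\<close>

lemma ent_hist:
 fixes q :: "nat \<Rightarrow> 'b \<times> 'c list \<Rightarrow> 'c \<Rightarrow> real"
 assumes F: "simple_function M F" and Z: "\<And>j. j < n \<Longrightarrow> simple_function M (Z j)"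
  and nonneg: "\<And>i y z. q i y z \<ge> 0"
  and pos: "\<And>i x. i < n \<Longrightarrow> x \<in> space M \<Longrightarrow> q i (hist F Z i x) (Z i x) > 0"
  and sum: "\<And>i x. i < n \<Longrightarrow> x \<in> space M \<Longrightarrow>
   (\<Sum>z\<in>Z i ` (hist F Z i -` {hist F Z i x} \<inter> space M). q i (hist F Z i x) z) \<le> 1"
 shows "ent M (hist F Z n) \<le> ent M F + (\<Sum>i<n. \<integral>x. - ln (q i (hist F Z i x) (Z i x)) \<partial>M)" using Z pos sum
proof (induction n)
 case 0
 have "ent M (hist F Z 0) = ent M F" using F by (intro ent_cong_kernel) (auto simp: hist_def)
 then show ?case by simp
next
 case (Suc n)
 have s: "simple_function M (hist F Z n)" using F Suc.prems(1) by (intro simple_function_hist) auto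
 have "ent M (hist F Z (Suc n)) = ent M (\<lambda>x. (hist F Z n x, Z n x))"
  using s Suc.prems(1) by (intro ent_cong_kernel simple_function_Pair) (auto simp: hist_eq_iff less_Suc_eq)
 also have "\<dots> \<le> ent M (hist F Z n) + (\<integral>x. - ln (q n (hist F Z n x) (Z n x)) \<partial>M)"
  using s Suc.prems nonneg by (intro gibbs_conditional) auto
 also have "ent M (hist F Z n) \<le> ent M F + (\<Sum>i<n. \<integral>x. - ln (q i (hist F Z i x) (Z i x)) \<partial>M)"
  by (rule Suc.IH) (use Suc.prems in auto)
 finally show ?case by simp
qed

end

section \<open>Regularity of measures, and itineraries read off from orbits at a small scale\<close>

lemma inner_regular_restrict:
 fixes X :: "'a::polish_space set"
 assumes N: "sets M = sets (restrict_space borel X)" "prob_space M" "X \<in> sets borel"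
  and A: "A \<in> sets M" and e: "e > 0"
 obtains K where "compact K" "K \<subseteq> A" "K \<in> sets M" "measure M (A - K) < e"
proof -
 interpret N: prob_space M by fact
 have spX: "space M = X" using sets_eq_imp_space_eq[OF N(1)] by (simp add: space_restrict_space)
 have setsM: "B \<in> sets M \<longleftrightarrow> B \<subseteq> X \<and> B \<in> sets borel" for B
  unfolding N(1) using N(3) by (simp add: sets_restrict_space_iff)
 have idm: "(\<lambda>x. x) \<in> measurable M borel"
  unfolding measurable_cong_sets[OF N(1) refl] by (intro measurable_restrict_space1) simp
 \<comment> \<open>The inclusion turns \<open>M\<close> into a Borel measure on the whole Polish
   space, where inner regularity applies.\<close>
 define L where "L = distr M borel (\<lambda>x. x)"
 have L: "emeasure L B = emeasure M B" if "B \<in> sets M" for B using that idm setsM[of B] unfolding L_def spX[symmetric]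
  by (subst emeasure_distr) (auto simp: Int_absorb2 spX intro!: arg_cong[where f = "emeasure M"])
 have sL: "sets L = sets borel" by (simp add: L_def)
 interpret L: prob_space L unfolding L_def using idm by (rule N.prob_space_distr)
 have SL: "emeasure L A = (SUP K\<in>{K. K \<subseteq> A \<and> compact K}. emeasure L K)" using A setsM by (intro inner_regular sL) auto
 have "\<exists>K\<in>{K. K \<subseteq> A \<and> compact K}. emeasure L A < emeasure L K + ennreal e"
 proof (cases "emeasure L A = 0")
  case True
  then show ?thesis using e by (intro bexI[of _ "{}"]) auto
 next
  case False
  have "ennreal (measure L A - e) < emeasure L A" using False e unfolding L.emeasure_eq_measure
   by (intro ennreal_lessI) (auto simp: zero_less_measure_iff)
  also have "emeasure L A = (SUP K\<in>{K. K \<subseteq> A \<and> compact K}. emeasure L K)" by (rule SL)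
  finally obtain K where K: "K \<subseteq> A" "compact K" "ennreal (measure L A - e) < emeasure L K" by (auto simp: less_SUP_iff)
  have "measure L A - e < measure L K"
   using K(3) unfolding L.emeasure_eq_measure by (meson ennreal_leI linorder_not_less)
  then have "measure L A < measure L K + e" by linarith
  then show ?thesis
   using K e by (intro bexI[of _ K]) (auto simp: L.emeasure_eq_measure ennreal_plus[symmetric] intro!: ennreal_lessI simp del: ennreal_plus intro: add_nonneg_pos)
 qed
 then obtain K where K: "K \<subseteq> A" "compact K" "emeasure L A < emeasure L K + ennreal e" by auto
 have KM: "K \<in> sets M" using K A setsM[of K] setsM[of A] borel_compact[of K] by auto
 have "ennreal (measure M A) < ennreal (measure M K + e)"
  using K(3) L[OF A] L[OF KM] e by (simp add: N.emeasure_eq_measure ennreal_plus)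
 then have "measure M A < measure M K + e" by (meson ennreal_leI linorder_not_less)
 moreover have "measure M (A - K) = measure M A - measure M K" using A KM K by (intro N.finite_measure_Diff) auto
 ultimately show ?thesis using K KM by (intro that[of K]) auto
qed

lemma finite_compact_separated:
 fixes K :: "'b \<Rightarrow> 'a::heine_borel set"
 assumes "finite J" "\<And>j. j \<in> J \<Longrightarrow> compact (K j)"
  and "\<And>i j. i \<in> J \<Longrightarrow> j \<in> J \<Longrightarrow> i \<noteq> j \<Longrightarrow> K i \<inter> K j = {}"
 obtains e :: real where "e > 0"
  "\<And>i j x y. i \<in> J \<Longrightarrow> j \<in> J \<Longrightarrow> x \<in> K i \<Longrightarrow> y \<in> K j \<Longrightarrow> dist x y < e \<Longrightarrow> i = j"
proof -
 have "\<forall>p\<in>J \<times> J. \<exists>d>0. fst p \<noteq> snd p \<longrightarrow> (\<forall>x\<in>K (fst p). \<forall>y\<in>K (snd p). d \<le> dist x y)"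
 proof
  fix p assume p: "p \<in> J \<times> J"
  show "\<exists>d>0. fst p \<noteq> snd p \<longrightarrow> (\<forall>x\<in>K (fst p). \<forall>y\<in>K (snd p). d \<le> dist x y)"
  proof (cases "fst p = snd p")
   case False
   then have "\<exists>d>0. \<forall>x\<in>K (fst p). \<forall>y\<in>K (snd p). d \<le> dist x y" using assms(2) p assms(3)[of "fst p" "snd p"] False
    by (intro separate_compact_closed compact_imp_closed) (auto simp: mem_Times_iff)
   then show ?thesis by auto
  qed (auto intro: exI[of _ 1])
 qed
 then obtain d where d: "\<And>p. p \<in> J \<times> J \<Longrightarrow> d p > 0"
  "\<And>p x y. p \<in> J \<times> J \<Longrightarrow> fst p \<noteq> snd p \<Longrightarrow> x \<in> K (fst p) \<Longrightarrow> y \<in> K (snd p) \<Longrightarrow> (d p :: real) \<le> dist x y" by metis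
 define e where "e = Min (insert 1 (d ` (J \<times> J)))"
 have fin: "finite (insert 1 (d ` (J \<times> J)))" using assms(1) by auto
 show ?thesis
 proof (rule that)
  show "e > 0" unfolding e_def using fin d by (subst Min_gr_iff) auto
  fix i j x y assume *: "i \<in> J" "j \<in> J" "x \<in> K i" "y \<in> K j" "dist x y < e"
  show "i = j"
  proof (rule ccontr)
   assume "i \<noteq> j"
   then have "d (i, j) \<le> dist x y" using d(2)[of "(i, j)" x y] * by auto
   moreover have "e \<le> d (i, j)" unfolding e_def using fin * by (intro Min_le) auto
   ultimately show False using * by linarith
  qed
 qed
qed

lemma (in prob_space) simple_function_mem:
 assumes "A \<in> sets M"
 shows "simple_function M (\<lambda>x. x \<in> A)" using simple_function_indicator[OF assms, where 'b = nat]
 by (rule simple_function_kernel) (auto simp: indicator_def of_bool_def split: if_splits)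

text \<open>The atoms of \<open>Q\<close> contain compact sets at positive mutual distance which
  miss only a set \<open>U\<close> of small measure. If \<open>F\<close> determines orbits in
  \<open>G\<close> up to that distance, then \<open>Q\<close> has to be recorded separately only
  while the orbit visits \<open>U\<close>, and at all times for orbits outside \<open>G\<close>. The
  strength of the statement is that \<open>e\<close> is found before \<open>n\<close>,
  \<open>F\<close> and \<open>G\<close>.\<close>

lemma names_entropy_le_dynamical_cells:
 fixes X :: "'a::euclidean_space set" and Q :: "'a \<Rightarrow> 'b" and \<eta> :: real
 assumes M: "prob_space M" "sets M = sets (restrict_space borel X)" "X \<in> sets borel"
  and T: "T \<in> measurable M M" "distr M M T = M"
  and Q: "simple_function M Q" and eta: "\<eta> > 0"
 obtains e :: real where "e > 0"
  "\<And>n (F :: 'a \<Rightarrow> 'c) G. simple_function M F \<Longrightarrow> G \<in> sets M \<Longrightarrow>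
    (\<And>x y i. x \<in> G \<Longrightarrow> y \<in> G \<Longrightarrow> F x = F y \<Longrightarrow> i < n \<Longrightarrow> dist ((T ^^ i) x) ((T ^^ i) y) < e) \<Longrightarrow>
    ent M (names Q T n) \<le> ent M F + n * \<eta> + ln 2
     + measure M (space M - G) * n * ln (real (card (Q ` space M)))"
proof -
 interpret prob_space M by fact
 define q where "q = real (card (Q ` space M))"
 have finQ: "finite (Q ` space M)" using Q by (simp add: simple_function_def)
 have "Q ` space M \<noteq> {}" using not_empty by auto
 then have q1: "q \<ge> 1" using finQ by (simp add: q_def Suc_le_eq card_gt_0_iff)
 \<comment> \<open>Weight reserved for visits to \<open>U\<close>: a time outside \<open>U\<close>
   then costs - ln (1 - \<kappa>) = \<eta> / 2, a visit costs \<open>c\<close>.\<close>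
 define \<kappa> where "\<kappa> = 1 - exp (- (\<eta> / 2))"
 have k: "0 < \<kappa>" "\<kappa> < 1" "- ln (1 - \<kappa>) = \<eta> / 2" using eta by (auto simp: \<kappa>_def)
 define c where "c = ln (q / \<kappa>)"
 have "q / \<kappa> > 1" using k q1 by (simp add: field_simps)
 then have c: "c > 0" by (simp add: c_def)
 \<comment> \<open>Chosen so that the visits to \<open>U\<close> cost at most \<eta> / 2 per time
   step in the mean.\<close>
 define \<delta> where "\<delta> = \<eta> / 2 / c / q"
 have d: "\<delta> > 0" using eta c q1 by (simp add: \<delta>_def)
 have meas: "Q -` {y} \<inter> space M \<in> sets M" for y using Q by (rule simple_functionD(2))
 have "\<exists>K. compact K \<and> K \<subseteq> Q -` {y} \<inter> space M \<and> K \<in> sets M \<and> prob (Q -` {y} \<inter> space M - K) < \<delta>" for y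
  using inner_regular_restrict[OF M(2,1,3) meas d] by metis
 then obtain K where K: "\<And>y. compact (K y)" "\<And>y. K y \<subseteq> Q -` {y} \<inter> space M"
  "\<And>y. K y \<in> sets M" "\<And>y. prob (Q -` {y} \<inter> space M - K y) < \<delta>" by metis
 have disjK: "K i \<inter> K j = {}" if "i \<noteq> j" for i j using K(2)[of i] K(2)[of j] that by auto
 obtain e :: real where e: "e > 0"
  "\<And>i j x y. i \<in> Q ` space M \<Longrightarrow> j \<in> Q ` space M \<Longrightarrow> x \<in> K i \<Longrightarrow> y \<in> K j \<Longrightarrow> dist x y < e \<Longrightarrow> i = j"
  using finite_compact_separated[OF finQ, of K] K(1) disjK by metis
 define U where "U = (\<Union>y\<in>Q ` space M. Q -` {y} \<inter> space M - K y)"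
 have U [measurable]: "U \<in> sets M" unfolding U_def using finQ meas K(3) by (intro sets.finite_UN) auto
 have "prob U \<le> (\<Sum>y\<in>Q ` space M. prob (Q -` {y} \<inter> space M - K y))"
  unfolding U_def using finQ meas K(3) by (intro finite_measure_subadditive_finite) auto
 also have "\<dots> \<le> (\<Sum>y\<in>Q ` space M. \<delta>)" using K(4) by (intro sum_mono less_imp_le) auto
 also have "\<dots> = q * \<delta>" by (simp add: q_def)
 also have "\<dots> = \<eta> / 2 / c" using q1 by (simp add: \<delta>_def)
 finally have pU: "prob U * c \<le> \<eta> / 2" using c by (simp add: field_simps)
 have inK: "x \<in> K (Q x)" if "x \<in> space M" "x \<notin> U" for x using that by (auto simp: U_def)
 have Ti: "(T ^^ i) x \<in> space M" if "x \<in> space M" for i x using measurable_space[OF funpow_measurable[OF T(1)] that] .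
 show ?thesis
 proof (rule that[OF e(1)])
  fix n and F :: "'a \<Rightarrow> 'c" and G
  assume F: "simple_function M F" and G [measurable]: "G \<in> sets M"
   and sep: "\<And>x y i. x \<in> G \<Longrightarrow> y \<in> G \<Longrightarrow> F x = F y \<Longrightarrow> i < n \<Longrightarrow> dist ((T ^^ i) x) ((T ^^ i) y) < e"
  \<comment> \<open>\<open>None\<close> announces that the symbol at this time follows from
    \<open>F\<close> by the separation of the compact sets.\<close>
  define V where "V i x = (if x \<in> G \<and> (T ^^ i) x \<notin> U then None else Some (Q ((T ^^ i) x)))" for i x
  have Tm [measurable]: "(T ^^ i) \<in> measurable M M" for i using T(1) by (rule funpow_measurable)
  have sG: "simple_function M (\<lambda>x. x \<in> G)" using G by (rule simple_function_mem)
  have sV: "simple_function M (V i)" for i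
  proof -
   have sU: "simple_function M (\<lambda>x. x \<in> U)" using U by (rule simple_function_mem)
   have "simple_function M (\<lambda>x. ((x \<in> G, (T ^^ i) x \<in> U), Q ((T ^^ i) x)))"
    using simple_function_comp[OF sU Tm[of i]] simple_function_comp[OF Q Tm[of i]] sG by (intro simple_function_Pair)
   then show ?thesis by (rule simple_function_kernel) (auto simp: V_def)
  qed
  \<comment> \<open>Decoding requires to know whether the orbit starts in \<open>G\<close>; this bit
    is the summand ln 2.\<close>
  define F0 where "F0 x = (F x, x \<in> G)" for x
  have sF0: "simple_function M F0" unfolding F0_def [abs_def] using F sG by (rule simple_function_Pair)
  define w where "w b v = (if b then (case v of None \<Rightarrow> 1 - \<kappa> | Some (y :: 'b) \<Rightarrow> \<kappa> / q)
   else (case v of None \<Rightarrow> 0 | Some y \<Rightarrow> 1 / q))" for b v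
  have "ent M (names Q T n) \<le> ent M (hist F0 V n)"
  proof (rule ent_mono_kernel)
   show "simple_function M (hist F0 V n)" using sF0 sV by (intro simple_function_hist)
   fix x y assume xy: "x \<in> space M" "y \<in> space M" "hist F0 V n x = hist F0 V n y"
   show "names Q T n x = names Q T n y" unfolding names_eq_iff
   proof (intro allI impI)
    fix i assume i: "i < n"
    have *: "F x = F y" "x \<in> G \<longleftrightarrow> y \<in> G" "V i x = V i y" using xy(3) i by (auto simp: hist_eq_iff F0_def)
    show "Q ((T ^^ i) x) = Q ((T ^^ i) y)"
    proof (cases "V i x = None")
     case True
     then have "x \<in> G" "y \<in> G" "(T ^^ i) x \<notin> U" "(T ^^ i) y \<notin> U" using * by (auto simp: V_def split: if_splits)
     then show ?thesis using e(2)[of "Q ((T ^^ i) x)" "Q ((T ^^ i) y)" "(T ^^ i) x" "(T ^^ i) y"]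
       sep[of x y i] * i inK Ti xy(1,2) by auto
    next
     case False
     then show ?thesis using *(3) by (auto simp: V_def split: if_splits)
    qed
   qed
  qed
  also have "\<dots> \<le> ent M F0 + (\<Sum>i<n. \<integral>x. - ln (w (snd (fst (hist F0 V i x))) (V i x)) \<partial>M)"
  proof (rule ent_hist[where q = "\<lambda>i y z. w (snd (fst y)) z"])
   show "0 \<le> w (snd (fst y)) z" for y :: "('c \<times> bool) \<times> 'b option list" and z
    using k q1 by (auto simp: w_def split: option.split)
   show "0 < w (snd (fst (hist F0 V i x))) (V i x)" if "x \<in> space M" for i x
    using k q1 by (auto simp: w_def V_def hist_def F0_def)
   fix i x assume "x \<in> space M"
   let ?b = "x \<in> G"
   have "(\<Sum>z\<in>V i ` (hist F0 V i -` {hist F0 V i x} \<inter> space M). w (snd (fst (hist F0 V i x))) z)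
    \<le> (\<Sum>z\<in>insert None (Some ` Q ` space M). w (snd (fst (hist F0 V i x))) z)"
    using finQ Ti k q1 by (intro sum_mono2) (auto simp: V_def w_def split: option.split)
   also have "\<dots> = w ?b None + (\<Sum>y\<in>Q ` space M. w ?b (Some y))"
    using finQ by (subst sum.insert) (auto simp: sum.reindex hist_def F0_def)
   also have "\<dots> = 1" using q1 k by (auto simp: w_def q_def[symmetric])
   finally show "(\<Sum>z\<in>V i ` (hist F0 V i -` {hist F0 V i x} \<inter> space M).
    w (snd (fst (hist F0 V i x))) z) \<le> 1" .
  qed (use sF0 sV in auto)
  also have "ent M F0 \<le> ent M F + ent M (\<lambda>x. x \<in> G)" unfolding F0_def [abs_def] using F sG by (rule ent_subadditive)
  also have "ent M (\<lambda>x. x \<in> G) \<le> ln (card (UNIV :: bool set))" using sG by (rule ent_le_ln_card) auto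
  also have "(\<Sum>i<n. \<integral>x. - ln (w (snd (fst (hist F0 V i x))) (V i x)) \<partial>M) \<le> (\<Sum>i<n. \<eta> + prob (space M - G) * ln q)"
  proof (rule sum_mono)
   fix i assume "i \<in> {..<n}"
   have "prob ((T ^^ i) -` U \<inter> space M) = measure (distr M M (T ^^ i)) U" using U Tm by (intro measure_distr[symmetric])
   then have pTU: "prob ((T ^^ i) -` U \<inter> space M) = prob U" using T by (simp add: distr_funpow)
   have "(\<integral>x. - ln (w (snd (fst (hist F0 V i x))) (V i x)) \<partial>M)
    = (\<integral>x. - ln (w (snd (F0 x)) (V i x)) \<partial>M)" by (simp add: hist_def)
   also have "\<dots> \<le> (\<integral>x. \<eta> / 2 + indicator ((T ^^ i) -` U \<inter> space M) x * c + indicator (space M - G) x * ln q \<partial>M)"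
   proof (rule integral_mono)
    show "integrable M (\<lambda>x. - ln (w (snd (F0 x)) (V i x)))"
     using integral_simple_function(1)[OF simple_function_Pair[OF sF0 sV[of i]], of "\<lambda>p. - ln (w (snd (fst p)) (snd p))"]
     by simp
    show "integrable M (\<lambda>x. \<eta> / 2 + indicator ((T ^^ i) -` U \<inter> space M) x * c + indicator (space M - G) x * ln q)"
     by (intro Bochner_Integration.integrable_add integrable_mult_left) (auto simp: emeasure_eq_measure)
    fix x assume x: "x \<in> space M"
    have lq: "ln q \<ge> 0" using q1 by simp
    have "- ln (\<kappa> / q) = c" using k q1 by (simp add: c_def ln_div)
    moreover have "- ln (1 / q) = ln q" using q1 by (simp add: ln_div)
    ultimately show "- ln (w (snd (F0 x)) (V i x)) \<le> \<eta> / 2 + indicator ((T ^^ i) -` U \<inter> space M) x * c + indicator (space M - G) x * ln q"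
     using k(3) eta c lq x by (auto simp: F0_def V_def w_def indicator_def)
   qed
   also have "\<dots> = \<eta> / 2 + prob U * c + prob (space M - G) * ln q" using pTU by (subst Bochner_Integration.integral_add)
     (auto simp: emeasure_eq_measure prob_space Int_absorb2 intro!: Bochner_Integration.integrable_add integrable_mult_left)
   finally show "(\<integral>x. - ln (w (snd (fst (hist F0 V i x))) (V i x)) \<partial>M) \<le> \<eta> + prob (space M - G) * ln q" using pU by simp
  qed
  finally show "ent M (names Q T n) \<le> ent M F + n * \<eta> + ln 2
     + measure M (space M - G) * n * ln (real (card (Q ` space M)))" by (simp add: q_def algebra_simps)
 qed
qed

section \<open>Spanning sets, and the comparison of metric with topological entropy\<close>

lemma simple_function_least_index:
 fixes A :: "nat \<Rightarrow> 'a set"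
 assumes A: "\<And>j. j < N \<Longrightarrow> A j \<inter> space M \<in> sets M"
  and cover: "\<And>x. x \<in> space M \<Longrightarrow> \<exists>j<N. x \<in> A j"
 shows "simple_function M (\<lambda>x. LEAST j. x \<in> A j)" unfolding simple_function_def
proof
 have lt: "(LEAST j. x \<in> A j) < N" if "x \<in> space M" for x using cover[OF that] by (meson Least_le le_less_trans)
 then have "(\<lambda>x. LEAST j. x \<in> A j) ` space M \<subseteq> {..<N}" by auto
 then show "finite ((\<lambda>x. LEAST j. x \<in> A j) ` space M)" by (rule finite_subset) simp
 show "\<forall>y\<in>(\<lambda>x. LEAST j. x \<in> A j) ` space M. (\<lambda>x. LEAST j. x \<in> A j) -` {y} \<inter> space M \<in> sets M"
 proof
  fix y assume "y \<in> (\<lambda>x. LEAST j. x \<in> A j) ` space M"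
  then have y: "y < N" using lt by auto
  have "(\<lambda>x. LEAST j. x \<in> A j) -` {y} \<inter> space M = (A y \<inter> space M) - (\<Union>j<y. A j \<inter> space M)"
  proof (intro set_eqI iffI)
   fix x assume x: "x \<in> (\<lambda>x. LEAST j. x \<in> A j) -` {y} \<inter> space M"
   then have "\<exists>j. x \<in> A j" using cover by blast
   then have "x \<in> A y" using x by (metis (mono_tags, lifting) IntD1 LeastI singletonD vimageD)
   moreover have "x \<notin> A j" if "j < y" for j using that x not_less_Least by auto
   ultimately show "x \<in> (A y \<inter> space M) - (\<Union>j<y. A j \<inter> space M)" using x by auto
  next
   fix x assume x: "x \<in> (A y \<inter> space M) - (\<Union>j<y. A j \<inter> space M)"
   have "(LEAST j. x \<in> A j) = y" using x by (intro Least_equality) (auto simp: not_less[symmetric])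
   then show "x \<in> (\<lambda>x. LEAST j. x \<in> A j) -` {y} \<inter> space M" using x by auto
  qed
  also have "\<dots> \<in> sets M" using A y by (intro sets.Diff sets.finite_UN) auto
  finally show "(\<lambda>x. LEAST j. x \<in> A j) -` {y} \<inter> space M \<in> sets M" .
 qed
qed

text \<open>A separated set of maximal cardinality is spanning. The maximum exists because for large
  n the cardinalities are bounded by exp (n h).\<close>

lemma eventually_spanning_set:
 fixes X :: "'a::metric_space set" and h :: real
 assumes h: "topological_entropy X T < ereal h" and e: "\<epsilon> > 0"
 shows "eventually (\<lambda>n. \<exists>E. finite E \<and> E \<subseteq> X \<and> real (card E) \<le> exp (n * h) \<and>
  (\<forall>x\<in>X. \<exists>y\<in>E. \<forall>i<n. dist ((T ^^ i) x) ((T ^^ i) y) \<le> \<epsilon>)) sequentially"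
proof -
 have "limsup (\<lambda>n. SUP E\<in>{E. finite E \<and> separated_set X T n \<epsilon> E}. ereal (ln (real (card E)) / real n)) < ereal h"
  using e by (intro le_less_trans[OF _ h]) (auto simp: topological_entropy_def intro!: SUP_upper2[of \<epsilon>])
 then have "eventually (\<lambda>n. (SUP E\<in>{E. finite E \<and> separated_set X T n \<epsilon> E}. ereal (ln (real (card E)) / real n)) < ereal h) sequentially"
  by (rule Limsup_lessD)
 then show ?thesis using eventually_gt_at_top[of 0]
 proof eventually_elim
  case (elim n)
  have bd: "real (card E) \<le> exp (n * h)" if "finite E" "separated_set X T n \<epsilon> E" for E
  proof (cases "E = {}")
   case False
   have "ereal (ln (real (card E)) / real n) \<le> (SUP E\<in>{E. finite E \<and> separated_set X T n \<epsilon> E}. ereal (ln (real (card E)) / real n))"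
    using that by (intro SUP_upper) auto
   then have "ereal (ln (real (card E)) / real n) < ereal h" using elim(1) by (rule le_less_trans)
   then have "ln (real (card E)) < n * h" using elim(2) by (simp add: field_simps)
   moreover have "real (card E) > 0" using False that by (simp add: card_gt_0_iff)
   ultimately show ?thesis by (metis exp_less_cancel_iff exp_ln less_imp_le)
  qed simp
  let ?P = "\<lambda>k. \<exists>E. finite E \<and> separated_set X T n \<epsilon> E \<and> card E = k"
  have "?P 0" by (auto intro!: exI[of _ "{}"] simp: separated_set_def)
  moreover have "\<forall>k. ?P k \<longrightarrow> k \<le> nat \<lceil>exp (n * h)\<rceil>"
  proof (intro allI impI)
   fix k assume "?P k"
   then have "real k \<le> exp (n * h)" using bd by auto
   then show "k \<le> nat \<lceil>exp (n * h)\<rceil>" by linarith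
  qed
  ultimately have "finite (Collect ?P)" "Collect ?P \<noteq> {}" by (auto simp: finite_nat_set_iff_bounded_le)
  then obtain k where k: "?P k" "\<And>j. ?P j \<Longrightarrow> j \<le> k" using Max_in[of "Collect ?P"] Max_ge[of "Collect ?P"] by blast
  then obtain E where E: "finite E" "separated_set X T n \<epsilon> E" "card E = k" by auto
  have "\<exists>y\<in>E. \<forall>i<n. dist ((T ^^ i) x) ((T ^^ i) y) \<le> \<epsilon>" if x: "x \<in> X" for x
  proof (rule ccontr)
   assume *: "\<not> ?thesis"
   have xE: "x \<notin> E"
   proof
    assume "x \<in> E"
    moreover have "\<forall>i<n. dist ((T ^^ i) x) ((T ^^ i) x) \<le> \<epsilon>" using e by simp
    ultimately show False using * by blast
   qed
   have "separated_set X T n \<epsilon> (insert x E)" unfolding separated_set_def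
   proof (intro conjI ballI impI)
    show "insert x E \<subseteq> X" using E x by (auto simp: separated_set_def)
    fix a b assume ab: "a \<in> insert x E" "b \<in> insert x E" "a \<noteq> b"
    consider "a = x" "b \<in> E" | "b = x" "a \<in> E" | "a \<in> E" "b \<in> E" using ab by auto
    then show "\<exists>i<n. \<epsilon> < dist ((T ^^ i) a) ((T ^^ i) b)"
    proof cases
     case 1 then show ?thesis using * by (auto simp: not_le)
    next
     case 2
     then have "\<exists>i<n. \<epsilon> < dist ((T ^^ i) x) ((T ^^ i) a)" using * by (auto simp: not_le)
     then show ?thesis using 2 by (simp add: dist_commute)
    next
     case 3 then show ?thesis using E ab by (auto simp: separated_set_def)
    qed
   qed
   then have "card (insert x E) \<le> k" using E by (intro k(2)) auto
   then show False using xE E by simp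
  qed
  then show ?case using E bd by (auto simp: separated_set_def)
 qed
qed

text \<open>A measurable choice of a centre that follows the orbit. The centres are an arbitrary
  family \<open>c i y\<close>, because orbits of nearby maps will be followed by orbits of the limit
  map.\<close>

lemma simple_function_spanning_index:
 fixes X :: "'a::euclidean_space set"
 assumes M: "prob_space M" "sets M = sets (restrict_space borel X)"
  and T: "T \<in> measurable M M"
  and E: "finite E" "\<And>x. x \<in> X \<Longrightarrow> \<exists>y\<in>E. \<forall>i<n. dist ((T ^^ i) x) (c i y) \<le> e"
 obtains F :: "'a \<Rightarrow> nat" and z :: "nat \<Rightarrow> 'b" where "simple_function M F" "\<And>x. x \<in> X \<Longrightarrow> F x < card E"
  "\<And>x i. x \<in> X \<Longrightarrow> i < n \<Longrightarrow> dist ((T ^^ i) x) (c i (z (F x))) \<le> e"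
proof -
 have spX: "space M = X" using sets_eq_imp_space_eq[OF M(2)] by (simp add: space_restrict_space)
 obtain z where z: "bij_betw z {..<card E} E" using E(1) by (metis ex_bij_betw_nat_finite atLeast0LessThan)
 define A where "A j = {x. \<forall>i<n. dist ((T ^^ i) x) (c i (z j)) \<le> e}" for j
 have cover: "\<exists>j<card E. x \<in> A j" if "x \<in> space M" for x
 proof -
  have "\<exists>y\<in>E. \<forall>i<n. dist ((T ^^ i) x) (c i y) \<le> e" using E(2) that spX by simp
  then obtain y where y: "y \<in> E" "\<forall>i<n. dist ((T ^^ i) x) (c i y) \<le> e" by blast
  moreover obtain j where "j < card E" "y = z j" using z y(1) by (auto simp: bij_betw_def)
  ultimately show ?thesis by (auto simp: A_def)
 qed
 have idm: "(\<lambda>x. x) \<in> measurable M borel"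
  unfolding measurable_cong_sets[OF M(2) refl] by (intro measurable_restrict_space1) simp
 have Tm [measurable]: "(\<lambda>x. (T ^^ i) x) \<in> measurable M borel" for i
  using measurable_comp[OF funpow_measurable[OF T, of i] idm] by (simp add: o_def)
 have meas: "A j \<inter> space M \<in> sets M" for j
 proof -
  have "A j \<inter> space M = {x\<in>space M. \<forall>i<n. dist ((T ^^ i) x) (c i (z j)) \<le> e}" by (auto simp: A_def)
  also have "\<dots> \<in> sets M" by measurable
  finally show ?thesis .
 qed
 show ?thesis
 proof (rule that)
  show "simple_function M (\<lambda>x. LEAST j. x \<in> A j)" using meas cover by (rule simple_function_least_index)
  fix x assume x: "x \<in> X"
  obtain j where j: "j < card E" "x \<in> A j" using cover x spX by auto
  show "(LEAST j. x \<in> A j) < card E" using j by (meson Least_le le_less_trans)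
  show "dist ((T ^^ i) x) (c i (z (LEAST j. x \<in> A j))) \<le> e" if "i < n" for i
   using LeastI[of "\<lambda>j. x \<in> A j", OF j(2)] that by (simp add: A_def)
 qed
qed

text \<open>Goodwyn's half of the variational principle: the index of a Bowen ball of radius
  \<open>e / 3\<close> determines the orbit up to \<open>e\<close>, hence the itineraries of any
  finite partition up to small entropy.\<close>

lemma metric_entropy_le_topological_entropy:
 fixes X :: "'a::euclidean_space set"
 assumes M: "prob_space M" "sets M = sets (restrict_space borel X)" "X \<in> sets borel"
  and T: "T \<in> measurable M M" "distr M M T = M"
 shows "metric_entropy T M \<le> topological_entropy X T"
proof (rule ccontr)
 interpret prob_space M by fact
 have spX: "space M = X" using sets_eq_imp_space_eq[OF M(2)] by (simp add: space_restrict_space)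
 assume "\<not> ?thesis"
 then have "topological_entropy X T < metric_entropy T M" by simp
 then obtain Q :: "'a \<Rightarrow> 'a set" where Q: "simple_function M Q"
  "topological_entropy X T < limsup (\<lambda>n. ereal (ent M (names Q T n) / real n))"
  using metric_entropy_greaterE[OF T(1)] by metis
 then obtain d where d: "topological_entropy X T < ereal d"
   "ereal d < limsup (\<lambda>n. ereal (ent M (names Q T n) / real n))" using ereal_dense2 by blast
 then obtain c where c: "topological_entropy X T < ereal c" "ereal c < ereal d" using ereal_dense2 by blast
 define \<eta> where "\<eta> = (d - c) / 2"
 have eta: "\<eta> > 0" using c by (simp add: \<eta>_def)
 obtain e :: real where e: "e > 0"
  "\<And>n (F :: 'a \<Rightarrow> nat) G. simple_function M F \<Longrightarrow> G \<in> sets M \<Longrightarrow>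
    (\<And>x y i. x \<in> G \<Longrightarrow> y \<in> G \<Longrightarrow> F x = F y \<Longrightarrow> i < n \<Longrightarrow> dist ((T ^^ i) x) ((T ^^ i) y) < e) \<Longrightarrow>
    ent M (names Q T n) \<le> ent M F + n * \<eta> + ln 2
     + prob (space M - G) * n * ln (real (card (Q ` space M)))"
  by (rule names_entropy_le_dynamical_cells[OF M T Q(1) eta]) blast
 have e3: "e / 3 > 0" using e by simp
 have lim: "(\<lambda>n. ln 2 / real n) \<longlonglongrightarrow> 0" by (rule lim_const_over_n)
 have "eventually (\<lambda>n. ereal (ent M (names Q T n) / real n) \<le> ereal d) sequentially"
  using eventually_spanning_set[OF c(1) e3] eventually_gt_at_top[of 0]
   order_tendstoD(2)[OF lim eta]
 proof eventually_elim
  case (elim n)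
  then obtain E where E: "finite E" "E \<subseteq> X" "real (card E) \<le> exp (n * c)"
   "\<And>x. x \<in> X \<Longrightarrow> \<exists>y\<in>E. \<forall>i<n. dist ((T ^^ i) x) ((T ^^ i) y) \<le> e / 3" by blast
  obtain F :: "'a \<Rightarrow> nat" and z where F: "simple_function M F" "\<And>x. x \<in> X \<Longrightarrow> F x < card E"
   "\<And>x i. x \<in> X \<Longrightarrow> i < n \<Longrightarrow> dist ((T ^^ i) x) ((T ^^ i) (z (F x))) \<le> e / 3"
   using simple_function_spanning_index[OF M(1,2) T(1) E(1), of n "\<lambda>i. T ^^ i" "e / 3"] E(4) by metis
  have "ent M (names Q T n) \<le> ent M F + n * \<eta> + ln 2 + prob (space M - space M) * n * ln (real (card (Q ` space M)))"
  proof (rule e(2)[OF F(1)])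
   fix x y i assume "x \<in> space M" "y \<in> space M" "F x = F y" "i < n"
   then have "dist ((T ^^ i) x) ((T ^^ i) (z (F x))) \<le> e / 3" "dist ((T ^^ i) y) ((T ^^ i) (z (F x))) \<le> e / 3"
    using F(3)[of x i] F(3)[of y i] spX by auto
   then have "dist ((T ^^ i) x) ((T ^^ i) y) \<le> e / 3 + e / 3" by (meson dist_triangle2 add_mono order_trans)
   then show "dist ((T ^^ i) x) ((T ^^ i) y) < e" using e(1) by simp
  qed simp
  moreover have "ent M F \<le> ln (card {..<card E})" using F spX by (intro ent_le_ln_card) auto
  moreover have "ln (card {..<card E}) \<le> n * c"
  proof -
   obtain x where "x \<in> X" using not_empty spX by auto
   then have "card E > 0" using F(2)[of x] by simp
   then have "ln (real (card E)) \<le> ln (exp (n * c))" using E(3) by (subst ln_le_cancel_iff) auto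
   then show ?thesis by simp
  qed
  ultimately have "ent M (names Q T n) \<le> n * c + n * \<eta> + ln 2" by simp
  moreover have "ln 2 < n * \<eta>" using elim by (simp add: field_simps)
  ultimately have "ent M (names Q T n) \<le> n * d" by (simp add: \<eta>_def field_simps)
  then show ?case using elim by (simp add: field_simps)
 qed
 then have "limsup (\<lambda>n. ereal (ent M (names Q T n) / real n)) \<le> ereal d" by (rule Limsup_bounded)
 then show False using d(2) by simp
qed

section \<open>Weak convergence of measures\<close>

lemma borel_prob_onD:
 assumes "borel_prob_on X M"
 shows "prob_space M" "sets M = sets (restrict_space borel X)" "space M = X"
  "X \<in> sets borel \<Longrightarrow> B \<subseteq> X \<Longrightarrow> B \<in> sets borel \<Longrightarrow> B \<in> sets M"
proof -
 show 1: "prob_space M" "sets M = sets (restrict_space borel X)" using assms by (auto simp: borel_prob_on_def)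
 show "space M = X" using sets_eq_imp_space_eq[OF 1(2)] by (simp add: space_restrict_space)
 show "B \<in> sets M" if "X \<in> sets borel" "B \<subseteq> X" "B \<in> sets borel"
  unfolding 1(2) using that by (simp add: sets_restrict_space_iff)
qed

lemma borel_prob_on_continuous_measurable:
 assumes "borel_prob_on X M" "continuous_on X (\<phi> :: _ \<Rightarrow> _::topological_space)"
 shows "\<phi> \<in> borel_measurable M" unfolding measurable_cong_sets[OF borel_prob_onD(2)[OF assms(1)] refl]
 using assms(2) by (rule borel_measurable_continuous_on_restrict)

lemma borel_prob_on_continuous_integrable:
 fixes \<phi> :: "'a::topological_space \<Rightarrow> real"
 assumes M: "borel_prob_on X M" and X: "compact X" and \<phi>: "continuous_on X \<phi>"
 shows "integrable M \<phi>"
proof -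
 interpret prob_space M using M by (rule borel_prob_onD)
 have "bounded (\<phi> ` X)" using X \<phi> by (intro compact_imp_bounded compact_continuous_image)
 then obtain B where "\<And>x. x \<in> X \<Longrightarrow> norm (\<phi> x) \<le> B" by (auto simp: bounded_iff)
 then show ?thesis using borel_prob_on_continuous_measurable[OF M \<phi>] borel_prob_onD(3)[OF M]
  by (intro integrable_const_bound[where B = B]) auto
qed

lemma weak_star_uniform_limit:
 fixes X :: "'a::topological_space set" and \<psi>s :: "nat \<Rightarrow> 'a \<Rightarrow> real"
 assumes X: "compact X" and \<nu>: "\<And>k. borel_prob_on X (\<nu> k)" and w: "weak_star_converges X \<nu> \<mu>"
  and \<psi>: "uniform_limit X \<psi>s \<psi> sequentially" "\<And>k. continuous_on X (\<psi>s k)" "continuous_on X \<psi>"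
 shows "(\<lambda>k. integral\<^sup>L (\<nu> k) (\<psi>s k)) \<longlonglongrightarrow> integral\<^sup>L \<mu> \<psi>"
proof -
 have "(\<lambda>k. integral\<^sup>L (\<nu> k) (\<psi>s k) - integral\<^sup>L (\<nu> k) \<psi>) \<longlonglongrightarrow> 0"
 proof (rule metric_LIMSEQ_I)
  fix e :: real assume e: "e > 0"
  then have "eventually (\<lambda>k. \<forall>x\<in>X. dist (\<psi>s k x) (\<psi> x) < e / 2) sequentially"
   using uniform_limitD[OF \<psi>(1), of "e / 2"] by simp
  then obtain N where N: "\<And>k x. k \<ge> N \<Longrightarrow> x \<in> X \<Longrightarrow> dist (\<psi>s k x) (\<psi> x) < e / 2" by (auto simp: eventually_sequentially)
  have "dist (integral\<^sup>L (\<nu> k) (\<psi>s k) - integral\<^sup>L (\<nu> k) \<psi>) 0 < e" if "k \<ge> N" for k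
  proof -
   interpret prob_space "\<nu> k" using \<nu> by (rule borel_prob_onD)
   have i: "integrable (\<nu> k) (\<psi>s k)" "integrable (\<nu> k) \<psi>" using borel_prob_on_continuous_integrable[OF \<nu> X \<psi>(2)]
     borel_prob_on_continuous_integrable[OF \<nu> X \<psi>(3)] .
   have "\<bar>integral\<^sup>L (\<nu> k) (\<psi>s k) - integral\<^sup>L (\<nu> k) \<psi>\<bar> = \<bar>\<integral>x. \<psi>s k x - \<psi> x \<partial>\<nu> k\<bar>" using i by simp
   also have "\<dots> \<le> (\<integral>x. \<bar>\<psi>s k x - \<psi> x\<bar> \<partial>\<nu> k)" by (rule integral_abs_bound)
   also have "\<dots> \<le> (\<integral>x. e / 2 \<partial>\<nu> k)" using i N[OF that] borel_prob_onD(3)[OF \<nu>]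
    by (intro integral_mono) (auto simp: dist_real_def intro: less_imp_le)
   also have "\<dots> < e" using e by (simp add: prob_space)
   finally show ?thesis by (simp add: dist_real_def)
  qed
  then show "\<exists>no. \<forall>n\<ge>no. dist (integral\<^sup>L (\<nu> n) (\<psi>s n) - integral\<^sup>L (\<nu> n) \<psi>) 0 < e" by blast
 qed
 moreover have "(\<lambda>k. integral\<^sup>L (\<nu> k) \<psi>) \<longlonglongrightarrow> integral\<^sup>L \<mu> \<psi>" using w \<psi>(3) by (simp add: weak_star_converges_def)
 ultimately show ?thesis by (rule Lim_transform[rotated])
qed

text \<open>The integrands are continuous and decrease to the indicator of the zero set of
  \<open>g\<close>. With \<open>g\<close> built from distances, closed sets become accessible to
  weak convergence.\<close>

lemma integral_infdist_test_tendsto: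
 fixes g :: "'a::topological_space \<Rightarrow> real"
 assumes M: "borel_prob_on X M" and X: "X \<in> sets borel" and g: "continuous_on X g" "\<And>x. x \<in> X \<Longrightarrow> g x \<ge> 0"
 shows "(\<lambda>j. \<integral>x. max 0 (1 - real j * g x) \<partial>M) \<longlonglongrightarrow> measure M {x\<in>X. g x = 0}"
proof -
 interpret prob_space M using M by (rule borel_prob_onD)
 have sp: "space M = X" using M by (rule borel_prob_onD)
 have [measurable]: "g \<in> borel_measurable M" using M g(1) by (rule borel_prob_on_continuous_measurable)
 have "{x\<in>space M. g x = 0} \<in> sets M" by measurable
 then have [measurable]: "{x\<in>X. g x = 0} \<in> sets M" by (simp add: sp)
 have "(\<lambda>j. \<integral>x. max 0 (1 - real j * g x) \<partial>M) \<longlonglongrightarrow> (\<integral>x. indicator {x\<in>X. g x = 0} x \<partial>M)"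
 proof (rule integral_dominated_convergence[where w = "\<lambda>_. 1"])
  show "AE x in M. (\<lambda>j. max 0 (1 - real j * g x)) \<longlonglongrightarrow> indicator {x\<in>X. g x = 0} x"
  proof (rule AE_I2)
   fix x assume x: "x \<in> space M"
   show "(\<lambda>j. max 0 (1 - real j * g x)) \<longlonglongrightarrow> indicator {x\<in>X. g x = 0} x"
   proof (cases "g x = 0")
    case False
    then have gx: "g x > 0" using g(2) x sp by fastforce
    have "eventually (\<lambda>j. max 0 (1 - real j * g x) = 0) sequentially"
    proof -
     obtain N :: nat where N: "1 / g x < real N" using reals_Archimedean2 by blast
     have "max 0 (1 - real j * g x) = 0" if "j \<ge> N" for j
     proof -
      have "1 / g x \<le> real j" using N that by linarith
      then show ?thesis using gx by (simp add: field_simps max_def)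
     qed
     then show ?thesis by (auto simp: eventually_sequentially)
    qed
    then show ?thesis using False by (simp add: tendsto_eventually)
   qed (use x sp in simp)
  qed
  show "AE x in M. norm (max 0 (1 - real j * g x)) \<le> 1" for j using g(2) sp by (intro AE_I2) auto
 qed auto
 then show ?thesis using sp by (simp add: Int_absorb2)
qed

text \<open>Integrals of continuous functions determine the measures of closed sets, which form an
  intersection-stable generator.\<close>

lemma borel_prob_on_eqI:
 fixes X :: "'a::euclidean_space set"
 assumes M: "borel_prob_on X M" and N: "borel_prob_on X N" and X: "closed X"
  and eq: "\<And>\<phi> :: 'a \<Rightarrow> real. continuous_on X \<phi> \<Longrightarrow> integral\<^sup>L M \<phi> = integral\<^sup>L N \<phi>"
 shows "M = N"
proof -
 interpret M: prob_space M using M by (rule borel_prob_onD)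
 interpret N: prob_space N using N by (rule borel_prob_onD)
 have Xb: "X \<in> sets borel" using X by simp
 have sp: "space M = X" "space N = X" using M N borel_prob_onD(3) by auto
 have cl: "measure M (C \<inter> X) = measure N (C \<inter> X)" if C: "closed C" for C
 proof (cases "C = {}")
  case False
  let ?g = "\<lambda>x. infdist x C"
  have "{x\<in>X. ?g x = 0} = C \<inter> X" using in_closed_iff_infdist_zero[OF C False] by auto
  moreover have g: "continuous_on X ?g" by (intro continuous_intros)
  ultimately have "(\<lambda>j. \<integral>x. max 0 (1 - real j * ?g x) \<partial>M) \<longlonglongrightarrow> measure M (C \<inter> X)"
   "(\<lambda>j. \<integral>x. max 0 (1 - real j * ?g x) \<partial>N) \<longlonglongrightarrow> measure N (C \<inter> X)"
   using integral_infdist_test_tendsto[OF M Xb g] integral_infdist_test_tendsto[OF N Xb g]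
   by (auto simp: infdist_nonneg)
  moreover have "(\<integral>x. max 0 (1 - real j * ?g x) \<partial>M) = (\<integral>x. max 0 (1 - real j * ?g x) \<partial>N)" for j
   by (intro eq continuous_intros)
  ultimately show ?thesis using LIMSEQ_unique by auto
 qed simp
 have idM: "(\<lambda>x. x) \<in> measurable M borel" "(\<lambda>x. x) \<in> measurable N borel"
  using borel_prob_on_continuous_measurable[OF M continuous_on_id]
   borel_prob_on_continuous_measurable[OF N continuous_on_id] by auto
 define M' where "M' = distr M borel (\<lambda>x. x)"
 define N' where "N' = distr N borel (\<lambda>x. x)"
 have eM: "emeasure M' A = emeasure M (A \<inter> X)" "emeasure N' A = emeasure N (A \<inter> X)" if "A \<in> sets borel" for A
  using that idM by (auto simp: M'_def N'_def emeasure_distr sp)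
 have "M' = N'"
 proof (rule measure_eqI_generator_eq[where E = "Collect closed" and \<Omega> = UNIV and A = "\<lambda>_. UNIV"])
  show "Int_stable (Collect closed :: 'a set set)" by (auto simp: Int_stable_def)
  show "sets M' = sigma_sets UNIV (Collect closed)" "sets N' = sigma_sets UNIV (Collect closed)"
   by (simp_all add: M'_def N'_def borel_eq_closed)
  show "emeasure M' S = emeasure N' S" if "S \<in> Collect closed" for S
   using that eM[of S] cl[of S] by (simp add: M.emeasure_eq_measure N.emeasure_eq_measure)
  show "emeasure M' UNIV \<noteq> \<infinity>" using eM[of UNIV] by (simp add: M.emeasure_eq_measure)
 qed auto
 show ?thesis
 proof (rule measure_eqI)
  show "sets M = sets N" using borel_prob_onD(2)[OF M] borel_prob_onD(2)[OF N] by simp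
  fix A assume "A \<in> sets M"
  then have A: "A \<in> sets borel" "A \<inter> X = A" using borel_prob_onD(2)[OF M] Xb by (auto simp: sets_restrict_space_iff)
  show "emeasure M A = emeasure N A" using eM[OF A(1)] \<open>M' = N'\<close> A(2) by simp
 qed
qed

section \<open>Iterates of a convergent sequence of maps, and invariance of the limit
  measure\<close>

lemma uniform_limit_compose_continuous:
 fixes X :: "'a::metric_space set" and \<phi> :: "'a \<Rightarrow> 'b::metric_space"
 assumes X: "compact X" and g: "uniform_limit Y gs g sequentially"
  "\<And>k. gs k \<in> Y \<rightarrow> X" "g \<in> Y \<rightarrow> X" and \<phi>: "continuous_on X \<phi>"
 shows "uniform_limit Y (\<lambda>k x. \<phi> (gs k x)) (\<lambda>x. \<phi> (g x)) sequentially"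
proof (rule uniform_limitI)
 fix e :: real assume "e > 0"
 moreover have "uniformly_continuous_on X \<phi>" using \<phi> X by (rule compact_uniformly_continuous)
 ultimately obtain d where d: "d > 0" "\<And>x y. x \<in> X \<Longrightarrow> y \<in> X \<Longrightarrow> dist x y < d \<Longrightarrow> dist (\<phi> x) (\<phi> y) < e"
  by (metis uniformly_continuous_on_def)
 have "eventually (\<lambda>k. \<forall>x\<in>Y. dist (gs k x) (g x) < d) sequentially" using g(1) d(1) by (simp add: uniform_limit_iff)
 then show "eventually (\<lambda>k. \<forall>x\<in>Y. dist (\<phi> (gs k x)) (\<phi> (g x)) < e) sequentially"
  by eventually_elim (use d(2) g in blast)
qed

lemma funpow_Pi:
 assumes "f \<in> X \<rightarrow> X"
 shows "(f ^^ i) \<in> X \<rightarrow> X" using assms by (induction i) (auto simp: Pi_iff)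

lemma uniform_limit_funpow:
 fixes X :: "'a::metric_space set"
 assumes X: "compact X" and f: "uniform_limit X fs f sequentially"
  "\<And>k. fs k \<in> X \<rightarrow> X" "f \<in> X \<rightarrow> X" "continuous_on X f"
 shows "uniform_limit X (\<lambda>k. fs k ^^ i) (f ^^ i) sequentially"
proof (induction i)
 case 0
 show ?case by (simp add: uniform_limit_iff)
next
 case (Suc i)
 have inv: "(fs k ^^ i) \<in> X \<rightarrow> X" "(f ^^ i) \<in> X \<rightarrow> X" for k using f(2,3) by (auto intro!: funpow_Pi)
 have 1: "uniform_limit X (\<lambda>k x. f ((fs k ^^ i) x)) (\<lambda>x. f ((f ^^ i) x)) sequentially"
  using X Suc inv f(4) by (rule uniform_limit_compose_continuous)
 show ?case
 proof (rule uniform_limitI)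
  fix e :: real assume e: "e > 0"
  have "eventually (\<lambda>k. \<forall>x\<in>X. dist (f ((fs k ^^ i) x)) (f ((f ^^ i) x)) < e / 2) sequentially"
   "eventually (\<lambda>k. \<forall>x\<in>X. dist (fs k x) (f x) < e / 2) sequentially"
   using uniform_limitD[OF 1, of "e / 2"] uniform_limitD[OF f(1), of "e / 2"] e by auto
  then show "eventually (\<lambda>k. \<forall>x\<in>X. dist ((fs k ^^ Suc i) x) ((f ^^ Suc i) x) < e) sequentially"
  proof eventually_elim
   case (elim k)
   show ?case
   proof
    fix x assume x: "x \<in> X"
    have "dist (fs k ((fs k ^^ i) x)) (f ((fs k ^^ i) x)) < e / 2" using elim(2) inv x by auto
    moreover have "dist (f ((fs k ^^ i) x)) (f ((f ^^ i) x)) < e / 2" using elim(1) x by auto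
    ultimately show "dist ((fs k ^^ Suc i) x) ((f ^^ Suc i) x) < e"
     using dist_triangle[of "fs k ((fs k ^^ i) x)" "f ((f ^^ i) x)" "f ((fs k ^^ i) x)"] by simp
   qed
  qed
 qed
qed

lemma continuous_on_funpow:
 assumes "f \<in> X \<rightarrow> X" "continuous_on X f"
 shows "continuous_on X (f ^^ i)"
proof (induction i)
 case (Suc i)
 have "continuous_on X (f \<circ> (f ^^ i))" using Suc assms funpow_Pi[OF assms(1), of i]
  by (intro continuous_on_compose) (auto intro: continuous_on_subset)
 then show ?case by simp
qed (simp add: id_def)

lemma borel_prob_on_self_measurable:
 assumes M: "borel_prob_on X M" and f: "f \<in> X \<rightarrow> X" "continuous_on X f"
 shows "f \<in> measurable M M"
proof -
 have "f \<in> measurable (restrict_space borel X) (restrict_space borel X)"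
  using f by (intro measurable_restrict_space2 borel_measurable_continuous_on_restrict)
   (auto simp: space_restrict_space)
 then show ?thesis using borel_prob_onD(2)[OF M] by (simp cong: measurable_cong_sets)
qed

text \<open>The functions \<open>\<phi> (fs k x)\<close> converge uniformly to
  \<open>\<phi> (f x)\<close>, so both sides of the invariance identity pass to the limit, and
  continuous functions determine the measure.\<close>

lemma weak_star_limit_invariant:
 fixes X :: "'a::euclidean_space set"
 assumes X: "compact X" and f: "uniform_limit X fs f sequentially"
  "\<And>k. fs k \<in> X \<rightarrow> X" "f \<in> X \<rightarrow> X" "continuous_on X f" "\<And>k. continuous_on X (fs k)"
  and \<nu>: "\<And>k. borel_prob_on X (\<nu> k)" "\<And>k. invariant_measure (fs k) (\<nu> k)"
  and \<mu>: "borel_prob_on X \<mu>" "weak_star_converges X \<nu> \<mu>"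
 shows "invariant_measure f \<mu>"
proof -
 have fm: "f \<in> measurable \<mu> \<mu>" using \<mu>(1) f(3,4) by (rule borel_prob_on_self_measurable)
 interpret prob_space \<mu> using \<mu>(1) by (rule borel_prob_onD)
 have "distr \<mu> \<mu> f = \<mu>"
 proof (rule borel_prob_on_eqI[OF _ \<mu>(1)])
  show "borel_prob_on X (distr \<mu> \<mu> f)"
   using borel_prob_onD(2)[OF \<mu>(1)] fm by (simp add: borel_prob_on_def prob_space_distr)
  show "closed X" using X by (rule compact_imp_closed)
  fix \<phi> :: "'a \<Rightarrow> real" assume \<phi>: "continuous_on X \<phi>"
  have c: "continuous_on X (\<lambda>x. \<phi> (fs k x))" "continuous_on X (\<lambda>x. \<phi> (f x))" for k
   using f by (auto intro!: continuous_on_compose2[OF \<phi>])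
  have "(\<lambda>k. \<integral>x. \<phi> (fs k x) \<partial>\<nu> k) \<longlonglongrightarrow> (\<integral>x. \<phi> (f x) \<partial>\<mu>)"
   using X \<nu>(1) \<mu>(2) uniform_limit_compose_continuous[OF X f(1-3) \<phi>] c by (rule weak_star_uniform_limit)
  moreover have "(\<integral>x. \<phi> (fs k x) \<partial>\<nu> k) = integral\<^sup>L (\<nu> k) \<phi>" for k
  proof -
   have "(\<integral>x. \<phi> (fs k x) \<partial>\<nu> k) = integral\<^sup>L (distr (\<nu> k) (\<nu> k) (fs k)) \<phi>"
    using \<nu>(2)[of k] borel_prob_on_continuous_measurable[OF \<nu>(1) \<phi>]
    by (intro integral_distr[symmetric]) (auto simp: invariant_measure_def)
   then show ?thesis using \<nu>(2)[of k] by (simp add: invariant_measure_def)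
  qed
  moreover have "(\<lambda>k. integral\<^sup>L (\<nu> k) \<phi>) \<longlonglongrightarrow> integral\<^sup>L \<mu> \<phi>" using \<mu>(2) \<phi> by (simp add: weak_star_converges_def)
  ultimately have "(\<integral>x. \<phi> (f x) \<partial>\<mu>) = integral\<^sup>L \<mu> \<phi>" using LIMSEQ_unique by simp
  then show "integral\<^sup>L (distr \<mu> \<mu> f) \<phi> = integral\<^sup>L \<mu> \<phi>"
   using fm borel_prob_on_continuous_measurable[OF \<mu>(1) \<phi>] by (simp add: integral_distr)
 qed
 then show ?thesis using fm by (simp add: invariant_measure_def)
qed

section \<open>Partitions with null boundary and the continuity of their entropy\<close>

lemma null_sphere_radius:
 fixes X :: "'a::euclidean_space set"
 assumes M: "borel_prob_on X M" and r: "(r::real) > 0"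
 obtains \<rho> where "0 < \<rho>" "\<rho> < r" "measure M {x\<in>X. dist c x = \<rho>} = 0"
proof -
 interpret prob_space M using M by (rule borel_prob_onD)
 have [measurable]: "dist c \<in> borel_measurable M"
  using M by (rule borel_prob_on_continuous_measurable) (intro continuous_intros)
 interpret N: prob_space "distr M borel (dist c)" by (rule prob_space_distr) simp
 \<comment> \<open>Spheres around \<open>c\<close> of different radii are disjoint, so only
   countably many of them carry mass.\<close>
 have "countable {\<rho>. measure (distr M borel (dist c)) {\<rho>} \<noteq> 0}" by (rule N.countable_support)
 moreover have "uncountable {0<..<r}" using r by (simp add: uncountable_open_interval)
 ultimately have "\<not> {0<..<r} \<subseteq> {\<rho>. measure (distr M borel (dist c)) {\<rho>} \<noteq> 0}" using countable_subset by blast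
 then obtain \<rho> where \<rho>: "0 < \<rho>" "\<rho> < r" "measure (distr M borel (dist c)) {\<rho>} = 0" by auto
 have "measure (distr M borel (dist c)) {\<rho>} = measure M (dist c -` {\<rho>} \<inter> space M)" by (rule measure_distr) auto
 also have "dist c -` {\<rho>} \<inter> space M = {x\<in>X. dist c x = \<rho>}" using borel_prob_onD(3)[OF M] by auto
 finally show ?thesis using \<rho> by (intro that[of \<rho>]) auto
qed

lemma tendsto_minus_x_ln_x:
 fixes p :: "nat \<Rightarrow> real"
 assumes "p \<longlonglongrightarrow> a" "\<And>k. p k \<ge> 0"
 shows "(\<lambda>k. p k * ln (p k)) \<longlonglongrightarrow> a * ln a"
proof (cases "a = 0")
 case False
 then show ?thesis using assms by (intro tendsto_intros) auto
next
 case True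
 have 1: "((\<lambda>x::real. x * ln x) \<longlongrightarrow> 0) (at_right 0)" by real_asymp
 show ?thesis
 proof (rule tendstoI)
  fix e :: real assume e: "e > 0"
  obtain b where b: "b > 0" "\<And>x. 0 < x \<Longrightarrow> x < b \<Longrightarrow> \<bar>x * ln x\<bar> < e"
   using tendstoD[OF 1 e] by (auto simp: eventually_at_right_field dist_real_def)
  have "eventually (\<lambda>k. p k < b) sequentially" using order_tendstoD(2)[OF assms(1)] b(1) True by simp
  then show "eventually (\<lambda>k. dist (p k * ln (p k)) (a * ln a) < e) sequentially"
  proof eventually_elim
   case (elim k)
   show ?case
   proof (cases "p k = 0")
    case False
    then have "p k > 0" using assms(2)[of k] by simp
    then show ?thesis using b(2) elim True by simp
   qed (use e True in simp)
  qed
 qed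
qed

text \<open>As the total mass is 1, a loss at one place would have to be compensated by a gain
  elsewhere; asymptotic upper bounds at all places therefore imply convergence.\<close>

lemma tendsto_of_eventually_le_sum_one:
 fixes p :: "nat \<Rightarrow> 'b \<Rightarrow> real"
 assumes L: "finite L" and sum: "\<And>k. (\<Sum>v\<in>L. p k v) = 1" "(\<Sum>v\<in>L. q v) = 1"
  and le: "\<And>v e. v \<in> L \<Longrightarrow> e > 0 \<Longrightarrow> eventually (\<lambda>k. p k v \<le> q v + e) sequentially"
  and v: "v \<in> L"
 shows "(\<lambda>k. p k v) \<longlonglongrightarrow> q v"
proof (rule tendstoI)
 fix e :: real assume e: "e > 0"
 define d where "d = e / (real (card L) + 1)"
 have d: "d > 0" using e by (simp add: d_def add_nonneg_pos)
 have cd: "real (card L) * d < e" using e by (simp add: d_def field_simps)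
 have "eventually (\<lambda>k. \<forall>w\<in>L. p k w \<le> q w + d) sequentially" using L le d by (intro eventually_ball_finite) auto
 then show "eventually (\<lambda>k. dist (p k v) (q v) < e) sequentially"
 proof eventually_elim
  case (elim k)
  have c1: "card L \<ge> 1" using L v by (auto simp: Suc_le_eq card_gt_0_iff)
  have "(\<Sum>w\<in>L - {v}. p k w) \<le> (\<Sum>w\<in>L - {v}. q w + d)" using elim by (intro sum_mono) auto
  also have "\<dots> = (\<Sum>w\<in>L - {v}. q w) + (real (card L) - 1) * d" using L v c1 by (simp add: sum.distrib of_nat_diff)
  finally have "1 - p k v \<le> 1 - q v + (real (card L) - 1) * d" using sum(1)[of k] sum(2) L v by (simp add: sum.remove)
  then have "q v \<le> p k v + (real (card L) - 1) * d" by simp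
  moreover have "(real (card L) - 1) * d \<le> real (card L) * d" using d by simp
  moreover have "p k v \<le> q v + d" using elim v by auto
  moreover have "d \<le> real (card L) * d" using c1 d by simp
  ultimately show ?case using cd by (auto simp: dist_real_def)
 qed
qed

lemma (in prob_space) ent_eq_sum_superset:
 assumes F: "simple_function M F" and L: "finite L" "F ` space M \<subseteq> L"
 shows "ent M F = - (\<Sum>v\<in>L. prob {x\<in>space M. F x = v} * ln (prob {x\<in>space M. F x = v}))"
  and "(\<Sum>v\<in>L. prob {x\<in>space M. F x = v}) = 1"
proof -
 have eq: "F -` {v} \<inter> space M = {x\<in>space M. F x = v}" for v by auto
 have z: "prob {x\<in>space M. F x = v} = 0" if "v \<in> L - F ` space M" for v
 proof -
  have *: "{x\<in>space M. F x = v} = {}" using that by auto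
  show ?thesis unfolding * by simp
 qed
 have "(\<Sum>v\<in>F ` space M. prob {x\<in>space M. F x = v} * ln (prob {x\<in>space M. F x = v}))
   = (\<Sum>v\<in>L. prob {x\<in>space M. F x = v} * ln (prob {x\<in>space M. F x = v}))" using L z by (intro sum.mono_neutral_left) auto
 then show "ent M F = - (\<Sum>v\<in>L. prob {x\<in>space M. F x = v} * ln (prob {x\<in>space M. F x = v}))" by (simp add: ent_def eq)
 have "(\<Sum>v\<in>F ` space M. prob {x\<in>space M. F x = v}) = (\<Sum>v\<in>L. prob {x\<in>space M. F x = v})"
  using L z by (intro sum.mono_neutral_left) auto
 then show "(\<Sum>v\<in>L. prob {x\<in>space M. F x = v}) = 1"
  using integral_simple_function(2)[OF F, of "\<lambda>_. 1"] by (simp add: eq prob_space)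
qed

text \<open>The cells are cut out by small balls whose spheres are null for \<open>\<mu>\<close>.
  Weak convergence yields only upper bounds for the masses of closed cylinders, but the masses sum
  to 1, so this is enough; the drift from \<open>f\<close> to \<open>fs k\<close> is absorbed by the
  continuity of the test function.\<close>

lemma small_partition_entropy_limit:
 fixes X :: "'a::euclidean_space set"
 assumes X: "compact X" and f: "uniform_limit X fs f sequentially"
  "\<And>k. fs k \<in> X \<rightarrow> X" "f \<in> X \<rightarrow> X" "continuous_on X f" "\<And>k. continuous_on X (fs k)"
  and \<nu>: "\<And>k. borel_prob_on X (\<nu> k)"
  and \<mu>: "borel_prob_on X \<mu>" "weak_star_converges X \<nu> \<mu>" and inv: "invariant_measure f \<mu>"
  and e: "(\<epsilon>::real) > 0"
 obtains P :: "'a \<Rightarrow> nat" where "simple_function \<mu> P" "\<And>k. simple_function (\<nu> k) P"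
  "\<And>x y. x \<in> X \<Longrightarrow> y \<in> X \<Longrightarrow> P x = P y \<Longrightarrow> dist x y < \<epsilon>"
  "\<And>m. (\<lambda>k. ent (\<nu> k) (names P (fs k) m)) \<longlonglongrightarrow> ent \<mu> (names P f m)"
proof -
 interpret mu: prob_space \<mu> using \<mu>(1) by (rule borel_prob_onD)
 have nu: "prob_space (\<nu> k)" for k using \<nu> by (rule borel_prob_onD)
 have Xb: "X \<in> sets borel" using X by (simp add: borel_compact)
 have spm: "space \<mu> = X" and spn: "space (\<nu> k) = X" for k using \<mu>(1) \<nu> borel_prob_onD(3) by blast+
 have fm: "f \<in> measurable \<mu> \<mu>" using \<mu>(1) f(3,4) by (rule borel_prob_on_self_measurable)
 have fsm: "fs k \<in> measurable (\<nu> k) (\<nu> k)" for k using \<nu> f(2,5) by (rule borel_prob_on_self_measurable)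
 have "\<forall>c. \<exists>\<rho>. 0 < \<rho> \<and> \<rho> < \<epsilon> / 2 \<and> measure \<mu> {x\<in>X. dist c x = \<rho>} = 0"
 proof
  fix c
  obtain \<rho> where "0 < \<rho>" "\<rho> < \<epsilon> / 2" "measure \<mu> {x\<in>X. dist c x = \<rho>} = 0"
   using null_sphere_radius[OF \<mu>(1), of "\<epsilon> / 2" c] e by auto
  then show "\<exists>\<rho>. 0 < \<rho> \<and> \<rho> < \<epsilon> / 2 \<and> measure \<mu> {x\<in>X. dist c x = \<rho>} = 0" by blast
 qed
 then obtain \<rho> where \<rho>: "\<And>c. 0 < \<rho> c" "\<And>c. \<rho> c < \<epsilon> / 2" "\<And>c. measure \<mu> {x\<in>X. dist c x = \<rho> c} = 0" by metis
 have cov0: "X \<subseteq> (\<Union>c\<in>X. ball c (\<rho> c))" using \<rho>(1) by force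
 obtain C where C: "C \<subseteq> X" "finite C" "X \<subseteq> (\<Union>c\<in>C. ball c (\<rho> c))" by (rule compactE_image[OF X _ cov0]) auto
 obtain z where z: "bij_betw z {..<card C} C" using C(2) by (metis ex_bij_betw_nat_finite atLeast0LessThan)
 define N where "N = card C"
 define B where "B j = ball (z j) (\<rho> (z j))" for j
 have cov: "\<exists>j<N. x \<in> B j" if x: "x \<in> X" for x
 proof -
  obtain c where c: "c \<in> C" "x \<in> ball c (\<rho> c)" using C x by blast
  moreover obtain j where "j < N" "c = z j" using z c(1) by (auto simp: bij_betw_def N_def)
  ultimately show ?thesis by (auto simp: B_def)
 qed
 define P where "P x = (LEAST j. x \<in> B j)" for x
 have PB: "P x < N" "x \<in> B (P x)" if x: "x \<in> X" for x
 proof -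
  obtain j where j: "j < N" "x \<in> B j" using cov x by auto
  then show "P x < N" unfolding P_def by (meson Least_le le_less_trans)
  show "x \<in> B (P x)" unfolding P_def using j(2) by (rule LeastI)
 qed
 have sP: "simple_function M P" if "borel_prob_on X M" for M unfolding P_def [abs_def]
 proof (rule simple_function_least_index)
  show "B j \<inter> space M \<in> sets M" for j
   using borel_prob_onD(4)[OF that Xb, of "B j \<inter> X"] borel_prob_onD(3)[OF that] Xb by (auto simp: B_def)
  show "\<exists>j<N. x \<in> B j" if "x \<in> space M" for x using cov that borel_prob_onD(3)[OF \<open>borel_prob_on X M\<close>] by auto
 qed
 define S where "S = (\<Union>c\<in>C. {x\<in>X. dist c x = \<rho> c})"
 have Sm1: "{x\<in>X. dist c x = \<rho> c} \<in> sets \<mu>" for c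
 proof -
  have [measurable]: "dist c \<in> borel_measurable \<mu>"
   using \<mu>(1) by (rule borel_prob_on_continuous_measurable) (intro continuous_intros)
  have "{x\<in>space \<mu>. dist c x = \<rho> c} \<in> sets \<mu>" by measurable
  then show ?thesis by (simp add: spm)
 qed
 have Sm: "S \<in> sets \<mu>" unfolding S_def using C(2) Sm1 by (intro sets.finite_UN) auto
 have "measure \<mu> S \<le> (\<Sum>c\<in>C. measure \<mu> {x\<in>X. dist c x = \<rho> c})"
  unfolding S_def using C(2) Sm1 by (intro mu.finite_measure_subadditive_finite) auto
 then have S0: "measure \<mu> S = 0" using \<rho>(3) by (simp add: measure_le_0_iff)
 \<comment> \<open>Closed substitutes for the cells; they exceed the cells only inside the null set
   \<open>S\<close> of spheres.\<close>
 define K where "K j = closure {x\<in>X. P x = j}" for j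
 have KX: "K j \<subseteq> X" for j unfolding K_def using X by (intro closure_minimal) (auto intro: compact_imp_closed)
 have KP: "P x = j" if x: "x \<in> K j" "x \<notin> S" for x j
 proof -
  have xX: "x \<in> X" using KX x by auto
  \<comment> \<open>Membership in each of the balls, hence the least index \<open>P\<close>, is
    constant on this neighbourhood of \<open>x\<close>, because \<open>x\<close> lies on none of the
    spheres.\<close>
  define U where "U = (\<Inter>i<N. if x \<in> B i then B i else - cball (z i) (\<rho> (z i)))"
  have "open U" unfolding U_def B_def by (intro open_INT) auto
  moreover have "x \<in> U"
  proof -
   have "x \<notin> cball (z i) (\<rho> (z i))" if "i < N" "x \<notin> B i" for i
   proof -
    have "z i \<in> C" using z that by (auto simp: bij_betw_def N_def)
    then have "dist (z i) x \<noteq> \<rho> (z i)" using x xX by (auto simp: S_def)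
    then show ?thesis using that by (auto simp: B_def)
   qed
   then show ?thesis by (auto simp: U_def)
  qed
  ultimately have "U \<inter> {x\<in>X. P x = j} \<noteq> {}" using x(1) unfolding K_def closure_iff_nhds_not_empty by blast
  then obtain y where y: "y \<in> U" "y \<in> X" "P y = j" by auto
  have mem: "y \<in> B i \<longleftrightarrow> x \<in> B i" if "i < N" for i
  proof (cases "x \<in> B i")
   case True
   have "y \<in> (if x \<in> B i then B i else - cball (z i) (\<rho> (z i)))" using y(1) that unfolding U_def by blast
   then show ?thesis using True by simp
  next
   case False
   have "y \<in> (if x \<in> B i then B i else - cball (z i) (\<rho> (z i)))" using y(1) that unfolding U_def by blast
   then have "y \<notin> cball (z i) (\<rho> (z i))" using False by simp
   then show ?thesis using False by (auto simp: B_def)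
  qed
  have "P x = P y" unfolding P_def
  proof (rule Least_equality)
   have "x \<in> B (P y)" using PB[OF y(2)] mem by auto
   then show "x \<in> B (LEAST j. y \<in> B j)" by (simp add: P_def)
   fix i assume i: "x \<in> B i"
   show "(LEAST j. y \<in> B j) \<le> i"
   proof (cases "i < N")
    case True then show ?thesis using mem i by (intro Least_le) auto
   next
    case False then show ?thesis using PB(1)[OF y(2)] by (simp add: P_def)
   qed
  qed
  then show ?thesis using y by simp
 qed
 have lim: "(\<lambda>k. ent (\<nu> k) (names P (fs k) m)) \<longlonglongrightarrow> ent \<mu> (names P f m)" for m
 proof -
  define L where "L = {v. set v \<subseteq> {..<N} \<and> length v = m}"
  have finL: "finite L" unfolding L_def by (rule finite_lists_length_eq) simp
  have rng: "names P g m ` X \<subseteq> L" if "g \<in> X \<rightarrow> X" for g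
   using PB(1) funpow_Pi[OF that] by (fastforce simp: names_def L_def)
  define p where "p k v = measure (\<nu> k) {x\<in>X. names P (fs k) m x = v}" for k v
  define q where "q v = measure \<mu> {x\<in>X. names P f m x = v}" for v
  have "ent (\<nu> k) (names P (fs k) m) = - (\<Sum>v\<in>L. p k v * ln (p k v))" "(\<Sum>v\<in>L. p k v) = 1" for k
   using prob_space.ent_eq_sum_superset[OF nu simple_function_names[OF fsm sP[OF \<nu>]] finL, where n1 = m]
    rng[OF f(2), of k] by (auto simp: spn p_def)
  note p = this
  have q: "ent \<mu> (names P f m) = - (\<Sum>v\<in>L. q v * ln (q v))" "(\<Sum>v\<in>L. q v) = 1"
   using mu.ent_eq_sum_superset[OF simple_function_names[OF fm sP[OF \<mu>(1)]] finL, where n1 = m]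
    rng[OF f(3)] by (auto simp: spm q_def)
  have le: "eventually (\<lambda>k. p k v \<le> q v + d) sequentially" if v: "v \<in> L" and d: "d > 0" for v and d :: real
  proof (cases "\<exists>i<m. {x\<in>X. P x = v ! i} = {}")
   \<comment> \<open>A symbol of \<open>v\<close> that never occurs is treated apart: its closed
     cell would be empty, and \<open>infdist\<close> to the empty set is 0 by convention.\<close>
   case True
   then obtain i where i: "i < m" "{x\<in>X. P x = v ! i} = {}" by auto
   have E: "{x\<in>X. names P (fs k) m x = v} = {}" for k
   proof -
    have "names P (fs k) m x \<noteq> v" if "x \<in> X" for x
    proof
     assume "names P (fs k) m x = v"
     then have "P ((fs k ^^ i) x) = v ! i" using i by (auto simp: names_def)
     moreover have "(fs k ^^ i) x \<in> X" using funpow_Pi[OF f(2)] that by auto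
     ultimately show False using i by auto
    qed
    then show ?thesis by auto
   qed
   have "p k v = 0" for k unfolding p_def E by simp
   then show ?thesis using d by (auto simp: q_def intro!: always_eventually add_nonneg_nonneg)
  next
   case False
   then have ne: "K (v ! i) \<noteq> {}" if "i < m" for i using that closure_subset by (fastforce simp: K_def)
   \<comment> \<open>Vanishes exactly on the orbits that run through the closed cells prescribed by
     \<open>v\<close>; up to a null set this is the cylinder of \<open>v\<close>.\<close>
   define g where "g x = (\<Sum>i<m. infdist ((f ^^ i) x) (K (v ! i)))" for x
   have gc: "continuous_on X g" unfolding g_def using continuous_on_funpow[OF f(3,4)]
    by (intro continuous_on_sum continuous_on_infdist) (simp add: eta_contract_eq)
   have g0: "g x \<ge> 0" for x unfolding g_def by (intro sum_nonneg infdist_nonneg)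
   have "(\<lambda>j. \<integral>x. max 0 (1 - real j * g x) \<partial>\<mu>) \<longlonglongrightarrow> measure \<mu> {x\<in>X. g x = 0}"
    using \<mu>(1) Xb gc g0 by (rule integral_infdist_test_tendsto)
   moreover have "measure \<mu> {x\<in>X. g x = 0} \<le> q v"
   proof -
    have Tm: "(f ^^ i) \<in> measurable \<mu> \<mu>" for i using fm by (rule funpow_measurable)
    define S' where "S' = (\<Union>i<m. (f ^^ i) -` S \<inter> space \<mu>)"
    have S'm: "S' \<in> sets \<mu>" unfolding S'_def using Tm Sm by (intro sets.finite_UN) (auto intro: measurable_sets)
    have "measure \<mu> S' \<le> (\<Sum>i<m. measure \<mu> ((f ^^ i) -` S \<inter> space \<mu>))"
     unfolding S'_def using Tm Sm by (intro mu.finite_measure_subadditive_finite) (auto intro: measurable_sets)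
    also have "\<dots> = (\<Sum>i<m. measure (distr \<mu> \<mu> (f ^^ i)) S)"
     using Tm Sm by (intro sum.cong refl measure_distr[symmetric]) auto
    also have "\<dots> = 0" using inv S0 mu.distr_funpow[of f] by (simp add: invariant_measure_def)
    finally have S'0: "measure \<mu> S' = 0" by (simp add: measure_le_0_iff)
    have A: "{x\<in>X. names P f m x = v} \<in> sets \<mu>"
     using simple_functionD(2)[OF simple_function_names[OF fm sP[OF \<mu>(1)]], of m "{v}"] spm
     by (auto simp: vimage_def Int_def conj_commute)
    have "{x\<in>X. g x = 0} \<subseteq> {x\<in>X. names P f m x = v} \<union> S'"
    proof
     fix x assume x: "x \<in> {x\<in>X. g x = 0}"
     show "x \<in> {x\<in>X. names P f m x = v} \<union> S'"
     proof (cases "x \<in> S'")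
      case False
      have "P ((f ^^ i) x) = v ! i" if i: "i < m" for i
      proof (rule KP)
       have "infdist ((f ^^ i) x) (K (v ! i)) = 0" using x i by (auto simp: g_def sum_nonneg_eq_0_iff infdist_nonneg)
       then show "(f ^^ i) x \<in> K (v ! i)" using in_closed_iff_infdist_zero[of "K (v ! i)"] ne[OF i] by (simp add: K_def)
       show "(f ^^ i) x \<notin> S" using False x i spm by (auto simp: S'_def)
      qed
      then have "names P f m x = v" using v by (auto simp: names_def L_def list_eq_iff_nth_eq)
      then show ?thesis using x by auto
     qed simp
    qed
    then have "measure \<mu> {x\<in>X. g x = 0} \<le> measure \<mu> ({x\<in>X. names P f m x = v} \<union> S')"
     using A S'm by (intro mu.finite_measure_mono) auto
    also have "\<dots> \<le> q v + measure \<mu> S'" unfolding q_def using A S'm by (intro measure_Un_le)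
    finally show ?thesis using S'0 by simp
   qed
   ultimately have "eventually (\<lambda>j. (\<integral>x. max 0 (1 - real j * g x) \<partial>\<mu>) < q v + d / 2) sequentially"
    using d by (intro order_tendstoD(2)) auto
   then obtain j where j: "(\<integral>x. max 0 (1 - real j * g x) \<partial>\<mu>) < q v + d / 2" by (auto simp: eventually_sequentially)
   have psi_c: "continuous_on X (\<lambda>x. max 0 (1 - real j * g x))" using gc by (intro continuous_intros)
   have "(\<lambda>k. \<integral>x. max 0 (1 - real j * g x) \<partial>\<nu> k) \<longlonglongrightarrow> (\<integral>x. max 0 (1 - real j * g x) \<partial>\<mu>)"
    using \<mu>(2) psi_c by (simp add: weak_star_converges_def)
   then have ev1: "eventually (\<lambda>k. (\<integral>x. max 0 (1 - real j * g x) \<partial>\<nu> k) < q v + d / 2) sequentially"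
    using j by (rule order_tendstoD(2))
   \<comment> \<open>If the iterates of \<open>fs k\<close> and \<open>f\<close> differ by less than
     \<open>t\<close>, then \<open>real j * g\<close> is at most \<open>d / 2\<close> on the
     cylinder of \<open>v\<close> for \<open>fs k\<close>.\<close>
   define t where "t = d / 2 / (real j * real m + 1)"
   have t: "t > 0" "real j * real m * t \<le> d / 2"
   proof -
    have jm: "real j * real m + 1 > 0" by (simp add: add_nonneg_pos)
    show t0: "t > 0" using d jm by (simp add: t_def)
    have "t * (real j * real m + 1) = d / 2"
     unfolding t_def by (rule nonzero_eq_divide_eq[THEN iffD1, OF _ refl]) (use jm in linarith)
    then show "real j * real m * t \<le> d / 2" using t0 by (simp add: algebra_simps)
   qed
   have "eventually (\<lambda>k. \<forall>i\<in>{..<m}. \<forall>x\<in>X. dist ((fs k ^^ i) x) ((f ^^ i) x) < t) sequentially"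
    using uniform_limitD[OF uniform_limit_funpow[OF X f(1-4)] t(1)] by (intro eventually_ball_finite) auto
   then show ?thesis using ev1
   proof eventually_elim
    case (elim k)
    interpret nk: prob_space "\<nu> k" by (rule nu)
    let ?A = "{x\<in>X. names P (fs k) m x = v}"
    have A: "?A \<in> sets (\<nu> k)"
     using simple_functionD(2)[OF simple_function_names[OF fsm[of k] sP[OF \<nu>[of k]], of m], of "{v}"] spn
     by (auto simp: vimage_def Int_def conj_commute)
    have "(\<integral>x. indicator ?A x - d / 2 \<partial>\<nu> k) \<le> (\<integral>x. max 0 (1 - real j * g x) \<partial>\<nu> k)"
    proof (rule integral_mono)
     show "integrable (\<nu> k) (\<lambda>x. indicator ?A x - d / 2)"
      using A by (intro Bochner_Integration.integrable_diff) (auto simp: nk.emeasure_eq_measure)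
     show "integrable (\<nu> k) (\<lambda>x. max 0 (1 - real j * g x))"
      using \<nu> X psi_c by (rule borel_prob_on_continuous_integrable)
     fix x assume "x \<in> space (\<nu> k)"
     then have x: "x \<in> X" using spn by simp
     show "indicator ?A x - d / 2 \<le> max 0 (1 - real j * g x)"
     proof (cases "x \<in> ?A")
      case True
      have "g x \<le> (\<Sum>i<m. t)" unfolding g_def
      proof (rule sum_mono)
       fix i assume i: "i \<in> {..<m}"
       have "P ((fs k ^^ i) x) = v ! i" using True i by (auto simp: names_def)
       then have "(fs k ^^ i) x \<in> K (v ! i)" using funpow_Pi[OF f(2)] x closure_subset by (fastforce simp: K_def)
       then have "infdist ((f ^^ i) x) (K (v ! i)) \<le> dist ((f ^^ i) x) ((fs k ^^ i) x)" by (rule infdist_le)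
       also have "\<dots> \<le> t" using elim(1) i x by (auto simp: dist_commute intro: less_imp_le)
       finally show "infdist ((f ^^ i) x) (K (v ! i)) \<le> t" .
      qed
      then have "real j * g x \<le> real j * (real m * t)" by (intro mult_left_mono) auto
      also have "\<dots> \<le> d / 2" using t(2) by (simp add: mult.assoc)
      finally show ?thesis using True by simp
     qed (use d in auto)
    qed
    moreover have "(\<integral>x. indicator ?A x - d / 2 \<partial>\<nu> k) = p k v - d / 2"
     using A by (subst Bochner_Integration.integral_diff)
      (use nk.prob_space in \<open>auto simp: nk.emeasure_eq_measure p_def Int_absorb2 spn\<close>)
    ultimately show ?case using elim(2) by simp
   qed
  qed
  have "(\<lambda>k. p k v) \<longlonglongrightarrow> q v" if "v \<in> L" for v using tendsto_of_eventually_le_sum_one[OF finL p(2) q(2) le that] .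
  then have "(\<lambda>k. - (\<Sum>v\<in>L. p k v * ln (p k v))) \<longlonglongrightarrow> - (\<Sum>v\<in>L. q v * ln (q v))"
   by (intro tendsto_intros tendsto_minus_x_ln_x) (auto simp: p_def)
  then show ?thesis by (simp add: p(1) q(1))
 qed
 show ?thesis
 proof (rule that[OF sP[OF \<mu>(1)] sP[OF \<nu>] _ lim])
  fix x y assume xy: "x \<in> X" "y \<in> X" "P x = P y"
  then have "dist (z (P x)) x < \<rho> (z (P x))" "dist (z (P x)) y < \<rho> (z (P x))"
   using PB(2)[of x] PB(2)[of y] by (auto simp: B_def)
  then show "dist x y < \<epsilon>" using dist_triangle3[of x y "z (P x)"] \<rho>(2)[of "z (P x)"] by linarith
 qed
qed

section \<open>Birkhoff averages\<close>

definition birkhoff_sum :: "('a \<Rightarrow> real) \<Rightarrow> ('a \<Rightarrow> 'a) \<Rightarrow> nat \<Rightarrow> 'a \<Rightarrow> real" where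
 "birkhoff_sum \<phi> T n x = (\<Sum>i<n. \<phi> ((T ^^ i) x))"

text \<open>Meaningful where the averages are bounded, since \<open>real_of_ereal\<close> sends
  infinite values to 0.\<close>

definition birkhoff_limsup :: "('a \<Rightarrow> real) \<Rightarrow> ('a \<Rightarrow> 'a) \<Rightarrow> 'a \<Rightarrow> real" where
 "birkhoff_limsup \<phi> T x = real_of_ereal (limsup (\<lambda>n. ereal (birkhoff_sum \<phi> T n x / real n)))"

lemma birkhoff_sum_add: "birkhoff_sum \<phi> T (n + m) x = birkhoff_sum \<phi> T n x + birkhoff_sum \<phi> T m ((T ^^ n) x)"
proof (induction m)
 case (Suc m)
 have "(T ^^ m) ((T ^^ n) x) = (T ^^ (n + m)) x" by (simp add: add.commute[of n m] funpow_add)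
 then show ?case using Suc by (simp add: birkhoff_sum_def)
qed (simp add: birkhoff_sum_def)

lemma birkhoff_sum_bound:
 assumes "\<And>i. \<bar>\<phi> ((T ^^ i) x)\<bar> \<le> B"
 shows "\<bar>birkhoff_sum \<phi> T n x\<bar> \<le> real n * B"
proof -
 have "\<bar>birkhoff_sum \<phi> T n x\<bar> \<le> (\<Sum>i<n. B)"
  unfolding birkhoff_sum_def using assms by (intro order_trans[OF sum_abs] sum_mono)
 then show ?thesis by simp
qed

lemma birkhoff_limsup:
 assumes "\<And>i. \<bar>\<phi> ((T ^^ i) x)\<bar> \<le> B"
 shows "ereal (birkhoff_limsup \<phi> T x) = limsup (\<lambda>n. ereal (birkhoff_sum \<phi> T n x / real n))"
  and "\<bar>birkhoff_limsup \<phi> T x\<bar> \<le> B"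
proof -
 let ?l = "limsup (\<lambda>n. ereal (birkhoff_sum \<phi> T n x / real n))"
 have B0: "B \<ge> 0" using assms[of 0] by linarith
 have bd: "\<bar>birkhoff_sum \<phi> T n x / real n\<bar> \<le> B" for n
  using birkhoff_sum_bound[of \<phi> T x B n, OF assms] B0 by (cases "n = 0") (auto simp: field_simps)
 have "?l \<le> ereal B" using abs_le_D1[OF bd] by (intro Limsup_bounded always_eventually) simp
 moreover have "ereal (- B) \<le> ?l"
 proof -
  have "ereal (- B) \<le> liminf (\<lambda>n. ereal (birkhoff_sum \<phi> T n x / real n))"
  proof (intro Liminf_bounded always_eventually allI)
   fix n show "ereal (- B) \<le> ereal (birkhoff_sum \<phi> T n x / real n)" using abs_le_D2[OF bd, of n] by simp
  qed
  also have "\<dots> \<le> ?l" by (rule Liminf_le_Limsup) simp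
  finally show ?thesis .
 qed
 ultimately obtain l where "?l = ereal l" "\<bar>l\<bar> \<le> B" by (cases ?l) (auto simp: abs_le_iff)
 then show "ereal (birkhoff_limsup \<phi> T x) = ?l" "\<bar>birkhoff_limsup \<phi> T x\<bar> \<le> B" by (auto simp: birkhoff_limsup_def)
qed

text \<open>The Birkhoff sums at \<open>x\<close> and at \<open>T x\<close> differ only by two
  boundary terms.\<close>

lemma birkhoff_limsup_invariant:
 assumes "\<And>i. \<bar>\<phi> ((T ^^ i) x)\<bar> \<le> B"
 shows "birkhoff_limsup \<phi> T (T x) = birkhoff_limsup \<phi> T x"
proof -
 have B0: "B \<ge> 0" using assms[of 0] by linarith
 define u where "u n = (birkhoff_sum \<phi> T n (T x) - birkhoff_sum \<phi> T n x) / real n" for n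
 have "\<bar>u n\<bar> \<le> 2 * B / real n" for n
 proof -
  have "birkhoff_sum \<phi> T n (T x) - birkhoff_sum \<phi> T n x = \<phi> ((T ^^ n) x) - \<phi> ((T ^^ 0) x)"
   using birkhoff_sum_add[of \<phi> T n 1 x] birkhoff_sum_add[of \<phi> T 1 n x] by (simp add: birkhoff_sum_def funpow_swap1)
  then have "\<bar>birkhoff_sum \<phi> T n (T x) - birkhoff_sum \<phi> T n x\<bar> \<le> 2 * B" using assms[of n] assms[of 0] by linarith
  then show ?thesis by (simp add: u_def divide_right_mono)
 qed
 moreover have "(\<lambda>n. 2 * B / real n) \<longlonglongrightarrow> 0" by (rule lim_const_over_n)
 ultimately have "u \<longlonglongrightarrow> 0" by (intro Lim_null_comparison[where f = u and g = "\<lambda>n. 2 * B / real n"]) auto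
 then have lim: "(\<lambda>n. ereal (u n)) \<longlonglongrightarrow> ereal 0" by simp
 have "(\<lambda>n. ereal (birkhoff_sum \<phi> T n (T x) / real n)) = (\<lambda>n. ereal (u n) + ereal (birkhoff_sum \<phi> T n x / real n))"
  by (auto simp: u_def diff_divide_distrib)
 then have "limsup (\<lambda>n. ereal (birkhoff_sum \<phi> T n (T x) / real n)) = limsup (\<lambda>n. ereal (birkhoff_sum \<phi> T n x / real n))"
  using ereal_limsup_lim_add[OF lim, of "\<lambda>n. ereal (birkhoff_sum \<phi> T n x / real n)"] by simp
 then show ?thesis by (simp add: birkhoff_limsup_def)
qed

context prob_space
begin

lemma measurable_birkhoff_sum [measurable]:
 assumes [measurable]: "T \<in> measurable M M" "\<phi> \<in> borel_measurable M"
 shows "birkhoff_sum \<phi> T n \<in> borel_measurable M"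
proof -
 have [measurable]: "(T ^^ i) \<in> measurable M M" for i using assms(1) by (rule funpow_measurable)
 show ?thesis unfolding birkhoff_sum_def [abs_def] by measurable
qed

lemma measurable_birkhoff_limsup [measurable]:
 assumes [measurable]: "T \<in> measurable M M" "\<phi> \<in> borel_measurable M"
 shows "birkhoff_limsup \<phi> T \<in> borel_measurable M" unfolding birkhoff_limsup_def [abs_def] by measurable

lemma integral_comp_funpow:
 assumes T: "T \<in> measurable M M" "distr M M T = M" and \<phi>: "\<phi> \<in> borel_measurable M"
 shows "(\<integral>x. \<phi> ((T ^^ i) x) \<partial>M) = (\<integral>x. \<phi> x \<partial>M :: real)"
proof -
 have "(\<integral>x. \<phi> ((T ^^ i) x) \<partial>M) = integral\<^sup>L (distr M M (T ^^ i)) \<phi>"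
  using funpow_measurable[OF T(1)] \<phi> by (intro integral_distr[symmetric])
 then show ?thesis by (simp add: distr_funpow[OF T])
qed

lemma bounded_integrable:
 fixes \<phi> :: "'a \<Rightarrow> real"
 assumes "\<phi> \<in> borel_measurable M" "\<And>x. x \<in> space M \<Longrightarrow> \<bar>\<phi> x\<bar> \<le> B"
 shows "integrable M \<phi>" using assms by (intro integrable_const_bound[where B = B]) auto

text \<open>Garsia's proof of the maximal ergodic inequality.\<close>

lemma integral_nonneg_of_positive_sums:
 assumes T: "T \<in> measurable M M" "distr M M T = M" and \<phi>: "\<phi> \<in> borel_measurable M"
  and B: "\<And>x. x \<in> space M \<Longrightarrow> \<bar>\<phi> x\<bar> \<le> B"
  and pos: "\<And>x. x \<in> space M \<Longrightarrow> \<exists>n. birkhoff_sum \<phi> T n x > 0"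
 shows "0 \<le> (\<integral>x. \<phi> x \<partial>M)"
proof -
 note [measurable] = T(1) \<phi>
 \<comment> \<open>\<open>m n\<close> is the maximum of the Birkhoff sums of lengths 0 to
   \<open>n\<close>, written as a recursion.\<close>
 define m where "m = rec_nat (\<lambda>x. 0) (\<lambda>_ u x. max 0 (\<phi> x + u (T x)))"
 have m0: "m 0 = (\<lambda>x. 0)" and mS: "m (Suc n) = (\<lambda>x. max 0 (\<phi> x + m n (T x)))" for n by (auto simp: m_def)
 have [measurable]: "m n \<in> borel_measurable M" for n by (induction n) (simp_all add: m0 mS)
 have Tx: "T x \<in> space M" if "x \<in> space M" for x using T(1) that by (rule measurable_space)
 have nonneg: "0 \<le> m n x" for n x by (cases n) (auto simp: m0 mS)
 have bd: "m n x \<le> real n * \<bar>B\<bar>" if "x \<in> space M" for n x using that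
 proof (induction n arbitrary: x)
  case (Suc n)
  have "m n (T x) \<le> real n * \<bar>B\<bar>" "\<phi> x \<le> \<bar>B\<bar>" using Suc Tx B[of x] by auto
  then show ?case by (simp add: mS distrib_right)
 qed (simp add: m0)
 have step: "m n x \<le> m (Suc n) x" for n x
 proof (induction n arbitrary: x)
  case (Suc n)
  have "max 0 (\<phi> x + m n (T x)) \<le> max 0 (\<phi> x + m (Suc n) (T x))" by (intro max.mono add_left_mono order_refl Suc)
  then show ?case by (simp only: mS[THEN fun_cong, of n x] mS[THEN fun_cong, of "Suc n" x])
 qed (simp add: m0 nonneg)
 have mono: "m n x \<le> m k x" if "n \<le> k" for n k x using that step by (rule lift_Suc_mono_le[rotated])
 have ge: "birkhoff_sum \<phi> T n x \<le> m n x" for n x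
 proof (induction n arbitrary: x)
  case (Suc n)
  have "birkhoff_sum \<phi> T (Suc n) x = \<phi> x + birkhoff_sum \<phi> T n (T x)"
   using birkhoff_sum_add[of \<phi> T 1 n x] by (simp add: birkhoff_sum_def)
  then show ?case using Suc[of "T x"] by (simp add: mS)
 qed (simp add: m0 birkhoff_sum_def)
 have int: "integrable M (m n)" for n by (rule bounded_integrable[where B = "real n * \<bar>B\<bar>"]) (use nonneg bd in auto)
 have intT: "integrable M (\<lambda>x. m n (T x))" for n
  by (rule bounded_integrable[where B = "real n * \<bar>B\<bar>"]) (use nonneg bd Tx in auto)
 let ?f = "\<lambda>n x. if m n x > 0 then \<phi> x else 0"
 have "0 \<le> (\<integral>x. ?f (Suc n) x \<partial>M)" for n
 proof -
  have "(\<integral>x. m (Suc n) x - m n (T x) \<partial>M) \<le> (\<integral>x. ?f (Suc n) x \<partial>M)"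
  proof (rule integral_mono)
   show "integrable M (?f (Suc n))" by (rule bounded_integrable[where B = "\<bar>B\<bar>"]) (use B in fastforce)+
   \<comment> \<open>Garsia's pointwise inequality: equality where \<open>m (Suc n)\<close> is
     positive; elsewhere the left side is at most 0.\<close>
   show "m (Suc n) x - m n (T x) \<le> ?f (Suc n) x" for x using nonneg[of n "T x"] by (auto simp: mS max_def)
  qed (use int intT in auto)
  moreover have "(\<integral>x. m n (T x) \<partial>M) = (\<integral>x. m n x \<partial>M)" using integral_comp_funpow[OF T, of "m n" 1] by simp
  moreover have "(\<integral>x. m n x \<partial>M) \<le> (\<integral>x. m (Suc n) x \<partial>M)" using int step by (intro integral_mono)
  ultimately show ?thesis using int intT by simp
 qed
 moreover have "(\<lambda>n. \<integral>x. ?f (Suc n) x \<partial>M) \<longlonglongrightarrow> (\<integral>x. \<phi> x \<partial>M)"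
 proof (rule integral_dominated_convergence[where w = "\<lambda>_. \<bar>B\<bar>"])
  show "AE x in M. (\<lambda>n. ?f (Suc n) x) \<longlonglongrightarrow> \<phi> x"
  proof (rule AE_I2)
   fix x assume "x \<in> space M"
   then obtain n where "birkhoff_sum \<phi> T n x > 0" using pos by blast
   then have "0 < m (Suc k) x" if "k \<ge> n" for k using ge[of n x] mono[of n "Suc k" x] that by simp
   then show "(\<lambda>n. ?f (Suc n) x) \<longlonglongrightarrow> \<phi> x" by (intro tendsto_eventually) (auto simp: eventually_sequentially)
  qed
  show "AE x in M. norm (?f (Suc n) x) \<le> \<bar>B\<bar>" for n using B by (intro AE_I2) fastforce
 qed auto
 ultimately show ?thesis by (intro LIMSEQ_le_const[where a = 0]) auto
qed

text \<open>With \<psi> the upper average, which is invariant, \<phi> - \<psi> + e has a positive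
  Birkhoff sum at every point, hence a nonnegative integral. This holds for every invariant measure,
  and is applied later to the limit measure, which may fail to be ergodic.\<close>

lemma integral_birkhoff_limsup_le:
 assumes T: "T \<in> measurable M M" "distr M M T = M" and \<phi>: "\<phi> \<in> borel_measurable M"
  and B: "\<And>x. x \<in> space M \<Longrightarrow> \<bar>\<phi> x\<bar> \<le> B"
 shows "(\<integral>x. birkhoff_limsup \<phi> T x \<partial>M) \<le> (\<integral>x. \<phi> x \<partial>M)"
proof (rule field_le_epsilon)
 fix e :: real assume e: "e > 0"
 note [measurable] = T(1) \<phi>
 have Tx: "(T ^^ i) x \<in> space M" if "x \<in> space M" for i x using measurable_space[OF funpow_measurable[OF T(1)] that] .
 have Bi: "\<bar>\<phi> ((T ^^ i) x)\<bar> \<le> B" if "x \<in> space M" for i x using B Tx that by blast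
 define \<psi> where "\<psi> = birkhoff_limsup \<phi> T"
 have [measurable]: "\<psi> \<in> borel_measurable M" unfolding \<psi>_def by measurable
 have \<psi>B: "\<bar>\<psi> x\<bar> \<le> B" if "x \<in> space M" for x unfolding \<psi>_def using Bi[OF that] by (rule birkhoff_limsup(2))
 have \<psi>T: "\<psi> ((T ^^ i) x) = \<psi> x" if x: "x \<in> space M" for i x
 proof (induction i)
  case (Suc i)
  have "\<bar>\<phi> ((T ^^ j) ((T ^^ i) x))\<bar> \<le> B" for j using Bi Tx[OF x] by blast
  then have "\<psi> (T ((T ^^ i) x)) = \<psi> ((T ^^ i) x)" unfolding \<psi>_def by (rule birkhoff_limsup_invariant)
  then show ?case using Suc by simp
 qed simp
 have i: "integrable M \<phi>" by (rule bounded_integrable) (use B in auto)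
 have i': "integrable M \<psi>" by (rule bounded_integrable) (use \<psi>B in auto)
 have "0 \<le> (\<integral>x. \<phi> x - \<psi> x + e \<partial>M)"
 proof (rule integral_nonneg_of_positive_sums[OF T])
  show "\<bar>\<phi> x - \<psi> x + e\<bar> \<le> 2 * B + e" if "x \<in> space M" for x using B[OF that] \<psi>B[OF that] e by linarith
  fix x assume x: "x \<in> space M"
  have sum: "birkhoff_sum (\<lambda>x. \<phi> x - \<psi> x + e) T n x = birkhoff_sum \<phi> T n x - real n * (\<psi> x - e)" for n
   by (simp add: birkhoff_sum_def \<psi>T[OF x] sum.distrib sum_subtractf algebra_simps)
  show "\<exists>n. birkhoff_sum (\<lambda>x. \<phi> x - \<psi> x + e) T n x > 0"
  proof (rule ccontr)
   assume "\<not> ?thesis"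
   then have "birkhoff_sum \<phi> T n x \<le> real n * (\<psi> x - e)" for n unfolding sum not_ex not_less by simp
   then have "birkhoff_sum \<phi> T n x / real n \<le> \<psi> x - e" if "n \<ge> 1" for n using that by (simp add: field_simps)
   then have "limsup (\<lambda>n. ereal (birkhoff_sum \<phi> T n x / real n)) \<le> ereal (\<psi> x - e)"
    by (intro Limsup_bounded) (auto simp: eventually_sequentially)
   then have "ereal (\<psi> x) \<le> ereal (\<psi> x - e)" using birkhoff_limsup(1)[of \<phi> T x B] Bi[OF x] by (simp add: \<psi>_def)
   then show False using e by simp
  qed
 qed measurable
 then show "(\<integral>x. birkhoff_limsup \<phi> T x \<partial>M) \<le> (\<integral>x. \<phi> x \<partial>M) + e" using i i' by (simp add: prob_space \<psi>_def)
qed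

text \<open>The superlevel sets of the invariant upper average have measure 0 or 1, and measure 1 at
  a level above the mean would contradict the bound on its integral.\<close>

lemma ergodic_birkhoff_limsup_le:
 assumes T: "ergodic_measure T M" and \<phi>: "\<phi> \<in> borel_measurable M"
  and B: "\<And>x. x \<in> space M \<Longrightarrow> \<bar>\<phi> x\<bar> \<le> B"
 shows "AE x in M. birkhoff_limsup \<phi> T x \<le> (\<integral>x. \<phi> x \<partial>M)"
proof -
 have T': "T \<in> measurable M M" "distr M M T = M"
  and erg: "\<And>A. A \<in> sets M \<Longrightarrow> T -` A \<inter> space M = A \<Longrightarrow> prob A = 0 \<or> prob A = 1"
  using T by (auto simp: ergodic_measure_def invariant_measure_def)
 note [measurable] = T'(1) \<phi>
 have Tm [measurable]: "(T ^^ i) \<in> measurable M M" for i using T'(1) by (rule funpow_measurable)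
 have Bi: "\<bar>\<phi> ((T ^^ i) x)\<bar> \<le> B" if "x \<in> space M" for i x using B measurable_space[OF Tm that] by blast
 define \<psi> where "\<psi> = birkhoff_limsup \<phi> T"
 have \<psi>m [measurable]: "\<psi> \<in> borel_measurable M" unfolding \<psi>_def by measurable
 have \<psi>B: "\<bar>\<psi> x\<bar> \<le> B" if "x \<in> space M" for x unfolding \<psi>_def using Bi[OF that] by (rule birkhoff_limsup(2))
 have \<psi>T: "\<psi> (T x) = \<psi> x" if x: "x \<in> space M" for x unfolding \<psi>_def using Bi[OF x] by (rule birkhoff_limsup_invariant)
 let ?m = "\<integral>x. \<phi> x \<partial>M"
 have z: "prob {x\<in>space M. \<psi> x > t} = 0" if t: "t > ?m" for t
 proof (rule ccontr)
  assume ne: "prob {x\<in>space M. \<psi> x > t} \<noteq> 0"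
  have "T -` {x\<in>space M. \<psi> x > t} \<inter> space M = {x\<in>space M. \<psi> x > t}" using \<psi>T measurable_space[OF T'(1)] by auto
  then have "prob {x\<in>space M. \<psi> x > t} = 1" using erg[of "{x\<in>space M. \<psi> x > t}"] ne by auto
  then have "AE x in M. \<psi> x > t" by (auto simp: prob_eq_1)
  then have "(\<integral>x. t \<partial>M) \<le> (\<integral>x. \<psi> x \<partial>M)" using bounded_integrable[OF \<psi>m \<psi>B] by (intro integral_mono_AE) auto
  then have "t \<le> (\<integral>x. \<psi> x \<partial>M)" by (simp add: prob_space)
  also have "\<dots> \<le> ?m" unfolding \<psi>_def using T' \<phi> B by (rule integral_birkhoff_limsup_le)
  finally show False using t by simp
 qed
 have "AE x in M. \<forall>j. \<not> \<psi> x > ?m + 1 / real (Suc j)" unfolding AE_all_countable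
 proof
  fix j
  show "AE x in M. \<not> \<psi> x > ?m + 1 / real (Suc j)"
   using z[of "?m + 1 / real (Suc j)"] by (subst AE_iff_measurable[OF _ refl]) (auto simp: emeasure_eq_measure)
 qed
 then show ?thesis
 proof eventually_elim
  case (elim x)
  show ?case
  proof (rule ccontr)
   assume "\<not> ?thesis"
   then have "\<psi> x - ?m > 0" by (simp add: \<psi>_def)
   then obtain j where "inverse (real (Suc j)) < \<psi> x - ?m" using reals_Archimedean by blast
   then have "\<psi> x > ?m + 1 / real (Suc j)" by (simp add: field_simps)
   then show False using elim by blast
  qed
 qed
qed

text \<open>The one-sided bound for \<phi> and for - \<phi>.\<close>

lemma ergodic_birkhoff:
 assumes T: "ergodic_measure T M" and \<phi>: "\<phi> \<in> borel_measurable M"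
  and B: "\<And>x. x \<in> space M \<Longrightarrow> \<bar>\<phi> x\<bar> \<le> B"
 shows "AE x in M. (\<lambda>n. birkhoff_sum \<phi> T n x / real n) \<longlonglongrightarrow> (\<integral>x. \<phi> x \<partial>M)"
proof -
 have T': "T \<in> measurable M M" using T by (auto simp: ergodic_measure_def invariant_measure_def)
 have Bi: "\<bar>\<phi> ((T ^^ i) x)\<bar> \<le> B" if "x \<in> space M" for i x
  using B measurable_space[OF funpow_measurable[OF T'] that] by blast
 have 1: "AE x in M. birkhoff_limsup \<phi> T x \<le> (\<integral>x. \<phi> x \<partial>M)" using T \<phi> B by (rule ergodic_birkhoff_limsup_le)
 have 2: "AE x in M. birkhoff_limsup (\<lambda>x. - \<phi> x) T x \<le> (\<integral>x. - \<phi> x \<partial>M)"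
  using T \<phi> B by (intro ergodic_birkhoff_limsup_le[where B = B]) auto
 show ?thesis using 1 2 AE_space
 proof eventually_elim
  case (elim x)
  let ?m = "\<integral>x. \<phi> x \<partial>M"
  let ?s = "\<lambda>n. ereal (birkhoff_sum \<phi> T n x / real n)"
  have "limsup ?s \<le> ereal ?m" using birkhoff_limsup(1)[of \<phi> T x B] Bi[OF elim(3)] elim(1) by (metis ereal_less_eq(3))
  moreover have "limsup (\<lambda>n. - ?s n) \<le> ereal (- ?m)"
  proof -
   have "(\<lambda>n. - ?s n) = (\<lambda>n. ereal (birkhoff_sum (\<lambda>x. - \<phi> x) T n x / real n))" by (auto simp: birkhoff_sum_def sum_negf)
   moreover have "\<bar>- \<phi> ((T ^^ i) x)\<bar> \<le> B" for i using Bi[OF elim(3)] by simp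
   ultimately show ?thesis using birkhoff_limsup(1)[of "\<lambda>x. - \<phi> x" T x B, symmetric] elim(2) by simp
  qed
  then have "ereal ?m \<le> liminf ?s" by (metis ereal_Limsup_uminus ereal_minus_le_minus uminus_ereal.simps(1))
  ultimately show ?case by (rule limsup_le_liminf_real)
 qed
qed

end

section \<open>Lifts of one-dimensional maps\<close>

text \<open>A bounded Borel section of \<open>param\<close>. On the circle it is the argument
  divided by 2 pi, written with \<open>arccos\<close> to make measurability visible.\<close>

fun coordinate :: "one_dim \<Rightarrow> complex \<Rightarrow> real" where
 "coordinate Interval x = Re x"
| "coordinate Circle x = (if Im x \<ge> 0 then arccos (Re x) else - arccos (Re x)) / (2 * pi)"

lemma coordinate:
 assumes "x \<in> points I"
 shows "coordinate I x \<in> coord_dom I" "param I (coordinate I x) = x" "\<bar>coordinate I x\<bar> \<le> 1"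
proof -
 have "coordinate I x \<in> coord_dom I \<and> param I (coordinate I x) = x \<and> \<bar>coordinate I x\<bar> \<le> 1"
 proof (cases I)
  case Interval
  then show ?thesis using assms by (auto simp: points_def)
 next
  case Circle
  then have n: "norm x = 1" using assms points_Circle by auto
  have re: "- 1 \<le> Re x" "Re x \<le> 1" using abs_Re_le_cmod[of x] n by auto
  have "(Re x)\<^sup>2 + (Im x)\<^sup>2 = 1" using n by (metis cmod_power2 one_power2)
  then have "sqrt (1 - (Re x)\<^sup>2) = \<bar>Im x\<bar>" by (metis add_diff_cancel_left' real_sqrt_abs)
  then have s: "sin (arccos (Re x)) = \<bar>Im x\<bar>" using re by (simp add: sin_arccos)
  have "param I (coordinate I x) = x" using Circle re s by (auto simp: complex_eq_iff)
  moreover have "\<bar>coordinate I x\<bar> \<le> 1"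
  proof -
   have "0 \<le> arccos (Re x)" "arccos (Re x) \<le> pi" using re by (auto intro: arccos_lbound arccos_ubound)
   then have "\<bar>arccos (Re x) / (2 * pi)\<bar> \<le> 1" using pi_gt_zero by (simp add: field_simps)
   then show ?thesis using Circle by simp
  qed
  ultimately show ?thesis using Circle by simp
 qed
 then show "coordinate I x \<in> coord_dom I" "param I (coordinate I x) = x" "\<bar>coordinate I x\<bar> \<le> 1" by auto
qed

lemma continuous_on_param: "continuous_on S (param I)" by (cases I) (auto intro!: continuous_intros)

lemma param_in_points: "t \<in> coord_dom I \<Longrightarrow> param I t \<in> points I" by (simp add: points_def)

lemma compact_points: "compact (points I)"
 by (cases I) (auto simp: points_Circle points_Interval intro!: compact_continuous_image continuous_intros)

lemma points_borel: "points I \<in> sets borel" using compact_points by (rule borel_compact)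

lemma coordinate_measurable:
 assumes M: "borel_prob_on (points I) M"
 shows "coordinate I \<in> borel_measurable M"
proof (cases I)
 case Interval
 have "Re \<in> borel_measurable M" using M by (rule borel_prob_on_continuous_measurable) (intro continuous_intros)
 then show ?thesis using Interval by (simp cong: measurable_cong)
next
 case Circle
 have [measurable]: "Im \<in> borel_measurable M"
  using M by (rule borel_prob_on_continuous_measurable) (intro continuous_intros)
 have "\<bar>Re x\<bar> \<le> 1" if "x \<in> points I" for x using abs_Re_le_cmod[of x] that Circle by (simp add: points_Circle)
 then have "continuous_on (points I) (\<lambda>x. arccos (Re x))" by (intro continuous_intros) (auto simp: abs_le_iff)
 then have [measurable]: "(\<lambda>x. arccos (Re x)) \<in> borel_measurable M" by (rule borel_prob_on_continuous_measurable[OF M])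
 have "(\<lambda>x. (if Im x \<ge> 0 then arccos (Re x) else - arccos (Re x)) / (2 * pi)) \<in> borel_measurable M" by measurable
 then show ?thesis using Circle by (simp cong: measurable_cong)
qed

lemma norm_cis_diff: "norm (cis a - cis b) = 2 * \<bar>sin ((a - b) / 2)\<bar>"
proof -
 have "cis a - cis b = cis b * (cis (a - b) - 1)" by (simp add: right_diff_distrib cis_mult)
 then have "norm (cis a - cis b) = norm (cis (a - b) - 1)" by (simp add: norm_mult)
 then show ?thesis using dist_exp_i_1[of "a - b"] by (simp only: cis_conv_exp)
qed

lemma dist_param_le: "dist (param I s) (param I t) \<le> 2 * pi * \<bar>s - t\<bar>"
proof (cases I)
 case Interval
 have "1 * \<bar>s - t\<bar> \<le> 2 * pi * \<bar>s - t\<bar>" using pi_ge_two by (intro mult_right_mono) auto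
 then show ?thesis using Interval by (simp add: dist_norm flip: of_real_diff)
next
 case Circle
 have "norm (cis (2 * pi * s) - cis (2 * pi * t)) \<le> \<bar>2 * pi * s - 2 * pi * t\<bar>"
 proof -
  have "norm (cis (2 * pi * s) - cis (2 * pi * t)) = 2 * \<bar>sin ((2 * pi * s - 2 * pi * t) / 2)\<bar>" by (rule norm_cis_diff)
  also have "\<dots> \<le> 2 * \<bar>(2 * pi * s - 2 * pi * t) / 2\<bar>" by (intro mult_left_mono abs_sin_x_le_abs_x) auto
  finally show ?thesis by simp
 qed
 also have "\<dots> = 2 * pi * \<bar>s - t\<bar>" by (simp flip: right_diff_distrib add: abs_mult)
 finally show ?thesis using Circle by (simp add: dist_norm)
qed

text \<open>Chords of the circle dominate the coordinate distance as long as the latter is at most 1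
  / 4. A restriction is unavoidable, since coordinates that differ by an integer give the same
  point.\<close>

lemma le_dist_param:
 assumes "\<bar>s - t\<bar> \<le> 1 / 4"
 shows "\<bar>s - t\<bar> \<le> dist (param I s) (param I t)"
proof (cases I)
 case Interval
 then show ?thesis by (simp add: dist_norm flip: of_real_diff)
next
 case Circle
 let ?y = "\<bar>pi * (s - t)\<bar>"
 have y: "?y \<le> pi / 4" using mult_left_mono[OF assms, of pi] by (simp add: abs_mult)
 have "?y \<le> 2 * sin ?y"
 proof (cases "?y = 0")
  case False
  then have "0 < ?y" by linarith
  then obtain z where z: "0 < z" "z < ?y" "sin ?y - sin 0 = (?y - 0) * cos z"
   using MVT2[of 0 ?y sin cos] DERIV_sin by blast
  have "cos z \<ge> cos (pi / 3)" using z y pi_gt_zero by (intro cos_monotone_0_pi_le) auto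
  then have "cos z \<ge> 1 / 2" by (simp add: cos_60)
  then have "?y * (1 / 2) \<le> ?y * cos z" by (intro mult_left_mono) auto
  then show ?thesis using z by simp
 qed simp
 also have "sin ?y = \<bar>sin (pi * (s - t))\<bar>"
 proof -
  have "\<bar>sin (pi * (s - t))\<bar> = \<bar>sin ?y\<bar>" by (simp add: abs_if)
  also have "\<dots> = sin ?y" using y by (intro abs_of_nonneg sin_ge_zero) auto
  finally show ?thesis by simp
 qed
 also have "2 * \<bar>sin (pi * (s - t))\<bar> = norm (cis (2 * pi * s) - cis (2 * pi * t))"
  by (simp add: norm_cis_diff right_diff_distrib[symmetric] mult.assoc del: right_diff_distrib')
 finally have "pi * \<bar>s - t\<bar> \<le> norm (cis (2 * pi * s) - cis (2 * pi * t))" by (simp add: abs_mult)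
 moreover have "1 * \<bar>s - t\<bar> \<le> pi * \<bar>s - t\<bar>" using pi_ge_two by (intro mult_right_mono) auto
 ultimately show ?thesis using Circle by (simp add: dist_norm)
qed

lemma param_eq_imp_shift:
 assumes "s \<in> coord_dom I" "t \<in> coord_dom I" "param I s = param I t"
 obtains n :: int where "s = t + of_int n" "\<And>u. I = Circle \<or> n = 0"
proof (cases I)
 case Interval
 then show ?thesis using assms by (intro that[of 0]) auto
next
 case Circle
 then have "exp (\<i> * of_real (2 * pi * s)) = exp (\<i> * of_real (2 * pi * t))" using assms by (simp add: cis_conv_exp)
 then obtain n :: int where "\<i> * of_real (2 * pi * s) = \<i> * of_real (2 * pi * t) + (of_int (2 * n) * of_real pi) * \<i>"
  by (auto simp: exp_eq)
 then have "Im (\<i> * of_real (2 * pi * s)) = Im (\<i> * of_real (2 * pi * t) + (of_int (2 * n) * of_real pi) * \<i>)" by simp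
 then have "(2 * pi) * s = (2 * pi) * (t + of_int n)" by (simp add: algebra_simps)
 then have "s = t + of_int n" by (subst (asm) mult_cancel_left) auto
 then show ?thesis using Circle by (intro that[of n]) auto
qed

text \<open>On the circle, take a continuous logarithm along the contractible line; its real part
  vanishes because all values have modulus 1.\<close>

lemma is_lift_exists:
 assumes g: "g \<in> points I \<rightarrow> points I" "continuous_on (points I) g"
 shows "\<exists>G. is_lift I g G"
proof (cases I)
 case Interval
 have c: "continuous_on {0..1} (\<lambda>t. g (complex_of_real t))"
  using g Interval by (intro continuous_on_compose2[OF g(2)]) (auto simp: points_Interval intro!: continuous_intros)
 have "is_lift I g (\<lambda>t. Re (g (complex_of_real t)))" unfolding is_lift_def Interval coord_dom.simps param.simps
 proof (intro conjI ballI)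
  show "continuous_on {0..1} (\<lambda>t. Re (g (complex_of_real t)))" using c by (intro continuous_intros)
  have *: "\<exists>s\<in>{0..1}. g (complex_of_real t) = complex_of_real s" if "t \<in> {0..1}" for t
  proof -
   have "g (complex_of_real t) \<in> complex_of_real ` {0..1}"
    using g(1) that Interval unfolding Interval points_Interval by blast
   then show ?thesis by blast
  qed
  then show "(\<lambda>t. Re (g (complex_of_real t))) \<in> {0..1} \<rightarrow> {0..1}" by fastforce
  show "complex_of_real (Re (g (complex_of_real t))) = g (complex_of_real t)" if "t \<in> {0..1}" for t
   using *[OF that] by auto
 qed
 then show ?thesis by blast
next
 case Circle
 let ?f = "\<lambda>t::real. g (cis (2 * pi * t))"
 have sub: "cis (2 * pi * t) \<in> points I" for t using Circle by (simp add: points_Circle)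
 have c: "continuous_on UNIV ?f" using sub by (intro continuous_on_compose2[OF g(2)]) (auto intro!: continuous_intros)
 have n: "norm (?f t) = 1" for t using g(1) sub[of t] Circle by (auto simp: points_Circle)
 obtain L where L: "continuous_on UNIV L" "\<And>t. ?f t = exp (L t)"
 proof (rule continuous_logarithm_on_contractible[OF c])
  show "contractible (UNIV :: real set)" by (rule convex_imp_contractible) simp
  show "?f t \<noteq> 0" for t using n[of t] by auto
 qed auto
 have re: "Re (L t) = 0" for t
 proof -
  have "exp (Re (L t)) = 1" using n[of t] L(2)[of t] by (simp add: norm_exp_eq_Re)
  then show ?thesis by simp
 qed
 have "is_lift I g (\<lambda>t. Im (L t) / (2 * pi))" unfolding is_lift_def Circle coord_dom.simps param.simps
 proof (intro conjI ballI)
  show "continuous_on UNIV (\<lambda>t. Im (L t) / (2 * pi))" using L(1) by (intro continuous_intros) auto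
  fix t :: real
  have "L t = \<i> * of_real (Im (L t))" using re[of t] by (simp add: complex_eq_iff)
  then have "cis (Im (L t)) = exp (L t)" by (simp add: cis_conv_exp)
  then show "cis (2 * pi * (Im (L t) / (2 * pi))) = g (cis (2 * pi * t))" using L(2) by simp
 qed auto
 then show ?thesis by blast
qed

lemma is_lift_lift_of:
 assumes "g \<in> points I \<rightarrow> points I" "continuous_on (points I) g"
 shows "is_lift I g (lift_of I g)" unfolding lift_of_def using is_lift_exists[OF assms] by (rule someI_ex)

text \<open>The difference of two lifts is continuous and takes integer values on a connected
  set.\<close>

lemma is_lift_unique:
 assumes G: "is_lift I g G" "is_lift I g G'"
 obtains c where "\<And>t. t \<in> coord_dom I \<Longrightarrow> G t = G' t + c"
proof -
 have int: "\<exists>n::int. G t - G' t = of_int n" if t: "t \<in> coord_dom I" for t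
 proof -
  have "G t \<in> coord_dom I" "G' t \<in> coord_dom I" "param I (G t) = param I (G' t)" using G t by (auto simp: is_lift_def)
  then obtain n :: int where "G t = G' t + of_int n" by (rule param_eq_imp_shift)
  then show ?thesis by (intro exI[of _ n]) simp
 qed
 have "(\<lambda>t. G t - G' t) constant_on coord_dom I"
 proof (rule continuous_discrete_range_constant)
  show "connected (coord_dom I)" by (cases I) auto
  show "continuous_on (coord_dom I) (\<lambda>t. G t - G' t)" using G by (intro continuous_intros) (auto simp: is_lift_def)
  fix s assume s: "s \<in> coord_dom I"
  have "1 \<le> norm ((G t - G' t) - (G s - G' s))" if t: "t \<in> coord_dom I" "G t - G' t \<noteq> G s - G' s" for t
  proof -
   obtain n :: int where "G t - G' t = of_int n" using int[OF t(1)] by blast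
   moreover obtain m :: int where "G s - G' s = of_int m" using int[OF s] by blast
   ultimately show ?thesis using t(2) by (simp flip: of_int_diff of_int_abs)
  qed
  then show "\<exists>e>0. \<forall>t. t \<in> coord_dom I \<and> G t - G' t \<noteq> G s - G' s \<longrightarrow> e \<le> norm ((G t - G' t) - (G s - G' s))"
   by (intro exI[of _ 1]) auto
 qed
 then obtain c where "\<And>t. t \<in> coord_dom I \<Longrightarrow> G t - G' t = c" by (auto simp: constant_on_def)
 then show ?thesis by (intro that[of c]) (simp add: algebra_simps)
qed

lemma is_lift_funpow:
 assumes G: "is_lift I g G"
 shows "is_lift I (g ^^ n) (G ^^ n)"
proof (induction n)
 case 0
 then show ?case by (simp add: is_lift_def id_def)
next
 case (Suc n)
 have 1: "continuous_on (coord_dom I) G" "G \<in> coord_dom I \<rightarrow> coord_dom I"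
   "\<And>t. t \<in> coord_dom I \<Longrightarrow> param I (G t) = g (param I t)" using G by (auto simp: is_lift_def)
 have 2: "continuous_on (coord_dom I) (G ^^ n)" "(G ^^ n) \<in> coord_dom I \<rightarrow> coord_dom I"
   "\<And>t. t \<in> coord_dom I \<Longrightarrow> param I ((G ^^ n) t) = (g ^^ n) (param I t)" using Suc by (auto simp: is_lift_def)
 have "continuous_on (coord_dom I) (\<lambda>t. G ((G ^^ n) t))" using 2(2) by (intro continuous_on_compose2[OF 1(1) 2(1)]) auto
 moreover have "(\<lambda>t. G ((G ^^ n) t)) \<in> coord_dom I \<rightarrow> coord_dom I" using 1(2) 2(2) by blast
 moreover have "param I (G ((G ^^ n) t)) = g ((g ^^ n) (param I t))" if "t \<in> coord_dom I" for t
  using 1(3)[of "(G ^^ n) t"] 2(2) 2(3)[OF that] that by auto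
 ultimately show ?case by (simp add: is_lift_def o_def)
qed

section \<open>Derivatives of lifts and the chain rule\<close>

lemma at_within_coord_dom_nontrivial:
 assumes "t \<in> coord_dom I"
 shows "at t within coord_dom I \<noteq> bot" using assms by (cases I) (auto simp: trivial_limit_within islimpt_Icc)

lemma DERIV_coord_dom_unique:
 fixes F :: "real \<Rightarrow> real"
 assumes "t \<in> coord_dom I" "(F has_real_derivative d) (at t within coord_dom I)"
 shows "vector_derivative F (at t within coord_dom I) = d" using assms at_within_coord_dom_nontrivial
 by (intro vector_derivative_within) (auto simp: has_real_derivative_iff_has_vector_derivative)

lemma DERIV_coord_dom_of_differentiable:
 fixes F :: "real \<Rightarrow> real"
 assumes "F differentiable (at t within coord_dom I)"
 shows "(F has_real_derivative vector_derivative F (at t within coord_dom I)) (at t within coord_dom I)"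
 using assms by (simp add: has_real_derivative_iff_has_vector_derivative vector_derivative_works)

lemma coord_deriv_Suc:
 "coord_deriv I (Suc k) g t = vector_derivative (coord_deriv I k g) (at t within coord_dom I)"
 by (simp add: coord_deriv_def nderiv_within_def)

lemma coord_deriv_0: "coord_deriv I 0 g = lift_of I g" by (simp add: coord_deriv_def nderiv_within_def)

lemma Cr_map_DERIV:
 assumes g: "Cr_map I r g" and k: "k < nat \<lfloor>r\<rfloor>" and t: "t \<in> coord_dom I"
 shows "(coord_deriv I k g has_real_derivative coord_deriv I (Suc k) g t) (at t within coord_dom I)"
 using g k t by (auto simp: Cr_map_def coord_deriv_Suc intro!: DERIV_coord_dom_of_differentiable)

lemma Cr_map_continuous_deriv:
 assumes g: "Cr_map I r g" and k: "k \<le> nat \<lfloor>r\<rfloor>"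
 shows "continuous_on (coord_dom I) (coord_deriv I k g)"
proof (cases "k = nat \<lfloor>r\<rfloor>")
 case False
 then show ?thesis using Cr_map_DERIV[OF g, of k] k by (intro DERIV_continuous_on) auto
qed (use g in \<open>simp add: Cr_map_def\<close>)

lemma Cr_map_lift_DERIV:
 assumes g: "Cr_map I r g" and r: "r > 1" and t: "t \<in> coord_dom I"
 shows "(lift_of I g has_real_derivative coord_deriv I 1 g t) (at t within coord_dom I)"
 using Cr_map_DERIV[OF g _ t, of 0] r by (simp add: coord_deriv_0 zero_less_nat_eq)

lemma Cr_map_is_lift: "Cr_map I r g \<Longrightarrow> is_lift I g (lift_of I g)" by (intro is_lift_lift_of) (auto simp: Cr_map_def)

lemma DERIV_shift_coord_dom:
 fixes F :: "real \<Rightarrow> real"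
 assumes t: "t \<in> coord_dom I" and eq: "\<And>u. u \<in> coord_dom I \<Longrightarrow> F' u = F u + c"
  and F: "(F has_real_derivative d) (at t within coord_dom I)"
 shows "(F' has_real_derivative d) (at t within coord_dom I)"
proof -
 have "((\<lambda>u. F u + c) has_real_derivative d) (at t within coord_dom I)" using F by (auto intro!: derivative_eq_intros)
 then show ?thesis by (rule has_field_derivative_transform_within[where d = 1]) (use t eq in auto)
qed

text \<open>Any lift computes the derivative. This matters for iterates: the iterate of the chosen
  lift is a lift of the iterate, but perhaps not the chosen one.\<close>

lemma coord_deriv_1_eq_of_lift:
 assumes G: "is_lift I g G" and g: "g \<in> points I \<rightarrow> points I" "continuous_on (points I) g"
  and t: "t \<in> coord_dom I" and d: "(G has_real_derivative d) (at t within coord_dom I)"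
 shows "coord_deriv I 1 g t = d"
proof -
 obtain c where c: "\<And>t. t \<in> coord_dom I \<Longrightarrow> lift_of I g t = G t + c"
  using is_lift_unique[OF is_lift_lift_of[OF g] G] by blast
 have "(lift_of I g has_real_derivative d) (at t within coord_dom I)" using t c d by (rule DERIV_shift_coord_dom)
 then show ?thesis using t by (simp add: coord_deriv_Suc coord_deriv_0 DERIV_coord_dom_unique)
qed

text \<open>On the circle, a lift precomposed with an integer translation is again a lift of the
  same map, so the derivative is periodic.\<close>

lemma coord_deriv_1_param:
 assumes g: "Cr_map I r g" and r: "r > 1" and st: "s \<in> coord_dom I" "t \<in> coord_dom I" "param I s = param I t"
 shows "coord_deriv I 1 g s = coord_deriv I 1 g t"
proof -
 obtain n :: int where n: "s = t + of_int n" "I = Circle \<or> n = 0" using param_eq_imp_shift[OF st] by metis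
 show ?thesis
 proof (cases "I = Circle")
  case False
  then show ?thesis using n by simp
 next
  case True
  let ?G = "lift_of I g"
  have lift: "is_lift I g ?G" using g by (rule Cr_map_is_lift)
  have "is_lift I g (\<lambda>u. ?G (u + of_int n))"
  proof -
   have "cis (2 * pi * (u + of_int n)) = cis (2 * pi * u)" for u
   proof -
    have "cis (2 * pi * (u + of_int n)) = cis (2 * pi * u) * cis (2 * pi * of_int n)"
     by (simp only: cis_mult distrib_left)
    also have "cis (2 * pi * of_int n) = 1" by (rule cis_multiple_2pi) simp
    finally show ?thesis by simp
   qed
   moreover have "continuous_on UNIV (\<lambda>u. ?G (u + of_int n))"
    using lift True by (intro continuous_on_compose2[of UNIV ?G UNIV "\<lambda>u. u + of_int n"] continuous_intros)
     (auto simp: is_lift_def)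
   ultimately show ?thesis using lift True by (auto simp: is_lift_def)
  qed
  moreover have "((\<lambda>u. ?G (u + of_int n)) has_real_derivative coord_deriv I 1 g s) (at t within coord_dom I)"
   using Cr_map_lift_DERIV[OF g r st(1)] True n by (simp add: DERIV_shift)
  ultimately show ?thesis using g by (intro coord_deriv_1_eq_of_lift[OF _ _ _ st(2), symmetric]) (auto simp: Cr_map_def)
 qed
qed

lemma map_deriv_param:
 assumes g: "Cr_map I r g" and r: "r > 1" and t: "t \<in> coord_dom I"
 shows "map_deriv I g (param I t) = coord_deriv I 1 g t"
proof -
 have "inv_into (coord_dom I) (param I) (param I t) \<in> coord_dom I"
  "param I (inv_into (coord_dom I) (param I) (param I t)) = param I t"
  using t by (auto intro: inv_into_into f_inv_into_f)
 then show ?thesis using coord_deriv_1_param[OF g r _ t] by (simp add: map_deriv_def)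
qed

lemma DERIV_lift_funpow:
 assumes g: "Cr_map I r g" and r: "r > 1" and t: "t \<in> coord_dom I"
 shows "((lift_of I g ^^ n) has_real_derivative (\<Prod>i<n. coord_deriv I 1 g ((lift_of I g ^^ i) t))) (at t within coord_dom I)"
proof (induction n)
 case 0
 then show ?case by (simp add: id_def)
next
 case (Suc n)
 let ?G = "lift_of I g"
 have dom: "(?G ^^ n) u \<in> coord_dom I" if "u \<in> coord_dom I" for u
  using is_lift_funpow[OF Cr_map_is_lift[OF g], of n] that by (auto simp: is_lift_def)
 have "(?G has_real_derivative coord_deriv I 1 g ((?G ^^ n) t)) (at ((?G ^^ n) t) within (?G ^^ n) ` coord_dom I)"
  using Cr_map_lift_DERIV[OF g r dom[OF t]] dom by (rule_tac has_field_derivative_subset) auto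
 then have "(?G \<circ> (?G ^^ n) has_real_derivative
   coord_deriv I 1 g ((?G ^^ n) t) * (\<Prod>i<n. coord_deriv I 1 g ((?G ^^ i) t))) (at t within coord_dom I)"
  using Suc by (rule DERIV_image_chain)
 then show ?case by (simp add: mult.commute del: One_nat_def o_apply)
qed

lemma map_deriv_funpow:
 assumes g: "Cr_map I r g" and r: "r > 1" and x: "x \<in> points I"
 shows "map_deriv I (g ^^ n) x = (\<Prod>i<n. map_deriv I g ((g ^^ i) x))"
proof -
 let ?G = "lift_of I g"
 have gp: "g \<in> points I \<rightarrow> points I" "continuous_on (points I) g" using g by (auto simp: Cr_map_def)
 define t where "t = inv_into (coord_dom I) (param I) x"
 have t: "t \<in> coord_dom I" "param I t = x" using x by (auto simp: t_def points_def intro: inv_into_into f_inv_into_f)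
 have lift: "is_lift I (g ^^ i) (?G ^^ i)" for i using Cr_map_is_lift[OF g] by (rule is_lift_funpow)
 have "map_deriv I (g ^^ n) x = coord_deriv I 1 (g ^^ n) t" by (simp add: map_deriv_def t_def)
 also have "\<dots> = (\<Prod>i<n. coord_deriv I 1 g ((?G ^^ i) t))"
  using lift funpow_Pi[OF gp(1)] continuous_on_funpow[OF gp] t(1) DERIV_lift_funpow[OF g r t(1)]
  by (rule coord_deriv_1_eq_of_lift)
 also have "\<dots> = (\<Prod>i<n. map_deriv I g ((g ^^ i) x))"
 proof (rule prod.cong[OF refl])
  fix i
  have "(?G ^^ i) t \<in> coord_dom I" "param I ((?G ^^ i) t) = (g ^^ i) x" using lift[of i] t by (auto simp: is_lift_def)
  then show "coord_deriv I 1 g ((?G ^^ i) t) = map_deriv I g ((g ^^ i) x)" using map_deriv_param[OF g r] by metis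
 qed
 finally show ?thesis .
qed

text \<open>\<open>map_deriv\<close> is defined through \<open>inv_into\<close>, which cannot be
  continuous on the circle. Instead, preimages of closed sets are recognised as images under
  \<open>param\<close> of compact sets in a bounded part of the coordinate domain.\<close>

lemma continuous_on_map_deriv:
 assumes g: "Cr_map I r g" and r: "r > 1"
 shows "continuous_on (points I) (map_deriv I g)"
proof -
 define K where "K = coord_dom I \<inter> {-1..1}"
 have K: "compact K" by (cases I) (auto simp: K_def)
 have img: "param I ` K = points I"
 proof
  show "points I \<subseteq> param I ` K" using coordinate unfolding K_def by (force simp: abs_le_iff)
 qed (auto simp: K_def points_def)
 have hc: "continuous_on K (coord_deriv I 1 g)"
  by (rule continuous_on_subset[OF Cr_map_continuous_deriv[OF g]]) (use r in \<open>auto simp: K_def le_nat_iff\<close>)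
 have "closed (map_deriv I g -` B \<inter> points I)" if B: "closed B" for B
 proof -
  have "map_deriv I g -` B \<inter> points I = param I ` (K \<inter> coord_deriv I 1 g -` B)"
   using map_deriv_param[OF g r] unfolding img[symmetric] by (auto simp: K_def)
  moreover have "compact (param I ` (K \<inter> coord_deriv I 1 g -` B))"
  proof (rule compact_continuous_image[OF continuous_on_param])
   have "closed (K \<inter> coord_deriv I 1 g -` B)"
    using hc B K by (intro continuous_closed_preimage) (auto intro: compact_imp_closed)
   then have "compact (K \<inter> (K \<inter> coord_deriv I 1 g -` B))" using K by (intro compact_Int_closed)
   then show "compact (K \<inter> coord_deriv I 1 g -` B)" by (simp add: Int_assoc[symmetric])
  qed
  ultimately show ?thesis by (simp add: compact_imp_closed)
 qed
 then show ?thesis using compact_points compact_imp_closed by (subst continuous_on_closed_vimage) auto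
qed

section \<open>Oscillations of a differentiable function\<close>

definition alternating_chain :: "real set \<Rightarrow> real set \<Rightarrow> nat \<Rightarrow> (nat \<Rightarrow> real) \<Rightarrow> bool" where
 "alternating_chain A B m t \<longleftrightarrow> (\<forall>i<m. t i < t (Suc i)) \<and> (\<forall>i\<le>m. t i \<in> (if even i then A else B))"

text \<open>One more than the largest \<open>m\<close> of a chain that ends at or before
  \<open>x\<close>, and 0 if there is none. When chain lengths are bounded this is a monotone
  function with boundedly many values: measurable and cheap to record.\<close>

definition chain_index :: "real set \<Rightarrow> real set \<Rightarrow> real \<Rightarrow> nat" where
 "chain_index A B x = Sup (insert 0 {Suc m |m. \<exists>t. alternating_chain A B m t \<and> t m \<le> x})"

lemma alternating_chain_append:
 assumes "alternating_chain A B m t" "t m < z" "z \<in> (if even (Suc m) then A else B)"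
 shows "alternating_chain A B (Suc m) (t(Suc m := z))"
 using assms by (auto simp: alternating_chain_def less_Suc_eq le_Suc_eq)

context
 fixes A B :: "real set" and N :: nat
 assumes bound: "\<And>m t. alternating_chain A B m t \<Longrightarrow> m < N"
begin

lemma chain_index_ge:
 assumes "alternating_chain A B m t" "t m \<le> x"
 shows "Suc m \<le> chain_index A B x" unfolding chain_index_def
proof (rule cSup_upper)
 show "Suc m \<in> insert 0 {Suc m |m. \<exists>t. alternating_chain A B m t \<and> t m \<le> x}" using assms by blast
 show "bdd_above (insert 0 {Suc m |m. \<exists>t. alternating_chain A B m t \<and> t m \<le> x})"
  using bound by (intro bdd_aboveI[of _ N]) (auto simp: Suc_le_eq)
qed

lemma chain_index_le: "chain_index A B x \<le> N"
 unfolding chain_index_def using bound by (intro cSup_least) (auto simp: Suc_le_eq)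

lemma chain_index_attained:
 assumes "chain_index A B x > 0"
 obtains m t where "chain_index A B x = Suc m" "alternating_chain A B m t" "t m \<le> x"
proof -
 let ?S = "insert 0 {Suc m |m. \<exists>t. alternating_chain A B m t \<and> t m \<le> x}"
 have "finite ?S" by (rule finite_subset[of _ "{..N}"]) (use bound in \<open>auto simp: Suc_le_eq\<close>)
 then have "Sup ?S \<in> ?S" by (simp add: cSup_eq_Max Max_in del: insert_iff)
 then have "chain_index A B x \<in> ?S" by (simp add: chain_index_def)
 then show ?thesis using assms that by auto
qed

lemma chain_index_mono: "mono (chain_index A B)"
proof (rule monoI)
 fix x y :: real assume xy: "x \<le> y"
 show "chain_index A B x \<le> chain_index A B y"
 proof (cases "chain_index A B x > 0")
  case True
  then obtain m t where "chain_index A B x = Suc m" "alternating_chain A B m t" "t m \<le> x" by (rule chain_index_attained)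
  then show ?thesis using chain_index_ge[of m t y] xy by simp
 qed simp
qed

text \<open>A longest chain up to \<open>x\<close> ends in \<open>A\<close> or in \<open>B\<close>.
  In the first case \<open>z\<close> would prolong it before \<open>y\<close>; in the second case
  \<open>x\<close> itself would prolong it.\<close>

lemma chain_index_eq_imp_no_alternation:
 assumes AB: "A \<inter> B = {}" and x: "x \<in> A" and eq: "chain_index A B x = chain_index A B y"
  and z: "x < z" "z \<le> y"
 shows "z \<notin> B"
proof
 assume zB: "z \<in> B"
 have "Suc 0 \<le> chain_index A B x" using x by (intro chain_index_ge[of 0 "\<lambda>_. x"]) (auto simp: alternating_chain_def)
 then obtain m t where t: "chain_index A B x = Suc m" "alternating_chain A B m t" "t m \<le> x"
  using chain_index_attained[of x] by auto
 show False
 proof (cases "even m")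
  case True
  then have "alternating_chain A B (Suc m) (t(Suc m := z))" using t z zB by (intro alternating_chain_append) auto
  from chain_index_ge[OF this, of y] show False using t eq z by simp
 next
  case False
  then have "t m \<in> B" using t(2) by (auto simp: alternating_chain_def)
  then have "t m \<noteq> x" using AB x by auto
  then have "alternating_chain A B (Suc m) (t(Suc m := x))" using t x False by (intro alternating_chain_append) auto
  from chain_index_ge[OF this, of x] show False using t by simp
 qed
qed

end

section \<open>Rolle's theorem and the number of oscillations\<close>

lemma Rolle_within:
 fixes h h' :: "real \<Rightarrow> real"
 assumes J: "convex J" "a \<in> J" "b \<in> J" and ab: "a < b" "h a = h b"
  and der: "\<And>t. t \<in> J \<Longrightarrow> (h has_real_derivative h' t) (at t within J)"
 obtains w where "a < w" "w < b" "w \<in> J" "h' w = 0"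
proof -
 have sub: "{a..b} \<subseteq> J" using J by (metis convex_contains_segment closed_segment_eq_real_ivl1 ab(1) less_imp_le)
 have "\<exists>x\<in>{a<..<b}. h b - h a = (\<lambda>d. h' x * d) (b - a)"
 proof (rule mvt_simple[OF ab(1)])
  fix x assume "a \<le> x" "x \<le> b"
  then have "(h has_real_derivative h' x) (at x within {a..b})"
   using der sub by (intro has_field_derivative_subset[OF der]) auto
  then show "(h has_derivative (\<lambda>d. h' x * d)) (at x within {a..b})" by (simp add: has_field_derivative_def)
 qed
 then obtain w where "a < w" "w < b" "h b - h a = h' w * (b - a)" by auto
 then show ?thesis using ab sub by (intro that[of w]) auto
qed

text \<open>Absolute values that are low, high and low again exclude monotonicity, so
  \<open>h\<close> is not injective and Rolle applies.\<close>

lemma low_high_low_critical_point: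
 fixes h h' :: "real \<Rightarrow> real"
 assumes J: "convex J" "t1 \<in> J" "t3 \<in> J" and t: "t1 < t2" "t2 < t3"
  and der: "\<And>t. t \<in> J \<Longrightarrow> (h has_real_derivative h' t) (at t within J)"
  and lv: "\<bar>h t1\<bar> \<le> \<alpha>" "\<beta> \<le> \<bar>h t2\<bar>" "\<bar>h t3\<bar> \<le> \<alpha>" "\<alpha> < \<beta>"
 obtains w where "t1 < w" "w < t3" "w \<in> J" "h' w = 0"
proof -
 have sub: "{t1..t3} \<subseteq> J" using J t by (metis convex_contains_segment closed_segment_eq_real_ivl1 less_imp_le less_trans)
 have cont: "continuous_on {t1..t3} h"
  using der sub by (intro continuous_on_subset[OF DERIV_continuous_on[of J h h']]) auto
 have "\<not> inj_on h {t1..t3}"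
 proof
  assume inj: "inj_on h {t1..t3}"
  show False using continuous_inj_imp_mono[OF t cont inj] lv by linarith
 qed
 then obtain a b where ab: "a \<in> {t1..t3}" "b \<in> {t1..t3}" "a < b" "h a = h b"
  by (metis inj_on_def linorder_neqE_linordered_idom)
 obtain w where "a < w" "w < b" "w \<in> J" "h' w = 0" using Rolle_within[OF J(1) _ _ ab(3,4) der] ab(1,2) sub by blast
 then show ?thesis using ab by (intro that[of w]) auto
qed

text \<open>Each use of Rolle's theorem gives up one zero and gains one derivative.\<close>

lemma repeated_Rolle:
 fixes H :: "nat \<Rightarrow> real \<Rightarrow> real"
 assumes J: "convex J"
  and der: "\<And>j t. j < k \<Longrightarrow> t \<in> J \<Longrightarrow> (H j has_real_derivative H (Suc j) t) (at t within J)"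
  and w: "\<And>i. i < m \<Longrightarrow> w i < w (Suc i)" "\<And>i. i \<le> m \<Longrightarrow> w i \<in> J \<and> H j0 (w i) = 0"
  and j: "j \<le> m" "j0 + j \<le> k"
 shows "\<exists>w. (\<forall>i<m - j. w i < w (Suc i)) \<and> (\<forall>i\<le>m - j. w i \<in> J \<and> H (j0 + j) (w i) = 0)" using j
proof (induction j)
 case 0
 then show ?case using w by auto
next
 case (Suc j)
 then obtain v where v: "\<And>i. i < m - j \<Longrightarrow> v i < v (Suc i)" "\<And>i. i \<le> m - j \<Longrightarrow> v i \<in> J \<and> H (j0 + j) (v i) = 0" by auto
 have "\<exists>u. v i < u \<and> u < v (Suc i) \<and> u \<in> J \<and> H (Suc (j0 + j)) u = 0" if i: "i < m - j" for i
  using Rolle_within[OF J, of "v i" "v (Suc i)" "H (j0 + j)" "H (Suc (j0 + j))"] v(1)[OF i] v(2)[of i] v(2)[of "Suc i"] i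
   der[of "j0 + j"] Suc.prems by (metis Suc_leI less_imp_le add_Suc_right Suc_le_lessD)
 then obtain u where u: "\<And>i. i < m - j \<Longrightarrow> v i < u i \<and> u i < v (Suc i) \<and> u i \<in> J \<and> H (Suc (j0 + j)) (u i) = 0" by metis
 have "u i < u (Suc i)" if "i < m - Suc j" for i using u[of i] u[of "Suc i"] that by linarith
 moreover have "u i \<in> J \<and> H (j0 + Suc j) (u i) = 0" if "i \<le> m - Suc j" for i using u[of i] that Suc.prems by auto
 ultimately show ?case by blast
qed

text \<open>With \<open>k\<close> zeros of \<open>H 1\<close>, each of \<open>H 1\<close> up to
  \<open>H k\<close> has a zero. Hence an oscillation bound for \<open>H k\<close> is a bound for
  its size, and integrating downwards gains a factor \<rho> at each level. Only the oscillation of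
  the top derivative enters, which is what a Hoelder condition controls.\<close>

lemma oscillation_le_of_critical_points:
 fixes H :: "nat \<Rightarrow> real \<Rightarrow> real"
 assumes J: "convex J" "\<And>s t. s \<in> J \<Longrightarrow> t \<in> J \<Longrightarrow> \<bar>s - t\<bar> \<le> \<rho>"
  and der: "\<And>j t. j < k \<Longrightarrow> t \<in> J \<Longrightarrow> (H j has_real_derivative H (Suc j) t) (at t within J)"
  and osc: "\<And>s t. s \<in> J \<Longrightarrow> t \<in> J \<Longrightarrow> \<bar>H k s - H k t\<bar> \<le> K"
  and w: "\<And>i. Suc i < k \<Longrightarrow> w i < w (Suc i)" "\<And>i. i < k \<Longrightarrow> w i \<in> J \<and> H 1 (w i) = 0"
  and st: "s \<in> J" "t \<in> J"
 shows "\<bar>H 0 s - H 0 t\<bar> \<le> K * \<rho> ^ k"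
proof -
 have \<rho>0: "\<rho> \<ge> 0" using J(2)[OF st(1) st(1)] by simp
 have osc_j: "\<bar>H j a - H j b\<bar> \<le> K * \<rho> ^ (k - j)" if "j \<le> k" "a \<in> J" "b \<in> J" for j a b using that
 proof (induction "k - j" arbitrary: j a b)
  case 0
  then show ?case using osc by simp
 next
  case (Suc n)
  then have jk: "j < k" and n: "n = k - Suc j" by auto
  have "\<exists>v. v \<in> J \<and> H (Suc j) v = 0"
  proof -
   have "\<exists>w. (\<forall>i<(k - 1) - j. w i < w (Suc i)) \<and> (\<forall>i\<le>(k - 1) - j. w i \<in> J \<and> H (1 + j) (w i) = 0)"
    using repeated_Rolle[of J k H "k - 1" w 1 j] J(1) der w jk by auto
   then show ?thesis by auto
  qed
  then obtain v where v: "v \<in> J" "H (Suc j) v = 0" by blast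
  have bd: "\<bar>H (Suc j) c\<bar> \<le> K * \<rho> ^ (k - Suc j)" if "c \<in> J" for c using Suc.hyps(1)[OF n _ that v(1)] jk v(2) by simp
  have "\<bar>H j a - H j b\<bar> \<le> K * \<rho> ^ (k - Suc j) * \<bar>a - b\<bar>"
   using field_differentiable_bound[OF J(1) der[OF jk] , of "K * \<rho> ^ (k - Suc j)" a b] bd Suc.prems by (simp add: norm_minus_commute)
  also have "\<dots> \<le> K * \<rho> ^ (k - Suc j) * \<rho>"
  proof (rule mult_left_mono)
   show "\<bar>a - b\<bar> \<le> \<rho>" using J(2) Suc.prems by blast
   show "0 \<le> K * \<rho> ^ (k - Suc j)" using bd[OF v(1)] by linarith
  qed
  also have "\<dots> = K * \<rho> ^ (k - j)" using n Suc.hyps(2) by (metis mult.assoc power_Suc2)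
  finally show ?case .
 qed
 show ?thesis using osc_j[of 0 s t] st by simp
qed

text \<open>Every high point between two low ones yields a critical point. With \<open>k\<close> of
  them, \<open>H 0\<close> oscillates too little to pass between the levels \<alpha> and \<beta>. A
  chain that begins with a high point is shifted by one, whence 2 k + 2.\<close>

lemma alternating_chain_bound:
 fixes H :: "nat \<Rightarrow> real \<Rightarrow> real"
 assumes J: "convex J" "\<And>s t. s \<in> J \<Longrightarrow> t \<in> J \<Longrightarrow> \<bar>s - t\<bar> \<le> \<rho>"
  and der: "\<And>j t. j < k \<Longrightarrow> t \<in> J \<Longrightarrow> (H j has_real_derivative H (Suc j) t) (at t within J)"
  and osc: "\<And>s t. s \<in> J \<Longrightarrow> t \<in> J \<Longrightarrow> \<bar>H k s - H k t\<bar> \<le> K"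
  and L: "\<And>t. t \<in> L \<Longrightarrow> t \<in> J \<and> \<bar>H 0 t\<bar> \<le> \<alpha>" and U: "\<And>t. t \<in> U \<Longrightarrow> t \<in> J \<and> \<beta> \<le> \<bar>H 0 t\<bar>"
  and gap: "K * \<rho> ^ k < \<beta> - \<alpha>" "\<alpha> < \<beta>"
  and chain: "alternating_chain L U m t \<or> alternating_chain U L m t"
 shows "m < 2 * k + 2"
proof -
 have no: False if c: "\<And>i. i \<le> 2 * k \<Longrightarrow> t i < t (Suc i)"
   "\<And>i. i \<le> 2 * k + 1 \<Longrightarrow> t i \<in> (if even i then L else U)" for t :: "nat \<Rightarrow> real"
 proof -
  have t01: "t 0 \<in> L" "t 1 \<in> U" using c(2)[of 0] c(2)[of 1] by auto
  have "\<exists>w. t (2 * q) < w \<and> w < t (2 * q + 2) \<and> w \<in> J \<and> H 1 w = 0" if q: "q < k" for q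
  proof -
   have 1: "t (2 * q) \<in> L" "t (2 * q + 1) \<in> U" "t (2 * q + 2) \<in> L"
    using c(2)[of "2 * q"] c(2)[of "2 * q + 1"] c(2)[of "2 * q + 2"] q by auto
   have 2: "t (2 * q) < t (2 * q + 1)" "t (2 * q + 1) < t (2 * q + 2)"
    using c(1)[of "2 * q"] c(1)[of "2 * q + 1"] q by auto
   have d0: "(H 0 has_real_derivative H 1 u) (at u within J)" if "u \<in> J" for u using der[of 0 u] that q by simp
   show ?thesis
    using low_high_low_critical_point[OF J(1) _ _ 2 d0, of \<alpha> \<beta>] L[OF 1(1)] U[OF 1(2)] L[OF 1(3)] gap(2) by metis
  qed
  then obtain w where w: "\<And>q. q < k \<Longrightarrow> t (2 * q) < w q \<and> w q < t (2 * q + 2) \<and> w q \<in> J \<and> H 1 (w q) = 0" by metis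
  have "w i < w (Suc i)" if "Suc i < k" for i using w[of i] w[of "Suc i"] that by simp
  then have "\<bar>H 0 (t 1) - H 0 (t 0)\<bar> \<le> K * \<rho> ^ k" using L[OF t01(1)] U[OF t01(2)] w
   by (intro oscillation_le_of_critical_points[OF J der osc, where w = w]) auto
  moreover have "\<beta> - \<alpha> \<le> \<bar>H 0 (t 1) - H 0 (t 0)\<bar>" using L[OF t01(1)] U[OF t01(2)] by linarith
  ultimately show False using gap by linarith
 qed
 show ?thesis
 proof (rule ccontr)
  assume m: "\<not> ?thesis"
  from chain show False
  proof
   assume "alternating_chain L U m t"
   then show False using m by (intro no[of t]) (auto simp: alternating_chain_def)
  next
   assume "alternating_chain U L m t"
   then have c: "\<And>i. i < m \<Longrightarrow> t i < t (Suc i)" "\<And>i. i \<le> m \<Longrightarrow> t i \<in> (if even i then U else L)"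
    by (auto simp: alternating_chain_def)
   show False
   proof (rule no[of "\<lambda>i. t (Suc i)"])
    show "t (Suc i) < t (Suc (Suc i))" if "i \<le> 2 * k" for i using c(1)[of "Suc i"] that m by simp
    show "t (Suc i) \<in> (if even i then L else U)" if "i \<le> 2 * k + 1" for i using c(2)[of "Suc i"] that m by (cases "even i") auto
   qed
  qed
 qed
qed

text \<open>
 On the cells of the grid of mesh \<open>\<epsilon> exp (- d / \<sigma>)\<close>, points where \<open>|h|\<close> is about \<open>exp (- d)\<close> are grouped
 into clusters, numbered by two indices, between which \<open>|h|\<close> neither drops nor rises much.
\<close>

definition separates_clusters :: "real set \<Rightarrow> real \<Rightarrow> real \<Rightarrow> (real \<Rightarrow> real) \<Rightarrow> nat \<Rightarrow>
  (nat \<Rightarrow> int \<Rightarrow> real \<Rightarrow> nat) \<Rightarrow> (nat \<Rightarrow> int \<Rightarrow> real \<Rightarrow> nat) \<Rightarrow> bool" where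
 "separates_clusters D \<epsilon> \<sigma> h N i1 i2 \<longleftrightarrow> (\<forall>d j. mono (i1 d j) \<and> mono (i2 d j)) \<and>
  (\<forall>d j x. i1 d j x \<le> N \<and> i2 d j x \<le> N) \<and>
  (\<forall>d j x y z. x \<in> D \<longrightarrow> y \<in> D \<longrightarrow> x \<le> z \<longrightarrow> z \<le> y \<longrightarrow>
   \<lfloor>x / (\<epsilon> * exp (- real d / \<sigma>))\<rfloor> = j \<longrightarrow> \<lfloor>y / (\<epsilon> * exp (- real d / \<sigma>))\<rfloor> = j \<longrightarrow>
   exp (- real d - 1) \<le> \<bar>h x\<bar> \<longrightarrow> \<bar>h x\<bar> \<le> exp (- real d) \<longrightarrow>
   i1 d j x = i1 d j y \<longrightarrow> i2 d j x = i2 d j y \<longrightarrow>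
   exp (- real d - 2) < \<bar>h z\<bar> \<and> \<bar>h z\<bar> < exp (- real d + 1))"

text \<open>On a cell of mesh \<rho> the oscillation bound is C times the power k + \<theta> of
  \<rho>. The mesh is chosen so that this scales like exp (- d), exactly as the gaps between the
  levels do, and one smallness condition on \<epsilon> serves all depths. The two indices count
  alternations with much smaller and with much larger values.\<close>

lemma critical_clusters:
 fixes H :: "nat \<Rightarrow> real \<Rightarrow> real"
 assumes D: "convex D"
  and der: "\<And>j t. j < k \<Longrightarrow> t \<in> D \<Longrightarrow> (H j has_real_derivative H (Suc j) t) (at t within D)"
  and hoelder: "\<And>s t. s \<in> D \<Longrightarrow> t \<in> D \<Longrightarrow> \<bar>H k s - H k t\<bar> \<le> C * \<bar>s - t\<bar> powr \<theta>"
  and par: "\<theta> \<ge> 0" "real k + \<theta> > 0" "\<epsilon> > 0" "C \<ge> 0"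
  and \<epsilon>: "C * \<epsilon> powr (real k + \<theta>) < exp (- 1) - exp (- 2)"
 obtains i1 i2 where "separates_clusters D \<epsilon> (real k + \<theta>) (H 0) (2 * k + 2) i1 i2"
proof -
 define \<rho> where "\<rho> d = \<epsilon> * exp (- real d / (real k + \<theta>))" for d :: nat
 have \<rho>: "\<rho> d > 0" for d using par by (simp add: \<rho>_def)
 define J where "J d j = D \<inter> {x. \<lfloor>x / \<rho> d\<rfloor> = j}" for d and j :: int
 define A where "A d j = {x\<in>J d j. exp (- real d - 1) \<le> \<bar>H 0 x\<bar> \<and> \<bar>H 0 x\<bar> \<le> exp (- real d)}" for d j
 define B1 where "B1 d j = {x\<in>J d j. \<bar>H 0 x\<bar> \<le> exp (- real d - 2)}" for d j
 define B2 where "B2 d j = {x\<in>J d j. exp (- real d + 1) \<le> \<bar>H 0 x\<bar>}" for d j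
 have cell: "{x. \<lfloor>x / \<rho> d\<rfloor> = j} = {of_int j * \<rho> d ..< (of_int j + 1) * \<rho> d}" for d j
  using \<rho>[of d] by (auto simp: floor_eq_iff field_simps)
 have Jc: "convex (J d j)" for d j unfolding J_def cell using D by (intro convex_Int) (auto simp: convex_real_interval)
 have Jl: "\<bar>s - t\<bar> \<le> \<rho> d" if "s \<in> J d j" "t \<in> J d j" for s t d j
  using that unfolding J_def cell by (auto simp: algebra_simps abs_le_iff)
 have Jder: "(H i has_real_derivative H (Suc i) t) (at t within J d j)" if "i < k" "t \<in> J d j" for i t d j
  using der[of i t] that by (auto simp: J_def intro: has_field_derivative_subset)
 have Josc: "\<bar>H k s - H k t\<bar> \<le> C * \<rho> d powr \<theta>" if "s \<in> J d j" "t \<in> J d j" for s t d j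
 proof -
  have "\<bar>H k s - H k t\<bar> \<le> C * \<bar>s - t\<bar> powr \<theta>" using hoelder that by (auto simp: J_def)
  also have "\<dots> \<le> C * \<rho> d powr \<theta>" using Jl[OF that] par by (intro mult_left_mono powr_mono2) auto
  finally show ?thesis .
 qed
 have K: "C * \<rho> d powr \<theta> * \<rho> d ^ k < exp (- real d) * (exp (- 1) - exp (- 2))" for d
 proof -
  have "C * \<rho> d powr \<theta> * \<rho> d ^ k = C * \<rho> d powr (real k + \<theta>)" using \<rho>[of d] by (simp add: powr_add powr_realpow mult_ac)
  also have "\<rho> d powr (real k + \<theta>) = \<epsilon> powr (real k + \<theta>) * exp (- real d)"
   using par by (simp add: \<rho>_def powr_mult exp_powr_real)
  also have "C * (\<epsilon> powr (real k + \<theta>) * exp (- real d)) = exp (- real d) * (C * \<epsilon> powr (real k + \<theta>))" by simp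
  also have "\<dots> < exp (- real d) * (exp (- 1) - exp (- 2))" using \<epsilon> by simp
  finally show ?thesis .
 qed
 have b1: "m < 2 * k + 2" if "alternating_chain (A d j) (B1 d j) m t" for d j m t
 proof (rule alternating_chain_bound[OF Jc Jl Jder Josc])
  show "C * \<rho> d powr \<theta> * \<rho> d ^ k < exp (- real d - 1) - exp (- real d - 2)"
   using K[of d] by (simp add: exp_diff exp_minus field_simps)
  show "alternating_chain (B1 d j) (A d j) m t \<or> alternating_chain (A d j) (B1 d j) m t" using that by simp
 qed (auto simp: A_def B1_def)
 have b2: "m < 2 * k + 2" if "alternating_chain (A d j) (B2 d j) m t" for d j m t
 proof (rule alternating_chain_bound[OF Jc Jl Jder Josc])
  have "exp (- 1) - exp (- 2) \<le> (1 :: real)" using exp_ge_zero[of "- 2 :: real"] exp_le_one_iff[of "- 1 :: real"] by linarith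
  also have "1 \<le> exp 1 - (1 :: real)" using exp_ge_add_one_self[of 1] by linarith
  finally have "exp (- real d) * (exp (- 1) - exp (- 2)) \<le> exp (- real d) * (exp 1 - 1)" by (intro mult_left_mono) auto
  then show "C * \<rho> d powr \<theta> * \<rho> d ^ k < exp (- real d + 1) - exp (- real d)"
   using K[of d] unfolding exp_add right_diff_distrib by linarith
  show "alternating_chain (A d j) (B2 d j) m t \<or> alternating_chain (B2 d j) (A d j) m t" using that by simp
 qed (auto simp: A_def B2_def)
 have AB: "A d j \<inter> B1 d j = {}" "A d j \<inter> B2 d j = {}" for d j
 proof -
  have *: "exp (- real d - 2) < exp (- real d - 1)" "exp (- real d) < exp (- real d + 1)" by simp_all
  have "\<not> (x \<in> A d j \<and> x \<in> B1 d j)" "\<not> (x \<in> A d j \<and> x \<in> B2 d j)" for x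
   unfolding A_def B1_def B2_def using * by (auto simp del: exp_less_cancel_iff)
  then show "A d j \<inter> B1 d j = {}" "A d j \<inter> B2 d j = {}" by auto
 qed
 show ?thesis
 proof (rule that[of "\<lambda>d j. chain_index (A d j) (B1 d j)" "\<lambda>d j. chain_index (A d j) (B2 d j)"],
   unfold separates_clusters_def, intro conjI allI impI)
  show "mono (chain_index (A d j) (B1 d j))" "mono (chain_index (A d j) (B2 d j))" for d j
   using chain_index_mono[OF b1] chain_index_mono[OF b2] by auto
  show "chain_index (A d j) (B1 d j) x \<le> 2 * k + 2" "chain_index (A d j) (B2 d j) x \<le> 2 * k + 2" for d j x
   using chain_index_le[OF b1] chain_index_le[OF b2] by auto
  fix d j x y z
  assume *: "x \<in> D" "y \<in> D" "x \<le> z" "z \<le> y"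
   "\<lfloor>x / (\<epsilon> * exp (- real d / (real k + \<theta>)))\<rfloor> = j" "\<lfloor>y / (\<epsilon> * exp (- real d / (real k + \<theta>)))\<rfloor> = j"
   "exp (- real d - 1) \<le> \<bar>H 0 x\<bar>" "\<bar>H 0 x\<bar> \<le> exp (- real d)"
   "chain_index (A d j) (B1 d j) x = chain_index (A d j) (B1 d j) y"
   "chain_index (A d j) (B2 d j) x = chain_index (A d j) (B2 d j) y"
  have xJ: "x \<in> J d j" "y \<in> J d j" using * by (auto simp: J_def \<rho>_def)
  moreover have "z \<in> D" using D *(1-4) unfolding is_interval_convex_1[symmetric] by (rule mem_is_interval_1_I)
  ultimately have zJ: "z \<in> J d j" using *(3,4) unfolding J_def cell by auto
  have xA: "x \<in> A d j" using xJ(1) *(7,8) by (simp add: A_def)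
  have "z \<notin> B1 d j \<and> z \<notin> B2 d j"
  proof (cases "x = z")
   case True then show ?thesis using AB[of d j] xA by auto
  next
   case False
   then have "x < z" using * by simp
   then show ?thesis using chain_index_eq_imp_no_alternation[OF _ AB(1) xA *(9) _ *(4)] b1[of d j]
     chain_index_eq_imp_no_alternation[OF _ AB(2) xA *(10) _ *(4)] b2[of d j] by blast
  qed
  then show "exp (- real d - 2) < \<bar>H 0 z\<bar>" "\<bar>H 0 z\<bar> < exp (- real d + 1)" using zJ by (auto simp: B1_def B2_def not_le)
 qed
qed

section \<open>Measurability of codes and counting of grid cells\<close>

lemma simple_function_of_finite_range:
 assumes "F \<in> measurable M (count_space UNIV)" "finite (F ` space M)"
 shows "simple_function M F" using assms unfolding simple_function_def by (auto intro: measurable_sets)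

lemma mono_nat_measurable:
 fixes f :: "real \<Rightarrow> nat"
 assumes "mono f"
 shows "f \<in> measurable borel (count_space UNIV)"
proof -
 have "mono (\<lambda>x. real (f x))" using assms by (auto simp: mono_def)
 then have [measurable]: "(\<lambda>x. real (f x)) \<in> borel_measurable borel" by (rule borel_measurable_mono)
 have "(\<lambda>x. nat \<lfloor>real (f x)\<rfloor>) \<in> measurable borel (count_space UNIV)" by measurable
 then show ?thesis by simp
qed

lemma card_floor_image_le:
 fixes f :: "'a \<Rightarrow> real"
 assumes S: "S \<noteq> {}" and d: "\<And>x y. x \<in> S \<Longrightarrow> y \<in> S \<Longrightarrow> \<bar>f x - f y\<bar> \<le> d" and \<rho>: "\<rho> > 0"
 shows "finite ((\<lambda>x. \<lfloor>f x / \<rho>\<rfloor>) ` S)" "real (card ((\<lambda>x. \<lfloor>f x / \<rho>\<rfloor>) ` S)) \<le> d / \<rho> + 2"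
proof -
 let ?F = "(\<lambda>x. \<lfloor>f x / \<rho>\<rfloor>) ` S"
 have diff: "real_of_int (i - j) \<le> d / \<rho> + 1" if "i \<in> ?F" "j \<in> ?F" for i j
 proof -
  obtain x y where xy: "x \<in> S" "y \<in> S" "i = \<lfloor>f x / \<rho>\<rfloor>" "j = \<lfloor>f y / \<rho>\<rfloor>" using \<open>i \<in> ?F\<close> \<open>j \<in> ?F\<close> by auto
  have "real_of_int i \<le> f x / \<rho>" "f y / \<rho> < real_of_int j + 1" using xy by linarith+
  moreover have "f x / \<rho> - f y / \<rho> \<le> d / \<rho>"
   using d[OF xy(1,2)] \<rho> by (simp flip: diff_divide_distrib add: divide_right_mono)
  ultimately show ?thesis by simp
 qed
 obtain x0 where "x0 \<in> S" using S by auto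
 then have i0: "\<lfloor>f x0 / \<rho>\<rfloor> \<in> ?F" by auto
 have "?F \<subseteq> {\<lfloor>f x0 / \<rho>\<rfloor> - \<lceil>d / \<rho> + 1\<rceil>..\<lfloor>f x0 / \<rho>\<rfloor> + \<lceil>d / \<rho> + 1\<rceil>}"
 proof
  fix i assume i: "i \<in> ?F"
  show "i \<in> {\<lfloor>f x0 / \<rho>\<rfloor> - \<lceil>d / \<rho> + 1\<rceil>..\<lfloor>f x0 / \<rho>\<rfloor> + \<lceil>d / \<rho> + 1\<rceil>}"
   using diff[OF i i0] diff[OF i0 i] by (auto simp: le_ceiling_iff) linarith+
 qed
 then show fin: "finite ?F" using finite_subset by blast
 have ne: "?F \<noteq> {}" using S by auto
 have "?F \<subseteq> {Min ?F..Max ?F}" using fin by auto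
 then have "card ?F \<le> card {Min ?F..Max ?F}" by (intro card_mono) auto
 also have "\<dots> = nat (Max ?F - Min ?F + 1)" by simp
 finally have "real (card ?F) \<le> real_of_int (Max ?F - Min ?F) + 1" using Min_le[OF fin i0] Max_ge[OF fin i0] by linarith
 also have "\<dots> \<le> d / \<rho> + 1 + 1" using diff[OF Max_in[OF fin ne] Min_in[OF fin ne]] by simp
 finally show "real (card ?F) \<le> d / \<rho> + 2" by simp
qed

text \<open>The values of the vector are separated by the sum of the variations of its components.\<close>

lemma card_monotone_grid_vectors:
 fixes f :: "nat \<Rightarrow> 'a \<Rightarrow> int" and b :: "'a \<Rightarrow> real"
 assumes fin: "finite (V ` S)"
  and V: "\<And>x y. x \<in> S \<Longrightarrow> y \<in> S \<Longrightarrow> V x = V y \<longleftrightarrow> (\<forall>i<n. f i x = f i y)"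
  and inj: "\<And>x y. x \<in> S \<Longrightarrow> y \<in> S \<Longrightarrow> b x = b y \<Longrightarrow> V x = V y"
  and betw: "\<And>x y z i. x \<in> S \<Longrightarrow> y \<in> S \<Longrightarrow> z \<in> S \<Longrightarrow> i < n \<Longrightarrow> b x \<le> b y \<Longrightarrow> b y \<le> b z \<Longrightarrow>
   (f i x \<le> f i y \<and> f i y \<le> f i z) \<or> (f i z \<le> f i y \<and> f i y \<le> f i x)"
  and bd: "\<And>x y i. x \<in> S \<Longrightarrow> y \<in> S \<Longrightarrow> i < n \<Longrightarrow> \<bar>f i x - f i y\<bar> \<le> int m"
 shows "card (V ` S) \<le> n * m + 1"
proof (cases "S = {}")
 case False
 define R where "R v = (SOME x. x \<in> S \<and> V x = v)" for v
 have R: "R v \<in> S" "V (R v) = v" if "v \<in> V ` S" for v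
  using that someI_ex[of "\<lambda>x. x \<in> S \<and> V x = v"] unfolding R_def by auto
 define B where "B = b ` R ` V ` S"
 have finB: "finite B" and neB: "B \<noteq> {}" using fin False by (auto simp: B_def)
 have "Min B \<in> B" using finB neB by (rule Min_in)
 then obtain v0 where v0: "v0 \<in> V ` S" "b (R v0) = Min B" unfolding B_def by (metis imageE)
 define x0 where "x0 = R v0"
 have x0: "x0 \<in> S" using R v0 by (simp add: x0_def)
 have min: "b x0 \<le> b (R v)" if "v \<in> V ` S" for v
  using v0(2) Min_le[OF finB, of "b (R v)"] that by (auto simp: x0_def B_def)
 \<comment> \<open>Total variation from the representative \<open>x0\<close> with the least value of
   \<open>b\<close>. Each component moves away from its value at \<open>x0\<close> monotonically, so
   \<open>T\<close> strictly increases whenever the vector changes.\<close>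
 define T where "T x = (\<Sum>i<n. \<bar>f i x - f i x0\<bar>)" for x
 have less: "T x < T y" if xy: "x \<in> S" "y \<in> S" "b x0 \<le> b x" "b x \<le> b y" "V x \<noteq> V y" for x y
 proof -
  have le: "\<bar>f i x - f i x0\<bar> \<le> \<bar>f i y - f i x0\<bar> \<and> (f i x \<noteq> f i y \<longrightarrow> \<bar>f i x - f i x0\<bar> < \<bar>f i y - f i x0\<bar>)"
   if "i < n" for i using betw[OF x0 xy(1,2) that xy(3,4)] by auto
  obtain i where "i < n" "f i x \<noteq> f i y" using V[OF xy(1,2)] xy(5) by auto
  then show ?thesis unfolding T_def using le by (intro sum_strict_mono_ex1) auto
 qed
 have inj_T: "inj_on (\<lambda>v. T (R v)) (V ` S)"
 proof (rule inj_onI)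
  fix v w assume vw: "v \<in> V ` S" "w \<in> V ` S" "T (R v) = T (R w)"
  show "v = w"
  proof (rule ccontr)
   assume "v \<noteq> w"
   then have ne: "V (R v) \<noteq> V (R w)" "V (R w) \<noteq> V (R v)" using R vw by auto
   show False using less[OF R(1)[OF vw(1)] R(1)[OF vw(2)] min[OF vw(1)] _ ne(1)]
     less[OF R(1)[OF vw(2)] R(1)[OF vw(1)] min[OF vw(2)] _ ne(2)] vw(3) by (cases "b (R v) \<le> b (R w)") auto
  qed
 qed
 have "(\<lambda>v. T (R v)) ` V ` S \<subseteq> {0..int (n * m)}"
 proof
  fix t assume "t \<in> (\<lambda>v. T (R v)) ` V ` S"
  then obtain v where v: "v \<in> V ` S" "t = T (R v)" by auto
  have "t \<le> (\<Sum>i<n. int m)" unfolding v T_def using bd[OF R(1)[OF v(1)] x0] by (intro sum_mono) auto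
  moreover have "t \<ge> 0" unfolding v T_def by (intro sum_nonneg) auto
  ultimately show "t \<in> {0..int (n * m)}" by simp
 qed
 then have "card (V ` S) \<le> card {0..int (n * m)}" using inj_T by (metis card_image card_mono finite_atLeastAtMost_int)
 also have "\<dots> = nat (int (n * m + 1))" by simp
 finally show ?thesis by (simp only: nat_int)
qed simp

section \<open>Coding of orbits\<close>

text \<open>
 The logarithmic deficit of size of the orbit pieces: \<open>a l\<close> is minus the logarithm of the derivative
 at time \<open>l\<close>. Only deep contractions (at least \<open>a0\<close>) open a bad time interval.
\<close>

fun deficit :: "real \<Rightarrow> real \<Rightarrow> real \<Rightarrow> real \<Rightarrow> (nat \<Rightarrow> real) \<Rightarrow> nat \<Rightarrow> real" where
 "deficit \<sigma> \<gamma> a1 a0 a 0 = 0"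
| "deficit \<sigma> \<gamma> a1 a0 a (Suc l) =
  (if a l \<ge> a0 then max (deficit \<sigma> \<gamma> a1 a0 a l) ((a l - 1) / \<sigma>) + a l - 2
   else if deficit \<sigma> \<gamma> a1 a0 a l = 0 then 0
   else max 0 (deficit \<sigma> \<gamma> a1 a0 a l + a l - (if a l \<ge> a1 then 2 else \<gamma>)))"

lemma deficit_nonneg:
 assumes "a0 \<ge> 2"
 shows "deficit \<sigma> \<gamma> a1 a0 a l \<ge> 0" by (induction l) (use assms in auto)

lemma deficit_measurable [measurable]:
 assumes [measurable]: "\<And>l. a l \<in> borel_measurable M"
 shows "(\<lambda>x. deficit \<sigma> \<gamma> a1 a0 (\<lambda>l. a l x) l) \<in> borel_measurable M" by (induction l) simp_all

locale one_dim_system =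
 fixes I :: one_dim and r :: real and g :: "complex \<Rightarrow> complex" and M :: "complex measure"
 assumes r: "r > 1" and g: "Cr_map I r g" and M: "borel_prob_on (points I) M"
  and inv: "invariant_measure g M"
begin

sublocale prob_space M using M by (rule borel_prob_onD)

abbreviation "X \<equiv> points I"
abbreviation "D \<equiv> coord_dom I"
abbreviation "G \<equiv> lift_of I g"
abbreviation "h \<equiv> coord_deriv I (Suc 0) g"

text \<open>The orbit on the line for the fixed lift. On the circle it is not reduced modulo 1, so
  that points with a common code span ordinary intervals.\<close>

definition "u l x = (G ^^ l) (coordinate I x)"
text \<open>By \<open>ln 0 = 0\<close> the value is 0 at a zero of the derivative, where infinity
  would be natural. Such orbits have to be kept away explicitly, by \<open>shallow_orbits\<close> or
  by statements that hold almost everywhere.\<close>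

definition "contraction l x = - ln \<bar>map_deriv I g ((g ^^ l) x)\<bar>"

lemma space_M: "space M = X" using M by (rule borel_prob_onD)
lemma g_maps: "g \<in> X \<rightarrow> X" and g_cont: "continuous_on X g" using g by (auto simp: Cr_map_def)
lemma g_measurable: "g \<in> measurable M M" and g_distr: "distr M M g = M" using inv by (auto simp: invariant_measure_def)
lemma gl_measurable [measurable]: "(g ^^ l) \<in> measurable M M" using g_measurable by (rule funpow_measurable)
lemma gl_in: "x \<in> X \<Longrightarrow> (g ^^ l) x \<in> X" using funpow_Pi[OF g_maps] by blast
lemma lift: "is_lift I g G" using g by (rule Cr_map_is_lift)
lemma G_in: "t \<in> D \<Longrightarrow> (G ^^ l) t \<in> D" using is_lift_funpow[OF lift, of l] by (auto simp: is_lift_def)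
lemma param_G: "t \<in> D \<Longrightarrow> param I ((G ^^ l) t) = (g ^^ l) (param I t)"
 using is_lift_funpow[OF lift, of l] by (auto simp: is_lift_def)
lemma u_in: "x \<in> X \<Longrightarrow> u l x \<in> D" unfolding u_def using coordinate(1) G_in by blast
lemma param_u: "x \<in> X \<Longrightarrow> param I (u l x) = (g ^^ l) x" unfolding u_def using coordinate param_G by metis
lemma h_u: "x \<in> X \<Longrightarrow> h (u l x) = map_deriv I g ((g ^^ l) x)"
 using map_deriv_param[OF g r u_in] param_u by (metis One_nat_def)
lemma u_Suc: "u (Suc l) x = G (u l x)" by (simp add: u_def)
lemma G_DERIV: "t \<in> D \<Longrightarrow> (G has_real_derivative h t) (at t within D)" using Cr_map_lift_DERIV[OF g r] by simp
lemma convex_D: "convex D" by (cases I) auto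


lemma u_measurable [measurable]: "u l \<in> borel_measurable M"
proof -
 have "coordinate I \<in> measurable M (restrict_space borel D)"
  using coordinate_measurable[OF M] coordinate(1) space_M by (intro measurable_restrict_space2) auto
 moreover have "(G ^^ l) \<in> measurable (restrict_space borel D) borel"
  using is_lift_funpow[OF lift, of l] by (intro borel_measurable_continuous_on_restrict) (simp add: is_lift_def)
 ultimately have "(\<lambda>x. (G ^^ l) (coordinate I x)) \<in> measurable M borel" by (rule measurable_compose)
 then show ?thesis by (simp add: u_def [abs_def])
qed

lemma u_bounded: obtains B where "\<And>x. x \<in> X \<Longrightarrow> \<bar>u l x\<bar> \<le> B"
proof -
 have "compact (D \<inter> {-1..1})" by (cases I) auto
 moreover have "continuous_on (D \<inter> {-1..1}) (G ^^ l)"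
  using is_lift_funpow[OF lift, of l] by (intro continuous_on_subset[OF _ Int_lower1]) (simp add: is_lift_def)
 ultimately have "bounded ((G ^^ l) ` (D \<inter> {-1..1}))" by (intro compact_imp_bounded compact_continuous_image)
 then obtain B where B: "\<And>t. t \<in> D \<inter> {-1..1} \<Longrightarrow> \<bar>(G ^^ l) t\<bar> \<le> B" unfolding bounded_iff by force
 show ?thesis
 proof (rule that)
  fix x assume "x \<in> X"
  then show "\<bar>u l x\<bar> \<le> B" unfolding u_def using coordinate[of x I] by (intro B) (auto simp: abs_le_iff)
 qed
qed

lemma map_deriv_measurable [measurable]: "map_deriv I g \<in> borel_measurable M"
 using M continuous_on_map_deriv[OF g r] by (rule borel_prob_on_continuous_measurable)

lemma contraction_measurable [measurable]: "contraction l \<in> borel_measurable M"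
proof -
 show ?thesis unfolding contraction_def [abs_def] by measurable
qed

lemma mean_value_bound:
 assumes st: "s \<in> D" "t \<in> D" and B: "\<And>z. z \<in> closed_segment s t \<Longrightarrow> \<bar>h z\<bar> \<le> B"
 shows "\<bar>G s - G t\<bar> \<le> B * \<bar>s - t\<bar>"
proof -
 have sub: "closed_segment s t \<subseteq> D" using convex_D st by (rule closed_segment_subset[rotated -1])
 have "norm (G s - G t) \<le> B * norm (s - t)"
 proof (rule field_differentiable_bound)
  show "(G has_real_derivative h z) (at z within closed_segment s t)" if "z \<in> closed_segment s t" for z
   using has_field_derivative_subset[OF G_DERIV sub] that sub by blast
 qed (use B in auto)
 then show ?thesis by simp
qed

lemma injective_of_nonvanishing:
 assumes st: "s \<in> D" "t \<in> D" and h: "\<And>z. z \<in> closed_segment s t \<Longrightarrow> h z \<noteq> 0"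
 shows "inj_on G (closed_segment s t)"
proof (rule inj_onI, rule ccontr)
 fix a b assume ab: "a \<in> closed_segment s t" "b \<in> closed_segment s t" "G a = G b" "a \<noteq> b"
 have sub: "closed_segment s t \<subseteq> D" using convex_D st by (rule closed_segment_subset[rotated -1])
 define a' b' where "a' = min a b" and "b' = max a b"
 have ab': "a' \<in> closed_segment s t" "b' \<in> closed_segment s t" "G a' = G b'" "a' < b'"
  using ab by (auto simp: a'_def b'_def min_def max_def)
 have "(G has_real_derivative h z) (at z within closed_segment s t)" if "z \<in> closed_segment s t" for z
  using has_field_derivative_subset[OF G_DERIV sub] that sub by blast
 then obtain w where "w \<in> closed_segment s t" "h w = 0"
  using Rolle_within[OF convex_closed_segment ab'(1,2,4,3)] by blast
 then show False using h by blast
qed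

end

lemma minus_ln_one_minus_le:
 assumes "0 < (t :: real)" "t \<le> 1 / 2"
 shows "- ln (1 - t) \<le> 2 * t"
proof -
 have "ln (inverse (1 - t)) \<le> inverse (1 - t) - 1" using assms by (intro ln_le_minus_one) auto
 also have "\<dots> = t / (1 - t)" using assms by (simp add: field_simps)
 also have "\<dots> \<le> t / (1 / 2)" using assms by (intro divide_left_mono) auto
 finally show ?thesis using assms by (simp add: ln_inverse)
qed

text \<open>With these weights, naming a depth d costs only about 2 ln d.\<close>

lemma sum_inverse_triangular_le: "(\<Sum>d<B. 1 / (real (d + 1) * real (d + 2))) \<le> 1"
proof -
 have "(\<Sum>d<B. 1 / (real (d + 1) * real (d + 2))) = 1 - 1 / real (B + 1)"
 proof (induction B)
  case (Suc B)
  have "1 / (real (B + 1) * real (B + 2)) = 1 / real (B + 1) - 1 / real (B + 2)" by (simp add: field_simps)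
  then show ?case using Suc by simp
 qed simp
 then show ?thesis by simp
qed

text \<open>Price of one time step, freed from integer depths and from truncation: the logarithm of
  the number of grid cells that the current piece can meet, the constant \<open>K\<close>, and 2 ln
  (a + 2) for naming the depth. Contractions between \<open>a1\<close> and \<open>a0\<close> are
  charged the full cell count, without credit for a small piece.\<close>

definition orbit_cost :: "real \<Rightarrow> real \<Rightarrow> real \<Rightarrow> real \<Rightarrow> real \<Rightarrow> real \<Rightarrow> (nat \<Rightarrow> real) \<Rightarrow> nat \<Rightarrow> real" where
 "orbit_cost \<sigma> \<gamma> a1 a0 \<kappa> K a l = (if a1 \<le> a l then
   (if a0 \<le> a l then max 0 ((a l - 1) / \<sigma> - deficit \<sigma> \<gamma> a1 a0 a l) + 1 / \<sigma> else a l / \<sigma>) + K + 2 * ln (a l + 2)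
  else 2 * \<kappa>)"

context one_dim_system
begin

lemma finite_floor_u:
 assumes S: "S \<subseteq> X" and c: "c > 0"
 shows "finite ((\<lambda>x. \<lfloor>u l x / c\<rfloor>) ` S)"
proof (cases "S = {}")
 case False
 obtain B where B: "\<And>x. x \<in> X \<Longrightarrow> \<bar>u l x\<bar> \<le> B" using u_bounded by blast
 show ?thesis
 proof (rule card_floor_image_le(1)[where d = "2 * B", OF False _ c])
  fix x y assume "x \<in> S" "y \<in> S"
  then have "\<bar>u l x\<bar> \<le> B" "\<bar>u l y\<bar> \<le> B" using B S by auto
  then show "\<bar>u l x - u l y\<bar> \<le> 2 * B" by linarith
 qed
qed simp

lemma simple_floor_u:
 assumes "c > 0"
 shows "simple_function M (\<lambda>x. \<lfloor>u l x / c\<rfloor>)"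
proof (rule simple_function_of_finite_range)
 show "finite ((\<lambda>x. \<lfloor>u l x / c\<rfloor>) ` space M)" unfolding space_M using assms by (intro finite_floor_u) auto
qed measurable

lemma ent_floor_u:
 assumes c: "c > 0"
 shows "ent M (\<lambda>x. \<lfloor>u 0 x / c\<rfloor>) \<le> ln (2 / c + 2)"
proof -
 let ?F = "(\<lambda>x. \<lfloor>u 0 x / c\<rfloor>) ` space M"
 have b: "\<bar>u 0 x - u 0 y\<bar> \<le> 2" if "x \<in> space M" "y \<in> space M" for x y
  using coordinate(3)[of x I] coordinate(3)[of y I] that unfolding space_M u_def by simp
 have fin: "finite ?F" and card: "real (card ?F) \<le> 2 / c + 2" using card_floor_image_le[OF not_empty b c] by auto
 have "card ?F > 0" using fin not_empty by (simp add: card_gt_0_iff)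
 then have "ln (real (card ?F)) \<le> ln (2 / c + 2)" using card by (subst ln_le_cancel_iff) auto
 then show ?thesis using ent_le_ln_card[OF simple_floor_u[OF c] order_refl fin] by linarith
qed

end

text \<open>The 4 comes from the cell count, the square of N1 + 1 from the pair of cluster indices,
  and \<gamma> / 2 is the weight given to critical times.\<close>

definition "code_const \<gamma> N1 = ln 4 + 2 * ln (real N1 + 1) - ln (\<gamma> / 2)"

lemma code_const_nonneg:
 assumes "0 < \<gamma>" "\<gamma> \<le> 1"
 shows "code_const \<gamma> N1 \<ge> 0"
proof -
 have "ln (\<gamma> / 2) \<le> 0" "0 \<le> ln (4 :: real)" "0 \<le> ln (real N1 + 1)" using assms by auto
 then show ?thesis unfolding code_const_def by linarith
qed

definition bounded_distortion :: "real set \<Rightarrow> real \<Rightarrow> real \<Rightarrow> real \<Rightarrow> (real \<Rightarrow> real) \<Rightarrow> bool" where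
 "bounded_distortion D \<delta> a \<gamma> h \<longleftrightarrow> (\<forall>s\<in>D. \<forall>t\<in>D. \<bar>s - t\<bar> \<le> \<delta> \<longrightarrow> exp (- a) < \<bar>h s\<bar> \<longrightarrow>
  0 < \<bar>h t\<bar> \<and> \<bar>h t\<bar> \<le> exp \<gamma> * \<bar>h s\<bar>)"

text \<open>The bound \<epsilon> exp (R1 + 2) \<le> 1 / 4 ensures that a piece of size \<epsilon>,
  even after one more step, is so short that distances on the line are dominated by distances in the
  space.\<close>

locale coding_system = one_dim_system +
 fixes \<epsilon> \<gamma> a1 a0 R1 :: real and N1 :: nat and i1 i2 :: "nat \<Rightarrow> int \<Rightarrow> real \<Rightarrow> nat"
 assumes \<epsilon>: "\<epsilon> > 0" "\<epsilon> * exp (R1 + 2) \<le> 1 / 4" and \<gamma>: "0 < \<gamma>" "\<gamma> \<le> 1"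
  and a10: "2 \<le> a1" "a1 \<le> a0" "2 < a0"
  and R1: "R1 \<ge> 0" "\<And>x. x \<in> X \<Longrightarrow> \<bar>map_deriv I g x\<bar> \<le> exp R1"
  and distortion: "bounded_distortion D \<epsilon> a1 \<gamma> h"
  and clusters: "separates_clusters D \<epsilon> (r - 1) h N1 i1 i2"
begin

abbreviation "orbit_deficit l x \<equiv> deficit (r - 1) \<gamma> a1 a0 (\<lambda>l. contraction l x) l"

definition "\<kappa> = \<gamma> / 2"

lemma \<kappa>: "0 < \<kappa>" "\<kappa> \<le> 1 / 2" using \<gamma> by (auto simp: \<kappa>_def)

lemma h_bound: "t \<in> D \<Longrightarrow> \<bar>h t\<bar> \<le> exp R1" using R1(2)[OF param_in_points[of t I]] map_deriv_param[OF g r, of t] by simp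

lemma cluster_mono: "mono (i1 d j)" "mono (i2 d j)" and cluster_le: "i1 d j x \<le> N1" "i2 d j x \<le> N1"
 using clusters by (auto simp: separates_clusters_def)

lemma cluster:
 assumes "x \<in> D" "y \<in> D" "x \<le> z" "z \<le> y"
  "\<lfloor>x / (\<epsilon> * exp (- real d / (r - 1)))\<rfloor> = j" "\<lfloor>y / (\<epsilon> * exp (- real d / (r - 1)))\<rfloor> = j"
  "exp (- real d - 1) \<le> \<bar>h x\<bar>" "\<bar>h x\<bar> \<le> exp (- real d)" "i1 d j x = i1 d j y" "i2 d j x = i2 d j y"
 shows "exp (- real d - 2) < \<bar>h z\<bar> \<and> \<bar>h z\<bar> < exp (- real d + 1)"
 by (rule clusters[unfolded separates_clusters_def, THEN conjunct2, THEN conjunct2, rule_format, OF assms])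

text \<open>
 At depth \<open>d\<close> the mesh \<open>\<epsilon> exp (- d / (r - 1))\<close> is the scale on which the bound on the \<open>C\<^sup>r\<close> norm
 prevents a derivative of size \<open>exp (- d)\<close> from oscillating more than a bounded number of times.
\<close>

context
 fixes A n :: nat
begin

definition "sdef l x = orbit_deficit l x"
text \<open>Truncation at depth \<open>A\<close> up to time \<open>n\<close> leaves finitely many
  codes. The orbits that are excluded will be few once \<open>A\<close> is large, and they are given
  up.\<close>

definition "shallow_orbits = {x\<in>X. \<forall>l<n. exp (- real A) \<le> \<bar>map_deriv I g ((g ^^ l) x)\<bar>}"
definition "\<rho> d = \<epsilon> * exp (- real d / (r - 1))"
definition "critical l x \<longleftrightarrow> a1 \<le> contraction l x"
definition "depth l x = nat \<lfloor>contraction l x\<rfloor>"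
definition "cell l x = \<lfloor>u l x / \<rho> (depth l x)\<rfloor>"
text \<open>Noncritical times record nothing, since bounded distortion does the work there; the
  orbits that are given up record nothing at all.\<close>

definition "code l x = (if x \<in> shallow_orbits \<and> critical l x
  then Some (depth l x, cell l x, i1 (depth l x) (cell l x) (u l x), i2 (depth l x) (cell l x) (u l x)) else None)"
definition "code_cost l x = (if x \<notin> shallow_orbits then 0 else if critical l x
  then max 0 (real (depth l x) / (r - 1) - sdef l x) + ln 4 + 2 * ln (real N1 + 1) - ln \<kappa>
   + ln (real (depth l x + 1) * real (depth l x + 2))
  else 2 * \<kappa>)"
lemma \<rho>_pos: "\<rho> d > 0" using \<epsilon> by (simp add: \<rho>_def)

lemma sdef_nonneg: "sdef l x \<ge> 0" unfolding sdef_def using a10 by (intro deficit_nonneg) auto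

lemma shallow_orbitsD:
 assumes x: "x \<in> shallow_orbits" and l: "l < n"
 shows "x \<in> X" "h (u l x) \<noteq> 0" "\<bar>h (u l x)\<bar> = exp (- contraction l x)" "contraction l x \<le> real A"
proof -
 show xX: "x \<in> X" using x by (simp add: shallow_orbits_def)
 have hu: "h (u l x) = map_deriv I g ((g ^^ l) x)" using xX by (rule h_u)
 have ge: "exp (- real A) \<le> \<bar>h (u l x)\<bar>" using x l by (simp add: shallow_orbits_def hu)
 then have pos: "\<bar>h (u l x)\<bar> > 0" using exp_gt_zero[of "- real A"] by linarith
 then show "h (u l x) \<noteq> 0" by simp
 show eq: "\<bar>h (u l x)\<bar> = exp (- contraction l x)" using pos by (simp add: contraction_def hu)
 show "contraction l x \<le> real A" using ge unfolding eq by simp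
qed

lemma shallow_orbits_subset: "shallow_orbits \<subseteq> X" by (auto simp: shallow_orbits_def)

lemma shallow_orbits_sets [measurable]: "shallow_orbits \<in> sets M"
proof -
 have "shallow_orbits = {x\<in>space M. \<forall>l\<in>{..<n}. exp (- real A) \<le> \<bar>map_deriv I g ((g ^^ l) x)\<bar>}"
  unfolding shallow_orbits_def space_M by auto
 also have "\<dots> \<in> sets M" by measurable
 finally show ?thesis .
qed

lemma depth_bounds:
 assumes "critical l x"
 shows "real (depth l x) \<le> contraction l x" "contraction l x < real (depth l x) + 1"
proof -
 have "contraction l x \<ge> 2" using assms a10 by (simp add: critical_def)
 then have "real (depth l x) = real_of_int \<lfloor>contraction l x\<rfloor>" by (simp add: depth_def)
 then show "real (depth l x) \<le> contraction l x" "contraction l x < real (depth l x) + 1" by linarith+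
qed

text \<open>The code must control the whole segment between two lifted points, not only its ends:
  absence of critical points gives monotone iterates, and the upper bound on the derivative gives
  the size of the next piece. At critical times the loss exp 2 comes from rounding the contraction
  to an integer depth and from the width of a cluster.\<close>

lemma code_segment:
 assumes x: "x \<in> shallow_orbits" and y: "y \<in> shallow_orbits" and l: "l < n"
  and code: "code l x = code l y" and close: "\<bar>u l x - u l y\<bar> \<le> \<epsilon>"
  and z: "z \<in> closed_segment (u l x) (u l y)"
 shows "h z \<noteq> 0" "\<bar>h z\<bar> \<le> (if critical l x then exp (2 - contraction l x) else exp (\<gamma> - contraction l x))"
  and "critical l x \<longleftrightarrow> critical l y"
proof -
 have X: "x \<in> X" "y \<in> X" using shallow_orbitsD(1)[OF x l] shallow_orbitsD(1)[OF y l] .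
 have D: "u l x \<in> D" "u l y \<in> D" using X u_in by auto
 have zD: "z \<in> D" using z closed_segment_subset[OF D convex_D] by blast
 show cr: "critical l x \<longleftrightarrow> critical l y" using code x y by (auto simp: code_def split: if_splits)
 have "h z \<noteq> 0 \<and> \<bar>h z\<bar> \<le> (if critical l x then exp (2 - contraction l x) else exp (\<gamma> - contraction l x))"
 proof (cases "critical l x")
  case False
  have "\<bar>u l x - z\<bar> \<le> \<epsilon>" using z close by (auto simp: closed_segment_eq_real_ivl split: if_splits)
  moreover have "exp (- a1) < \<bar>h (u l x)\<bar>" unfolding shallow_orbitsD(3)[OF x l] using False by (simp add: critical_def)
  ultimately have "0 < \<bar>h z\<bar> \<and> \<bar>h z\<bar> \<le> exp \<gamma> * \<bar>h (u l x)\<bar>" using distortion D zD unfolding bounded_distortion_def by blast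
  then show ?thesis using False unfolding shallow_orbitsD(3)[OF x l] by (simp add: exp_add[symmetric])
 next
  case True
  define d j where "d = depth l x" and "j = cell l x"
  have eq: "depth l y = d" "cell l y = j" "i1 d j (u l x) = i1 d j (u l y)" "i2 d j (u l x) = i2 d j (u l y)"
   using code x y True cr by (auto simp: code_def d_def j_def)
  have fl: "\<lfloor>u l x / (\<epsilon> * exp (- real d / (r - 1)))\<rfloor> = j" "\<lfloor>u l y / (\<epsilon> * exp (- real d / (r - 1)))\<rfloor> = j"
   using eq by (auto simp: cell_def \<rho>_def d_def j_def)
  have hx: "exp (- real d - 1) \<le> \<bar>h (u l x)\<bar>" "\<bar>h (u l x)\<bar> \<le> exp (- real d)"
   using depth_bounds[OF True] unfolding shallow_orbitsD(3)[OF x l] d_def by auto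
  have "critical l y" using True cr by simp
  then have hy: "exp (- real d - 1) \<le> \<bar>h (u l y)\<bar>" "\<bar>h (u l y)\<bar> \<le> exp (- real d)"
   using depth_bounds[of l y] eq(1) unfolding shallow_orbitsD(3)[OF y l] by auto
  have "exp (- real d - 2) < \<bar>h z\<bar> \<and> \<bar>h z\<bar> < exp (- real d + 1)"
  proof (cases "u l x \<le> u l y")
   \<comment> \<open>The cluster property starts from the left end of the segment, so the order of
     the two points decides which of them supplies the hypotheses.\<close>
   case True
   then show ?thesis using z cluster[OF D(1,2) _ _ fl hx eq(3,4)] by (auto simp: closed_segment_eq_real_ivl)
  next
   case False
   then show ?thesis using z cluster[OF D(2,1) _ _ fl(2,1) hy eq(3,4)[symmetric]] by (auto simp: closed_segment_eq_real_ivl)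
  qed
  moreover have "exp (- real d + 1) \<le> exp (2 - contraction l x)" using depth_bounds[OF True] by (simp add: d_def)
  moreover note exp_gt_zero[of "- real d - 2"]
  ultimately show ?thesis using True by (auto simp del: exp_le_cancel_iff exp_less_cancel_iff)
 qed
 then show "h z \<noteq> 0" "\<bar>h z\<bar> \<le> (if critical l x then exp (2 - contraction l x) else exp (\<gamma> - contraction l x))" by auto
qed

lemma finite_cells: "S \<subseteq> X \<Longrightarrow> finite ((\<lambda>x. \<lfloor>u l x / \<rho> d\<rfloor>) ` S)" using \<rho>_pos by (rule finite_floor_u[rotated])

lemma depth_le:
 assumes "x \<in> shallow_orbits" "l < n" "critical l x"
 shows "depth l x \<le> A" using depth_bounds(1)[OF assms(3)] shallow_orbitsD(4)[OF assms(1,2)] by linarith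

lemma simple_code:
 assumes l: "l < n"
 shows "simple_function M (code l)"
proof -
 have [measurable]: "depth l \<in> measurable M (count_space UNIV)" unfolding depth_def [abs_def] by measurable
 have [measurable]: "cell l \<in> measurable M (count_space UNIV)" unfolding cell_def [abs_def] \<rho>_def by measurable
 have [measurable]: "i1 d j \<in> measurable borel (count_space UNIV)" "i2 d j \<in> measurable borel (count_space UNIV)" for d j
  using cluster_mono by (auto intro: mono_nat_measurable)
 have [measurable]: "(\<lambda>x. i1 (depth l x) (cell l x) (u l x)) \<in> measurable M (count_space UNIV)"
  by (rule measurable_compose_countable[where g = "depth l"], rule measurable_compose_countable[where g = "cell l"]) measurable
 have [measurable]: "(\<lambda>x. i2 (depth l x) (cell l x) (u l x)) \<in> measurable M (count_space UNIV)"
  by (rule measurable_compose_countable[where g = "depth l"], rule measurable_compose_countable[where g = "cell l"]) measurable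
 define P where "P x \<longleftrightarrow> x \<in> shallow_orbits \<and> critical l x" for x
 have [measurable]: "Measurable.pred M P" unfolding P_def critical_def by measurable
 have sP: "simple_function M P" by (rule simple_function_of_finite_range) auto
 have s1: "simple_function M (\<lambda>x. if P x then depth l x else 0)"
 proof (rule simple_function_of_finite_range)
  have "(\<lambda>x. if P x then depth l x else 0) ` space M \<subseteq> {..A}" using depth_le l by (auto simp: P_def)
  then show "finite ((\<lambda>x. if P x then depth l x else 0) ` space M)" by (rule finite_subset) simp
 qed measurable
 have s2: "simple_function M (\<lambda>x. if P x then cell l x else 0)"
 proof (rule simple_function_of_finite_range)
  have "(\<lambda>x. if P x then cell l x else 0) ` space M \<subseteq> insert 0 (\<Union>d\<le>A. (\<lambda>x. \<lfloor>u l x / \<rho> d\<rfloor>) ` X)"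
   using depth_le[OF _ l] space_M by (auto simp: P_def cell_def)
  then show "finite ((\<lambda>x. if P x then cell l x else 0) ` space M)"
   by (rule finite_subset) (use finite_cells[of X] in auto)
 qed measurable
 have s3: "simple_function M (\<lambda>x. if P x then i1 (depth l x) (cell l x) (u l x) else 0)"
 proof (rule simple_function_of_finite_range)
  have "(\<lambda>x. if P x then i1 (depth l x) (cell l x) (u l x) else 0) ` space M \<subseteq> {..N1}" using cluster_le by auto
  then show "finite ((\<lambda>x. if P x then i1 (depth l x) (cell l x) (u l x) else 0) ` space M)" by (rule finite_subset) simp
 qed measurable
 have s4: "simple_function M (\<lambda>x. if P x then i2 (depth l x) (cell l x) (u l x) else 0)"
 proof (rule simple_function_of_finite_range)
  have "(\<lambda>x. if P x then i2 (depth l x) (cell l x) (u l x) else 0) ` space M \<subseteq> {..N1}" using cluster_le by auto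
  then show "finite ((\<lambda>x. if P x then i2 (depth l x) (cell l x) (u l x) else 0) ` space M)" by (rule finite_subset) simp
 qed measurable
 show ?thesis by (rule simple_function_kernel[OF simple_function_Pair[OF simple_function_Pair[OF simple_function_Pair[OF
   simple_function_Pair[OF sP s1] s2] s3] s4]]) (auto simp: code_def P_def split: if_splits)
qed

lemma sdef_measurable [measurable]: "sdef l \<in> borel_measurable M" unfolding sdef_def [abs_def] by measurable

lemma integrable_code_cost:
 assumes l: "l < n"
 shows "integrable M (code_cost l)"
proof (rule bounded_integrable)
 show "code_cost l \<in> borel_measurable M" unfolding code_cost_def [abs_def] critical_def depth_def by measurable
 define B where "B = real A / (r - 1) + ln 4 + 2 * ln (real N1 + 1) - ln \<kappa> + ln (real (A + 1) * real (A + 2)) + 2 * \<kappa>"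
 fix x assume "x \<in> space M"
 have lk: "ln \<kappa> \<le> 0" using \<kappa> by simp
 have B1: "0 \<le> real A / (r - 1)" "0 \<le> ln (4 :: real)" "0 \<le> ln (real N1 + 1)" "0 \<le> ln (real (A + 1) * real (A + 2))"
  using r by (auto intro!: ln_ge_zero simp: algebra_simps)
 show "\<bar>code_cost l x\<bar> \<le> B"
 proof (cases "x \<in> shallow_orbits \<and> critical l x")
  case True
  then have dA: "depth l x \<le> A" using depth_le l by blast
  have "real (depth l x) / (r - 1) - sdef l x \<le> real A / (r - 1)"
   using dA r sdef_nonneg[of l x] divide_right_mono[of "real (depth l x)" "real A" "r - 1"] by auto
  moreover have "ln (real (depth l x + 1) * real (depth l x + 2)) \<le> ln (real (A + 1) * real (A + 2))"
   using dA by (subst ln_le_cancel_iff) (auto intro!: mult_mono simp del: of_nat_add of_nat_Suc)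
  moreover have "0 \<le> ln (real (depth l x + 1) * real (depth l x + 2))" by (intro ln_ge_zero) (auto simp: algebra_simps)
  moreover have "code_cost l x = max 0 (real (depth l x) / (r - 1) - sdef l x) + ln 4 + 2 * ln (real N1 + 1) - ln \<kappa>
    + ln (real (depth l x + 1) * real (depth l x + 2))" using True by (simp only: code_cost_def if_True if_False simp_thms)
  ultimately show ?thesis using B1 lk \<kappa> unfolding B_def by linarith
 next
  case False
  then have "0 \<le> code_cost l x" "code_cost l x \<le> 2 * \<kappa>" using \<kappa> by (auto simp: code_cost_def)
  then show ?thesis using B1 lk \<kappa> unfolding B_def abs_le_iff by linarith
 qed
qed

text \<open>The integer depth is at most the contraction \<open>a\<close>; the summand 1 / (r - 1)
  compensates for the a - 1 that appears in the deficit.\<close>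

lemma code_cost_le_orbit_cost:
 assumes x: "x \<in> X" and l: "l < n"
 shows "code_cost l x \<le> orbit_cost (r - 1) \<gamma> a1 a0 (\<gamma> / 2) (code_const \<gamma> N1) (\<lambda>l. contraction l x) l"
proof -
 define K where "K = ln 4 + 2 * ln (real N1 + 1) - ln \<kappa>"
 define a where "a = contraction l x"
 have K0: "K \<ge> 0"
 proof -
  have "ln \<kappa> \<le> 0" "0 \<le> ln (4 :: real)" "0 \<le> ln (real N1 + 1)" using \<kappa> by auto
  then show ?thesis unfolding K_def by linarith
 qed
 have s0: "sdef l x \<ge> 0" by (rule sdef_nonneg)
 have oc: "orbit_cost (r - 1) \<gamma> a1 a0 \<kappa> K (\<lambda>l. contraction l x) l =
  (if a1 \<le> a then (if a0 \<le> a then max 0 ((a - 1) / (r - 1) - sdef l x) + 1 / (r - 1) else a / (r - 1)) + K + 2 * ln (a + 2) else 2 * \<kappa>)"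
  by (simp add: orbit_cost_def a_def sdef_def)
 have "code_cost l x \<le> orbit_cost (r - 1) \<gamma> a1 a0 \<kappa> K (\<lambda>l. contraction l x) l"
 proof (cases "a1 \<le> a")
  case False
  then show ?thesis using oc \<kappa> by (auto simp: code_cost_def critical_def a_def)
 next
  case True
  then have a2: "a \<ge> 2" using a10 by simp
  have crit: "critical l x" using True by (simp add: critical_def a_def)
  define d where "d = real (depth l x)"
  have d: "d \<le> a" "0 \<le> d" using depth_bounds[OF crit] by (auto simp: d_def a_def)
  have dr: "d / (r - 1) \<le> a / (r - 1)" using d r by (intro divide_right_mono) auto
  have ar: "a / (r - 1) = (a - 1) / (r - 1) + 1 / (r - 1)" by (simp add: add_divide_distrib[symmetric])
  have ar0: "0 \<le> a / (r - 1)" "0 \<le> 1 / (r - 1)" using a2 r by auto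
  have ln0: "0 \<le> ln (a + 2)" using a2 by simp
  have "(d + 1) * (d + 2) \<le> (a + 2) * (a + 2)" using d by (intro mult_mono) auto
  then have "ln ((d + 1) * (d + 2)) \<le> ln ((a + 2) * (a + 2))" using d by (subst ln_le_cancel_iff) (auto intro!: mult_pos_pos)
  also have "\<dots> = 2 * ln (a + 2)" using a2 by (simp add: ln_mult)
  finally have lnd: "ln ((d + 1) * (d + 2)) \<le> 2 * ln (a + 2)" .
  have "code_cost l x \<le> max 0 (d / (r - 1) - sdef l x) + K + 2 * ln (a + 2)"
  proof (cases "x \<in> shallow_orbits")
   case True
   then have "code_cost l x = max 0 (d / (r - 1) - sdef l x) + K + ln ((d + 1) * (d + 2))"
    using crit by (simp add: code_cost_def K_def d_def add.commute)
   then show ?thesis using lnd by linarith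
  next
   case False
   then show ?thesis using K0 ln0 by (simp add: code_cost_def)
  qed
  moreover have "max 0 (d / (r - 1) - sdef l x) \<le> (if a0 \<le> a then max 0 ((a - 1) / (r - 1) - sdef l x) + 1 / (r - 1) else a / (r - 1))"
   using dr ar ar0 s0 by auto
  ultimately show ?thesis using oc True by auto
 qed
 then show ?thesis by (simp only: K_def \<kappa>_def code_const_def)
qed

text \<open>An abstract description of the good times: \<open>W\<close> must keep orbits
  \<epsilon>-close in the space whenever the deficit is 0. It will be a list of Bowen balls in one
  application and an itinerary in another.\<close>

context
 fixes W :: "complex \<Rightarrow> 'w"
 assumes W: "simple_function M W"
  and W_close: "\<And>x y l. x \<in> X \<Longrightarrow> y \<in> X \<Longrightarrow> W x = W y \<Longrightarrow> l \<le> n \<Longrightarrow> orbit_deficit l x = 0 \<Longrightarrow>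
   dist ((g ^^ l) x) ((g ^^ l) y) \<le> \<epsilon>"
begin

text \<open>\<open>W\<close> controls distances in the space only; the grid cell makes the starting
  coordinates on the line \<epsilon>-close too.\<close>

definition "code0 x = (x \<in> shallow_orbits, W x, \<lfloor>u 0 x / \<epsilon>\<rfloor>)"
abbreviation "past \<equiv> hist code0 code"
abbreviation "fibre l x \<equiv> past l -` {past l x} \<inter> space M"

lemma simple_code0: "simple_function M code0" unfolding code0_def [abs_def]
proof (intro simple_function_Pair)
 show "simple_function M (\<lambda>x. x \<in> shallow_orbits)" by (rule simple_function_mem) measurable
 show "simple_function M W" by (rule W)
 show "simple_function M (\<lambda>x. \<lfloor>u 0 x / \<epsilon>\<rfloor>)" using \<epsilon>(1) by (rule simple_floor_u)
qed

text \<open>This is the meaning of the recursion for the deficit. A deep contraction puts both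
  points into one grid cell, of size \<epsilon> exp (- (a - 1) / (r - 1)), and then multiplies by at
  most exp (2 - a). At other times the distance is multiplied by the derivative with its distortion,
  exp 2 or exp \<gamma>. When the deficit is 0, \<open>W\<close> resets the size to
  \<epsilon>.\<close>

lemma code_size:
 assumes x: "x \<in> shallow_orbits" and y: "y \<in> shallow_orbits" and l: "l \<le> n"
  and code: "past l x = past l y"
 shows "\<bar>u l x - u l y\<bar> \<le> \<epsilon> * exp (- sdef l x)" using l code
proof (induction l)
 case 0
 have "\<lfloor>u 0 x / \<epsilon>\<rfloor> = \<lfloor>u 0 y / \<epsilon>\<rfloor>" using 0 by (auto simp: hist_eq_iff code0_def)
 then have "\<bar>u 0 x / \<epsilon> - u 0 y / \<epsilon>\<bar> \<le> 1" by linarith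
 then show ?case using \<epsilon> by (simp add: sdef_def field_simps abs_le_iff)
next
 case (Suc l)
 have l: "l < n" and lcode: "code l x = code l y" "past l x = past l y" using Suc.prems by (auto simp: hist_eq_iff)
 have X: "x \<in> X" "y \<in> X" using shallow_orbitsD(1)[OF x l] shallow_orbitsD(1)[OF y l] .
 have D: "u l x \<in> D" "u l y \<in> D" using X u_in by auto
 define s where "s = sdef l x"
 define a where "a = contraction l x"
 have s0: "s \<ge> 0" using sdef_nonneg by (simp add: s_def)
 have IH: "\<bar>u l x - u l y\<bar> \<le> \<epsilon> * exp (- s)" using Suc.IH lcode l by (simp add: s_def)
 also have "\<dots> \<le> \<epsilon> * 1" using \<epsilon> s0 by (intro mult_left_mono) auto
 finally have close: "\<bar>u l x - u l y\<bar> \<le> \<epsilon>" by simp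
 note seg = code_segment[OF x y l lcode(1) close]
 define \<tau> where "\<tau> = (if critical l x then 2 else \<gamma>)"
 have step: "\<bar>u (Suc l) x - u (Suc l) y\<bar> \<le> exp (\<tau> - a) * \<bar>u l x - u l y\<bar>"
  unfolding u_Suc using D seg(2) by (intro mean_value_bound) (auto simp: \<tau>_def a_def)
 have aR: "- a \<le> R1"
 proof -
  have "exp (- a) \<le> exp R1" using h_bound[OF D(1)] unfolding a_def shallow_orbitsD(3)[OF x l, symmetric] .
  then show ?thesis by simp
 qed
 have W_eq: "W x = W y" using Suc.prems by (auto simp: hist_eq_iff code0_def)
 have sSuc: "sdef (Suc l) x = (if a \<ge> a0 then max s ((a - 1) / (r - 1)) + a - 2
   else if s = 0 then 0 else max 0 (s + a - \<tau>))" by (simp add: sdef_def s_def a_def \<tau>_def critical_def)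
 show ?case
 proof (cases "sdef (Suc l) x = 0")
  case True
  \<comment> \<open>The piece may have outgrown \<epsilon>, but its length is still at most 1 / 4.
    It cannot wrap around the circle, so the closeness in the space that \<open>W\<close> guarantees
    transfers to the line.\<close>
  have "\<tau> - a \<le> R1 + 2" using aR \<gamma> by (simp add: \<tau>_def)
  then have "\<bar>u (Suc l) x - u (Suc l) y\<bar> \<le> exp (R1 + 2) * \<epsilon>" using close by (intro order_trans[OF step] mult_mono) auto
  then have "\<bar>u (Suc l) x - u (Suc l) y\<bar> \<le> 1 / 4" using \<epsilon> by (simp add: mult.commute)
  then have "\<bar>u (Suc l) x - u (Suc l) y\<bar> \<le> dist (param I (u (Suc l) x)) (param I (u (Suc l) y))" by (rule le_dist_param)
  also have "\<dots> = dist ((g ^^ Suc l) x) ((g ^^ Suc l) y)" using X param_u by metis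
  also have "\<dots> \<le> \<epsilon>" using W_close[OF X W_eq, of "Suc l"] Suc.prems True unfolding sdef_def by blast
  finally show ?thesis using True by simp
 next
  case False
  show ?thesis
  proof (cases "a \<ge> a0")
   case True
   have crit: "critical l x" using True a10 by (simp add: critical_def a_def)
   then have critd: "real (depth l x) \<ge> a - 1" using depth_bounds by (fastforce simp: a_def)
   have "critical l y" using crit seg(3) by auto
   then have "cell l x = cell l y" "depth l x = depth l y" using lcode(1) x y crit by (auto simp: code_def)
   then have "\<lfloor>u l x / \<rho> (depth l x)\<rfloor> = \<lfloor>u l y / \<rho> (depth l x)\<rfloor>" by (simp add: cell_def)
   then have "\<bar>u l x / \<rho> (depth l x) - u l y / \<rho> (depth l x)\<bar> \<le> 1" by linarith
   then have "\<bar>u l x - u l y\<bar> \<le> \<rho> (depth l x)" using \<rho>_pos[of "depth l x"] by (simp add: field_simps abs_le_iff)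
   also have "\<dots> \<le> \<epsilon> * exp (- ((a - 1) / (r - 1)))"
    unfolding \<rho>_def using \<epsilon> critd r by (intro mult_left_mono) (auto simp: divide_right_mono)
   finally have "\<bar>u l x - u l y\<bar> \<le> \<epsilon> * exp (- max s ((a - 1) / (r - 1)))" using IH by (auto simp: max_def)
   then have "\<bar>u (Suc l) x - u (Suc l) y\<bar> \<le> exp (2 - a) * (\<epsilon> * exp (- max s ((a - 1) / (r - 1))))"
    using step crit by (intro order_trans[OF step] mult_mono) (auto simp: \<tau>_def)
   also have "\<dots> = \<epsilon> * exp (- sdef (Suc l) x)" unfolding sSuc using True by (simp add: exp_add[symmetric] algebra_simps)
   finally show ?thesis .
  next
   case not_deep: False
   then have "s \<noteq> 0" "s + a - \<tau> > 0" "sdef (Suc l) x = s + a - \<tau>" using False sSuc by (auto simp: max_def split: if_splits)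
   then have "exp (\<tau> - a) * exp (- s) = exp (- sdef (Suc l) x)" unfolding exp_add[symmetric] by simp
   then have "exp (\<tau> - a) * (\<epsilon> * exp (- s)) = \<epsilon> * exp (- sdef (Suc l) x)" by (metis mult.left_commute)
   moreover have "\<bar>u (Suc l) x - u (Suc l) y\<bar> \<le> exp (\<tau> - a) * (\<epsilon> * exp (- s))"
    using IH by (intro order_trans[OF step] mult_left_mono) auto
   ultimately show ?thesis by (simp only:)
  qed
 qed
qed

definition "cell_count l y d = card ((\<lambda>x. \<lfloor>u l x / \<rho> d\<rfloor>) ` {x\<in>shallow_orbits. past l x = y})"
text \<open>The kernel for Gibbs' inequality: mass 1 - \<kappa> for a noncritical time; \<kappa> is
  spread over the depths with summable weights and then uniformly over cluster indices and over the
  cells met by the current piece. An orbit that is given up has \<open>None\<close> as its only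
  code.\<close>

definition "weight l y z = (if fst (fst y) then
  (case z of None \<Rightarrow> 1 - \<kappa>
   | Some (d, j :: int, p :: nat, p' :: nat) \<Rightarrow> \<kappa> / (real (d + 1) * real (d + 2)) / (real N1 + 1)\<^sup>2 / real (cell_count l y d))
  else (case z of None \<Rightarrow> 1 | Some _ \<Rightarrow> 0))"
lemma fst_code0: "fst (fst (past l x)) \<longleftrightarrow> x \<in> shallow_orbits" by (simp add: hist_def code0_def)

text \<open>The points with the same past lie within 2 \<epsilon> exp (- deficit) of each other, so
  they meet at most 2 + 2 exp (d / (r - 1) - deficit) cells. A small piece makes the next
  contraction cheap.\<close>

lemma cell_count_bounds:
 assumes l: "l < n" and x: "x \<in> shallow_orbits"
 shows "cell_count l (past l x) d > 0"
  "real (cell_count l (past l x) d) \<le> 4 * exp (max 0 (real d / (r - 1) - sdef l x))"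
proof -
 let ?S = "{y\<in>shallow_orbits. past l y = past l x}"
 have xS: "x \<in> ?S" using x by simp
 have fin: "finite ((\<lambda>x. \<lfloor>u l x / \<rho> d\<rfloor>) ` ?S)" using shallow_orbits_subset by (intro finite_cells) auto
 then show "cell_count l (past l x) d > 0"
  using xS unfolding cell_count_def by (simp add: card_gt_0_iff) (use x in blast)
 have "\<bar>u l y - u l y'\<bar> \<le> 2 * \<epsilon> * exp (- sdef l x)" if "y \<in> ?S" "y' \<in> ?S" for y y'
 proof -
  have "\<bar>u l x - u l y\<bar> \<le> \<epsilon> * exp (- sdef l x)" "\<bar>u l x - u l y'\<bar> \<le> \<epsilon> * exp (- sdef l x)"
   using that x l by (auto intro!: code_size)
  then show ?thesis by linarith
 qed
 then have "real (cell_count l (past l x) d) \<le> 2 * \<epsilon> * exp (- sdef l x) / \<rho> d + 2"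
  unfolding cell_count_def using xS \<rho>_pos by (intro card_floor_image_le(2)) auto
 also have "2 * \<epsilon> * exp (- sdef l x) / \<rho> d = 2 * exp (real d / (r - 1) - sdef l x)"
  using \<epsilon>(1) by (simp add: \<rho>_def exp_diff exp_minus field_simps)
 also have "\<dots> \<le> 2 * exp (max 0 (real d / (r - 1) - sdef l x))" by simp
 finally show "real (cell_count l (past l x) d) \<le> 4 * exp (max 0 (real d / (r - 1) - sdef l x))"
  using one_le_exp_iff[of "max 0 (real d / (r - 1) - sdef l x)"] by linarith
qed

lemma weight_nonneg: "weight l y z \<ge> 0" using \<kappa> by (auto simp: weight_def split: option.split prod.split)

lemma weight_code:
 assumes l: "l < n"
 shows "weight l (past l x) (code l x) > 0"
  and "- ln (weight l (past l x) (code l x)) \<le> code_cost l x"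
proof -
 have "weight l (past l x) (code l x) > 0 \<and> - ln (weight l (past l x) (code l x)) \<le> code_cost l x"
 proof (cases "x \<in> shallow_orbits")
  case False
  then show ?thesis by (simp add: weight_def fst_code0 code_def code_cost_def)
 next
  case True
  show ?thesis
  proof (cases "critical l x")
   case False
   have "- ln (1 - \<kappa>) \<le> 2 * \<kappa>" using \<kappa> by (rule minus_ln_one_minus_le)
   then show ?thesis using True False \<kappa> by (simp add: weight_def fst_code0 code_def code_cost_def)
  next
   case crit: True
   define d where "d = depth l x"
   define c where "c = real (cell_count l (past l x) d)"
   have c: "c > 0" "c \<le> 4 * exp (max 0 (real d / (r - 1) - sdef l x))"
    using cell_count_bounds[OF l True, of d] by (auto simp: c_def)
   have w: "weight l (past l x) (code l x) = \<kappa> / (real (d + 1) * real (d + 2)) / (real N1 + 1)\<^sup>2 / c"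
    using True crit by (simp add: weight_def fst_code0 code_def d_def c_def)
   have "ln c \<le> ln (4 * exp (max 0 (real d / (r - 1) - sdef l x)))" using c by (subst ln_le_cancel_iff) auto
   also have "\<dots> = ln 4 + max 0 (real d / (r - 1) - sdef l x)" by (subst ln_mult) auto
   finally have lc: "ln c \<le> ln 4 + max 0 (real d / (r - 1) - sdef l x)" .
   have "ln (weight l (past l x) (code l x)) = ln \<kappa> - ln (real (d + 1) * real (d + 2)) - 2 * ln (real N1 + 1) - ln c"
   proof -
    define P Q where "P = real (d + 1) * real (d + 2)" and "Q = (real N1 + 1)\<^sup>2"
    have PQ: "P > 0" "Q > 0" by (auto simp: P_def Q_def)
    have "ln (\<kappa> / P / Q / c) = ln \<kappa> - ln P - ln Q - ln c" using PQ c(1) \<kappa> by (simp add: ln_div ln_mult)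
    moreover have "ln Q = 2 * ln (real N1 + 1)" by (simp add: Q_def ln_realpow)
    ultimately show ?thesis unfolding w P_def Q_def by simp
   qed
   moreover have "weight l (past l x) (code l x) > 0" unfolding w using c(1) \<kappa> by simp
   ultimately show ?thesis using lc True crit by (simp add: code_cost_def d_def)
  qed
 qed
 then show "weight l (past l x) (code l x) > 0"
  "- ln (weight l (past l x) (code l x)) \<le> code_cost l x" by auto
qed

lemma sum_weight_le:
 assumes l: "l < n" and x: "x \<in> space M"
 shows "(\<Sum>z\<in>code l ` (fibre l x). weight l (past l x) z) \<le> 1"
proof (cases "x \<in> shallow_orbits")
 case False
 have "code l ` (fibre l x) \<subseteq> {None}"
 proof (rule image_subsetI)
  fix y assume "y \<in> fibre l x"
  then have "past l y = past l x" by simp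
  then have "y \<notin> shallow_orbits" using False fst_code0 by metis
  then show "code l y \<in> {None}" by (simp add: code_def)
 qed
 then have "(\<Sum>z\<in>code l ` (fibre l x). weight l (past l x) z)
  \<le> (\<Sum>z\<in>{None}. weight l (past l x) z)" using weight_nonneg by (intro sum_mono2) auto
 also have "\<dots> = 1" using False by (simp add: weight_def fst_code0)
 finally show ?thesis .
next
 case True
 let ?y = "past l x"
 define J where "J d = (\<lambda>y. \<lfloor>u l y / \<rho> d\<rfloor>) ` {y\<in>shallow_orbits. past l y = ?y}" for d
 have finJ: "finite (J d)" for d unfolding J_def using shallow_orbits_subset by (intro finite_cells) auto
 have cJ: "card (J d) = cell_count l ?y d" for d by (simp add: J_def cell_count_def)
 let ?T = "SIGMA d:{..<Suc A}. J d \<times> {..N1} \<times> {..N1}"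
 have finT: "finite ?T" using finJ by auto
 have "code l ` (past l -` {?y} \<inter> space M) \<subseteq> insert None (Some ` ?T)"
 proof
  fix z assume "z \<in> code l ` (past l -` {?y} \<inter> space M)"
  then obtain y where y: "past l y = ?y" "z = code l y" by auto
  have ys: "y \<in> shallow_orbits" using y(1) True fst_code0 by metis
  then show "z \<in> insert None (Some ` ?T)" using depth_le[OF ys l] cluster_le y unfolding y(2)
   by (auto simp: code_def J_def cell_def less_Suc_eq_le)
 qed
 then have "(\<Sum>z\<in>code l ` (past l -` {?y} \<inter> space M). weight l ?y z) \<le> (\<Sum>z\<in>insert None (Some ` ?T). weight l ?y z)"
  using weight_nonneg finT by (intro sum_mono2) auto
 also have "\<dots> = (1 - \<kappa>) + (\<Sum>t\<in>?T. weight l ?y (Some t))"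
  using finT True by (subst sum.insert) (auto simp: sum.reindex weight_def fst_code0)
 also have "(\<Sum>t\<in>?T. weight l ?y (Some t)) = (\<Sum>d<Suc A. \<Sum>t\<in>J d \<times> {..N1} \<times> {..N1}. weight l ?y (Some (d, t)))"
  using finJ by (subst sum.Sigma) auto
 also have "\<dots> = (\<Sum>d<Suc A. \<kappa> * (1 / (real (d + 1) * real (d + 2))))"
 proof (rule sum.cong[OF refl])
  fix d
  have c: "real (cell_count l ?y d) > 0" using cell_count_bounds(1)[OF l True] by simp
  have "(\<Sum>t\<in>J d \<times> {..N1} \<times> {..N1}. weight l ?y (Some (d, t)))
   = (\<Sum>t\<in>J d \<times> {..N1} \<times> {..N1}. \<kappa> / (real (d + 1) * real (d + 2)) / (real N1 + 1)\<^sup>2 / real (cell_count l ?y d))"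
   using True by (intro sum.cong) (auto simp: weight_def fst_code0)
  also have "\<dots> = real (cell_count l ?y d) * (real N1 + 1)\<^sup>2 * (\<kappa> / (real (d + 1) * real (d + 2)) / (real N1 + 1)\<^sup>2 / real (cell_count l ?y d))"
  proof -
   have "real (card (J d \<times> {..N1} \<times> {..N1})) = real (cell_count l ?y d) * (real N1 + 1)\<^sup>2"
    unfolding card_cartesian_product cJ by (simp add: power2_eq_square algebra_simps)
   then show ?thesis by (simp only: sum_constant)
  qed
  also have "\<dots> = \<kappa> * (1 / (real (d + 1) * real (d + 2)))" using c by (simp del: of_nat_add of_nat_Suc)
  finally show "(\<Sum>t\<in>J d \<times> {..N1} \<times> {..N1}. weight l ?y (Some (d, t))) = \<kappa> * (1 / (real (d + 1) * real (d + 2)))" .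
 qed
 also have "\<dots> = \<kappa> * (\<Sum>d<Suc A. 1 / (real (d + 1) * real (d + 2)))" by (rule sum_distrib_left[symmetric])
 also have "\<dots> \<le> \<kappa> * 1" using \<kappa> by (intro mult_left_mono sum_inverse_triangular_le) auto
 finally show ?thesis by simp
qed

lemma ent_hist_code: "ent M (past n) \<le> ent M code0 + (\<Sum>l<n. \<integral>x. code_cost l x \<partial>M)"
proof -
 have "ent M (past n) \<le> ent M code0 + (\<Sum>l<n. \<integral>x. - ln (weight l (past l x) (code l x)) \<partial>M)"
  using simple_code0 simple_code weight_nonneg weight_code(1) sum_weight_le by (rule ent_hist)
 also have "(\<Sum>l<n. \<integral>x. - ln (weight l (past l x) (code l x)) \<partial>M) \<le> (\<Sum>l<n. \<integral>x. code_cost l x \<partial>M)"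
 proof (rule sum_mono)
  fix l assume "l \<in> {..<n}"
  then have l: "l < n" by simp
  have s: "simple_function M (\<lambda>x. (past l x, code l x))"
   using simple_code0 simple_code l by (intro simple_function_Pair simple_function_hist) auto
  show "(\<integral>x. - ln (weight l (past l x) (code l x)) \<partial>M) \<le> (\<integral>x. code_cost l x \<partial>M)"
   using integral_simple_function(1)[OF s, of "\<lambda>p. - ln (weight l (fst p) (snd p))"] integrable_code_cost[OF l] weight_code(2)[OF l]
   by (intro integral_mono) auto
 qed
 finally show ?thesis by simp
qed

lemma ent_code0: "ent M code0 \<le> ent M W + ln 2 + ln (2 / \<epsilon> + 2)"
proof -
 have s1: "simple_function M (\<lambda>x. x \<in> shallow_orbits)" by (rule simple_function_mem) measurable
 have s2: "simple_function M (\<lambda>x. \<lfloor>u 0 x / \<epsilon>\<rfloor>)" by (rule simple_function_kernel[OF simple_code0]) (simp add: code0_def)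
 have s3: "simple_function M (\<lambda>x. (W x, \<lfloor>u 0 x / \<epsilon>\<rfloor>))" using W s2 by (rule simple_function_Pair)
 have "ent M code0 \<le> ent M (\<lambda>x. x \<in> shallow_orbits) + ent M (\<lambda>x. (W x, \<lfloor>u 0 x / \<epsilon>\<rfloor>))"
  unfolding code0_def [abs_def] using s1 s3 by (rule ent_subadditive)
 also have "ent M (\<lambda>x. (W x, \<lfloor>u 0 x / \<epsilon>\<rfloor>)) \<le> ent M W + ent M (\<lambda>x. \<lfloor>u 0 x / \<epsilon>\<rfloor>)" using W s2 by (rule ent_subadditive)
 also have "ent M (\<lambda>x. x \<in> shallow_orbits) \<le> ln (real (card (UNIV :: bool set)))" using s1 by (rule ent_le_ln_card) auto
 also have "ent M (\<lambda>x. \<lfloor>u 0 x / \<epsilon>\<rfloor>) \<le> ln (2 / \<epsilon> + 2)" using \<epsilon>(1) by (rule ent_floor_u)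
 finally show ?thesis by simp
qed

text \<open>The derivative has no zero on any of the successive segments, so the iterates do not
  fold: points between two points with the same code remain between them.\<close>

lemma inj_on_segment:
 assumes x: "x \<in> shallow_orbits" and y: "y \<in> shallow_orbits" and l: "l \<le> n"
  and code: "past n x = past n y"
 shows "inj_on (G ^^ l) (closed_segment (u 0 x) (u 0 y)) \<and>
  (G ^^ l) ` closed_segment (u 0 x) (u 0 y) \<subseteq> closed_segment (u l x) (u l y)" using l
proof (induction l)
 case 0
 then show ?case by simp
next
 case (Suc l)
 then have l: "l < n" by simp
 have lcode: "code l x = code l y" "past l x = past l y" using code l by (auto simp: hist_eq_iff)
 have X: "x \<in> X" "y \<in> X" using shallow_orbitsD(1)[OF x l] shallow_orbitsD(1)[OF y l] .
 have D: "u l x \<in> D" "u l y \<in> D" using X u_in by auto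
 have "\<bar>u l x - u l y\<bar> \<le> \<epsilon> * exp (- sdef l x)" using code_size[OF x y _ lcode(2)] l by simp
 also have "\<dots> \<le> \<epsilon> * 1" using \<epsilon> sdef_nonneg by (intro mult_left_mono) auto
 finally have close: "\<bar>u l x - u l y\<bar> \<le> \<epsilon>" by simp
 have inj: "inj_on G (closed_segment (u l x) (u l y))"
  using D code_segment(1)[OF x y l lcode(1) close] by (rule injective_of_nonvanishing)
 have sub: "closed_segment (u l x) (u l y) \<subseteq> D" using convex_D D by (rule closed_segment_subset[rotated -1])
 have cont: "continuous_on (closed_segment (u l x) (u l y)) G"
  using lift sub by (auto simp: is_lift_def intro: continuous_on_subset)
 have IH: "inj_on (G ^^ l) (closed_segment (u 0 x) (u 0 y))"
  "(G ^^ l) ` closed_segment (u 0 x) (u 0 y) \<subseteq> closed_segment (u l x) (u l y)" using Suc by auto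
 have "inj_on (G \<circ> (G ^^ l)) (closed_segment (u 0 x) (u 0 y))"
  using IH inj by (intro comp_inj_on) (auto intro: inj_on_subset)
 moreover have "G ` closed_segment (u l x) (u l y) \<subseteq> closed_segment (u (Suc l) x) (u (Suc l) y)"
  unfolding u_Suc using continuous_injective_image_segment_1[OF cont inj] by simp
 ultimately show ?case using IH(2) by (auto simp: o_def)
qed

text \<open>Passage from the scale \<epsilon> to an arbitrary scale \<open>e\<close>. Within one
  code all iterates are monotone, so the vector of fine grid cells visited up to time
  \<open>n\<close> takes only linearly many values in \<open>n\<close>. The refinement costs a
  logarithm of \<open>n\<close>, nothing in the limit.\<close>

lemma fine_code:
 assumes e: "(e :: real) > 0"
 obtains F :: "complex \<Rightarrow> ((bool \<times> 'w \<times> int) \<times> (nat \<times> int \<times> nat \<times> nat) option list) \<times> int list" where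
  "simple_function M F"
  "\<And>x y i. x \<in> shallow_orbits \<Longrightarrow> y \<in> shallow_orbits \<Longrightarrow> F x = F y \<Longrightarrow> i < n \<Longrightarrow> dist ((g ^^ i) x) ((g ^^ i) y) < e"
  "ent M F \<le> ent M W + ln 2 + ln (2 / \<epsilon> + 2) + (\<Sum>l<n. \<integral>x. code_cost l x \<partial>M)
   + ln (real n * (7 * \<epsilon> / e + 2) + 1)"
proof -
 \<comment> \<open>7 exceeds 2 pi, the Lipschitz constant of \<open>param\<close>.\<close>
 define \<delta> where "\<delta> = e / 7"
 have \<delta>: "\<delta> > 0" using e by (simp add: \<delta>_def)
 define f where "f i x = \<lfloor>u i x / \<delta>\<rfloor>" for i x
 define V where "V x = (if x \<in> shallow_orbits then map (\<lambda>i. f i x) [0..<n] else [])" for x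
 have sf: "simple_function M (\<lambda>x. \<lfloor>u i x / \<delta>\<rfloor>)" for i using \<delta> by (rule simple_floor_u)
 have sV: "simple_function M V"
 proof -
  have "simple_function M (\<lambda>x. (x \<in> shallow_orbits, map (\<lambda>i. f i x) [0..<n]))"
   using simple_function_mem[OF shallow_orbits_sets] sf unfolding f_def
   by (intro simple_function_Pair simple_function_map)
  then show ?thesis by (rule simple_function_kernel) (auto simp: V_def)
 qed
 have sH: "simple_function M (past n)" using simple_code0 simple_code by (intro simple_function_hist)
 define m where "m = nat \<lceil>\<epsilon> / \<delta>\<rceil> + 1"
 have m: "real m \<le> \<epsilon> / \<delta> + 2" using \<epsilon> \<delta> unfolding m_def by (simp add: of_nat_nat) linarith
 have count: "card (V ` (fibre n x)) \<le> n * m + 1" if x: "x \<in> space M" for x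
 proof (cases "x \<in> shallow_orbits")
  case False
  have "V ` (fibre n x) \<subseteq> {[]}"
  proof (rule image_subsetI)
   fix y assume "y \<in> fibre n x"
   then have "past n y = past n x" by simp
   then have "y \<notin> shallow_orbits" using False fst_code0 by metis
   then show "V y \<in> {[]}" by (simp add: V_def)
  qed
  then have "card (V ` (fibre n x)) \<le> card {[] :: int list}" by (intro card_mono) auto
  then show ?thesis by simp
 next
  case True
  let ?S = "fibre n x"
  have S: "y \<in> shallow_orbits" if "y \<in> ?S" for y using that True fst_code0[of n y] fst_code0[of n x] by auto
  have close: "\<bar>u i y - u i z\<bar> \<le> \<epsilon>" if "y \<in> ?S" "z \<in> ?S" "i < n" for y z i
  proof -
   have "past i y = past i z" using that by (auto simp: hist_eq_iff)
   then have "\<bar>u i y - u i z\<bar> \<le> \<epsilon> * exp (- sdef i y)" using code_size[OF S[OF that(1)] S[OF that(2)]] that(3) by simp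
   also have "\<dots> \<le> \<epsilon> * 1" using \<epsilon> sdef_nonneg by (intro mult_left_mono) auto
   finally show ?thesis by simp
  qed
  have uG: "u i y = (G ^^ i) (u 0 y)" for i y by (simp add: u_def)
  have fdiff: "f i y - f i z \<le> int m" if yz: "y \<in> ?S" "z \<in> ?S" and "i < n" for i y z
  proof -
   have "u i y / \<delta> - u i z / \<delta> \<le> \<epsilon> / \<delta>"
    using close[OF yz \<open>i < n\<close>] \<delta> by (simp flip: diff_divide_distrib add: divide_right_mono abs_le_iff)
   then have "real_of_int (f i y - f i z) < \<epsilon> / \<delta> + 1" unfolding f_def by linarith
   also have "\<dots> \<le> real_of_int (\<lceil>\<epsilon> / \<delta>\<rceil> + 1)" by (simp add: le_of_int_ceiling)
   finally have "f i y - f i z < \<lceil>\<epsilon> / \<delta>\<rceil> + 1" unfolding of_int_less_iff .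
   then show ?thesis unfolding m_def by linarith
  qed
  show ?thesis
  proof (rule card_monotone_grid_vectors[where f = f and b = "u 0"])
   show "finite (V ` ?S)" using sV by (auto simp: simple_function_def intro: finite_subset[of _ "V ` space M"])
   show "V y = V z \<longleftrightarrow> (\<forall>i<n. f i y = f i z)" if "y \<in> ?S" "z \<in> ?S" for y z
    using S[OF that(1)] S[OF that(2)] by (auto simp: V_def)
   show "V y = V z" if "y \<in> ?S" "z \<in> ?S" "u 0 y = u 0 z" for y z
   proof -
    have "u i y = u i z" for i using uG[of i y] uG[of i z] that(3) by simp
    then show ?thesis using S[OF that(1)] S[OF that(2)] by (auto simp: V_def f_def)
   qed
   show "\<bar>f i y - f i z\<bar> \<le> int m" if "y \<in> ?S" "z \<in> ?S" "i < n" for i y z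
    using fdiff[OF that] fdiff[OF that(2,1,3)] by linarith
   fix y z w i assume yzw: "y \<in> ?S" "z \<in> ?S" "w \<in> ?S" "i < n" "u 0 y \<le> u 0 z" "u 0 z \<le> u 0 w"
   have "past n y = past n w" using yzw by auto
   then have "(G ^^ i) ` closed_segment (u 0 y) (u 0 w) \<subseteq> closed_segment (u i y) (u i w)"
    using inj_on_segment[OF S[OF yzw(1)] S[OF yzw(3)], of i] yzw(4) by simp
   moreover have "u 0 z \<in> closed_segment (u 0 y) (u 0 w)" using yzw by (simp add: closed_segment_eq_real_ivl)
   ultimately have "u i z \<in> closed_segment (u i y) (u i w)" unfolding uG[of i z] by blast
   then have "(u i y \<le> u i z \<and> u i z \<le> u i w) \<or> (u i w \<le> u i z \<and> u i z \<le> u i y)"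
    by (auto simp: closed_segment_eq_real_ivl split: if_splits)
   then show "(f i y \<le> f i z \<and> f i z \<le> f i w) \<or> (f i w \<le> f i z \<and> f i z \<le> f i y)"
    unfolding f_def using \<delta> by (auto intro!: floor_mono divide_right_mono)
  qed
 qed
 define F where "F x = (past n x, V x)" for x
 show ?thesis
 proof (rule that[of F])
  show "simple_function M F" unfolding F_def [abs_def] using sH sV by (rule simple_function_Pair)
  show "dist ((g ^^ i) x) ((g ^^ i) y) < e" if xy: "x \<in> shallow_orbits" "y \<in> shallow_orbits" "F x = F y" "i < n" for x y i
  proof -
   have X: "x \<in> X" "y \<in> X" using xy shallow_orbits_subset by auto
   have "f i x = f i y" using xy by (auto simp: F_def V_def)
   then have "\<bar>u i x / \<delta> - u i y / \<delta>\<bar> < 1" unfolding f_def by linarith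
   then have d: "\<bar>u i x - u i y\<bar> < \<delta>" using \<delta> by (simp add: field_simps abs_less_iff)
   have "dist ((g ^^ i) x) ((g ^^ i) y) = dist (param I (u i x)) (param I (u i y))" using X param_u by metis
   also have "\<dots> \<le> 2 * pi * \<bar>u i x - u i y\<bar>" by (rule dist_param_le)
   also have "\<dots> \<le> 7 * \<bar>u i x - u i y\<bar>" using pi_less_4 pi_approx by (intro mult_right_mono) auto
   also have "\<dots> < 7 * \<delta>" using d by simp
   finally show ?thesis by (simp add: \<delta>_def)
  qed
  have "ent M F \<le> ent M (past n) + (\<integral>x. ln (real (card (V ` (fibre n x)))) \<partial>M)"
   unfolding F_def [abs_def] using sH sV by (rule ent_conditional_count)
  also have "(\<integral>x. ln (real (card (V ` (fibre n x)))) \<partial>M) \<le> (\<integral>x. ln (real (n * m + 1)) \<partial>M)"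
  proof (rule integral_mono)
   show "integrable M (\<lambda>x. ln (real (card (V ` (fibre n x)))))" by (rule integral_simple_function(1)[OF sH])
   fix x assume x: "x \<in> space M"
   have "finite (V ` (fibre n x))" using sV by (auto simp: simple_function_def intro: finite_subset[of _ "V ` space M"])
   then have "card (V ` (fibre n x)) > 0" using x by (auto simp: card_gt_0_iff)
   then show "ln (real (card (V ` (fibre n x)))) \<le> ln (real (n * m + 1))"
    using count[OF x] by (intro ln_le_cancel_iff[THEN iffD2]) (auto simp only: of_nat_le_iff of_nat_0_less_iff)
  qed simp
  also have "(\<integral>x. ln (real (n * m + 1)) \<partial>M) = ln (real (n * m + 1))" by (simp add: prob_space)
  also have "ln (real (n * m + 1)) \<le> ln (real n * (7 * \<epsilon> / e + 2) + 1)"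
  proof (subst ln_le_cancel_iff)
   have "\<epsilon> / \<delta> = 7 * \<epsilon> / e" by (simp add: \<delta>_def)
   then have "real n * real m \<le> real n * (7 * \<epsilon> / e + 2)" using m by (intro mult_left_mono) auto
   then show "real (n * m + 1) \<le> real n * (7 * \<epsilon> / e + 2) + 1" by simp
   then show "0 < real n * (7 * \<epsilon> / e + 2) + 1" by linarith
  qed (simp add: add_pos_nonneg)
  finally show "ent M F \<le> ent M W + ln 2 + ln (2 / \<epsilon> + 2) + (\<Sum>l<n. \<integral>x. code_cost l x \<partial>M)
   + ln (real n * (7 * \<epsilon> / e + 2) + 1)" using ent_hist_code ent_code0 by linarith
 qed
qed

end

end

end

section \<open>Estimates along a single orbit: potentials, reflected walks and blocks\<close>

lemma sum_le_of_block_bound: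
 fixes b :: "nat \<Rightarrow> real"
 assumes b: "\<And>i. b i \<le> R1" and block: "\<And>l. (\<Sum>i<p. b (l + i)) \<le> real p * R" and p: "p > 0" and R: "0 \<le> R" "0 \<le> R1"
 shows "(\<Sum>i<L. b (l + i)) \<le> real L * R + real p * R1"
proof (induction L arbitrary: l rule: less_induct)
 case (less L)
 show ?case
 proof (cases "L < p")
  case True
  have "(\<Sum>i<L. b (l + i)) \<le> (\<Sum>i<L. R1)" using b by (intro sum_mono)
  also have "\<dots> \<le> real p * R1" using True R by (simp add: mult_right_mono)
  also have "\<dots> \<le> real L * R + real p * R1" using R by simp
  finally show ?thesis .
 next
  case False
  then have L: "L = p + (L - p)" by simp
  have "(\<Sum>i<L. b (l + i)) = (\<Sum>i<p. b (l + i)) + (\<Sum>i<L - p. b (l + p + i))"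
  proof -
   have "(\<Sum>i<p + m. b (l + i)) = (\<Sum>i<p. b (l + i)) + (\<Sum>i<m. b (l + p + i))" for m by (induction m) (auto simp: add_ac)
   then show ?thesis using L by metis
  qed
  also have "\<dots> \<le> real p * R + (real (L - p) * R + real p * R1)"
   using less.IH[of "L - p" "l + p"] False p by (intro add_mono block) auto
  also have "\<dots> = real L * R + real p * R1" using False by (simp add: of_nat_diff algebra_simps)
  finally show ?thesis .
 qed
qed

lemma telescoping_potential:
 fixes E d :: "nat \<Rightarrow> real"
 assumes "\<And>l. l < n \<Longrightarrow> E (Suc l) - E l \<ge> d l"
 shows "(\<Sum>l<n. d l) \<le> E n - E 0" using assms
proof (induction n)
 case (Suc n)
 have "(\<Sum>l<n. d l) \<le> E n - E 0" using Suc by auto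
 then show ?case using Suc.prems[of n] by simp
qed simp

text \<open>
 The potential is the deficit corrected, during bad time intervals, by a bounded function \<open>V\<close>
 that turns the asymptotic growth rate \<open>R\<close> into a rate valid at each step.
\<close>

lemma deep_sum_le:
 fixes a :: "nat \<Rightarrow> real" and \<sigma> \<gamma> a1 a0 :: real
 defines "s \<equiv> deficit \<sigma> \<gamma> a1 a0 a"
 assumes par: "\<sigma> > 0" "2 < a0" "a1 \<le> a0" "\<gamma> \<ge> 0" "R \<ge> 0" "CV \<ge> 0"
  and stretch: "\<And>l L. l + L \<le> n \<Longrightarrow> (\<Sum>i<L. - a (l + i)) \<le> real L * R + CV"
 shows "(\<Sum>l<n. if a l \<ge> a0 then max 0 ((a l - 1) / \<sigma> - s l) + a l - 2 - CV else 0)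
  \<le> s n + (\<Sum>l<n. if s l > 0 then R + \<gamma> else 0) + (\<Sum>l<n. if a1 \<le> a l \<and> a l < a0 then 2 else 0)"
proof -
 \<comment> \<open>The largest excess, over the future up to \<open>n\<close>, of expansion over the
   rate \<open>R\<close>. It is nonnegative because of the empty stretch and at most
   \<open>CV\<close> by \<open>stretch\<close>.\<close>
 define V where "V l = Max ((\<lambda>L. \<Sum>i<L. (- a (l + i) - R)) ` {..n - l})" for l
 have V0: "0 \<le> V l" for l
 proof -
  have "(\<Sum>i<0. (- a (l + i) - R)) \<le> V l" unfolding V_def by (intro Max_ge imageI) auto
  then show ?thesis by simp
 qed
 have VC: "V l \<le> CV" if "l \<le> n" for l unfolding V_def
 proof (subst Max_le_iff, simp, simp, safe)
  fix L assume "L \<le> n - l"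
  then have "(\<Sum>i<L. - a (l + i)) \<le> real L * R + CV" using that by (intro stretch) auto
  then show "(\<Sum>i<L. (- a (l + i) - R)) \<le> CV" by (simp add: sum_subtractf)
 qed
 have VS: "- a l - R + V (Suc l) \<le> V l" if "l < n" for l
 proof -
  have "V (Suc l) \<in> (\<lambda>L. \<Sum>i<L. (- a (Suc l + i) - R)) ` {..n - Suc l}" unfolding V_def by (intro Max_in) auto
  then obtain L where L: "L \<le> n - Suc l" "V (Suc l) = (\<Sum>i<L. (- a (Suc l + i) - R))" by auto
  have "- a l - R + V (Suc l) = (\<Sum>i<Suc L. (- a (l + i) - R))" unfolding L by (subst sum.lessThan_Suc_shift) simp
  also have "\<dots> \<le> V l" unfolding V_def using L(1) that by (intro Max_ge imageI) auto
  finally show ?thesis .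
 qed
 have s0: "s l \<ge> 0" for l unfolding s_def using par by (intro deficit_nonneg) auto
 have sS: "s (Suc l) = (if a l \<ge> a0 then max (s l) ((a l - 1) / \<sigma>) + a l - 2
   else if s l = 0 then 0 else max 0 (s l + a l - (if a l \<ge> a1 then 2 else \<gamma>)))" for l by (simp add: s_def)
 \<comment> \<open>There is no correction at good times. When a deep contraction opens a bad
   interval, \<open>V\<close> enters with a value up to \<open>CV\<close>; this is why
   \<open>CV\<close> is subtracted from its gain.\<close>
 define E where "E l = (if s l > 0 then s l - V l else 0)" for l
 define d where "d l = (if a l \<ge> a0 then max 0 ((a l - 1) / \<sigma> - s l) + a l - 2 - CV else 0)
  - (if s l > 0 then R + \<gamma> else 0) - (if a1 \<le> a l \<and> a l < a0 then 2 else 0)" for l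
 have Ele: "E l \<le> s l" for l using V0[of l] s0[of l] by (simp add: E_def)
 have Ege: "s l - V l \<le> E l" for l using V0[of l] s0[of l] by (simp add: E_def)
 have "(\<Sum>l<n. d l) \<le> E n - E 0"
 proof (rule telescoping_potential)
  fix l assume l: "l < n"
  show "d l \<le> E (Suc l) - E l"
  proof (cases "a l \<ge> a0")
   case True
   have "s (Suc l) = s l + max 0 ((a l - 1) / \<sigma> - s l) + a l - 2" using True sS[of l] by (simp add: max_def)
   moreover have "R + \<gamma> \<ge> 0" using par by simp
   ultimately show ?thesis using True Ele[of l] Ege[of "Suc l"] VC[of "Suc l"] l by (auto simp: d_def)
  next
   case False
   show ?thesis
   proof (cases "s l = 0")
    case True
    then have "s (Suc l) = 0" using False sS[of l] by simp
    then show ?thesis using True False by (simp add: d_def E_def)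
   next
    case nz: False
    then have pos: "s l > 0" using s0[of l] by simp
    have "s (Suc l) \<ge> s l + a l - (if a l \<ge> a1 then 2 else \<gamma>)" using False nz sS[of l] by simp
    then show ?thesis using False pos VS[OF l] Ege[of "Suc l"] par by (auto simp: d_def E_def split: if_splits)
   qed
  qed
 qed
 moreover have "E 0 = 0" by (simp add: E_def s_def)
 ultimately have "(\<Sum>l<n. d l) \<le> s n" using Ele[of n] by simp
 then show ?thesis by (simp add: d_def sum_subtractf)
qed

text \<open>Contractions cut off at \<open>A\<close> drive a walk reflected at 0 that dominates the
  deficit. The excess over \<open>A\<close> is charged with the factor 1 + 1 / \<sigma>: once for
  the contraction, once for the refined grid.\<close>

lemma deficit_le_reflected_sum:
 fixes a M :: "nat \<Rightarrow> real"
 assumes par: "\<sigma> > 0" "A \<ge> 0" "\<gamma> \<ge> 0" "2 \<le> a0"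
  and M: "M 0 = 0" "\<And>l. M (Suc l) = max 0 (M l + min (a l) A)"
 shows "deficit \<sigma> \<gamma> a1 a0 a n \<le> A / \<sigma> + (\<Sum>l<n. (1 + 1 / \<sigma>) * max 0 (a l - A)) + M n"
proof (induction n)
 case 0
 then show ?case using par M by simp
next
 case (Suc n)
 let ?s = "deficit \<sigma> \<gamma> a1 a0 a"
 define B where "B = (\<Sum>l<n. (1 + 1 / \<sigma>) * max 0 (a l - A))"
 define e where "e = max 0 (a n - A)"
 have B0: "B \<ge> 0" unfolding B_def using par by (intro sum_nonneg) auto
 have M0: "M l \<ge> 0" for l by (cases l) (auto simp: M)
 have an: "a n = min (a n) A + e" by (simp add: e_def)
 have e0: "e \<ge> 0" "e / \<sigma> \<ge> 0" "A / \<sigma> \<ge> 0" using par by (auto simp: e_def)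
 have max_s: "max (?s n) (a n / \<sigma>) \<le> A / \<sigma> + B + M n + e / \<sigma>"
 proof -
  have "a n \<le> A + e" by (simp add: e_def)
  then have "a n / \<sigma> \<le> (A + e) / \<sigma>" using par by (intro divide_right_mono) auto
  then have "a n / \<sigma> \<le> A / \<sigma> + e / \<sigma>" by (simp add: add_divide_distrib)
  then show ?thesis using Suc e0 B0 M0[of n] unfolding B_def[symmetric] by simp
 qed
 have "?s (Suc n) \<le> max 0 (max (?s n) (a n / \<sigma>) + a n)"
 proof (cases "a n \<ge> a0")
  case True
  have "(a n - 1) / \<sigma> \<le> a n / \<sigma>" using par by (intro divide_right_mono) auto
  then show ?thesis using True by simp
 next
  case False
  then show ?thesis using par by auto
 qed
 also have "\<dots> \<le> max 0 (A / \<sigma> + B + M n + e / \<sigma> + (min (a n) A + e))" using max_s an by auto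
 also have "\<dots> \<le> A / \<sigma> + (B + (1 + 1 / \<sigma>) * e) + M (Suc n)"
 proof -
  have "(1 + 1 / \<sigma>) * e = e + e / \<sigma>" by (simp add: algebra_simps)
  moreover have "M n + min (a n) A \<le> M (Suc n)" "0 \<le> M (Suc n)" using M by auto
  ultimately show ?thesis using e0 B0 by (intro max.boundedI) linarith+
 qed
 finally show ?case by (simp add: B_def e_def)
qed

text \<open>The value of a reflected walk is the sum of its steps since its last reset to 0.\<close>

lemma reflected_sum_le:
 fixes b M :: "nat \<Rightarrow> real"
 assumes M: "M 0 = 0" "\<And>l. M (Suc l) = max 0 (M l + b l)"
  and bd: "\<And>i j. i \<le> j \<Longrightarrow> j \<le> n \<Longrightarrow> (\<Sum>l<j. b l) - (\<Sum>l<i. b l) \<le> c" and c: "c \<ge> 0"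
 shows "M n \<le> c"
proof -
 have "\<exists>i\<le>n. M n \<le> (\<Sum>l<n. b l) - (\<Sum>l<i. b l)" for n
 proof (induction n)
  case (Suc n)
  then obtain i where i: "i \<le> n" "M n \<le> (\<Sum>l<n. b l) - (\<Sum>l<i. b l)" by auto
  show ?case
  proof (cases "M n + b n \<ge> 0")
   case True
   then have "M (Suc n) \<le> (\<Sum>l<Suc n. b l) - (\<Sum>l<i. b l)" using i M(2)[of n] by simp
   then show ?thesis using i(1) by (intro exI[of _ i]) auto
  next
   case False
   then show ?thesis using M(2)[of n] by (intro exI[of _ "Suc n"]) auto
  qed
 qed (use M in auto)
 then show ?thesis using bd by (meson order_refl order_trans)
qed

text \<open>With drift \<open>c\<close> \<le> 0, the sum of the steps over any window before
  \<open>n\<close> exceeds 0 by at most a small multiple of \<open>n\<close>, uniformly in the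
  window.\<close>

lemma reflected_sum_sublinear:
 fixes b M :: "nat \<Rightarrow> real"
 assumes M: "M 0 = 0" "\<And>l. M (Suc l) = max 0 (M l + b l)"
  and lim: "(\<lambda>n. (\<Sum>l<n. b l) / real n) \<longlonglongrightarrow> c" and c: "c \<le> 0"
 shows "(\<lambda>n. M n / real n) \<longlonglongrightarrow> 0"
proof (rule LIMSEQ_I)
 fix e :: real assume e: "e > 0"
 define S where "S n = (\<Sum>l<n. b l)" for n
 obtain N where N: "\<And>n. n \<ge> N \<Longrightarrow> \<bar>S n / real n - c\<bar> < e / 4" using LIMSEQ_D[OF lim, of "e / 4"] e by (auto simp: S_def)
 define K where "K = (\<Sum>i\<le>N. \<bar>S i - c * real i\<bar>)"
 have K0: "K \<ge> 0" unfolding K_def by (intro sum_nonneg) auto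
 obtain N' :: nat where N': "real N' > 4 * K / e" using reals_Archimedean2 by blast
 have near: "\<bar>S i - c * real i\<bar> \<le> real n * e / 4" if n: "n \<ge> N' + 1" "i \<le> n" for i n
 proof (cases "i \<ge> N \<and> i > 0")
  case True
  then have "\<bar>S i / real i - c\<bar> < e / 4" using N by auto
  then have "\<bar>S i - c * real i\<bar> \<le> real i * (e / 4)" using True by (simp add: abs_le_iff abs_less_iff field_simps)
  also have "\<dots> \<le> real n * (e / 4)" using n e by (intro mult_right_mono) auto
  finally show ?thesis by simp
 next
  case False
  then have "i \<le> N" by auto
  then have "\<bar>S i - c * real i\<bar> \<le> K" unfolding K_def by (intro member_le_sum) auto
  also have "\<dots> \<le> real N' * e / 4" using N' e by (simp add: field_simps)
  also have "\<dots> \<le> real n * e / 4" using n e by (intro divide_right_mono mult_right_mono) auto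
  finally show ?thesis .
 qed
 have M0: "M l \<ge> 0" for l by (cases l) (auto simp: M)
 have "norm (M n / real n - 0) < e" if n: "n \<ge> N' + 1" for n
 proof -
  have "M n \<le> real n * e / 2"
  proof (rule reflected_sum_le[OF M])
   fix i j assume ij: "i \<le> j" "j \<le> n"
   have "S j - S i \<le> c * (real j - real i) + real n * e / 2"
    using near[OF n, of i] near[OF n, of j] ij unfolding abs_le_iff right_diff_distrib by linarith
   also have "c * (real j - real i) \<le> 0" using c ij by (intro mult_nonpos_nonneg) auto
   finally show "(\<Sum>l<j. b l) - (\<Sum>l<i. b l) \<le> real n * e / 2" by (simp add: S_def)
  qed (use e in simp)
  then have "M n / real n \<le> e / 2" using n by (simp add: field_simps)
  then have "M n / real n < e" using e by linarith
  then show ?thesis using M0[of n] by simp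
 qed
 then show "\<exists>no. \<forall>n\<ge>no. norm (M n / real n - 0) < e" by blast
qed

text \<open>
 Blocks of length \<open>m\<close> are started at good times not covered by an earlier block;
 \<open>block_counter\<close> is the remaining length of the current block.
\<close>

fun block_counter :: "nat \<Rightarrow> (nat \<Rightarrow> real) \<Rightarrow> nat \<Rightarrow> nat" where
 "block_counter m s 0 = 0"
| "block_counter m s (Suc l) =
  (if block_counter m s l = 0 then (if s l = 0 then m - 1 else 0) else block_counter m s l - 1)"

definition block_start :: "nat \<Rightarrow> (nat \<Rightarrow> real) \<Rightarrow> nat \<Rightarrow> bool" where
 "block_start m s l \<longleftrightarrow> block_counter m s l = 0 \<and> s l = 0"

lemma block_counter_less: "m > 0 \<Longrightarrow> block_counter m s l < m" by (induction l) auto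

text \<open>The counter keeps running through bad times, so a block always lasts \<open>m\<close>
  steps. A good time either starts a block or falls into the one that is being counted down.\<close>

lemma good_time_covered:
 assumes m: "m > 0" and s: "s l = 0"
 shows "\<exists>i<m. i \<le> l \<and> block_start m s (l - i)"
proof -
 have gen: "\<exists>i. i \<le> l \<and> block_start m s (l - i) \<and> i + block_counter m s l = m" if "block_counter m s l > 0" for l
  using that
 proof (induction l)
  case (Suc l)
  show ?case
  proof (cases "block_counter m s l = 0")
   case True
   then have "block_start m s l" "block_counter m s (Suc l) = m - 1"
    using Suc.prems by (auto simp: block_start_def split: if_splits)
   then show ?thesis using Suc.prems m by (intro exI[of _ 1]) auto
  next
   case False
   then obtain i where "i \<le> l" "block_start m s (l - i)" "i + block_counter m s l = m" using Suc.IH by auto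
   then show ?thesis using False by (intro exI[of _ "Suc i"]) auto
  qed
 qed simp
 show ?thesis
 proof (cases "block_counter m s l = 0")
  case True
  then show ?thesis using m s by (intro exI[of _ 0]) (auto simp: block_start_def)
 next
  case False
  then obtain i where "i \<le> l" "block_start m s (l - i)" "i + block_counter m s l = m" using gen by auto
  then show ?thesis using False by (intro exI[of _ i]) auto
 qed
qed

lemma card_block_starts:
 fixes a :: "nat \<Rightarrow> real" and \<sigma> \<gamma> a1 a0 :: real
 defines "s \<equiv> deficit \<sigma> \<gamma> a1 a0 a"
 assumes m: "m > 0" and a0: "2 \<le> a0"
 shows "(\<Sum>l<n. if block_start m s l then real m else 0)
  \<le> (\<Sum>l<n. if s l = 0 then 1 else 0) + (\<Sum>l<n. if a l \<ge> a0 then real m else 0) + real m"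
proof -
 define E where "E l = (if s l = 0 then real (block_counter m s l) else 0)" for l
 have E: "0 \<le> E l" "E l \<le> real m" for l using block_counter_less[OF m, of s l] by (auto simp: E_def)
 have good: "s (Suc l) = 0" if "s l = 0" "\<not> a l \<ge> a0" for l using that by (simp add: s_def)
 define d where "d l = (if block_start m s l then real m else 0) - (if s l = 0 then 1 else 0)
  - (if a l \<ge> a0 then real m else 0)" for l
 have "(\<Sum>l<n. d l) \<le> E n - E 0"
 proof (rule telescoping_potential)
  fix l
  show "d l \<le> E (Suc l) - E l"
  proof (cases "s l = 0")
   case False
   then show ?thesis using E(1)[of "Suc l"] by (simp add: d_def E_def block_start_def)
  next
   case True
   show ?thesis
   proof (cases "a l \<ge> a0")
    case True
    then show ?thesis using E[of l] E(1)[of "Suc l"] \<open>s l = 0\<close>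
     by (cases "block_counter m s l = 0") (auto simp: d_def block_start_def E_def)
   next
    case False
    then have "s (Suc l) = 0" using good \<open>s l = 0\<close> by blast
    then show ?thesis using False \<open>s l = 0\<close> m
     by (cases "block_counter m s l = 0") (auto simp: d_def block_start_def E_def of_nat_diff)
   qed
  qed
 qed
 then have "(\<Sum>l<n. d l) \<le> real m" using E(1)[of 0] E(2)[of n] by linarith
 then show ?thesis by (simp add: d_def sum_subtractf)
qed

section \<open>The truncated logarithm of the derivative\<close>

context one_dim_system
begin

text \<open>Cutting off at - A gives a bounded continuous function, fit for ergodic averages and
  weak limits, that decreases to the logarithm of the derivative as A grows.\<close>

definition "log_deriv_cut A x = ln (max \<bar>map_deriv I g x\<bar> (exp (- A)))"

lemma map_deriv_bounded: obtains R1 where "R1 \<ge> 0" "\<And>x. x \<in> X \<Longrightarrow> \<bar>map_deriv I g x\<bar> \<le> exp R1"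
proof -
 have "bounded (map_deriv I g ` X)"
  using continuous_on_map_deriv[OF g r] compact_points by (intro compact_imp_bounded compact_continuous_image)
 then obtain B where B: "\<And>x. x \<in> X \<Longrightarrow> \<bar>map_deriv I g x\<bar> \<le> B" by (auto simp: bounded_iff)
 show ?thesis
 proof (rule that[of "ln (max B 1)"])
  show "\<bar>map_deriv I g x\<bar> \<le> exp (ln (max B 1))" if "x \<in> X" for x using B[OF that] by simp
 qed simp
qed

lemma log_deriv_cut_bounds:
 assumes "\<bar>map_deriv I g x\<bar> \<le> exp R1" "R1 \<ge> 0" "A \<ge> 0"
 shows "- A \<le> log_deriv_cut A x" "log_deriv_cut A x \<le> R1" "\<bar>log_deriv_cut A x\<bar> \<le> max A R1"
proof -
 have "ln (exp (- A)) \<le> log_deriv_cut A x" unfolding log_deriv_cut_def by (subst ln_le_cancel_iff) (auto simp: less_max_iff_disj)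
 then show 1: "- A \<le> log_deriv_cut A x" by simp
 have "exp (- A) \<le> exp R1" using assms by simp
 then have "log_deriv_cut A x \<le> ln (exp R1)"
  unfolding log_deriv_cut_def using assms by (subst ln_le_cancel_iff) (auto simp: less_max_iff_disj)
 then show 2: "log_deriv_cut A x \<le> R1" by simp
 show "\<bar>log_deriv_cut A x\<bar> \<le> max A R1" using 1 2 by auto
qed

lemma log_deriv_cut_measurable [measurable]: "log_deriv_cut A \<in> borel_measurable M"
 unfolding log_deriv_cut_def [abs_def] by measurable

lemma log_deriv_cut_bounded:
 assumes "A \<ge> 0"
 obtains B where "\<And>x. x \<in> space M \<Longrightarrow> \<bar>log_deriv_cut A x\<bar> \<le> B"
proof -
 obtain R1 where "R1 \<ge> 0" "\<And>x. x \<in> X \<Longrightarrow> \<bar>map_deriv I g x\<bar> \<le> exp R1" by (rule map_deriv_bounded) blast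
 then show ?thesis using log_deriv_cut_bounds(3)[OF _ _ assms] by (intro that[of "max A R1"]) (auto simp: space_M)
qed

end

section \<open>Ruelle's inequality and its consequences\<close>

locale one_dim_ergodic = one_dim_system +
 assumes erg: "ergodic_measure g M"
begin

text \<open>
 Ruelle's inequality. Since \<open>g\<close> is one-dimensional, an initial grid of mesh \<open>exp (- n L)\<close>, with \<open>L\<close>
 slightly above the exponent, already controls most orbits up to time \<open>n\<close>.
\<close>

lemma names_entropy_Ruelle:
 assumes A: "A \<ge> 0" and Q: "simple_function M Q" and \<eta>: "(\<eta>::real) > 0"
 shows "limsup (\<lambda>n. ereal (ent M (names Q g n) / real n)) \<le> ereal (max 0 (\<integral>x. log_deriv_cut A x \<partial>M) + 5 * \<eta>)"
proof -
 define c where "c = max 0 (\<integral>x. log_deriv_cut A x \<partial>M)"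
 define L where "L = c + 2 * \<eta>"
 have L: "L > 0" using \<eta> by (simp add: L_def c_def add_nonneg_pos)
 obtain B where B: "\<And>x. x \<in> space M \<Longrightarrow> \<bar>log_deriv_cut A x\<bar> \<le> B" using log_deriv_cut_bounded[OF A] by blast
 let ?S = "birkhoff_sum (log_deriv_cut A) g"
 have [measurable]: "?S l \<in> borel_measurable M" for l using g_measurable by (intro measurable_birkhoff_sum) auto
 have SB: "\<bar>?S l x\<bar> \<le> real l * B" if "x \<in> space M" for l x using B gl_in that space_M by (intro birkhoff_sum_bound) auto
 obtain e :: real where e: "e > 0"
  "\<And>n (F :: complex \<Rightarrow> int) E. simple_function M F \<Longrightarrow> E \<in> sets M \<Longrightarrow>
    (\<And>x y i. x \<in> E \<Longrightarrow> y \<in> E \<Longrightarrow> F x = F y \<Longrightarrow> i < n \<Longrightarrow> dist ((g ^^ i) x) ((g ^^ i) y) < e) \<Longrightarrow>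
    ent M (names Q g n) \<le> ent M F + n * \<eta> + ln 2
     + prob (space M - E) * n * ln (real (card (Q ` space M)))"
  by (rule names_entropy_le_dynamical_cells[OF prob_space_axioms borel_prob_onD(2)[OF M] points_borel g_measurable g_distr Q \<eta>]) blast
 \<comment> \<open>A change of the derivative by less than \<open>t\<close> multiplies the larger of
   its absolute value and exp (- A) by at most exp \<eta>.\<close>
 define t where "t = exp (- A) * (exp \<eta> - 1)"
 have "t > 0" using \<eta> by (simp add: t_def)
 moreover have "uniformly_continuous_on X (map_deriv I g)"
  using continuous_on_map_deriv[OF g r] compact_points by (rule compact_uniformly_continuous)
 ultimately obtain d where d: "d > 0" "\<And>x y. x \<in> X \<Longrightarrow> y \<in> X \<Longrightarrow> dist x y < d \<Longrightarrow> dist (map_deriv I g x) (map_deriv I g y) < t"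
  unfolding uniformly_continuous_on_def by (metis dist_commute)
 define \<rho> where "\<rho> = min d e / 8"
 have \<rho>: "\<rho> > 0" "8 * \<rho> \<le> d" "8 * \<rho> \<le> e" using d(1) e(1) by (auto simp: \<rho>_def)
 have near: "dist (param I s) (param I t) < min d e" if "\<bar>s - t\<bar> \<le> \<rho>" for s t
 proof -
  have "2 * pi * \<bar>s - t\<bar> \<le> 2 * pi * \<rho>" using that by (intro mult_left_mono) auto
  also have "\<dots> < 8 * \<rho>" using pi_less_4 \<rho>(1) by simp
  finally have "2 * pi * \<bar>s - t\<bar> < 8 * \<rho>" .
  then show ?thesis using dist_param_le[of I s t] \<rho> by linarith
 qed
 have dist_h: "\<bar>h z\<bar> \<le> exp (log_deriv_cut A (param I s) + \<eta>)" if "s \<in> D" "z \<in> D" "\<bar>z - s\<bar> \<le> \<rho>" for s z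
 proof -
  let ?m = "max \<bar>h s\<bar> (exp (- A))"
  have "dist (map_deriv I g (param I z)) (map_deriv I g (param I s)) < t"
   using that near by (intro d(2) param_in_points) auto
  then have "\<bar>h z\<bar> \<le> \<bar>h s\<bar> + t" using map_deriv_param[OF g r] that by (simp add: dist_real_def)
  also have "\<dots> \<le> ?m + ?m * (exp \<eta> - 1)" unfolding t_def using \<eta> by (intro add_mono mult_right_mono) auto
  also have "\<dots> = exp (log_deriv_cut A (param I s) + \<eta>)"
   using map_deriv_param[OF g r that(1)] by (simp add: log_deriv_cut_def exp_add less_max_iff_disj algebra_simps)
  finally show ?thesis .
 qed
 \<comment> \<open>Orbits whose accumulated expansion stays below n L at all times up to
   \<open>n\<close>, not just at the end, so that a piece of the initial grid never outgrows
   \<rho>.\<close>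
 define E where "E n = {x\<in>space M. \<forall>l\<in>{..n}. ?S l x + real l * \<eta> \<le> real n * L}" for n
 have E[measurable]: "E n \<in> sets M" for n unfolding E_def by measurable
 define \<delta> where "\<delta> n = \<rho> * exp (- (real n * L))" for n
 define F where "F n x = \<lfloor>u 0 x / \<delta> n\<rfloor>" for n x
 have \<delta>: "\<delta> n > 0" for n using \<rho>(1) by (simp add: \<delta>_def)
 have close: "\<bar>u l x - u l y\<bar> \<le> \<delta> n * exp (?S l x + real l * \<eta>)"
  if x: "x \<in> E n" "y \<in> E n" "F n x = F n y" and l: "l \<le> n" for n l x y using l
 proof (induction l)
  case 0
  have "\<bar>u 0 x / \<delta> n - u 0 y / \<delta> n\<bar> \<le> 1" using x(3) unfolding F_def by linarith
  then show ?case using \<delta>[of n] by (simp add: birkhoff_sum_def field_simps abs_le_iff)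
 next
  case (Suc l)
  have X: "x \<in> X" "y \<in> X" using x space_M by (auto simp: E_def)
  have D: "u l x \<in> D" "u l y \<in> D" using X u_in by auto
  have IH: "\<bar>u l x - u l y\<bar> \<le> \<delta> n * exp (?S l x + real l * \<eta>)" using Suc by simp
  also have "\<dots> \<le> \<delta> n * exp (real n * L)" using x(1) Suc.prems \<delta>[of n] by (auto simp: E_def)
  also have "\<dots> = \<rho>" by (simp add: \<delta>_def flip: exp_add)
  finally have small: "\<bar>u l x - u l y\<bar> \<le> \<rho>" .
  have "\<bar>h z\<bar> \<le> exp (log_deriv_cut A ((g ^^ l) x) + \<eta>)" if z: "z \<in> closed_segment (u l x) (u l y)" for z
  proof -
   have "z \<in> D" using z closed_segment_subset[OF D convex_D] by blast
   moreover have "\<bar>z - u l x\<bar> \<le> \<rho>" using z small by (auto simp: closed_segment_eq_real_ivl split: if_splits)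
   ultimately show ?thesis using dist_h[OF D(1)] param_u[OF X(1)] by simp
  qed
  then have "\<bar>u (Suc l) x - u (Suc l) y\<bar> \<le> exp (log_deriv_cut A ((g ^^ l) x) + \<eta>) * \<bar>u l x - u l y\<bar>"
   unfolding u_Suc using D by (intro mean_value_bound) auto
  also have "\<dots> \<le> exp (log_deriv_cut A ((g ^^ l) x) + \<eta>) * (\<delta> n * exp (?S l x + real l * \<eta>))"
   using IH by (intro mult_left_mono) auto
  also have "\<dots> = \<delta> n * exp (?S (Suc l) x + real (Suc l) * \<eta>)" by (simp add: birkhoff_sum_def exp_add algebra_simps)
  finally show ?case .
 qed
 have cells: "dist ((g ^^ i) x) ((g ^^ i) y) < e" if x: "x \<in> E n" "y \<in> E n" "F n x = F n y" and i: "i < n" for n x y i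
 proof -
  have "\<bar>u i x - u i y\<bar> \<le> \<delta> n * exp (?S i x + real i * \<eta>)" using close[OF x] i by simp
  also have "\<dots> \<le> \<delta> n * exp (real n * L)" using x(1) i \<delta>[of n] by (auto simp: E_def)
  also have "\<dots> = \<rho>" by (simp add: \<delta>_def flip: exp_add)
  finally have "dist (param I (u i x)) (param I (u i y)) < min d e" by (rule near)
  then show ?thesis using param_u x space_M by (auto simp: E_def)
 qed
 have sF: "simple_function M (F n)" for n unfolding F_def [abs_def] using \<delta> by (rule simple_floor_u)
 have entF: "ent M (F n) \<le> ln (2 / \<rho> + 2) + real n * L" for n
 proof -
  have "2 / \<delta> n + 2 \<le> (2 / \<rho> + 2) * exp (real n * L)" using L by (simp add: \<delta>_def exp_minus field_simps)
  also have "\<dots> = exp (ln (2 / \<rho> + 2) + real n * L)" using \<rho>(1) by (simp add: exp_add add_pos_pos)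
  finally have "ln (2 / \<delta> n + 2) \<le> ln (2 / \<rho> + 2) + real n * L" using \<delta>[of n] by (intro ln_le_of_le_exp) (auto simp: add_pos_pos)
  then show ?thesis using ent_floor_u[OF \<delta>[of n]] unfolding F_def [abs_def] by linarith
 qed
 have "(\<lambda>n. \<integral>x. indicator (space M - E n) x \<partial>M) \<longlonglongrightarrow> (\<integral>x. (0 :: real) \<partial>M)"
 proof (rule integral_dominated_convergence[where w = "\<lambda>_. 1"])
  have "AE x in M. (\<lambda>n. ?S n x / real n) \<longlonglongrightarrow> (\<integral>x. log_deriv_cut A x \<partial>M)"
   by (rule ergodic_birkhoff[OF erg log_deriv_cut_measurable B])
  then show "AE x in M. (\<lambda>n. indicator (space M - E n) x :: real) \<longlonglongrightarrow> 0" using AE_space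
  proof eventually_elim
   case (elim x)
   have "(\<integral>x. log_deriv_cut A x \<partial>M) < c + \<eta>" using \<eta> by (simp add: c_def)
   then have "eventually (\<lambda>l. ?S l x / real l < c + \<eta>) sequentially" using elim(1) by (intro order_tendstoD(2))
   then obtain N where N: "\<And>l. l \<ge> N \<Longrightarrow> ?S l x / real l < c + \<eta>" by (auto simp: eventually_sequentially)
   obtain N' :: nat where N': "real N * \<bar>B\<bar> / \<eta> \<le> real N'" using real_arch_simple by blast
   have "x \<in> E n" if n: "n \<ge> N'" for n
   proof -
    have "?S l x + real l * \<eta> \<le> real n * L" if l: "l \<le> n" for l
    proof (cases "l \<ge> N \<and> l > 0")
     case True
     then have "?S l x + real l * \<eta> \<le> real l * L" using N[of l] by (simp add: L_def field_simps)
     also have "\<dots> \<le> real n * L" using l L by (intro mult_right_mono) auto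
     finally show ?thesis .
    next
     case False
     have "real l * B \<le> real l * \<bar>B\<bar>" by (intro mult_left_mono) auto
     also have "\<dots> \<le> real N * \<bar>B\<bar>" using False by (intro mult_right_mono) auto
     also have "\<dots> \<le> real N' * \<eta>" using N' \<eta> by (simp add: pos_divide_le_eq)
     also have "\<dots> \<le> real n * \<eta>" using n \<eta> by (intro mult_right_mono) auto
     finally have "?S l x \<le> real n * \<eta>" using SB[OF elim(2), of l] by linarith
     moreover have "real l * \<eta> \<le> real n * \<eta>" "0 \<le> real n * c" using l \<eta> by (auto simp: c_def)
     ultimately show ?thesis by (simp add: L_def algebra_simps)
    qed
    then show ?thesis using elim(2) by (auto simp: E_def)
   qed
   then show ?case by (intro tendsto_eventually) (auto simp: eventually_sequentially intro!: exI[of _ N'])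
  qed
 qed (auto simp: indicator_def)
 then have "(\<lambda>n. prob (space M - E n) * ln (real (card (Q ` space M)))) \<longlonglongrightarrow> 0"
  by (intro tendsto_mult_left_zero) (simp add: Int_absorb1)
 from order_tendstoD(2)[OF this \<eta>] have p: "eventually (\<lambda>n. prob (space M - E n) * ln (real (card (Q ` space M))) < \<eta>) sequentially" .
 have "(\<lambda>n. (ln (2 / \<rho> + 2) + ln 2) / real n) \<longlonglongrightarrow> 0" by (rule lim_const_over_n)
 from p order_tendstoD(2)[OF this \<eta>] eventually_gt_at_top[of 0]
 have "eventually (\<lambda>n. ereal (ent M (names Q g n) / real n) \<le> ereal (c + 5 * \<eta>)) sequentially"
 proof eventually_elim
  case (elim n)
  have "ent M (names Q g n) \<le> ent M (F n) + n * \<eta> + ln 2 + prob (space M - E n) * n * ln (real (card (Q ` space M)))"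
   by (rule e(2)[OF sF E cells])
  then have "ent M (names Q g n) / real n \<le> ((ln (2 / \<rho> + 2) + ln 2) + real n * L + n * \<eta> + prob (space M - E n) * n * ln (real (card (Q ` space M)))) / real n"
   using entF[of n] by (intro divide_right_mono) auto
  also have "\<dots> = (ln (2 / \<rho> + 2) + ln 2) / real n + L + \<eta> + prob (space M - E n) * ln (real (card (Q ` space M)))"
   using elim(3) by (simp add: field_simps)
  finally show ?case using elim by (simp add: L_def)
 qed
 then show ?thesis unfolding c_def by (rule Limsup_bounded)
qed

text \<open>Having this for every truncation makes all truncated exponents positive as soon as the
  entropy is, before anything is known about integrability of the logarithm of the
  derivative.\<close>

lemma metric_entropy_le_log_deriv_cut:
 assumes A: "A \<ge> 0"
 shows "metric_entropy g M \<le> ereal (max 0 (\<integral>x. log_deriv_cut A x \<partial>M))"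
proof (rule ccontr)
 define c where "c = max 0 (\<integral>x. log_deriv_cut A x \<partial>M)"
 assume "\<not> ?thesis"
 then have "ereal c < metric_entropy g M" by (simp only: not_le c_def)
 then obtain d where d: "ereal c < ereal d" "ereal d < metric_entropy g M" using ereal_dense2 by blast
 obtain Q :: "complex \<Rightarrow> complex set" where Q: "simple_function M Q" "ereal d < limsup (\<lambda>n. ereal (ent M (names Q g n) / real n))"
  using metric_entropy_greaterE[OF g_measurable d(2)] .
 have "limsup (\<lambda>n. ereal (ent M (names Q g n) / real n)) \<le> ereal (c + 5 * ((d - c) / 5))"
  unfolding c_def by (rule names_entropy_Ruelle[OF A Q(1)]) (use d(1) in \<open>simp add: c_def\<close>)
 moreover have "c + 5 * ((d - c) / 5) = d" by (simp add: field_simps)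
 ultimately have "limsup (\<lambda>n. ereal (ent M (names Q g n) / real n)) \<le> ereal d" by (simp only:)
 then show False using Q(2) by (meson leD)
qed

end

section \<open>Integrability of the contraction and mean growth of the deficit\<close>

fun reflected_sum :: "(nat \<Rightarrow> real) \<Rightarrow> nat \<Rightarrow> real" where
 "reflected_sum b 0 = 0"
| "reflected_sum b (Suc l) = max 0 (reflected_sum b l + b l)"

lemma reflected_sum_bounds:
 assumes "\<And>l. \<bar>b l\<bar> \<le> B"
 shows "0 \<le> reflected_sum b n" "reflected_sum b n \<le> real n * B"
proof -
 have B: "B \<ge> 0" using assms[of 0] by linarith
 show 0: "0 \<le> reflected_sum b n" for n by (cases n) auto
 show "reflected_sum b n \<le> real n * B"
 proof (induction n)
  case (Suc n)
  have "b n \<le> B" using assms[of n] by linarith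
  then show ?case using Suc B by (simp add: algebra_simps)
 qed simp
qed

lemma measurable_reflected_sum [measurable]:
 assumes [measurable]: "\<And>l. b l \<in> borel_measurable M"
 shows "(\<lambda>x. reflected_sum (\<lambda>l. b l x) n) \<in> borel_measurable M" by (induction n) simp_all

locale expanding_system = one_dim_ergodic +
 assumes exponent_pos: "\<And>A. A \<ge> 0 \<Longrightarrow> (\<integral>x. log_deriv_cut A x \<partial>M) \<ge> 0"
begin

lemma log_deriv_cut_integrable:
 assumes "A \<ge> 0"
 shows "integrable M (log_deriv_cut A)"
proof -
 obtain B where B: "\<And>x. x \<in> space M \<Longrightarrow> \<bar>log_deriv_cut A x\<bar> \<le> B" using log_deriv_cut_bounded[OF assms] by blast
 show ?thesis by (rule bounded_integrable[OF log_deriv_cut_measurable B])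
qed

text \<open>If the derivative vanished on a set of positive measure, the truncated exponent would
  tend to minus infinity with the truncation level.\<close>

lemma AE_map_deriv_nonzero_0: "AE x in M. map_deriv I g x \<noteq> 0"
proof -
 obtain R1 where R1: "R1 \<ge> 0" "\<And>x. x \<in> X \<Longrightarrow> \<bar>map_deriv I g x\<bar> \<le> exp R1" by (rule map_deriv_bounded) blast
 define N where "N = {x\<in>space M. map_deriv I g x = 0}"
 have [measurable]: "N \<in> sets M" unfolding N_def by measurable
 have "A * prob N \<le> R1" if A: "A > 0" for A
 proof -
  have "0 \<le> (\<integral>x. log_deriv_cut A x \<partial>M)" using A by (intro exponent_pos) auto
  also have "\<dots> \<le> (\<integral>x. R1 - A * indicator N x \<partial>M)"
  proof (rule integral_mono)
   show "integrable M (log_deriv_cut A)" using A by (intro log_deriv_cut_integrable) auto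
   show "integrable M (\<lambda>x. R1 - A * indicator N x)" by (simp add: emeasure_eq_measure)
   fix x assume x: "x \<in> space M"
   show "log_deriv_cut A x \<le> R1 - A * indicator N x"
   proof (cases "x \<in> N")
    case True
    then have "log_deriv_cut A x = - A" by (simp add: N_def log_deriv_cut_def)
    then show ?thesis using True R1 by simp
   next
    case False
    then show ?thesis using log_deriv_cut_bounds(2)[OF R1(2) R1(1), of x A] A x space_M by simp
   qed
  qed
  also have "\<dots> = R1 - A * prob N" by (simp add: prob_space emeasure_eq_measure)
  finally show ?thesis by simp
 qed
 from this[of "(R1 + 1) / prob N"] have "prob N = 0"
  using R1(1) measure_nonneg[of M N] by (cases "prob N = 0") (auto simp: zero_less_divide_iff less_le)
 then show ?thesis unfolding N_def by (subst AE_iff_measurable[OF _ refl]) (auto simp: emeasure_eq_measure)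
qed

lemma AE_funpow:
 assumes P: "AE x in M. P x" "Measurable.pred M P"
 shows "AE x in M. P ((g ^^ l) x)"
proof -
 have m: "(g ^^ l) \<in> measurable M M" using g_measurable by (rule funpow_measurable)
 have "AE x in distr M M (g ^^ l). P x" using P(1) by (simp only: distr_funpow[OF g_measurable g_distr])
 then show ?thesis using m P(2) by (subst (asm) AE_distr_iff) (auto simp: pred_def)
qed

lemma AE_map_deriv_nonzero: "AE x in M. \<forall>l. map_deriv I g ((g ^^ l) x) \<noteq> 0" unfolding AE_all_countable
proof
 fix l
 show "AE x in M. map_deriv I g ((g ^^ l) x) \<noteq> 0" by (rule AE_funpow[OF AE_map_deriv_nonzero_0]) measurable
qed

lemma contraction_cut:
 assumes "map_deriv I g ((g ^^ l) x) \<noteq> 0"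
 shows "min (contraction l x) A = - log_deriv_cut A ((g ^^ l) x)"
proof -
 let ?y = "\<bar>map_deriv I g ((g ^^ l) x)\<bar>"
 have y: "?y > 0" using assms by simp
 show ?thesis
 proof (cases "?y \<ge> exp (- A)")
  case True
  then have "- A \<le> ln ?y" using y by (simp add: ln_ge_iff)
  then show ?thesis using True by (simp add: contraction_def log_deriv_cut_def max_def)
 next
  case False
  then have "ln ?y < - A" using y by (metis ln_exp ln_less_cancel_iff exp_gt_zero not_le)
  then show ?thesis using False by (simp add: contraction_def log_deriv_cut_def max_def)
 qed
qed

lemma contraction_funpow: "contraction l x = contraction 0 ((g ^^ l) x)" by (simp add: contraction_def)

lemma integral_contraction_comp:
 fixes f :: "real \<Rightarrow> real"
 assumes [measurable]: "f \<in> borel_measurable borel"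
 shows "(\<integral>x. f (contraction l x) \<partial>M) = (\<integral>x. f (contraction 0 x) \<partial>M)"
 unfolding contraction_funpow[of l] using g_measurable g_distr by (rule integral_comp_funpow) measurable

lemma sum_integral_contraction_comp:
 fixes f :: "real \<Rightarrow> real"
 assumes f: "f \<in> borel_measurable borel"
 shows "(\<Sum>l<n. \<integral>x. f (contraction l x) \<partial>M) = real n * (\<integral>x. f (contraction 0 x) \<partial>M)"
proof -
 have "(\<Sum>l<n. \<integral>x. f (contraction l x) \<partial>M) = (\<Sum>l<n. \<integral>x. f (contraction 0 x) \<partial>M)"
  by (rule sum.cong[OF refl], rule integral_contraction_comp[OF f])
 then show ?thesis by simp
qed

lemma integrable_contraction_comp:
 fixes f :: "real \<Rightarrow> real"
 assumes [measurable]: "f \<in> borel_measurable borel" and int: "integrable M (\<lambda>x. f (contraction 0 x))"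
 shows "integrable M (\<lambda>x. f (contraction l x))"
proof -
 have "integrable (distr M M (g ^^ l)) (\<lambda>x. f (contraction 0 x))"
  using int distr_funpow[OF g_measurable g_distr] by simp
 then show ?thesis unfolding contraction_funpow[of l] using gl_measurable by (subst (asm) integrable_distr_eq) auto
qed

context
 fixes R1 :: real
 assumes R1: "R1 \<ge> 0" "\<And>x. x \<in> X \<Longrightarrow> \<bar>map_deriv I g x\<bar> \<le> exp R1"
begin

text \<open>Nonnegative exponents mean that contraction is balanced by expansion, and the latter is
  at most \<open>R1\<close>. The bound for the truncations extends by monotone convergence.\<close>

lemma integrable_pos_contraction: "integrable M (\<lambda>x. max 0 (contraction 0 x))"
 and integral_pos_contraction: "(\<integral>x. max 0 (contraction 0 x) \<partial>M) \<le> R1"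
proof -
 let ?f = "\<lambda>i x. max 0 (min (contraction 0 x) (real i))"
 have int: "integrable M (?f i)" for i by (rule bounded_integrable[where B = "real i"]) auto
 have le: "(\<integral>x. ?f i x \<partial>M) \<le> R1" for i
 proof -
  have "(\<integral>x. ?f i x \<partial>M) \<le> (\<integral>x. R1 - log_deriv_cut (real i) x \<partial>M)"
  proof (rule integral_mono_AE)
   show "integrable M (\<lambda>x. R1 - log_deriv_cut (real i) x)" using log_deriv_cut_integrable by simp
   show "AE x in M. ?f i x \<le> R1 - log_deriv_cut (real i) x" using AE_map_deriv_nonzero_0 AE_space
   proof eventually_elim
    case (elim x)
    have "log_deriv_cut (real i) x \<le> R1"
     using log_deriv_cut_bounds(2)[OF R1(2) R1(1), of x "real i"] elim space_M by simp
    moreover have "min (contraction 0 x) (real i) = - log_deriv_cut (real i) x"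
     using contraction_cut[of 0 x "real i"] elim(1) by simp
    ultimately show ?case using R1(1) by simp
   qed
  qed (rule int)
  also have "\<dots> = R1 - (\<integral>x. log_deriv_cut (real i) x \<partial>M)" using log_deriv_cut_integrable by (simp add: prob_space)
  also have "\<dots> \<le> R1" using exponent_pos[of "real i"] by simp
  finally show ?thesis .
 qed
 have inc: "incseq (\<lambda>i. \<integral>x. ?f i x \<partial>M)" unfolding incseq_def using int by (auto intro!: integral_mono)
 obtain L where L: "(\<lambda>i. \<integral>x. ?f i x \<partial>M) \<longlonglongrightarrow> L" "\<And>i. (\<integral>x. ?f i x \<partial>M) \<le> L"
  using incseq_convergent[OF inc, of R1] le by blast
 have mono: "AE x in M. mono (\<lambda>i. ?f i x)" by (intro AE_I2) (auto simp: mono_def)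
 have lim: "AE x in M. (\<lambda>i. ?f i x) \<longlonglongrightarrow> max 0 (contraction 0 x)"
 proof (rule AE_I2)
  fix x
  obtain N :: nat where N: "contraction 0 x \<le> real N" using real_arch_simple by blast
  have "eventually (\<lambda>i. ?f i x = max 0 (contraction 0 x)) sequentially" unfolding eventually_sequentially
  proof (intro exI[of _ N] allI impI)
   fix i assume "N \<le> i"
   then have "contraction 0 x \<le> real i" using N by linarith
   then show "?f i x = max 0 (contraction 0 x)" by simp
  qed
  then show "(\<lambda>i. ?f i x) \<longlonglongrightarrow> max 0 (contraction 0 x)" by (rule tendsto_eventually)
 qed
 show "integrable M (\<lambda>x. max 0 (contraction 0 x))"
  using int mono lim L(1) by (rule integrable_monotone_convergence) measurable
 have "(\<integral>x. max 0 (contraction 0 x) \<partial>M) = L" using int mono lim L(1) by (rule integral_monotone_convergence) measurable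
 also have "L \<le> R1" using L(1) by (rule LIMSEQ_le_const2) (use le in auto)
 finally show "(\<integral>x. max 0 (contraction 0 x) \<partial>M) \<le> R1" .
qed

lemma tail_contraction_tendsto: "(\<lambda>A. \<integral>x. max 0 (contraction 0 x - real A) \<partial>M) \<longlonglongrightarrow> 0"
proof -
 have "(\<lambda>A. \<integral>x. max 0 (contraction 0 x - real A) \<partial>M) \<longlonglongrightarrow> (\<integral>x. 0 \<partial>M)"
 proof (rule integral_dominated_convergence[where w = "\<lambda>x. max 0 (contraction 0 x)"])
  show "AE x in M. (\<lambda>A. max 0 (contraction 0 x - real A)) \<longlonglongrightarrow> 0"
  proof (rule AE_I2)
   fix x
   obtain N :: nat where N: "contraction 0 x \<le> real N" using real_arch_simple by blast
   have "eventually (\<lambda>A. max 0 (contraction 0 x - real A) = 0) sequentially"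
    unfolding eventually_sequentially using N by (intro exI[of _ N]) force
   then show "(\<lambda>A. max 0 (contraction 0 x - real A)) \<longlonglongrightarrow> 0" by (rule tendsto_eventually)
  qed
 qed (use integrable_pos_contraction in auto)
 then show ?thesis by simp
qed

lemma integrable_tail: "integrable M (\<lambda>x. max 0 (contraction l x - real A))"
proof (rule integrable_contraction_comp[where f = "\<lambda>a. max 0 (a - real A)"])
 show "integrable M (\<lambda>x. max 0 (contraction 0 x - real A))"
  by (rule Bochner_Integration.integrable_bound[OF integrable_pos_contraction]) auto
qed measurable

text \<open>The steps average to minus the truncated exponent, which is at most 0, so the walk grows
  sublinearly almost everywhere; as the steps are bounded, dominated convergence gives the same in
  the mean.\<close>

lemma reflected_contraction_sublinear:
 assumes A: "A \<ge> 0"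
 shows "(\<lambda>n. (\<integral>x. reflected_sum (\<lambda>l. min (contraction l x) A) n \<partial>M) / real n) \<longlonglongrightarrow> 0"
  "integrable M (\<lambda>x. reflected_sum (\<lambda>l. min (contraction l x) A) n)"
proof -
 let ?M = "\<lambda>n x. reflected_sum (\<lambda>l. min (contraction l x) A) n"
 define B where "B = max A R1"
 have bd: "\<bar>min (contraction l x) A\<bar> \<le> B" if x: "x \<in> space M" for l x
 proof (cases "map_deriv I g ((g ^^ l) x) = 0")
  case True
  then show ?thesis using A by (simp add: contraction_def B_def)
 next
  case False
  have "(g ^^ l) x \<in> X" using x gl_in space_M by auto
  then show ?thesis using log_deriv_cut_bounds(3)[OF R1(2) R1(1) A] unfolding contraction_cut[OF False] B_def by simp
 qed
 have bM: "\<bar>?M n x\<bar> \<le> real n * B" if "x \<in> space M" for n x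
  using reflected_sum_bounds[of "\<lambda>l. min (contraction l x) A" B n] bd[OF that] by auto
 show "integrable M (?M n)" for n using bM by (intro bounded_integrable[where B = "real n * B"]) auto
 have "(\<lambda>n. \<integral>x. ?M n x / real n \<partial>M) \<longlonglongrightarrow> (\<integral>x. 0 \<partial>M)"
 proof (rule integral_dominated_convergence[where w = "\<lambda>_. B"])
  obtain B' where B': "\<And>x. x \<in> space M \<Longrightarrow> \<bar>log_deriv_cut A x\<bar> \<le> B'" using log_deriv_cut_bounded[OF A] by blast
  have bk: "AE x in M. (\<lambda>n. birkhoff_sum (log_deriv_cut A) g n x / real n) \<longlonglongrightarrow> (\<integral>x. log_deriv_cut A x \<partial>M)"
   by (rule ergodic_birkhoff[OF erg log_deriv_cut_measurable B'])
  show "AE x in M. (\<lambda>n. ?M n x / real n) \<longlonglongrightarrow> 0" using bk AE_map_deriv_nonzero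
  proof eventually_elim
   case (elim x)
   have "(\<Sum>l<n. min (contraction l x) A) = - birkhoff_sum (log_deriv_cut A) g n x" for n
    using contraction_cut[of _ x A] elim(2) by (simp add: birkhoff_sum_def sum_negf)
   then have "(\<lambda>n. (\<Sum>l<n. min (contraction l x) A) / real n) \<longlonglongrightarrow> - (\<integral>x. log_deriv_cut A x \<partial>M)"
    using tendsto_minus[OF elim(1)] by simp
   then show ?case by (rule reflected_sum_sublinear[rotated 2]) (use exponent_pos[OF A] in auto)
  qed
  show "AE x in M. norm (?M n x / real n) \<le> B" for n
  proof (rule AE_I2)
   fix x assume x: "x \<in> space M"
   have B0: "B \<ge> 0" using R1(1) by (simp add: B_def)
   show "norm (?M n x / real n) \<le> B" using bM[OF x, of n] B0 by (cases "n = 0") (auto simp: field_simps)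
  qed
 qed auto
 then show "(\<lambda>n. (\<integral>x. ?M n x \<partial>M) / real n) \<longlonglongrightarrow> 0" by simp
qed

text \<open>Cut the contractions at a level above which their mean is small: the upper part is paid
  directly, and the lower part is a reflected walk with bounded steps.\<close>

lemma deficit_sublinear:
 assumes par: "\<gamma> \<ge> 0" "2 \<le> a0" and \<theta>: "\<theta> > 0"
 shows "eventually (\<lambda>n. (\<integral>x. deficit (r - 1) \<gamma> a1 a0 (\<lambda>l. contraction l x) n \<partial>M) \<le> \<theta> * real n) sequentially"
  and "integrable M (\<lambda>x. deficit (r - 1) \<gamma> a1 a0 (\<lambda>l. contraction l x) n)"
proof -
 let ?s = "\<lambda>n x. deficit (r - 1) \<gamma> a1 a0 (\<lambda>l. contraction l x) n"
 define \<sigma> where "\<sigma> = r - 1"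
 have \<sigma>: "\<sigma> > 0" using r by (simp add: \<sigma>_def)
 let ?R = "\<lambda>A n x. real A / \<sigma> + (\<Sum>l<n. (1 + 1 / \<sigma>) * max 0 (contraction l x - real A)) + reflected_sum (\<lambda>l. min (contraction l x) (real A)) n"
 have le: "?s n x \<le> ?R A n x" for A n x
  unfolding \<sigma>_def[symmetric] by (rule deficit_le_reflected_sum) (use par \<sigma> in auto)
 have le0: "?s n x \<le> ?R 0 n x" for n x by (rule le)
 have iR: "integrable M (?R A n)" for A n using integrable_tail reflected_contraction_sublinear(2)[of "real A"] by auto
 have s0: "?s n x \<ge> 0" for n x using par by (intro deficit_nonneg) auto
 show ints: "integrable M (?s n)" for n
  by (rule Bochner_Integration.integrable_bound[OF iR[of 0 n]]) (use le0 s0 in \<open>auto intro!: AE_I2 order_trans[OF _ abs_ge_self]\<close>)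
 define \<beta> where "\<beta> = \<theta> / 3 / (1 + 1 / \<sigma>)"
 have pos: "1 + 1 / \<sigma> > 0" using \<sigma> by (simp add: add_pos_pos)
 then have "\<beta> * (1 + 1 / \<sigma>) = \<theta> / 3" unfolding \<beta>_def by (intro nonzero_eq_divide_eq[THEN iffD1]) auto
 then have \<beta>: "\<beta> > 0" "(1 + 1 / \<sigma>) * \<beta> = \<theta> / 3" using \<theta> pos by (auto simp: \<beta>_def mult.commute)
 have "eventually (\<lambda>A. (\<integral>x. max 0 (contraction 0 x - real A) \<partial>M) < \<beta>) sequentially"
  using order_tendstoD(2)[OF tail_contraction_tendsto \<beta>(1)] .
 then obtain A :: nat where A: "(\<integral>x. max 0 (contraction 0 x - real A) \<partial>M) < \<beta>" by (auto simp: eventually_sequentially)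
 have lim1: "(\<lambda>n. (real A / \<sigma>) / real n) \<longlonglongrightarrow> 0" by (rule lim_const_over_n)
 have lim2: "(\<lambda>n. (\<integral>x. reflected_sum (\<lambda>l. min (contraction l x) (real A)) n \<partial>M) / real n) \<longlonglongrightarrow> 0"
  by (rule reflected_contraction_sublinear(1)) simp
 have t3: "\<theta> / 3 > 0" using \<theta> by simp
 show "eventually (\<lambda>n. (\<integral>x. ?s n x \<partial>M) \<le> \<theta> * real n) sequentially"
  using order_tendstoD(2)[OF lim1 t3] order_tendstoD(2)[OF lim2 t3] eventually_gt_at_top[of 0]
 proof eventually_elim
  case (elim n)
  have "(\<integral>x. ?s n x \<partial>M) \<le> (\<integral>x. ?R A n x \<partial>M)" using ints iR le by (intro integral_mono) auto
  also have "\<dots> = real A / \<sigma> + (\<Sum>l<n. (1 + 1 / \<sigma>) * (\<integral>x. max 0 (contraction l x - real A) \<partial>M))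
   + (\<integral>x. reflected_sum (\<lambda>l. min (contraction l x) (real A)) n \<partial>M)"
   using integrable_tail reflected_contraction_sublinear(2)[of "real A" n] by (simp add: prob_space)
  also have "(\<Sum>l<n. (1 + 1 / \<sigma>) * (\<integral>x. max 0 (contraction l x - real A) \<partial>M)) = real n * ((1 + 1 / \<sigma>) * (\<integral>x. max 0 (contraction 0 x - real A) \<partial>M))"
   using sum_integral_contraction_comp[where f = "\<lambda>a. max 0 (a - real A)" and n = n]
   by (simp add: sum_distrib_left[symmetric])
  also have "\<dots> \<le> real n * ((1 + 1 / \<sigma>) * \<beta>)" using A \<sigma> by (intro mult_left_mono) auto
  also have "\<dots> = real n * (\<theta> / 3)" using \<beta> by simp
  finally have "(\<integral>x. ?s n x \<partial>M) \<le> real A / \<sigma> + real n * (\<theta> / 3) + (\<integral>x. reflected_sum (\<lambda>l. min (contraction l x) (real A)) n \<partial>M)" by simp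
  moreover have "real A / \<sigma> \<le> real n * (\<theta> / 3)"
  proof -
   define q where "q = real A / \<sigma>"
   have "q / real n < \<theta> / 3" using elim(1) by (simp only: q_def)
   then have "q < \<theta> / 3 * real n" using elim(3) by (simp only: pos_divide_less_eq of_nat_0_less_iff)
   then show ?thesis unfolding q_def[symmetric] by (simp only: mult.commute less_imp_le)
  qed
  moreover have "(\<integral>x. reflected_sum (\<lambda>l. min (contraction l x) (real A)) n \<partial>M) \<le> real n * (\<theta> / 3)"
   using elim by (simp add: field_simps)
  moreover have "\<theta> * real n = real n * (\<theta> / 3) + real n * (\<theta> / 3) + real n * (\<theta> / 3)" by (simp add: algebra_simps)
  ultimately show ?case by linarith
 qed
qed

end

end

section \<open>Entropy bounds through codes\<close>

text \<open>All auxiliary constants are tied to the single small number \<open>\<gamma>\<close>.\<close>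

locale coded_system = expanding_system + coding_system +
 fixes R :: real and p :: nat
 assumes R: "R \<ge> 0" and p: "p > 0" "\<And>x. x \<in> X \<Longrightarrow> \<bar>map_deriv I (g ^^ p) x\<bar> \<le> exp (real p * R)"
  and a0_large: "\<And>a. a0 \<le> a \<Longrightarrow> 1 + real p * R1 + 1 / (r - 1) + code_const \<gamma> N1 + 2 * ln (a + 2) \<le> \<gamma> * a"
   "2 * (2 + real p * R1) \<le> a0"
  and shallow_rare: "(1 / (r - 1) + code_const \<gamma> N1 + 5) *
   (\<integral>x. (if a1 \<le> contraction 0 x \<and> contraction 0 x < a0 then contraction 0 x else 0) \<partial>M) \<le> \<gamma>"
begin

text \<open>Divided by \<open>n\<close>, this is the frequency of bad times.\<close>

definition "bad_time n = (\<Sum>l<n. prob {x\<in>space M. orbit_deficit l x > 0})"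

abbreviation "shallow_part a \<equiv> (if a1 \<le> a \<and> a < a0 then a else 0)"
abbreviation "deep_part a \<equiv> (if a0 \<le> a then a else 0)"
abbreviation "bad_sum n x \<equiv> (\<Sum>l<n. if orbit_deficit l x > 0 then R + \<gamma> else 0)"
abbreviation "deep_gain l x \<equiv> (if a0 \<le> contraction l x
 then max 0 ((contraction l x - 1) / (r - 1) - orbit_deficit l x) + contraction l x - 2 - real p * R1 else 0)"
abbreviation "shallow_rate \<equiv> 1 / (r - 1) + code_const \<gamma> N1 + 5"
abbreviation "cost_bound n x \<equiv> (orbit_deficit n x + bad_sum n x) / r + (\<Sum>l<n. shallow_rate * shallow_part (contraction l x))
 + (\<Sum>l<n. \<gamma> * max 0 (contraction l x)) + real n * \<gamma>"
abbreviation "good_bound H n \<equiv> (real n - bad_time n) * H + (R + \<gamma>) / r * bad_time n + \<gamma> * (7 + R1) * real n"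
abbreviation "start_prob m l \<equiv> prob {x\<in>space M. block_start m (\<lambda>l. orbit_deficit l x) l}"
abbreviation "mean_shallow \<equiv> (\<integral>x. shallow_part (contraction 0 x) \<partial>M)"
abbreviation "mean_deep \<equiv> (\<integral>x. deep_part (contraction 0 x) \<partial>M)"

lemma r1: "r - 1 > 0" using r by simp

lemma orbit_deficit_nonneg: "orbit_deficit l x \<ge> 0" using a10 by (intro deficit_nonneg) auto

text \<open>By the chain rule, the bound on the derivative of the p-th iterate controls blocks of
  length \<open>p\<close>; an incomplete block costs at most p R1.\<close>

lemma AE_stretch: "AE x in M. \<forall>l L. (\<Sum>i<L. - contraction (l + i) x) \<le> real L * R + real p * R1"
 using AE_map_deriv_nonzero AE_space
proof eventually_elim
 case (elim x)
 have x: "x \<in> X" using elim space_M by simp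
 show ?case
 proof (intro allI)
  fix l L
  show "(\<Sum>i<L. - contraction (l + i) x) \<le> real L * R + real p * R1"
  proof (rule sum_le_of_block_bound)
   show "- contraction i x \<le> R1" for i
   proof -
    have "\<bar>map_deriv I g ((g ^^ i) x)\<bar> \<le> exp R1" using R1(2) gl_in[OF x] by blast
    then have "ln \<bar>map_deriv I g ((g ^^ i) x)\<bar> \<le> R1" using elim(1) by (intro ln_le_of_le_exp) auto
    then show ?thesis by (simp add: contraction_def)
   qed
   show "(\<Sum>i<p. - contraction (l + i) x) \<le> real p * R" for l
   proof -
    let ?y = "(g ^^ l) x"
    have y: "?y \<in> X" using gl_in[OF x] by blast
    have nz: "map_deriv I g ((g ^^ i) ?y) \<noteq> 0" for i using elim(1)[rule_format, of "i + l"] by (simp add: funpow_add)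
    have "(\<Sum>i<p. - contraction (l + i) x) = (\<Sum>i<p. ln \<bar>map_deriv I g ((g ^^ i) ?y)\<bar>)"
    proof (rule sum.cong[OF refl])
     fix i
     have "(g ^^ (l + i)) x = (g ^^ i) ?y" by (metis add.commute comp_apply funpow_add)
     then show "- contraction (l + i) x = ln \<bar>map_deriv I g ((g ^^ i) ?y)\<bar>" by (simp add: contraction_def)
    qed
    also have "\<dots> = ln (\<Prod>i<p. \<bar>map_deriv I g ((g ^^ i) ?y)\<bar>)" using nz by (intro ln_prod[symmetric]) auto
    also have "(\<Prod>i<p. \<bar>map_deriv I g ((g ^^ i) ?y)\<bar>) = \<bar>map_deriv I (g ^^ p) ?y\<bar>"
     using map_deriv_funpow[OF g r y, of p] by (simp add: abs_prod)
    also have "ln \<dots> \<le> real p * R"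
    proof -
     have "\<bar>map_deriv I (g ^^ p) ?y\<bar> > 0" using nz map_deriv_funpow[OF g r y, of p] by simp
     then show ?thesis using p(2)[OF y] by (rule ln_le_of_le_exp)
    qed
    finally show ?thesis .
   qed
  qed (use p R R1 in auto)
 qed
qed

lemma AE_deep_sum: "AE x in M. \<forall>n.
 (\<Sum>l<n. deep_gain l x)
  \<le> orbit_deficit n x + bad_sum n x
   + (\<Sum>l<n. shallow_part (contraction l x))" using AE_stretch
proof eventually_elim
 case (elim x)
 show ?case
 proof
  fix n
  have "(\<Sum>l<n. deep_gain l x)
   \<le> orbit_deficit n x + bad_sum n x
    + (\<Sum>l<n. if a1 \<le> contraction l x \<and> contraction l x < a0 then 2 else 0)"
   by (rule deep_sum_le) (use elim a10 \<gamma> R R1 r1 in auto)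
  also have "(\<Sum>l<n. if a1 \<le> contraction l x \<and> contraction l x < a0 then 2 else 0) \<le> (\<Sum>l<n. shallow_part (contraction l x))"
   using a10 by (intro sum_mono) auto
  finally show "(\<Sum>l<n. deep_gain l x)
   \<le> orbit_deficit n x + bad_sum n x
    + (\<Sum>l<n. shallow_part (contraction l x))" by simp
 qed
qed

text \<open>Here the factor 1 / r arises. For the logarithmic cell count c one has (r - 1) * c \<le>
  a - 1, that is, c \<le> (c + a - 1) / r. Constants and logarithms stay below \<gamma> a because
  \<open>a0\<close> is large.\<close>

lemma deep_cost_le:
 assumes a: "a0 \<le> a" and s: "s \<ge> 0"
 shows "max 0 ((a - 1) / (r - 1) - s) + 1 / (r - 1) + code_const \<gamma> N1 + 2 * ln (a + 2)
  \<le> (max 0 ((a - 1) / (r - 1) - s) + a - 2 - real p * R1) / r + \<gamma> * a"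
proof -
 define c where "c = max 0 ((a - 1) / (r - 1) - s)"
 have "c \<le> (a - 1) / (r - 1)" using a a10 s r1 by (auto simp: c_def)
 then have "(r - 1) * c \<le> a - 1" using r1 by (simp add: field_simps)
 then have "r * c \<le> c + a - 1" by (simp add: algebra_simps)
 then have "c \<le> (c + a - 1) / r" using r by (simp add: field_simps)
 also have "\<dots> = (c + a - 2 - real p * R1) / r + (1 + real p * R1) / r" by (simp add: add_divide_distrib[symmetric])
 also have "(1 + real p * R1) / r \<le> (1 + real p * R1) / 1" using r R1 by (intro divide_left_mono) auto
 finally have "c \<le> (c + a - 2 - real p * R1) / r + (1 + real p * R1)" by simp
 then show ?thesis using a0_large(1)[OF a] unfolding c_def by linarith
qed

lemma shallow_cost_le:
 assumes a: "a1 \<le> a"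
 shows "a / (r - 1) + code_const \<gamma> N1 + 2 * ln (a + 2) \<le> (1 / (r - 1) + code_const \<gamma> N1 + 4) * a"
proof -
 have a2: "a \<ge> 2" using a a10 by simp
 have "ln (a + 2) \<le> a + 2 - 1" using a2 by (intro ln_le_minus_one) auto
 then have "2 * ln (a + 2) \<le> 4 * a" using a2 by linarith
 moreover have "code_const \<gamma> N1 * 1 \<le> code_const \<gamma> N1 * a"
  using a2 code_const_nonneg[OF \<gamma>] by (intro mult_left_mono) auto
 ultimately show ?thesis by (simp add: algebra_simps)
qed

text \<open>The costs of deep contractions are an r-th part of the deficit they create. What does
  not survive in the final deficit has been repaid at rate at most R + \<gamma> per bad time; all
  other contributions are small errors.\<close>

lemma AE_sum_orbit_cost: "AE x in M. \<forall>n. (\<Sum>l<n. orbit_cost (r - 1) \<gamma> a1 a0 (\<gamma> / 2) (code_const \<gamma> N1) (\<lambda>l. contraction l x) l)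
 \<le> cost_bound n x" using AE_deep_sum
proof eventually_elim
 case (elim x)
 show ?case
 proof
  fix n
  let ?c = "\<lambda>l. orbit_cost (r - 1) \<gamma> a1 a0 (\<gamma> / 2) (code_const \<gamma> N1) (\<lambda>l. contraction l x) l"
  let ?d = "\<lambda>l. deep_gain l x"
  let ?C = "1 / (r - 1) + code_const \<gamma> N1 + 4"
  have "?c l \<le> ?d l / r + ?C * shallow_part (contraction l x) + \<gamma> * max 0 (contraction l x) + \<gamma>" for l
  proof -
   define a where "a = contraction l x"
   define C where "C = 1 / (r - 1) + code_const \<gamma> N1 + 4"
   define s where "s = orbit_deficit l x"
   have s: "s \<ge> 0" unfolding s_def by (rule orbit_deficit_nonneg)
   consider "a0 \<le> a" | "a1 \<le> a" "\<not> a0 \<le> a" | "\<not> a1 \<le> a" by blast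
   then have "(if a1 \<le> a then (if a0 \<le> a then max 0 ((a - 1) / (r - 1) - s) + 1 / (r - 1) else a / (r - 1))
     + code_const \<gamma> N1 + 2 * ln (a + 2) else 2 * (\<gamma> / 2))
    \<le> (if a \<ge> a0 then max 0 ((a - 1) / (r - 1) - s) + a - 2 - real p * R1 else 0) / r
     + C * shallow_part a + \<gamma> * max 0 a + \<gamma>"
   proof cases
    case 1
    then show ?thesis using deep_cost_le[OF 1 s] \<gamma> a10 by auto
   next
    case 2
    define q where "q = \<gamma> * max 0 a"
    have "q \<ge> 0" using \<gamma> by (simp add: q_def)
    then show ?thesis using 2 shallow_cost_le[OF 2(1)] \<gamma> unfolding C_def[symmetric] q_def[symmetric] by simp
   next
    case 3
    have "\<gamma> * max 0 a \<ge> 0" using \<gamma> by simp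
    then show ?thesis using 3 \<gamma> a10 by auto
   qed
   then show ?thesis unfolding orbit_cost_def a_def C_def s_def .
  qed
  then have "(\<Sum>l<n. ?c l) \<le> (\<Sum>l<n. ?d l / r + ?C * shallow_part (contraction l x) + \<gamma> * max 0 (contraction l x) + \<gamma>)"
   by (intro sum_mono)
  also have "\<dots> = (\<Sum>l<n. ?d l) / r + (\<Sum>l<n. ?C * shallow_part (contraction l x)) + (\<Sum>l<n. \<gamma> * max 0 (contraction l x)) + real n * \<gamma>"
   by (simp add: sum.distrib sum_divide_distrib)
  also have "(\<Sum>l<n. ?d l) / r \<le> (orbit_deficit n x + bad_sum n x + (\<Sum>l<n. shallow_part (contraction l x))) / r"
   using elim r by (intro divide_right_mono) auto
  also have "\<dots> = (orbit_deficit n x + bad_sum n x) / r + (\<Sum>l<n. shallow_part (contraction l x)) / r"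
   by (simp add: add_divide_distrib)
  also have "(\<Sum>l<n. shallow_part (contraction l x)) / r \<le> (\<Sum>l<n. shallow_part (contraction l x)) / 1"
   using r a10 by (intro divide_left_mono sum_nonneg) auto
  finally have "(\<Sum>l<n. ?c l) \<le> (orbit_deficit n x + bad_sum n x) / r
   + ((\<Sum>l<n. ?C * shallow_part (contraction l x)) + (\<Sum>l<n. shallow_part (contraction l x)))
   + (\<Sum>l<n. \<gamma> * max 0 (contraction l x)) + real n * \<gamma>" by simp
  also have "(\<Sum>l<n. ?C * shallow_part (contraction l x)) + (\<Sum>l<n. shallow_part (contraction l x))
   = (\<Sum>l<n. shallow_rate * shallow_part (contraction l x))"
   unfolding sum.distrib[symmetric] by (intro sum.cong) (auto simp: algebra_simps)
  finally show "(\<Sum>l<n. ?c l) \<le> cost_bound n x" .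
 qed
qed

lemma integrable_deep: "integrable M (\<lambda>x. deep_part (contraction l x))"
 and integrable_shallow: "integrable M (\<lambda>x. shallow_part (contraction l x))"
 and integrable_pos: "integrable M (\<lambda>x. max 0 (contraction l x))"
proof -
 note I = integrable_pos_contraction[OF R1]
 show "integrable M (\<lambda>x. max 0 (contraction l x))" by (rule integrable_contraction_comp[OF _ I]) measurable
 have [measurable]: "deep_part \<in> borel_measurable borel" "shallow_part \<in> borel_measurable borel" by measurable
 show "integrable M (\<lambda>x. deep_part (contraction l x))"
  by (rule integrable_contraction_comp[where f = "\<lambda>a. deep_part a"]) (measurable, rule Bochner_Integration.integrable_bound[OF I], use a10 in auto)
 show "integrable M (\<lambda>x. shallow_part (contraction l x))"
  by (rule integrable_contraction_comp[where f = "\<lambda>a. shallow_part a"]) (measurable, rule Bochner_Integration.integrable_bound[OF I], use a10 in auto)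
qed

lemma shallow_small: "mean_shallow \<le> \<gamma>"
proof -
 have "0 \<le> mean_shallow" using a10 by (intro integral_nonneg_AE) auto
 moreover have "1 / (r - 1) \<ge> 0" using r1 by simp
 ultimately have "1 * mean_shallow \<le> shallow_rate * mean_shallow"
  using code_const_nonneg[OF \<gamma>, of N1] by (intro mult_right_mono) linarith+
 then show ?thesis using shallow_rare by linarith
qed

lemma integral_bad_sum: "(\<integral>x. (\<Sum>l<n. if orbit_deficit l x > 0 then c else 0) \<partial>M) = c * bad_time n"
 and integrable_bad_sum: "integrable M (\<lambda>x. \<Sum>l<n. if orbit_deficit l x > 0 then c else (0 :: real))"
proof -
 have eq: "(if orbit_deficit l x > 0 then c else 0) = c * indicator {x\<in>space M. orbit_deficit l x > 0} x" if "x \<in> space M" for l x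
  using that by simp
 have int: "integrable M (\<lambda>x. if orbit_deficit l x > 0 then c else 0)" for l
  by (rule bounded_integrable[where B = "\<bar>c\<bar>"]) auto
 then show "integrable M (\<lambda>x. \<Sum>l<n. if orbit_deficit l x > 0 then c else (0 :: real))" by auto
 have "(\<integral>x. (if orbit_deficit l x > 0 then c else 0) \<partial>M) = c * prob {x\<in>space M. orbit_deficit l x > 0}" for l
  by (subst Bochner_Integration.integral_cong[OF refl eq]) (auto simp: Int_absorb1)
 then show "(\<integral>x. (\<Sum>l<n. if orbit_deficit l x > 0 then c else 0) \<partial>M) = c * bad_time n"
  using int by (simp add: bad_time_def sum_distrib_left)
qed

text \<open>A deep contraction creates a deficit of at least half its size, constants included, and
  this has to be repaid in bad time. Rare bad times therefore leave little room for deep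
  contractions.\<close>

lemma deep_time_le: "eventually (\<lambda>n. real n * mean_deep
 \<le> 4 * \<gamma> * real n + 2 * (R + \<gamma>) * bad_time n) sequentially" using deficit_sublinear(1)[OF R1, of \<gamma> a0 \<gamma> a1]
proof (rule eventually_mono)
 fix n assume n: "expectation (orbit_deficit n) \<le> \<gamma> * real n"
 have s: "integrable M (orbit_deficit n)" using a10 \<gamma> by (intro deficit_sublinear(2)[OF R1]) auto
 have "(\<integral>x. (\<Sum>l<n. deep_part (contraction l x) / 2) \<partial>M)
  \<le> (\<integral>x. orbit_deficit n x + bad_sum n x + (\<Sum>l<n. shallow_part (contraction l x)) \<partial>M)"
 proof (rule integral_mono_AE)
  show "AE x in M. (\<Sum>l<n. deep_part (contraction l x) / 2) \<le> orbit_deficit n x + bad_sum n x + (\<Sum>l<n. shallow_part (contraction l x))"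
   using AE_deep_sum
  proof eventually_elim
   case (elim x)
   have "(\<Sum>l<n. deep_part (contraction l x) / 2) \<le> (\<Sum>l<n. deep_gain l x)"
   proof (rule sum_mono)
    fix l
    show "deep_part (contraction l x) / 2 \<le> deep_gain l x"
    proof (cases "a0 \<le> contraction l x")
     case True
     define q where "q = max 0 ((contraction l x - 1) / (r - 1) - orbit_deficit l x)"
     define w where "w = real p * R1"
     have "q \<ge> 0" by (simp add: q_def)
     then show ?thesis using a0_large(2) True unfolding q_def[symmetric] w_def[symmetric] by simp
    qed simp
   qed
   then show ?case using elim[rule_format, of n] by linarith
  qed
 qed (use integrable_deep integrable_shallow integrable_bad_sum s in auto)
 also have "\<dots> = expectation (orbit_deficit n) + (R + \<gamma>) * bad_time n + (\<Sum>l<n. \<integral>x. shallow_part (contraction l x) \<partial>M)"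
  using integrable_shallow integrable_bad_sum s by (simp add: integral_bad_sum)
 also have "(\<Sum>l<n. \<integral>x. shallow_part (contraction l x) \<partial>M) = real n * mean_shallow"
  by (rule sum_integral_contraction_comp) measurable
 also have "\<dots> \<le> real n * \<gamma>" using shallow_small by (intro mult_left_mono) auto
 also have "(\<integral>x. (\<Sum>l<n. deep_part (contraction l x) / 2) \<partial>M) = (\<Sum>l<n. \<integral>x. deep_part (contraction l x) \<partial>M) / 2"
  using integrable_deep by (simp add: sum_divide_distrib)
 also have "(\<Sum>l<n. \<integral>x. deep_part (contraction l x) \<partial>M) = real n * mean_deep"
  by (rule sum_integral_contraction_comp) measurable
 finally show "real n * mean_deep \<le> 4 * \<gamma> * real n + 2 * (R + \<gamma>) * bad_time n" using n by (simp add: algebra_simps)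
qed (use \<gamma> a10 in auto)

text \<open>Almost every orbit avoids the zeros of the derivative, so for fixed \<open>n\<close> the
  derivatives up to time \<open>n\<close> have a positive lower bound. The level \<open>A\<close> is
  chosen after \<open>n\<close>.\<close>

lemma deep_orbits_negligible:
 assumes \<eta>: "\<eta> > 0"
 obtains A :: nat where "prob (space M - shallow_orbits A n) < \<eta>"
proof -
 let ?S = "\<lambda>A. shallow_orbits A n"
 have dec: "decseq (\<lambda>A. space M - ?S A)"
 proof (rule decseq_SucI)
  fix A
  have "exp (- real (Suc A)) \<le> exp (- real A)" by simp
  then have "?S A \<subseteq> ?S (Suc A)" unfolding shallow_orbits_def by (blast intro: order_trans)
  then show "space M - ?S (Suc A) \<subseteq> space M - ?S A" by blast
 qed
 have "AE x in M. x \<notin> (\<Inter>A. space M - ?S A)" using AE_map_deriv_nonzero AE_space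
 proof eventually_elim
  case (elim x)
  define b where "b = Min (insert 1 ((\<lambda>l. \<bar>map_deriv I g ((g ^^ l) x)\<bar>) ` {..<n}))"
  have b: "b > 0" using elim(1) by (auto simp: b_def)
  obtain A :: nat where A: "- ln b \<le> real A" using real_arch_simple by blast
  have "exp (- real A) \<le> exp (ln b)" using A by simp
  then have "exp (- real A) \<le> b" using b by simp
  moreover have "b \<le> \<bar>map_deriv I g ((g ^^ l) x)\<bar>" if "l < n" for l unfolding b_def using that by (intro Min_le) auto
  ultimately have "x \<in> ?S A" using elim(2) unfolding shallow_orbits_def space_M by force
  then show ?case by blast
 qed
 then have "prob (\<Inter>A. space M - ?S A) = 0" by (subst prob_eq_0) measurable
 moreover have "(\<lambda>A. prob (space M - ?S A)) \<longlonglongrightarrow> prob (\<Inter>A. space M - ?S A)"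
  using dec by (intro finite_Lim_measure_decseq) auto
 ultimately have "(\<lambda>A. prob (space M - ?S A)) \<longlonglongrightarrow> 0" by simp
 then have "eventually (\<lambda>A. prob (space M - ?S A) < \<eta>) sequentially" using \<eta> by (rule order_tendstoD(2))
 then show ?thesis using that by (auto simp: eventually_sequentially)
qed

lemma integrable_deficit: "integrable M (orbit_deficit n)" using a10 \<gamma> by (intro deficit_sublinear(2)[OF R1]) auto

text \<open>Everything except \<open>W\<close> has been paid here: bad time at rate (R + \<gamma>) /
  r, the rest at a multiple of \<gamma>. The quantifier over \<open>W\<close> stands inside the
  limit in \<open>n\<close>, because the codes to be inserted depend on \<open>n\<close>.\<close>

lemma names_entropy_le_code:
 assumes Q: "simple_function M Q"
 shows "eventually (\<lambda>n. \<forall>W :: complex \<Rightarrow> 'w. simple_function M W \<longrightarrow>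
  (\<forall>x\<in>X. \<forall>y\<in>X. \<forall>l\<le>n. W x = W y \<longrightarrow> orbit_deficit l x = 0 \<longrightarrow> dist ((g ^^ l) x) ((g ^^ l) y) \<le> \<epsilon>) \<longrightarrow>
  ent M (names Q g n) \<le> ent M W + \<gamma> * (3 + R1) * real n + (R + \<gamma>) / r * bad_time n) sequentially"
proof -
 \<comment> \<open>Four errors of this size add up to \<gamma>: comparison of itineraries, orbits
   given up, final deficit, and sublinear terms.\<close>
 define \<eta> where "\<eta> = \<gamma> / 4"
 have \<eta>: "\<eta> > 0" using \<gamma> by (simp add: \<eta>_def)
 obtain e :: real where e: "e > 0"
  "\<And>n (F :: complex \<Rightarrow> ((bool \<times> 'w \<times> int) \<times> (nat \<times> int \<times> nat \<times> nat) option list) \<times> int list) E.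
   simple_function M F \<Longrightarrow> E \<in> sets M \<Longrightarrow>
    (\<And>x y i. x \<in> E \<Longrightarrow> y \<in> E \<Longrightarrow> F x = F y \<Longrightarrow> i < n \<Longrightarrow> dist ((g ^^ i) x) ((g ^^ i) y) < e) \<Longrightarrow>
    ent M (names Q g n) \<le> ent M F + n * \<eta> + ln 2
     + prob (space M - E) * n * ln (real (card (Q ` space M)))"
  by (rule names_entropy_le_dynamical_cells[OF prob_space_axioms borel_prob_onD(2)[OF M] points_borel g_measurable g_distr Q \<eta>]) blast
 define q where "q = ln (real (card (Q ` space M)))"
 have q: "q \<ge> 0"
 proof -
  have "card (Q ` space M) > 0" using Q not_empty by (auto simp: simple_function_def card_gt_0_iff)
  then show ?thesis by (simp add: q_def Suc_le_eq)
 qed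
 define w where "w n = ln 2 + ln (2 / \<epsilon> + 2) + ln (real n * (7 * \<epsilon> / e + 2) + 1) + ln 2" for n
 have "(\<lambda>n. w n / real n) \<longlonglongrightarrow> 0"
 proof -
  have "7 * \<epsilon> / e + 2 > 0" using \<epsilon> e by (simp add: add_pos_pos)
  then show ?thesis unfolding w_def by real_asymp
 qed
 then have w: "eventually (\<lambda>n. w n / real n < \<eta>) sequentially" using \<eta> by (rule order_tendstoD(2))
 have s: "eventually (\<lambda>n. expectation (orbit_deficit n) \<le> \<eta> * real n) sequentially"
  using \<gamma> a10 \<eta> by (intro deficit_sublinear(1)[OF R1]) auto
 show ?thesis using w s eventually_gt_at_top[of 0]
 proof eventually_elim
  case (elim n)
  have wn: "w n \<le> \<eta> * real n" using elim(1,3) by (simp add: field_simps)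
  show ?case
  proof (intro allI impI)
   fix W :: "complex \<Rightarrow> 'w"
   assume W: "simple_function M W"
    and Wc: "\<forall>x\<in>X. \<forall>y\<in>X. \<forall>l\<le>n. W x = W y \<longrightarrow> orbit_deficit l x = 0 \<longrightarrow> dist ((g ^^ l) x) ((g ^^ l) y) \<le> \<epsilon>"
   \<comment> \<open>The 1 covers the case that \<open>Q\<close> has a single value and
     \<open>q\<close> is 0.\<close>
   have "\<eta> / (q + 1) > 0" using \<eta> q by simp
   then obtain A where A: "prob (space M - shallow_orbits A n) < \<eta> / (q + 1)" by (rule deep_orbits_negligible)
   let ?E = "shallow_orbits A n" and ?c = "code_cost A n"
   have Wc': "dist ((g ^^ l) x) ((g ^^ l) y) \<le> \<epsilon>" if "x \<in> X" "y \<in> X" "W x = W y" "l \<le> n" "orbit_deficit l x = 0" for x y l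
    using Wc that by blast
   obtain F :: "complex \<Rightarrow> ((bool \<times> 'w \<times> int) \<times> (nat \<times> int \<times> nat \<times> nat) option list) \<times> int list" where
    F: "simple_function M F"
     "\<And>x y i. x \<in> ?E \<Longrightarrow> y \<in> ?E \<Longrightarrow> F x = F y \<Longrightarrow> i < n \<Longrightarrow> dist ((g ^^ i) x) ((g ^^ i) y) < e"
     "ent M F \<le> ent M W + ln 2 + ln (2 / \<epsilon> + 2) + (\<Sum>l<n. \<integral>x. ?c l x \<partial>M) + ln (real n * (7 * \<epsilon> / e + 2) + 1)"
    by (rule fine_code[OF W Wc' e(1), where A = A]) (assumption | rule that)+
   note int_c = integrable_code_cost[of _ n A]
   have "(\<Sum>l<n. \<integral>x. ?c l x \<partial>M) = (\<integral>x. (\<Sum>l<n. ?c l x) \<partial>M)" using int_c by (simp add: Bochner_Integration.integral_sum)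
   also have "\<dots> \<le> (\<integral>x. cost_bound n x \<partial>M)"
   proof (rule integral_mono_AE)
    show "AE x in M. (\<Sum>l<n. ?c l x) \<le> cost_bound n x" using AE_sum_orbit_cost AE_space
    proof eventually_elim
     case (elim x)
     have "(\<Sum>l<n. ?c l x) \<le> (\<Sum>l<n. orbit_cost (r - 1) \<gamma> a1 a0 (\<gamma> / 2) (code_const \<gamma> N1) (\<lambda>l. contraction l x) l)"
      using code_cost_le_orbit_cost elim(2) space_M by (intro sum_mono) auto
     then show ?case using elim(1)[rule_format, of n] by linarith
    qed
    show "integrable M (\<lambda>x. \<Sum>l<n. ?c l x)" using int_c by auto
   qed (use integrable_shallow integrable_bad_sum integrable_pos integrable_deficit in auto)
   also have "\<dots> = (expectation (orbit_deficit n) + (R + \<gamma>) * bad_time n) / r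
    + (\<Sum>l<n. shallow_rate * (\<integral>x. shallow_part (contraction l x) \<partial>M))
    + (\<Sum>l<n. \<gamma> * (\<integral>x. max 0 (contraction l x) \<partial>M)) + real n * \<gamma>"
    using integrable_shallow integrable_bad_sum[of "R + \<gamma>" n] integrable_pos integrable_deficit
    by (simp add: integral_bad_sum prob_space)
   also have "(\<Sum>l<n. shallow_rate * (\<integral>x. shallow_part (contraction l x) \<partial>M))
    = real n * (shallow_rate * mean_shallow)"
    unfolding sum_distrib_left[symmetric] by (subst sum_integral_contraction_comp) auto
   also have "\<dots> \<le> real n * \<gamma>" using shallow_rare by (intro mult_left_mono) auto
   also have "(\<Sum>l<n. \<gamma> * (\<integral>x. max 0 (contraction l x) \<partial>M)) = real n * (\<gamma> * (\<integral>x. max 0 (contraction 0 x) \<partial>M))"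
    unfolding sum_distrib_left[symmetric] by (subst sum_integral_contraction_comp) auto
   also have "\<dots> \<le> real n * (\<gamma> * R1)" using integral_pos_contraction[OF R1] \<gamma> by (intro mult_left_mono) auto
   also have "(expectation (orbit_deficit n) + (R + \<gamma>) * bad_time n) / r = expectation (orbit_deficit n) / r + (R + \<gamma>) / r * bad_time n"
    by (subst add_divide_distrib) simp
   also have "expectation (orbit_deficit n) / r \<le> expectation (orbit_deficit n) / 1"
    using r orbit_deficit_nonneg by (intro divide_left_mono integral_nonneg_AE) auto
   also have "\<dots> \<le> \<eta> * real n" using elim(2) by simp
   finally have cost: "(\<Sum>l<n. \<integral>x. ?c l x \<partial>M) \<le> \<eta> * real n + (R + \<gamma>) / r * bad_time n + real n * \<gamma> + real n * (\<gamma> * R1) + real n * \<gamma>" by simp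
   have "ent M (names Q g n) \<le> ent M F + n * \<eta> + ln 2 + prob (space M - ?E) * n * q"
    unfolding q_def by (rule e(2)[OF F(1) shallow_orbits_sets F(2)])
   moreover have "prob (space M - ?E) * n * q \<le> \<eta> * real n"
   proof -
    have "prob (space M - ?E) * (q + 1) \<le> \<eta>" using A q by (simp add: field_simps)
    moreover have "prob (space M - ?E) * q \<le> prob (space M - ?E) * (q + 1)" by (intro mult_left_mono) auto
    ultimately have "prob (space M - ?E) * q \<le> \<eta>" by linarith
    then have "prob (space M - ?E) * q * real n \<le> \<eta> * real n" by (rule mult_right_mono) simp
    then show ?thesis by (simp add: algebra_simps)
   qed
   moreover have "\<gamma> * (3 + R1) * real n = 4 * (\<eta> * real n) + real n * \<gamma> + real n * (\<gamma> * R1) + real n * \<gamma>"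
    by (simp add: \<eta>_def algebra_simps)
   ultimately show "ent M (names Q g n) \<le> ent M W + \<gamma> * (3 + R1) * real n + (R + \<gamma>) / r * bad_time n"
    using cost F(3) wn unfolding w_def by (simp add: mult.commute)
  qed
 qed
qed

end

lemma block_counter_measurable [measurable]:
 fixes s :: "nat \<Rightarrow> 'a \<Rightarrow> real"
 assumes [measurable]: "\<And>l. s l \<in> borel_measurable M"
 shows "(\<lambda>x. block_counter m (\<lambda>l. s l x) l) \<in> measurable M (count_space UNIV)" by (induction l) simp_all

lemma block_start_measurable [measurable]:
 fixes s :: "nat \<Rightarrow> 'a \<Rightarrow> real"
 assumes [measurable]: "\<And>l. s l \<in> borel_measurable M"
 shows "Measurable.pred M (\<lambda>x. block_start m (\<lambda>l. s l x) l)" unfolding block_start_def by measurable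

context coded_system
begin

lemma deep_prob_le: "a0 * prob {x\<in>space M. contraction l x \<ge> a0} \<le> R1"
proof -
 have "a0 * prob {x\<in>space M. contraction l x \<ge> a0} = (\<integral>x. a0 * indicator {x\<in>space M. contraction l x \<ge> a0} x \<partial>M)"
  by (simp add: Int_absorb1)
 also have "\<dots> \<le> (\<integral>x. max 0 (contraction l x) \<partial>M)"
 proof (rule integral_mono)
  show "integrable M (\<lambda>x. a0 * indicator {x\<in>space M. contraction l x \<ge> a0} x)" by (simp add: emeasure_eq_measure)
 qed (use a10 integrable_pos in \<open>auto simp: indicator_def\<close>)
 also have "\<dots> = (\<integral>x. max 0 (contraction 0 x) \<partial>M)" by (rule integral_contraction_comp) measurable
 also have "\<dots> \<le> R1" by (rule integral_pos_contraction[OF R1])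
 finally show ?thesis .
qed

lemma bad_time_Suc: "bad_time n \<le> bad_time (Suc n)" by (simp add: bad_time_def)

lemma bad_time_bounds: "0 \<le> bad_time n" "bad_time n \<le> real n"
proof -
 show "0 \<le> bad_time n" by (auto simp: bad_time_def intro: sum_nonneg)
 have "bad_time n \<le> (\<Sum>l<n. 1)" unfolding bad_time_def by (intro sum_mono) auto
 then show "bad_time n \<le> real n" by simp
qed

text \<open>The expectation of the count along orbits; by Markov's inequality a deep contraction has
  probability at most R1 / a0 at each time.\<close>

lemma expected_block_starts:
 assumes m: "m > 0"
 shows "(\<Sum>l<n. start_prob m l)
  \<le> (real n - bad_time n) / real m + real n * R1 / a0 + 1"
proof -
 let ?st = "\<lambda>l. {x\<in>space M. block_start m (\<lambda>l. orbit_deficit l x) l}"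
 let ?bad = "\<lambda>l. {x\<in>space M. orbit_deficit l x > 0}"
 let ?deep = "\<lambda>l. {x\<in>space M. contraction l x \<ge> a0}"
 have [measurable]: "?st l \<in> sets M" "?bad l \<in> sets M" "?deep l \<in> sets M" for l by measurable
 let ?F = "\<lambda>l x. real m * indicator (?st l) x - (1 - indicator (?bad l) x) - real m * indicator (?deep l) x"
 have int: "integrable M (?F l)" for l by (auto simp: emeasure_eq_measure)
 have F: "(\<integral>x. ?F l x \<partial>M) = real m * prob (?st l) - (1 - prob (?bad l)) - real m * prob (?deep l)" for l
  by (simp add: emeasure_eq_measure prob_space Int_absorb1)
 have "(\<Sum>l<n. real m * prob (?st l) - (1 - prob (?bad l)) - real m * prob (?deep l)) = (\<integral>x. (\<Sum>l<n. ?F l x) \<partial>M)"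
  unfolding F[symmetric] by (rule Bochner_Integration.integral_sum[symmetric]) (rule int)
 also have "\<dots> \<le> (\<integral>x. real m \<partial>M)"
 proof (rule integral_mono)
  fix x assume x: "x \<in> space M"
  have "(\<Sum>l<n. if block_start m (\<lambda>l. orbit_deficit l x) l then real m else 0)
   \<le> (\<Sum>l<n. if orbit_deficit l x = 0 then 1 else 0) + (\<Sum>l<n. if contraction l x \<ge> a0 then real m else 0) + real m"
   using m a10 by (intro card_block_starts) auto
  moreover have "?F l x = (if block_start m (\<lambda>l. orbit_deficit l x) l then real m else 0)
   - (if orbit_deficit l x = 0 then 1 else 0) - (if contraction l x \<ge> a0 then real m else 0)" for l
   using orbit_deficit_nonneg[where l = l and x = x] x by (auto simp: indicator_def)
  ultimately show "(\<Sum>l<n. ?F l x) \<le> real m" by (simp only: sum_subtractf)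
 qed (intro Bochner_Integration.integrable_sum int, simp)
 finally have "real m * (\<Sum>l<n. prob (?st l)) \<le> (real n - bad_time n) + real m * (\<Sum>l<n. prob (?deep l)) + real m"
  by (simp add: prob_space sum_subtractf sum_distrib_left bad_time_def)
 moreover have "(\<Sum>l<n. prob (?deep l)) \<le> (\<Sum>l<n. R1 / a0)"
  using deep_prob_le a10 by (intro sum_mono) (simp add: field_simps)
 then have "real m * (\<Sum>l<n. prob (?deep l)) \<le> real m * (real n * R1 / a0)" by (intro mult_left_mono) auto
 moreover have "real m * ((real n - bad_time n) / real m + real n * R1 / a0 + 1) = (real n - bad_time n) + real m * (real n * R1 / a0) + real m"
 proof -
  have "real m * ((real n - bad_time n) / real m) = real n - bad_time n" using m by simp
  then show ?thesis by (simp only: distrib_left mult_1_right)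
 qed
 ultimately have "real m * (\<Sum>l<n. prob (?st l)) \<le> real m * ((real n - bad_time n) / real m + real n * R1 / a0 + 1)" by linarith
 then show ?thesis using m by (simp only: mult_le_cancel_left_pos of_nat_0_less_iff)
qed

text \<open>The index of a Bowen ball of length \<open>m\<close> is recorded at each block start and
  nothing at other times. Giving starts the weight \<gamma> / 2 makes each of the other times cost
  at most \<gamma>. Two orbits with the same index are within \<epsilon> because each is within
  \<epsilon> / 2 of the common centre.\<close>

lemma block_code:
 fixes E :: "'e set" and c :: "nat \<Rightarrow> 'e \<Rightarrow> complex"
 assumes m: "m > 0" and E: "finite E" "\<And>x. x \<in> X \<Longrightarrow> \<exists>y\<in>E. \<forall>i<m. dist ((g ^^ i) x) (c i y) \<le> \<epsilon> / 2"
 obtains W :: "complex \<Rightarrow> unit \<times> nat option list" where "simple_function M W"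
  "\<And>x y l. x \<in> X \<Longrightarrow> y \<in> X \<Longrightarrow> l < n \<Longrightarrow> W x = W y \<Longrightarrow> orbit_deficit l x = 0 \<Longrightarrow> dist ((g ^^ l) x) ((g ^^ l) y) \<le> \<epsilon>"
  "ent M W \<le> real n * \<gamma> + (ln (real (card E)) - ln (\<gamma> / 2)) * (\<Sum>l<n. start_prob m l)"
proof -
 let ?st = "\<lambda>l x. block_start m (\<lambda>l. orbit_deficit l x) l"
 have [measurable]: "Measurable.pred M (?st l)" for l by measurable
 obtain F :: "complex \<Rightarrow> nat" and z where F: "simple_function M F" "\<And>x. x \<in> X \<Longrightarrow> F x < card E"
  "\<And>x i. x \<in> X \<Longrightarrow> i < m \<Longrightarrow> dist ((g ^^ i) x) (c i (z (F x))) \<le> \<epsilon> / 2"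
  by (rule simple_function_spanning_index[OF prob_space_axioms borel_prob_onD(2)[OF M] g_measurable E]) blast+
 define Z where "Z l x = (if ?st l x then Some (F ((g ^^ l) x)) else None)" for l x
 have sZ: "simple_function M (Z l)" for l
 proof -
  have "simple_function M (?st l)" by (rule simple_function_of_finite_range) auto
  moreover have "simple_function M (\<lambda>x. F ((g ^^ l) x))" using F(1) gl_measurable by (rule simple_function_comp)
  ultimately have "simple_function M (\<lambda>x. (?st l x, F ((g ^^ l) x)))" by (rule simple_function_Pair)
  then show ?thesis by (rule simple_function_kernel) (auto simp: Z_def)
 qed
 have s0: "simple_function M (\<lambda>x. ())" by simp
 define W where "W = hist (\<lambda>x. ()) Z n"
 define N where "N = card E"
 obtain x0 where x0: "x0 \<in> X" using not_empty space_M by auto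
 have N: "N > 0" using F(2)[OF x0] by (simp add: N_def)
 define q where "q (l :: nat) (y :: unit \<times> nat option list) zz = (case zz of None \<Rightarrow> 1 - \<gamma> / 2 | Some j \<Rightarrow> if j < N then \<gamma> / 2 / real N else 0)" for l y zz
 have q0: "q l y zz \<ge> 0" for l y zz using \<gamma> by (auto simp: q_def split: option.split)
 have ZN: "Z l x \<in> insert None (Some ` {..<N})" if "x \<in> X" for l x using F(2) gl_in[OF that] by (auto simp: Z_def N_def)
 have qZ: "q l y (Z l x) = (if ?st l x then \<gamma> / 2 / real N else 1 - \<gamma> / 2)" if "x \<in> space M" for l y x
  using F(2)[of "(g ^^ l) x"] gl_in[of x l] that space_M by (auto simp: q_def Z_def N_def)
 show ?thesis
 proof (rule that[of W])
  show "simple_function M W" unfolding W_def using s0 sZ by (rule simple_function_hist)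
  show "dist ((g ^^ l) x) ((g ^^ l) y) \<le> \<epsilon>" if xy: "x \<in> X" "y \<in> X" "l < n" "W x = W y" "orbit_deficit l x = 0" for x y l
  proof -
   obtain i where i: "i < m" "i \<le> l" "?st (l - i) x" using good_time_covered[where s = "\<lambda>l. orbit_deficit l x" and l = l, OF m] xy(5) by blast
   have "Z (l - i) x = Z (l - i) y" using xy i by (auto simp: W_def hist_eq_iff)
   then have eq: "F ((g ^^ (l - i)) x) = F ((g ^^ (l - i)) y)" using i(3) by (auto simp: Z_def split: if_splits)
   have gg: "(g ^^ i) ((g ^^ (l - i)) w) = (g ^^ l) w" for w
    using i(2) by (metis comp_apply funpow_add le_add_diff_inverse)
   have "dist ((g ^^ i) ((g ^^ (l - i)) x)) (c i (z (F ((g ^^ (l - i)) x)))) \<le> \<epsilon> / 2"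
    "dist ((g ^^ i) ((g ^^ (l - i)) y)) (c i (z (F ((g ^^ (l - i)) x)))) \<le> \<epsilon> / 2"
    using F(3)[OF gl_in[OF xy(1), of "l - i"] i(1)] F(3)[OF gl_in[OF xy(2), of "l - i"] i(1)] unfolding eq by auto
   then show ?thesis unfolding gg using dist_triangle2[of "(g ^^ l) x" "(g ^^ l) y" "c i (z (F ((g ^^ (l - i)) x)))"] by linarith
  qed
  have "ent M W \<le> ent M (\<lambda>x. ()) + (\<Sum>l<n. \<integral>x. - ln (q l (hist (\<lambda>x. ()) Z l x) (Z l x)) \<partial>M)" unfolding W_def
  proof (rule ent_hist[OF s0 sZ q0])
   show "q l (hist (\<lambda>x. ()) Z l x) (Z l x) > 0" if "x \<in> space M" for l x using qZ[OF that] \<gamma> N by simp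
   show "(\<Sum>zz\<in>Z l ` (hist (\<lambda>x. ()) Z l -` {hist (\<lambda>x. ()) Z l x} \<inter> space M). q l (hist (\<lambda>x. ()) Z l x) zz) \<le> 1" for l x
   proof -
    have "(\<Sum>zz\<in>Z l ` (hist (\<lambda>x. ()) Z l -` {hist (\<lambda>x. ()) Z l x} \<inter> space M). q l (hist (\<lambda>x. ()) Z l x) zz)
     \<le> (\<Sum>zz\<in>insert None (Some ` {..<N}). q l (hist (\<lambda>x. ()) Z l x) zz)" using ZN space_M q0 by (intro sum_mono2) auto
    also have "\<dots> = 1" using N by (subst sum.insert) (auto simp: q_def sum.reindex)
    finally show ?thesis .
   qed
  qed
  also have "(\<Sum>l<n. \<integral>x. - ln (q l (hist (\<lambda>x. ()) Z l x) (Z l x)) \<partial>M)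
   \<le> (\<Sum>l<n. \<integral>x. \<gamma> + (ln (real N) - ln (\<gamma> / 2)) * indicator {x\<in>space M. ?st l x} x \<partial>M)"
  proof (intro sum_mono integral_mono)
   show "integrable M (\<lambda>x. - ln (q l (hist (\<lambda>x. ()) Z l x) (Z l x)))" for l
   proof -
    have "simple_function M (\<lambda>x. (hist (\<lambda>x. ()) Z l x, Z l x))" using s0 sZ by (intro simple_function_Pair simple_function_hist)
    then have "integrable M (\<lambda>x. (\<lambda>w. - ln (q l (fst w) (snd w))) (hist (\<lambda>x. ()) Z l x, Z l x))" by (rule integral_simple_function(1))
    then show ?thesis by simp
   qed
   show "integrable M (\<lambda>x. \<gamma> + (ln (real N) - ln (\<gamma> / 2)) * indicator {x\<in>space M. ?st l x} x)" for l
    by (auto simp: emeasure_eq_measure)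
   fix l x assume x: "x \<in> space M"
   have ln1: "- ln (1 - \<gamma> / 2) \<le> \<gamma>" using minus_ln_one_minus_le[of "\<gamma> / 2"] \<gamma> by simp
   have ln2: "- ln (\<gamma> / 2 / real N) = ln (real N) - ln (\<gamma> / 2)" using \<gamma> N by (subst ln_div) auto
   show "- ln (q l (hist (\<lambda>x. ()) Z l x) (Z l x)) \<le> \<gamma> + (ln (real N) - ln (\<gamma> / 2)) * indicator {x\<in>space M. ?st l x} x"
    unfolding qZ[OF x] using x ln1 ln2 \<gamma> by (cases "?st l x") (simp_all only: if_True if_False, auto)
  qed
  also have "\<dots> = real n * \<gamma> + (ln (real N) - ln (\<gamma> / 2)) * (\<Sum>l<n. prob {x\<in>space M. ?st l x})"
   by (simp add: prob_space sum.distrib sum_distrib_left Int_absorb1 emeasure_eq_measure)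
  finally show "ent M W \<le> real n * \<gamma> + (ln (real (card E)) - ln (\<gamma> / 2)) * (\<Sum>l<n. prob {x\<in>space M. ?st l x})"
   by (simp add: N_def)
 qed
qed

text \<open>Good times are coded by orbit blocks of length \<open>m\<close> of the limit map, of which there are about \<open>exp (m H)\<close>.\<close>

lemma names_entropy_le_good_time:
 fixes E :: "'e set" and c :: "nat \<Rightarrow> 'e \<Rightarrow> complex"
 assumes Q: "simple_function M Q"
  and m: "m > 0" and E: "finite E" "\<And>x. x \<in> X \<Longrightarrow> \<exists>y\<in>E. \<forall>i<m. dist ((g ^^ i) x) (c i y) \<le> \<epsilon> / 2"
  and H: "H \<ge> 0" "real (card E) \<le> exp (real m * H)"
  and m_large: "- ln (\<gamma> / 2) \<le> \<gamma> * real m" and a0_m: "R1 * (real m * (H + \<gamma>)) \<le> \<gamma> * a0"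
 shows "eventually (\<lambda>n. ent M (names Q g n) \<le> good_bound H n) sequentially"
proof -
 define L where "L = real m * (H + \<gamma>)"
 have L0: "L \<ge> 0" using H \<gamma> by (simp add: L_def)
 have "card E > 0"
 proof -
  obtain x0 where "x0 \<in> X" using not_empty space_M by auto
  then show ?thesis using E by (auto simp: card_gt_0_iff)
 qed
 then have "ln (real (card E)) \<le> real m * H" using H(2) by (intro ln_le_of_le_exp) auto
 then have lnE: "ln (real (card E)) - ln (\<gamma> / 2) \<le> L" using m_large by (simp add: L_def algebra_simps)
 define K where "K = 3 * \<gamma> + H + L"
 have "(\<lambda>n. K / real n) \<longlonglongrightarrow> 0" by (rule lim_const_over_n)
 then have "eventually (\<lambda>n. K / real n < \<gamma>) sequentially" using \<gamma>(1) by (rule order_tendstoD(2))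
 with names_entropy_le_code[OF Q, where 'w = "unit \<times> nat option list"] eventually_gt_at_top[of 0]
 show ?thesis
 proof eventually_elim
  case (elim n)
  have Kn: "K \<le> \<gamma> * real n" using elim(2,3) by (simp add: field_simps)
  \<comment> \<open>\<open>Suc n\<close>, since closeness is needed up to time \<open>n\<close>
    inclusive.\<close>
  obtain W :: "complex \<Rightarrow> unit \<times> nat option list" where W: "simple_function M W"
   "\<And>x y l. x \<in> X \<Longrightarrow> y \<in> X \<Longrightarrow> l < Suc n \<Longrightarrow> W x = W y \<Longrightarrow> orbit_deficit l x = 0 \<Longrightarrow> dist ((g ^^ l) x) ((g ^^ l) y) \<le> \<epsilon>"
   "ent M W \<le> real (Suc n) * \<gamma> + (ln (real (card E)) - ln (\<gamma> / 2)) * (\<Sum>l<Suc n. start_prob m l)"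
   by (rule block_code[OF m E, where n = "Suc n"]) blast+
  define T where "T = (\<Sum>l<Suc n. start_prob m l)"
  have T0: "T \<ge> 0" unfolding T_def by (intro sum_nonneg) auto
  have names: "ent M (names Q g n) \<le> ent M W + \<gamma> * (3 + R1) * real n + (R + \<gamma>) / r * bad_time n"
   using elim(1)[rule_format, of W] W(1,2) by (auto simp: less_Suc_eq_le)
  have "ent M W \<le> real (Suc n) * \<gamma> + L * T"
   using W(3) lnE T0 unfolding T_def[symmetric] by (smt (verit) mult_right_mono)
  \<comment> \<open>A full block costs \<open>L\<close>, that is H + \<gamma> per good time; the
    blocks cut short by deep contractions cost at most R1 L / a0 \<le> \<gamma> per time
    step.\<close>
  also have "L * T \<le> L * ((real (Suc n) - bad_time (Suc n)) / real m + real (Suc n) * R1 / a0 + 1)"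
   unfolding T_def using expected_block_starts[OF m, of "Suc n"] L0 by (rule mult_left_mono)
  also have "\<dots> = (H + \<gamma>) * (real (Suc n) - bad_time (Suc n)) + real (Suc n) * (R1 * L / a0) + L"
   using m by (simp add: L_def field_simps)
  also have "(H + \<gamma>) * (real (Suc n) - bad_time (Suc n)) \<le> (H + \<gamma>) * (real (Suc n) - bad_time n)"
   using H \<gamma> bad_time_Suc[of n] by (intro mult_left_mono) auto
  also have "\<dots> \<le> H * (real n - bad_time n) + H + \<gamma> * real (Suc n)"
   using \<gamma> bad_time_bounds(1)[of n] by (simp add: algebra_simps)
  also have "real (Suc n) * (R1 * L / a0) \<le> real (Suc n) * \<gamma>"
   using a0_m a10 unfolding L_def by (intro mult_left_mono) (auto simp: field_simps)
  finally have "ent M W \<le> H * (real n - bad_time n) + 3 * \<gamma> * real n + K" by (simp add: K_def algebra_simps)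
  then show ?case using names Kn by (simp add: algebra_simps)
 qed
qed

text \<open>Here \<open>W\<close> is the itinerary for \<open>P\<close>, whose entropy is reduced by
  subadditivity to blocks of a fixed length \<open>m\<close>, a quantity that can pass to weak
  limits.\<close>

lemma names_entropy_le_partition:
 fixes P :: "complex \<Rightarrow> 'c" and Q :: "complex \<Rightarrow> 'q"
 assumes Q: "simple_function M Q" and P: "simple_function M P"
  "\<And>x y. x \<in> X \<Longrightarrow> y \<in> X \<Longrightarrow> P x = P y \<Longrightarrow> dist x y < \<epsilon>" and m: "m > 0"
 shows "eventually (\<lambda>n. ent M (names Q g n) \<le> real n * (ent M (names P g m) / real m) + (R + \<gamma>) * bad_time n
  + \<gamma> * (4 + R1) * real n) sequentially"
proof -
 obtain C where C: "\<And>n. ent M (names P g n) \<le> real n * (ent M (names P g m) / real m) + C"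
  using ent_names_bound[OF g_measurable g_distr P(1) m] by blast
 define K where "K = ent M (names P g m) / real m + C"
 have "(\<lambda>n. K / real n) \<longlonglongrightarrow> 0" by (rule lim_const_over_n)
 then have "eventually (\<lambda>n. K / real n < \<gamma>) sequentially" using \<gamma>(1) by (rule order_tendstoD(2))
 with names_entropy_le_code[OF Q, where 'w = "'c list"] eventually_gt_at_top[of 0]
 show ?thesis
 proof eventually_elim
  case (elim n)
  have Kn: "K \<le> \<gamma> * real n" using elim(2,3) by (simp add: field_simps)
  have "ent M (names Q g n) \<le> ent M (names P g (Suc n)) + \<gamma> * (3 + R1) * real n + (R + \<gamma>) / r * bad_time n"
  proof (rule elim(1)[rule_format])
   show "simple_function M (names P g (Suc n))" using g_measurable P(1) by (rule simple_function_names)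
   fix x y l assume "x \<in> X" "y \<in> X" "l \<le> n" "names P g (Suc n) x = names P g (Suc n) y"
   then show "dist ((g ^^ l) x) ((g ^^ l) y) \<le> \<epsilon>"
    using P(2)[OF gl_in[of x l] gl_in[of y l]] by (simp add: names_eq_iff less_Suc_eq_le less_imp_le)
  qed
  moreover have "ent M (names P g (Suc n)) \<le> real n * (ent M (names P g m) / real m) + K"
  proof -
   define v where "v = ent M (names P g m) / real m"
   show ?thesis using C[of "Suc n"] unfolding K_def v_def[symmetric] by (simp add: distrib_right)
  qed
  moreover have "(R + \<gamma>) / r * bad_time n \<le> (R + \<gamma>) / 1 * bad_time n"
   using r R \<gamma> bad_time_bounds(1)[of n] by (intro mult_right_mono divide_left_mono) auto
  moreover have "\<gamma> * (4 + R1) * real n = \<gamma> * (3 + R1) * real n + \<gamma> * real n" by (simp add: algebra_simps)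
  ultimately show ?case using Kn by simp
 qed
qed

text \<open>Each bad time lowers the upper bound for the entropy by at least \<delta>, so entropy
  close to \<open>H\<close> forces bad times to be rare. This is read off at the infinitely many
  \<open>n\<close> at which the itineraries of a nearly optimal \<open>Q\<close> have large entropy;
  at such \<open>n\<close> the estimates for deep contractions and for \<open>P\<close> are
  evaluated.\<close>

theorem entropy_near_maximal:
 fixes E :: "'e set" and c :: "nat \<Rightarrow> 'e \<Rightarrow> complex"
 assumes m: "m > 0" and E: "finite E" "\<And>x. x \<in> X \<Longrightarrow> \<exists>y\<in>E. \<forall>i<m. dist ((g ^^ i) x) (c i y) \<le> \<epsilon> / 2"
  and H: "H \<ge> 0" "real (card E) \<le> exp (real m * H)"
  and m_large: "- ln (\<gamma> / 2) \<le> \<gamma> * real m" and a0_m: "R1 * (real m * (H + \<gamma>)) \<le> \<gamma> * a0"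
  and ent: "ereal (H - 3 * \<gamma>) < metric_entropy g M" and \<delta>: "\<delta> > 0" "(R + \<gamma>) / r + \<delta> \<le> H"
 shows "mean_deep \<le> 4 * \<gamma> + 2 * (R + \<gamma>) * (\<gamma> * (10 + R1) / \<delta>)"
  and "\<And>P m'. simple_function M P \<Longrightarrow> (\<And>x y. x \<in> X \<Longrightarrow> y \<in> X \<Longrightarrow> P x = P y \<Longrightarrow> dist x y < \<epsilon>) \<Longrightarrow> m' > 0 \<Longrightarrow>
   H - 3 * \<gamma> \<le> ent M (names (P :: complex \<Rightarrow> 'b) g m') / real m' + (R + \<gamma>) * (\<gamma> * (10 + R1) / \<delta>) + \<gamma> * (4 + R1)"
proof -
 obtain Q :: "complex \<Rightarrow> complex set" where Q: "simple_function M Q"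
  "ereal (H - 3 * \<gamma>) < limsup (\<lambda>n. ereal (ent M (names Q g n) / real n))"
  by (rule metric_entropy_greaterE[OF g_measurable ent])
 have freq: "frequently (\<lambda>n. ereal (H - 3 * \<gamma>) < ereal (ent M (names Q g n) / real n)) sequentially"
  unfolding frequently_def not_less
 proof
  assume "eventually (\<lambda>n. ereal (ent M (names Q g n) / real n) \<le> ereal (H - 3 * \<gamma>)) sequentially"
  then have "limsup (\<lambda>n. ereal (ent M (names Q g n) / real n)) \<le> ereal (H - 3 * \<gamma>)" by (rule Limsup_bounded)
  then show False using Q(2) by simp
 qed
 \<comment> \<open>10 = 7 + 3: the error in \<open>good_bound\<close> and the distance 3 \<gamma>
   from \<open>H\<close>.\<close>
 define b where "b = \<gamma> * (10 + R1) / \<delta>"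
 have key: "bad_time n \<le> b * real n"
  if n: "n > 0" "H - 3 * \<gamma> < ent M (names Q g n) / real n"
   and up: "ent M (names Q g n) \<le> good_bound H n" for n
 proof -
  have "(H - 3 * \<gamma>) * real n \<le> ent M (names Q g n)" using n by (simp add: field_simps)
  then have "(H - (R + \<gamma>) / r) * bad_time n \<le> \<gamma> * (10 + R1) * real n" using up by (simp add: algebra_simps)
  moreover have "\<delta> * bad_time n \<le> (H - (R + \<gamma>) / r) * bad_time n"
   using \<delta> bad_time_bounds(1) by (intro mult_right_mono) auto
  ultimately have "\<delta> * bad_time n \<le> \<gamma> * (10 + R1) * real n" by linarith
  then show ?thesis using \<delta>(1) by (simp add: b_def field_simps)
 qed
 have upper: "eventually (\<lambda>n. ent M (names Q g n) \<le> good_bound H n) sequentially"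
  by (rule names_entropy_le_good_time[OF Q(1) m E H m_large a0_m])
 note ev = upper eventually_gt_at_top[of 0]
 show "mean_deep \<le> 4 * \<gamma> + 2 * (R + \<gamma>) * (\<gamma> * (10 + R1) / \<delta>)"
 proof -
  have "frequently (\<lambda>n. (H - 3 * \<gamma> < ent M (names Q g n) / real n) \<and>
   (ent M (names Q g n) \<le> good_bound H n \<and> n > 0 \<and>
   real n * mean_deep \<le> 4 * \<gamma> * real n + 2 * (R + \<gamma>) * bad_time n)) sequentially"
   by (rule frequently_rev_mp[OF freq], use ev deep_time_le in eventually_elim) simp
  then obtain n where n: "n > 0" "H - 3 * \<gamma> < ent M (names Q g n) / real n"
   "ent M (names Q g n) \<le> good_bound H n"
   "real n * mean_deep \<le> 4 * \<gamma> * real n + 2 * (R + \<gamma>) * bad_time n" by (auto dest: frequently_ex)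
  note n(4)
  also have "2 * (R + \<gamma>) * bad_time n \<le> 2 * (R + \<gamma>) * (b * real n)"
   using key[OF n(1-3)] R \<gamma> by (intro mult_left_mono) auto
  also have "4 * \<gamma> * real n + 2 * (R + \<gamma>) * (b * real n) = real n * (4 * \<gamma> + 2 * (R + \<gamma>) * b)" by (simp add: algebra_simps)
  finally show ?thesis using n(1) unfolding b_def[symmetric] by (simp only: mult_le_cancel_left_pos of_nat_0_less_iff)
 qed
 fix P :: "complex \<Rightarrow> 'b" and m' :: nat
 assume P: "simple_function M P" "\<And>x y. x \<in> X \<Longrightarrow> y \<in> X \<Longrightarrow> P x = P y \<Longrightarrow> dist x y < \<epsilon>" "m' > 0"
 have lower: "eventually (\<lambda>n. ent M (names Q g n) \<le> real n * (ent M (names P g m') / real m') + (R + \<gamma>) * bad_time n + \<gamma> * (4 + R1) * real n) sequentially"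
  using Q(1) P by (rule names_entropy_le_partition)
 have "frequently (\<lambda>n. (H - 3 * \<gamma> < ent M (names Q g n) / real n) \<and>
   (ent M (names Q g n) \<le> good_bound H n \<and> n > 0 \<and>
   ent M (names Q g n) \<le> real n * (ent M (names P g m') / real m') + (R + \<gamma>) * bad_time n + \<gamma> * (4 + R1) * real n)) sequentially"
  by (rule frequently_rev_mp[OF freq], use ev lower in eventually_elim) simp
 then obtain n where n: "n > 0" "H - 3 * \<gamma> < ent M (names Q g n) / real n"
  "ent M (names Q g n) \<le> good_bound H n"
  "ent M (names Q g n) \<le> real n * (ent M (names P g m') / real m') + (R + \<gamma>) * bad_time n + \<gamma> * (4 + R1) * real n"
  by (auto dest: frequently_ex)
 have "real n * (H - 3 * \<gamma>) \<le> ent M (names Q g n)" using n(1,2) by (simp add: field_simps)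
 also note n(4)
 also have "(R + \<gamma>) * bad_time n \<le> (R + \<gamma>) * (b * real n)" using key[OF n(1-3)] R \<gamma> by (intro mult_left_mono) auto
 finally have "real n * (H - 3 * \<gamma>) \<le> real n * (ent M (names P g m') / real m' + (R + \<gamma>) * b + \<gamma> * (4 + R1))" by (simp add: algebra_simps)
 then show "H - 3 * \<gamma> \<le> ent M (names P g m') / real m' + (R + \<gamma>) * (\<gamma> * (10 + R1) / \<delta>) + \<gamma> * (4 + R1)"
  using n(1) unfolding b_def[symmetric] by (simp only: mult_le_cancel_left_pos of_nat_0_less_iff)
qed

end

section \<open>Lyapunov exponents\<close>

lemma ennreal_integral_le_nn_integral:
 fixes f :: "'a \<Rightarrow> real"
 assumes f: "integrable M f"
 shows "ennreal (\<integral>x. f x \<partial>M) \<le> (\<integral>\<^sup>+ x. ennreal (f x) \<partial>M)"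
proof -
 have i: "integrable M (\<lambda>x. max 0 (f x))" using f by simp
 have "(\<integral>x. f x \<partial>M) \<le> (\<integral>x. max 0 (f x) \<partial>M)" using f i by (rule integral_mono) simp
 then have "ennreal (\<integral>x. f x \<partial>M) \<le> ennreal (\<integral>x. max 0 (f x) \<partial>M)" by (rule ennreal_leI)
 also have "\<dots> = (\<integral>\<^sup>+ x. ennreal (max 0 (f x)) \<partial>M)" using i by (intro nn_integral_eq_integral[symmetric]) auto
 finally show ?thesis by (simp only: ennreal_max_0)
qed

text \<open>Cancellation in the presence of infinite values: \<open>p\<close> is finite, so
  \<open>n\<close> and \<open>q\<close> are infinite together.\<close>

lemma ereal_diff_eq_of_ennreal_sum:
 assumes "p + q = ennreal R + n" "p \<le> ennreal R" "R \<ge> 0"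
 shows "enn2ereal p - enn2ereal n = ereal R - enn2ereal q"
proof -
 have "p \<noteq> top" using assms(2) by (auto simp: top_unique)
 then obtain p' where p: "p = ennreal p'" "p' \<ge> 0" by (cases p) auto
 show ?thesis
 proof (cases n)
  case (real n')
  have "q \<noteq> top"
  proof
   assume "q = top"
   then have "ennreal R + ennreal n' = top" using assms(1) real by simp
   then show False by simp
  qed
  then obtain q' where q: "q = ennreal q'" "q' \<ge> 0" by (cases q) auto
  have "p' + q' = R + n'" using assms(1,3) p q real by (simp flip: ennreal_plus)
  then show ?thesis using p q real by simp
 next
  case top
  then have "q = top" using assms(1) p by (cases q) (auto simp flip: ennreal_plus)
  then show ?thesis using top p by (simp add: enn2ereal_top)
 qed
qed

context one_dim_system
begin

lemma log_abs_le_cut: "log_abs (map_deriv I g x) \<le> ereal (log_deriv_cut A x)"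
 by (auto simp: log_abs_def log_deriv_cut_def less_max_iff_disj)

lemma log_abs_map_deriv_measurable [measurable]: "(\<lambda>x. log_abs (map_deriv I g x)) \<in> borel_measurable M"
 unfolding log_abs_def by measurable

lemma lyapunov_at_measurable [measurable]: "lyapunov_at I g \<in> borel_measurable M"
proof -
 show ?thesis unfolding lyapunov_at_def [abs_def] by measurable
qed

lemma nn_integral_comp_funpow:
 assumes [measurable]: "f \<in> borel_measurable M"
 shows "(\<integral>\<^sup>+ x. f ((g ^^ i) x) \<partial>M) = (\<integral>\<^sup>+ x. f x \<partial>M)"
proof -
 have "(\<integral>\<^sup>+ x. f ((g ^^ i) x) \<partial>M) = integral\<^sup>N (distr M M (g ^^ i)) f"
  using gl_measurable by (intro nn_integral_distr[symmetric]) auto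
 then show ?thesis by (simp add: distr_funpow[OF g_measurable g_distr])
qed

lemma log_deriv_cut_integral_bounds:
 assumes "A \<ge> 0" and R1: "R1 \<ge> 0" "\<And>x. x \<in> X \<Longrightarrow> \<bar>map_deriv I g x\<bar> \<le> exp R1"
 shows "integrable M (log_deriv_cut A)" "(\<integral>x. log_deriv_cut A x \<partial>M) \<le> R1"
proof -
 show i: "integrable M (log_deriv_cut A)" by (rule bounded_integrable[where B = "max A R1"])
   (use log_deriv_cut_bounds(3)[OF R1(2) R1(1) assms(1)] space_M in auto)
 have "(\<integral>x. log_deriv_cut A x \<partial>M) \<le> (\<integral>x. R1 \<partial>M)"
  using i log_deriv_cut_bounds(2)[OF R1(2) R1(1) assms(1)] space_M by (intro integral_mono) auto
 then show "(\<integral>x. log_deriv_cut A x \<partial>M) \<le> R1" by (simp add: prob_space)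
qed

text \<open>Subtraction from \<open>R1\<close> makes the functions nonnegative. One inequality is
  Fatou's lemma for the averages, whose integrals are at most that of \<open>V\<close>. The other
  compares with truncated averages, whose upper limit integrates to at most the integral of the
  truncation. This takes the place of the ergodic theorem for a logarithm that may not be integrable
  and a measure that may not be ergodic.\<close>

lemma nn_integral_lyapunov_at:
 assumes R1: "R1 \<ge> 0" "\<And>x. x \<in> X \<Longrightarrow> \<bar>map_deriv I g x\<bar> \<le> exp R1"
 shows "(\<integral>\<^sup>+ x. e2ennreal (ereal R1 - lyapunov_at I g x) \<partial>M)
  = (SUP A::nat. ennreal (R1 - (\<integral>x. log_deriv_cut (real A) x \<partial>M)))"
proof (rule antisym)
 define V where "V x = e2ennreal (ereal R1 - log_abs (map_deriv I g x))" for x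
 have [measurable]: "V \<in> borel_measurable M" unfolding V_def [abs_def] by measurable
 have Vn: "V x = ennreal (R1 - ln \<bar>map_deriv I g x\<bar>)" if "map_deriv I g x \<noteq> 0" for x
  using that by (simp add: V_def log_abs_def)
 have V0: "V x = top" if "map_deriv I g x = 0" for x using that by (simp add: V_def log_abs_def)
 have Vsup: "V x = (SUP A::nat. ennreal (R1 - log_deriv_cut (real A) x))" if x: "x \<in> X" for x
 proof (cases "map_deriv I g x = 0")
  case True
  have "(SUP A::nat. ennreal (R1 - log_deriv_cut (real A) x)) = top"
  proof (rule ennreal_SUP_eq_top)
   fix n :: nat
   have "log_deriv_cut (real n) x = - real n" using True by (simp add: log_deriv_cut_def)
   then have "real n \<le> R1 - log_deriv_cut (real n) x" using R1(1) by simp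
   then show "\<exists>i\<in>UNIV. of_nat n \<le> ennreal (R1 - log_deriv_cut (real i) x)"
    using ennreal_leI by (fastforce simp: ennreal_of_nat_eq_real_of_nat)
  qed
  then show ?thesis by (simp only: V0[OF True])
 next
  case False
  show ?thesis
  proof (rule antisym)
   obtain A :: nat where A: "- ln \<bar>map_deriv I g x\<bar> \<le> real A" using real_arch_simple by blast
   then have "exp (- real A) \<le> exp (ln \<bar>map_deriv I g x\<bar>)" by simp
   then have "exp (- real A) \<le> \<bar>map_deriv I g x\<bar>" using False by simp
   then have "log_deriv_cut (real A) x = ln \<bar>map_deriv I g x\<bar>" by (simp add: log_deriv_cut_def max_def)
   then show "V x \<le> (SUP A::nat. ennreal (R1 - log_deriv_cut (real A) x))"
    using Vn[OF False] by (intro SUP_upper2[of A]) auto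
   have "ln \<bar>map_deriv I g x\<bar> \<le> log_deriv_cut (real A) x" for A :: nat
    using log_abs_le_cut[of x "real A"] False by (simp add: log_abs_def)
   then show "(SUP A::nat. ennreal (R1 - log_deriv_cut (real A) x)) \<le> V x"
    unfolding Vn[OF False] by (intro SUP_least ennreal_leI) simp
  qed
 qed
 have intV: "(\<integral>\<^sup>+ x. V x \<partial>M) = (SUP A::nat. ennreal (R1 - (\<integral>x. log_deriv_cut (real A) x \<partial>M)))"
 proof -
  have "(\<integral>\<^sup>+ x. V x \<partial>M) = (\<integral>\<^sup>+ x. (SUP A::nat. ennreal (R1 - log_deriv_cut (real A) x)) \<partial>M)"
   using Vsup space_M by (intro nn_integral_cong) auto
  also have "\<dots> = (SUP A::nat. \<integral>\<^sup>+ x. ennreal (R1 - log_deriv_cut (real A) x) \<partial>M)"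
  proof (rule nn_integral_monotone_convergence_SUP)
   show "incseq (\<lambda>A x. ennreal (R1 - log_deriv_cut (real A) x))"
   proof (rule incseq_SucI, rule le_funI, rule ennreal_leI)
    fix A x
    have "log_deriv_cut (real (Suc A)) x \<le> log_deriv_cut (real A) x"
     unfolding log_deriv_cut_def by (subst ln_le_cancel_iff) (auto simp: less_max_iff_disj max.coboundedI2)
    then show "R1 - log_deriv_cut (real A) x \<le> R1 - log_deriv_cut (real (Suc A)) x" by simp
   qed
  qed measurable
  also have "\<dots> = (SUP A::nat. ennreal (R1 - (\<integral>x. log_deriv_cut (real A) x \<partial>M)))"
  proof (rule SUP_cong[OF refl])
   fix A :: nat
   have i: "integrable M (log_deriv_cut (real A))" using R1 by (intro log_deriv_cut_integral_bounds) auto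
   have "(\<integral>\<^sup>+ x. ennreal (R1 - log_deriv_cut (real A) x) \<partial>M) = ennreal (\<integral>x. R1 - log_deriv_cut (real A) x \<partial>M)"
    using i log_deriv_cut_bounds(2)[OF R1(2) R1(1)] space_M by (intro nn_integral_eq_integral) auto
   then show "(\<integral>\<^sup>+ x. ennreal (R1 - log_deriv_cut (real A) x) \<partial>M) = ennreal (R1 - (\<integral>x. log_deriv_cut (real A) x \<partial>M))"
    using i by (simp add: prob_space)
  qed
  finally show ?thesis .
 qed
 define S where "S n x = (\<Sum>i<n. log_abs (map_deriv I g ((g ^^ i) x))) / ereal (real n)" for n x
 have [measurable]: "S n \<in> borel_measurable M" for n unfolding S_def [abs_def] by measurable
 have lim: "e2ennreal (ereal R1 - lyapunov_at I g x) = liminf (\<lambda>n. e2ennreal (ereal R1 - S n x))" for x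
 proof -
  have "ereal R1 - lyapunov_at I g x = ereal R1 + liminf (\<lambda>n. - S n x)"
   unfolding lyapunov_at_def S_def[symmetric] ereal_Liminf_uminus by (simp add: minus_ereal_def)
  also have "\<dots> = liminf (\<lambda>n. ereal R1 + (- S n x))" by (rule Liminf_add_ereal_left[symmetric]) auto
  finally have "e2ennreal (ereal R1 - lyapunov_at I g x) = e2ennreal (liminf (\<lambda>n. ereal R1 - S n x))" by (simp add: minus_ereal_def)
  also have "\<dots> = liminf (\<lambda>n. e2ennreal (ereal R1 - S n x))"
   by (rule Liminf_compose_continuous_mono[symmetric]) (auto intro: continuous_on_e2ennreal simp: mono_def e2ennreal_mono)
  finally show ?thesis .
 qed
 have Sn: "(\<integral>\<^sup>+ x. e2ennreal (ereal R1 - S n x) \<partial>M) \<le> (\<integral>\<^sup>+ x. V x \<partial>M)" if n: "n > 0" for n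
 proof -
  have "(\<integral>\<^sup>+ x. e2ennreal (ereal R1 - S n x) \<partial>M) \<le> (\<integral>\<^sup>+ x. (\<Sum>i<n. ennreal (1 / real n) * V ((g ^^ i) x)) \<partial>M)"
  proof (rule nn_integral_mono)
   fix x assume "x \<in> space M"
   then have x: "x \<in> X" by (simp add: space_M)
   show "e2ennreal (ereal R1 - S n x) \<le> (\<Sum>i<n. ennreal (1 / real n) * V ((g ^^ i) x))"
   proof (cases "\<exists>i<n. map_deriv I g ((g ^^ i) x) = 0")
    case True
    then obtain i where i: "i < n" "map_deriv I g ((g ^^ i) x) = 0" by auto
    have "top = ennreal (1 / real n) * V ((g ^^ i) x)" using V0[OF i(2)] n by (simp add: ennreal_mult_top)
    also have "\<dots> \<le> (\<Sum>i<n. ennreal (1 / real n) * V ((g ^^ i) x))" using i(1) by (intro member_le_sum) auto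
    finally have "(\<Sum>i<n. ennreal (1 / real n) * V ((g ^^ i) x)) = top" by (simp only: top_unique)
    then show ?thesis by (simp only: top_greatest)
   next
    case False
    let ?l = "\<lambda>i. ln \<bar>map_deriv I g ((g ^^ i) x)\<bar>"
    have le: "?l i \<le> R1" if "i < n" for i using False that R1(2)[OF gl_in[OF x, of i]] by (intro ln_le_of_le_exp) auto
    have "(\<Sum>i<n. log_abs (map_deriv I g ((g ^^ i) x))) = (\<Sum>i<n. ereal (?l i))"
     using False by (intro sum.cong) (auto simp: log_abs_def)
    then have "S n x = ereal ((\<Sum>i<n. ?l i) / real n)" using n by (simp add: S_def)
    then have "e2ennreal (ereal R1 - S n x) = ennreal (R1 - (\<Sum>i<n. ?l i) / real n)" by simp
    also have "R1 - (\<Sum>i<n. ?l i) / real n = (\<Sum>i<n. 1 / real n * (R1 - ?l i))"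
     using n by (simp add: sum_distrib_left[symmetric] sum_subtractf sum_divide_distrib[symmetric] diff_divide_distrib)
    also have "ennreal \<dots> = (\<Sum>i<n. ennreal (1 / real n * (R1 - ?l i)))" using le by (intro sum_ennreal[symmetric]) simp
    also have "\<dots> = (\<Sum>i<n. ennreal (1 / real n) * V ((g ^^ i) x))"
     using False le by (intro sum.cong refl) (subst ennreal_mult, auto simp: Vn)
    finally show ?thesis by simp
   qed
  qed
  also have "\<dots> = (\<Sum>i<n. ennreal (1 / real n) * (\<integral>\<^sup>+ x. V ((g ^^ i) x) \<partial>M))"
   by (simp add: nn_integral_sum nn_integral_cmult)
  also have "\<dots> = ennreal (real n) * ennreal (1 / real n) * (\<integral>\<^sup>+ x. V x \<partial>M)"
   by (simp add: nn_integral_comp_funpow ennreal_of_nat_eq_real_of_nat mult.assoc)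
  also have "ennreal (real n) * ennreal (1 / real n) = 1" using n by (simp flip: ennreal_mult)
  finally show ?thesis by simp
 qed
 have "(\<integral>\<^sup>+ x. e2ennreal (ereal R1 - lyapunov_at I g x) \<partial>M) = (\<integral>\<^sup>+ x. liminf (\<lambda>n. e2ennreal (ereal R1 - S n x)) \<partial>M)"
  by (simp add: lim)
 also have "\<dots> \<le> liminf (\<lambda>n. \<integral>\<^sup>+ x. e2ennreal (ereal R1 - S n x) \<partial>M)" by (rule nn_integral_liminf) measurable
 also have "\<dots> \<le> limsup (\<lambda>n. \<integral>\<^sup>+ x. e2ennreal (ereal R1 - S n x) \<partial>M)" by (rule Liminf_le_Limsup) simp
 also have "\<dots> \<le> (\<integral>\<^sup>+ x. V x \<partial>M)" using Sn by (intro Limsup_bounded eventually_mono[OF eventually_gt_at_top[of 0]]) auto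
 finally show "(\<integral>\<^sup>+ x. e2ennreal (ereal R1 - lyapunov_at I g x) \<partial>M) \<le> (SUP A::nat. ennreal (R1 - (\<integral>x. log_deriv_cut (real A) x \<partial>M)))"
  using intV by simp
 show "(SUP A::nat. ennreal (R1 - (\<integral>x. log_deriv_cut (real A) x \<partial>M))) \<le> (\<integral>\<^sup>+ x. e2ennreal (ereal R1 - lyapunov_at I g x) \<partial>M)"
 proof (rule SUP_least)
  fix A :: nat
  let ?\<phi> = "log_deriv_cut (real A)"
  obtain B where B: "\<And>x. x \<in> space M \<Longrightarrow> \<bar>?\<phi> x\<bar> \<le> B" using log_deriv_cut_bounded[of "real A"] by auto
  have Bi: "\<bar>?\<phi> ((g ^^ i) x)\<bar> \<le> B" if "x \<in> space M" for i x using B gl_in that space_M by auto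
  define \<psi> where "\<psi> = birkhoff_limsup ?\<phi> g"
  have [measurable]: "\<psi> \<in> borel_measurable M" unfolding \<psi>_def using g_measurable by (intro measurable_birkhoff_limsup) auto
  have "\<bar>\<psi> x\<bar> \<le> B" if "x \<in> space M" for x unfolding \<psi>_def using Bi[OF that] by (rule birkhoff_limsup(2))
  then have i\<psi>: "integrable M \<psi>" by (intro bounded_integrable[where B = B]) auto
  have le\<psi>: "(\<integral>x. \<psi> x \<partial>M) \<le> (\<integral>x. ?\<phi> x \<partial>M)"
   unfolding \<psi>_def using g_measurable g_distr log_deriv_cut_measurable B by (rule integral_birkhoff_limsup_le)
  have "ennreal (R1 - (\<integral>x. ?\<phi> x \<partial>M)) \<le> ennreal (\<integral>x. R1 - \<psi> x \<partial>M)"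
   using le\<psi> i\<psi> by (intro ennreal_leI) (simp add: prob_space)
  also have "\<dots> \<le> (\<integral>\<^sup>+ x. ennreal (R1 - \<psi> x) \<partial>M)" using i\<psi> by (intro ennreal_integral_le_nn_integral) auto
  also have "\<dots> \<le> (\<integral>\<^sup>+ x. e2ennreal (ereal R1 - lyapunov_at I g x) \<partial>M)"
  proof (rule nn_integral_mono)
   fix x assume x: "x \<in> space M"
   have "lyapunov_at I g x \<le> limsup (\<lambda>n. ereal (birkhoff_sum ?\<phi> g n x / real n))" unfolding lyapunov_at_def
   proof (rule Limsup_mono, rule eventually_mono[OF eventually_gt_at_top[of 0]])
    fix n :: nat assume n: "0 < n"
    have "(\<Sum>i<n. log_abs (map_deriv I g ((g ^^ i) x))) \<le> (\<Sum>i<n. ereal (?\<phi> ((g ^^ i) x)))"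
     by (intro sum_mono log_abs_le_cut)
    then have "(\<Sum>i<n. log_abs (map_deriv I g ((g ^^ i) x))) / ereal (real n) \<le> ereal (birkhoff_sum ?\<phi> g n x) / ereal (real n)"
     using n by (intro ereal_divide_right_mono) (auto simp: birkhoff_sum_def)
    then show "(\<Sum>i<n. log_abs (map_deriv I g ((g ^^ i) x))) / ereal (real n) \<le> ereal (birkhoff_sum ?\<phi> g n x / real n)"
     using n by simp
   qed
   also have "\<dots> = ereal (\<psi> x)" unfolding \<psi>_def using Bi[OF x] by (rule birkhoff_limsup(1)[symmetric])
   finally have "e2ennreal (ereal R1 - ereal (\<psi> x)) \<le> e2ennreal (ereal R1 - lyapunov_at I g x)"
    by (intro e2ennreal_mono ereal_minus_mono) auto
   then show "ennreal (R1 - \<psi> x) \<le> e2ennreal (ereal R1 - lyapunov_at I g x)" by simp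
  qed
  finally show "ennreal (R1 - (\<integral>x. ?\<phi> x \<partial>M)) \<le> (\<integral>\<^sup>+ x. e2ennreal (ereal R1 - lyapunov_at I g x) \<partial>M)" .
 qed
qed

lemma lyapunov_at_le:
 assumes R1: "R1 \<ge> 0" "\<And>x. x \<in> X \<Longrightarrow> \<bar>map_deriv I g x\<bar> \<le> exp R1" and x: "x \<in> X"
 shows "lyapunov_at I g x \<le> ereal R1" unfolding lyapunov_at_def
proof (rule Limsup_bounded, rule eventually_mono[OF eventually_gt_at_top[of 0]])
 fix n :: nat assume n: "0 < n"
 have "log_abs (map_deriv I g ((g ^^ i) x)) \<le> ereal R1" for i
  using R1(2)[OF gl_in[OF x, of i]] by (auto simp: log_abs_def intro!: ln_le_of_le_exp)
 then have "(\<Sum>i<n. log_abs (map_deriv I g ((g ^^ i) x))) \<le> (\<Sum>i<n. ereal R1)" by (intro sum_mono)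
 then have "(\<Sum>i<n. log_abs (map_deriv I g ((g ^^ i) x))) / ereal (real n) \<le> ereal (real n * R1) / ereal (real n)"
  using n by (intro ereal_divide_right_mono) auto
 then show "(\<Sum>i<n. log_abs (map_deriv I g ((g ^^ i) x))) / ereal (real n) \<le> ereal R1" using n by simp
qed

text \<open>As an infimum of integrals of continuous functions the exponent is upper semicontinuous
  in the measure. The difference of positive and negative parts is recovered from the nonnegative
  integral of \<open>R1\<close> minus the exponent.\<close>

theorem lyapunov_exponent_eq_INF:
 "lyapunov_exponent I g M = (INF A::nat. ereal (\<integral>x. log_deriv_cut (real A) x \<partial>M))"
proof -
 obtain R1 where R1: "R1 \<ge> 0" "\<And>x. x \<in> X \<Longrightarrow> \<bar>map_deriv I g x\<bar> \<le> exp R1" by (rule map_deriv_bounded) blast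
 let ?l = "lyapunov_at I g"
 let ?I = "\<lambda>A::nat. \<integral>x. log_deriv_cut (real A) x \<partial>M"
 define p where "p = (\<integral>\<^sup>+ x. e2ennreal (?l x) \<partial>M)"
 define n where "n = (\<integral>\<^sup>+ x. e2ennreal (- ?l x) \<partial>M)"
 define q where "q = (\<integral>\<^sup>+ x. e2ennreal (ereal R1 - ?l x) \<partial>M)"
 have q: "q = (SUP A. ennreal (R1 - ?I A))" unfolding q_def using R1 by (rule nn_integral_lyapunov_at)
 have lR: "?l x \<le> ereal R1" if "x \<in> space M" for x using lyapunov_at_le[OF R1] that space_M by auto
 have I: "?I A \<le> R1" for A using R1 by (intro log_deriv_cut_integral_bounds) auto
 have "p + q = (\<integral>\<^sup>+ x. e2ennreal (?l x) + e2ennreal (ereal R1 - ?l x) \<partial>M)"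
  unfolding p_def q_def by (rule nn_integral_add[symmetric]) measurable
 also have "\<dots> = (\<integral>\<^sup>+ x. ennreal R1 + e2ennreal (- ?l x) \<partial>M)"
 proof (rule nn_integral_cong)
  fix x assume "x \<in> space M"
  then show "e2ennreal (?l x) + e2ennreal (ereal R1 - ?l x) = ennreal R1 + e2ennreal (- ?l x)"
  proof (cases "?l x")
   case (real l)
   then have l: "l \<le> R1" using lR[OF \<open>x \<in> space M\<close>] by simp
   show ?thesis
   proof (cases "l \<ge> 0")
    case True
    then show ?thesis using l real R1(1) by (simp add: ennreal_neg flip: ennreal_plus)
   next
    case False
    then show ?thesis using l real R1(1) by (simp add: ennreal_neg flip: ennreal_plus)
   qed
  qed (use lR[of x] in \<open>auto simp: e2ennreal_neg\<close>)
 qed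
 also have "\<dots> = ennreal R1 + n" unfolding n_def by (subst nn_integral_add) (auto simp: emeasure_space_1)
 finally have pq: "p + q = ennreal R1 + n" .
 have "p \<le> (\<integral>\<^sup>+ x. ennreal R1 \<partial>M)" unfolding p_def
 proof (rule nn_integral_mono)
  fix x assume "x \<in> space M"
  then have "e2ennreal (?l x) \<le> e2ennreal (ereal R1)" by (intro e2ennreal_mono lR)
  then show "e2ennreal (?l x) \<le> ennreal R1" by simp
 qed
 then have "p \<le> ennreal R1" by (simp add: emeasure_space_1)
 with pq have "enn2ereal p - enn2ereal n = ereal R1 - enn2ereal q" using R1(1) by (rule ereal_diff_eq_of_ennreal_sum)
 then have eq: "lyapunov_exponent I g M = ereal R1 - enn2ereal q" by (simp add: lyapunov_exponent_def p_def n_def)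
 show ?thesis unfolding eq
 proof (rule antisym)
  show "ereal R1 - enn2ereal q \<le> (INF A. ereal (?I A))"
  proof (rule INF_greatest)
   fix A
   have "ennreal (R1 - ?I A) \<le> q" unfolding q by (rule SUP_upper) simp
   then have "ereal (R1 - ?I A) \<le> enn2ereal q" using I[of A] by (simp add: less_eq_ennreal.rep_eq)
   then show "ereal R1 - enn2ereal q \<le> ereal (?I A)" by (cases "enn2ereal q") auto
  qed
  define J where "J = (INF A. ereal (?I A))"
  have J: "J \<le> ereal (?I A)" for A unfolding J_def by (rule INF_lower) simp
  have "q \<le> e2ennreal (ereal R1 - J)" unfolding q
  proof (rule SUP_least)
   fix A
   have "e2ennreal (ereal R1 - ereal (?I A)) \<le> e2ennreal (ereal R1 - J)" using J by (intro e2ennreal_mono ereal_minus_mono) auto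
   then show "ennreal (R1 - ?I A) \<le> e2ennreal (ereal R1 - J)" by simp
  qed
  then have "enn2ereal q \<le> enn2ereal (e2ennreal (ereal R1 - J))" by (simp only: less_eq_ennreal.rep_eq)
  also have "\<dots> = ereal R1 - J"
  proof (rule enn2ereal_e2ennreal)
   have "J \<le> ereal R1" using order_trans[OF J[of 0], of "ereal R1"] I[of 0] by simp
   then show "0 \<le> ereal R1 - J" by (cases J) auto
  qed
  finally show "J \<le> ereal R1 - enn2ereal q" using J[of 0] by (cases J; cases "enn2ereal q") auto
 qed
qed

end

text \<open>Beyond the truncation at \<open>a0\<close>, the exponent can lose only what the
  contractions of size at least \<open>a0\<close> contribute.\<close>

lemma (in expanding_system) lyapunov_exponent_ge:
 assumes R1: "R1 \<ge> 0" "\<And>x. x \<in> X \<Longrightarrow> \<bar>map_deriv I g x\<bar> \<le> exp R1" and a0: "a0 \<ge> 0"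
 shows "ereal ((\<integral>x. log_deriv_cut a0 x \<partial>M) - (\<integral>x. (if a0 \<le> contraction 0 x then contraction 0 x else 0) \<partial>M)) \<le> lyapunov_exponent I g M"
 unfolding lyapunov_exponent_eq_INF
proof (rule INF_greatest)
 fix A :: nat
 let ?d = "\<lambda>x. if a0 \<le> contraction 0 x then contraction 0 x else 0"
 have d: "integrable M ?d"
  by (rule Bochner_Integration.integrable_bound[OF integrable_pos_contraction[OF R1]]) (use a0 in auto)
 have c: "integrable M (log_deriv_cut B)" if "B \<ge> 0" for B using that R1 by (rule log_deriv_cut_integral_bounds)
 have "(\<integral>x. log_deriv_cut a0 x \<partial>M) \<le> (\<integral>x. log_deriv_cut (real A) x + ?d x \<partial>M)"
 proof (rule integral_mono_AE)
  show "AE x in M. log_deriv_cut a0 x \<le> log_deriv_cut (real A) x + ?d x" using AE_map_deriv_nonzero_0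
  proof eventually_elim
   case (elim x)
   have "min (contraction 0 x) a0 = - log_deriv_cut a0 x" "min (contraction 0 x) (real A) = - log_deriv_cut (real A) x"
    using contraction_cut[of 0 x] elim by auto
   then show ?case using a0 by (auto simp: min_def split: if_splits)
  qed
 qed (use c a0 d in auto)
 also have "\<dots> = (\<integral>x. log_deriv_cut (real A) x \<partial>M) + (\<integral>x. ?d x \<partial>M)" using c[of "real A"] d by simp
 finally show "ereal ((\<integral>x. log_deriv_cut a0 x \<partial>M) - (\<integral>x. ?d x \<partial>M)) \<le> ereal (\<integral>x. log_deriv_cut (real A) x \<partial>M)" by simp
qed

section \<open>Growth rate\<close>

text \<open>Fekete's lemma; nonnegativity keeps the infimum finite.\<close>

lemma subadditive_convergent:
 fixes a :: "nat \<Rightarrow> real"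
 assumes nonneg: "\<And>n. a n \<ge> 0" and sub: "\<And>m n. a (m + n) \<le> a m + a n"
 shows "convergent (\<lambda>n. a n / real n)"
proof -
 define L where "L = (INF m\<in>{0<..}. a m / real m)"
 have bdd: "bdd_below ((\<lambda>m. a m / real m) ` {0<..})" using nonneg by (intro bdd_belowI2[of _ 0]) auto
 have "(\<lambda>n. a n / real n) \<longlonglongrightarrow> L"
 proof (rule LIMSEQ_I)
  fix e :: real assume e: "e > 0"
  then have "L < L + e / 2" by simp
  then obtain m where m: "m > 0" "a m / real m < L + e / 2"
   unfolding L_def by (subst (asm) cINF_less_iff[OF _ bdd]) auto
  define v where "v = a m / real m"
  obtain C where bound: "\<And>n. a n \<le> real n * v + C" unfolding v_def using subadditive_le[of a m] nonneg sub m(1) by blast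
  obtain N :: nat where N: "real N > 2 * C / e" using reals_Archimedean2 by blast
  have "norm (a n / real n - L) < e" if n: "n \<ge> N + 1" for n
  proof -
   have n0: "n > 0" using n by simp
   have "L \<le> a n / real n" unfolding L_def using n0 by (intro cINF_lower bdd) auto
   moreover have "a n / real n < L + e"
   proof -
    have "real n \<ge> real N" using n by simp
    then have "2 * C / e < real n" using N by linarith
    then have "C < real n * (e / 2)" using e by (simp add: field_simps)
    moreover have "real n * v \<le> real n * (L + e / 2)" using m(2) by (intro mult_left_mono) (auto simp: v_def)
    ultimately have "a n < real n * (L + e)" using bound[of n] by (simp add: algebra_simps)
    then show ?thesis using n0 by (simp add: field_simps)
   qed
   ultimately show ?thesis by simp
  qed
  then show "\<exists>no. \<forall>n\<ge>no. norm (a n / real n - L) < e" by blast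
 qed
 then show ?thesis by (rule convergentI)
qed

context
 fixes I :: one_dim and r :: real and g :: "complex \<Rightarrow> complex"
 assumes g: "Cr_map I r g" and r: "r > 1"
begin

lemma map_deriv_funpow_continuous: "continuous_on (points I) (map_deriv I (g ^^ n))"
proof -
 have gp: "g \<in> points I \<rightarrow> points I" "continuous_on (points I) g" using g by (auto simp: Cr_map_def)
 have "continuous_on (points I) (\<lambda>x. \<Prod>i<n. map_deriv I g ((g ^^ i) x))"
 proof (intro continuous_on_prod)
  fix i show "continuous_on (points I) (\<lambda>x. map_deriv I g ((g ^^ i) x))"
   by (rule continuous_on_compose2[OF continuous_on_map_deriv[OF g r] continuous_on_funpow[OF gp]])
    (use funpow_Pi[OF gp(1), of i] in auto)
 qed
 then show ?thesis using map_deriv_funpow[OF g r] by (subst continuous_on_cong[OF refl map_deriv_funpow[OF g r]]) auto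
qed

lemma points_nonempty: "points I \<noteq> {}" by (cases I) (auto simp: points_Circle points_Interval)

lemma map_deriv_funpow_le_SUP:
 "x \<in> points I \<Longrightarrow> \<bar>map_deriv I (g ^^ n) x\<bar> \<le> (SUP x\<in>points I. \<bar>map_deriv I (g ^^ n) x\<bar>)"
proof (rule cSUP_upper)
 have "compact ((\<lambda>x. \<bar>map_deriv I (g ^^ n) x\<bar>) ` points I)"
  using compact_points map_deriv_funpow_continuous by (intro compact_continuous_image continuous_on_rabs)
 then show "bdd_above ((\<lambda>x. \<bar>map_deriv I (g ^^ n) x\<bar>) ` points I)" by (intro bounded_imp_bdd_above compact_imp_bounded)
qed

definition "log_growth n = max 0 (ln (SUP x\<in>points I. \<bar>map_deriv I (g ^^ n) x\<bar>))"

text \<open>If the supremum is 0, its logarithm has the default value 0 and the bound remains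
  true.\<close>

lemma map_deriv_le_exp_log_growth:
 assumes x: "x \<in> points I"
 shows "\<bar>map_deriv I (g ^^ n) x\<bar> \<le> exp (log_growth n)"
proof -
 define S where "S = (SUP x\<in>points I. \<bar>map_deriv I (g ^^ n) x\<bar>)"
 have "S \<le> exp (max 0 (ln S))"
 proof (cases "S > 0")
  case True
  then have "S = exp (ln S)" by simp
  also have "\<dots> \<le> exp (max 0 (ln S))" by simp
  finally show ?thesis .
 next
  case False
  then show ?thesis using exp_gt_zero[of "max 0 (ln S)"] by linarith
 qed
 then show ?thesis using map_deriv_funpow_le_SUP[OF x, of n] by (simp add: log_growth_def S_def)
qed

lemma log_growth_subadditive: "log_growth (m + n) \<le> log_growth m + log_growth n"
proof -
 have gp: "g \<in> points I \<rightarrow> points I" using g by (auto simp: Cr_map_def)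
 define S where "S = (SUP x\<in>points I. \<bar>map_deriv I (g ^^ (m + n)) x\<bar>)"
 have "S \<le> exp (log_growth m + log_growth n)" unfolding S_def
 proof (rule cSUP_least[OF points_nonempty])
  fix x assume x: "x \<in> points I"
  have y: "(g ^^ m) x \<in> points I" using funpow_Pi[OF gp, of m] x by auto
  have "map_deriv I (g ^^ (m + n)) x = map_deriv I (g ^^ m) x * map_deriv I (g ^^ n) ((g ^^ m) x)"
  proof -
   have "(\<Prod>i<m + n. c i) = (\<Prod>i<m. c i) * (\<Prod>i<n. c (i + m))" for c :: "nat \<Rightarrow> real"
    by (induction n) (auto simp: add.commute mult.assoc)
   then show ?thesis unfolding map_deriv_funpow[OF g r x] map_deriv_funpow[OF g r y] by (simp add: funpow_add)
  qed
  then have "\<bar>map_deriv I (g ^^ (m + n)) x\<bar> \<le> exp (log_growth m) * exp (log_growth n)"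
   unfolding abs_mult using map_deriv_le_exp_log_growth x y by (simp add: abs_mult mult_mono)
  then show "\<bar>map_deriv I (g ^^ (m + n)) x\<bar> \<le> exp (log_growth m + log_growth n)" by (simp add: exp_add)
 qed
 moreover have "0 \<le> log_growth m + log_growth n" by (simp add: log_growth_def)
 ultimately have "ln S \<le> log_growth m + log_growth n"
 proof (cases "S > 0")
  case False
  have "\<bar>map_deriv I (g ^^ (m + n)) x\<bar> \<le> S" if "x \<in> points I" for x
   unfolding S_def using that by (rule map_deriv_funpow_le_SUP)
  then have "S \<ge> 0" using points_nonempty by (metis abs_ge_zero all_not_in_conv order_trans)
  then show ?thesis using False \<open>0 \<le> log_growth m + log_growth n\<close> by simp
 qed (simp add: ln_le_of_le_exp)
 then show ?thesis using \<open>0 \<le> log_growth m + log_growth n\<close> by (simp add: log_growth_def[of "m + n"] S_def)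
qed

lemma log_growth_tendsto: "(\<lambda>n. log_growth n / real n) \<longlonglongrightarrow> growth_rate I g"
proof -
 have "convergent (\<lambda>n. log_growth n / real n)"
  using log_growth_subadditive by (intro subadditive_convergent) (auto simp: log_growth_def)
 then have "(\<lambda>n. log_growth n / real n) \<longlonglongrightarrow> lim (\<lambda>n. log_growth n / real n)" by (simp add: convergent_LIMSEQ_iff)
 then show ?thesis by (simp add: growth_rate_def log_growth_def)
qed

lemma growth_rate_nonneg: "growth_rate I g \<ge> 0"
 using log_growth_tendsto by (rule LIMSEQ_le_const) (auto simp: log_growth_def)

lemma growth_rate_bound:
 assumes "growth_rate I g < R"
 obtains p where "p > 0" "\<And>x. x \<in> points I \<Longrightarrow> \<bar>map_deriv I (g ^^ p) x\<bar> \<le> exp (real p * R)"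
proof -
 have "eventually (\<lambda>n. log_growth n / real n < R \<and> n > 0) sequentially"
  using order_tendstoD(2)[OF log_growth_tendsto assms] eventually_gt_at_top[of 0] by eventually_elim simp
 then obtain p where p: "log_growth p / real p < R" "p > 0" by (auto simp: eventually_sequentially)
 then have "log_growth p \<le> real p * R" by (simp add: field_simps)
 then show ?thesis using map_deriv_le_exp_log_growth[of _ p] p(2) by (intro that[of p]) (auto intro: order_trans)
qed

end

lemma uniform_limit_map_deriv_funpow:
 assumes f: "Cr_map I r f" and fs: "\<And>k. Cr_map I r (fs k)" and r: "r > 1"
  and lim: "uniform_limit (points I) fs f sequentially"
   "uniform_limit (points I) (\<lambda>k. map_deriv I (fs k)) (map_deriv I f) sequentially"
 shows "uniform_limit (points I) (\<lambda>k. map_deriv I (fs k ^^ p)) (map_deriv I (f ^^ p)) sequentially"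
proof -
 let ?X = "points I"
 have fp: "f \<in> ?X \<rightarrow> ?X" "continuous_on ?X f" and fsp: "\<And>k. fs k \<in> ?X \<rightarrow> ?X" "\<And>k. continuous_on ?X (fs k)"
  using f fs by (auto simp: Cr_map_def)
 have c: "continuous_on ?X (map_deriv I f)" using f r by (rule continuous_on_map_deriv)
 have iter: "uniform_limit ?X (\<lambda>k. fs k ^^ i) (f ^^ i) sequentially" for i
  by (rule uniform_limit_funpow[OF compact_points lim(1) fsp(1) fp])
 have step: "uniform_limit ?X (\<lambda>k x. map_deriv I (fs k) ((fs k ^^ i) x)) (\<lambda>x. map_deriv I f ((f ^^ i) x)) sequentially" for i
 proof -
  have 1: "uniform_limit ?X (\<lambda>k x. map_deriv I f ((fs k ^^ i) x)) (\<lambda>x. map_deriv I f ((f ^^ i) x)) sequentially"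
   using compact_points iter funpow_Pi[OF fsp(1)] funpow_Pi[OF fp(1)] c by (rule uniform_limit_compose_continuous)
  show ?thesis
  proof (rule uniform_limitI)
   fix e :: real assume "e > 0"
   then have e: "e / 2 > 0" by simp
   show "\<forall>\<^sub>F k in sequentially. \<forall>x\<in>?X. dist (map_deriv I (fs k) ((fs k ^^ i) x)) (map_deriv I f ((f ^^ i) x)) < e"
    using uniform_limitD[OF 1 e] uniform_limitD[OF lim(2) e]
   proof eventually_elim
    case (elim k)
    show ?case
    proof
     fix x assume x: "x \<in> ?X"
     have "(fs k ^^ i) x \<in> ?X" using funpow_Pi[OF fsp(1)[of k], of i] x by auto
     then have "dist (map_deriv I (fs k) ((fs k ^^ i) x)) (map_deriv I f ((fs k ^^ i) x)) < e / 2" using elim(2) by blast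
     moreover have "dist (map_deriv I f ((fs k ^^ i) x)) (map_deriv I f ((f ^^ i) x)) < e / 2" using elim(1) x by blast
     ultimately show "dist (map_deriv I (fs k) ((fs k ^^ i) x)) (map_deriv I f ((f ^^ i) x)) < e"
      unfolding dist_real_def by linarith
    qed
   qed
  qed
 qed
 have bdd: "bounded (h ` ?X)" if "continuous_on ?X h" for h :: "complex \<Rightarrow> real"
  using that compact_points by (intro compact_imp_bounded compact_continuous_image)
 have "uniform_limit ?X (\<lambda>k x. \<Prod>i<p. map_deriv I (fs k) ((fs k ^^ i) x)) (\<lambda>x. \<Prod>i<p. map_deriv I f ((f ^^ i) x)) sequentially"
 proof (induction p)
  case 0
  show ?case by (simp add: uniform_limit_iff)
 next
  case (Suc p)
  have "bounded ((\<lambda>x. map_deriv I f ((f ^^ p) x)) ` ?X)"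
   by (rule bdd, rule continuous_on_compose2[OF c continuous_on_funpow[OF fp]]) (use funpow_Pi[OF fp(1), of p] in auto)
  moreover have "bounded ((\<lambda>x. \<Prod>i<p. map_deriv I f ((f ^^ i) x)) ` ?X)"
  proof -
   have "(\<lambda>x. \<Prod>i<p. map_deriv I f ((f ^^ i) x)) ` ?X = map_deriv I (f ^^ p) ` ?X"
    using map_deriv_funpow[OF f r] by (intro image_cong) auto
   then show ?thesis using bdd[OF map_deriv_funpow_continuous[OF f r]] by simp
  qed
  ultimately show ?case unfolding prod.lessThan_Suc by (intro uniform_lim_mult Suc step)
 qed
 moreover have "map_deriv I (fs k ^^ p) x = (\<Prod>i<p. map_deriv I (fs k) ((fs k ^^ i) x))"
  "map_deriv I (f ^^ p) x = (\<Prod>i<p. map_deriv I f ((f ^^ i) x))" if "x \<in> ?X" for k x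
  using map_deriv_funpow[OF fs r that] map_deriv_funpow[OF f r that] by auto
 ultimately show ?thesis by (subst uniform_limit_cong'[where g = "\<lambda>k x. \<Prod>i<p. map_deriv I (fs k) ((fs k ^^ i) x)" and i = "\<lambda>x. \<Prod>i<p. map_deriv I f ((f ^^ i) x)"]) auto
qed

section \<open>Approximation in entropy\<close>

locale entropy_approximation =
 fixes I :: one_dim and r :: real
  and f :: "complex \<Rightarrow> complex" and fs :: "nat \<Rightarrow> complex \<Rightarrow> complex"
  and \<nu> :: "nat \<Rightarrow> complex measure" and \<mu> :: "complex measure"
 assumes r: "r > 1" and f: "Cr_map I r f"
  and entropy_gap: "topological_entropy (points I) f > ereal (growth_rate I f / r)"
  and fs: "\<And>k. Cr_map I r (fs k)" and conv: "Cr_weakly_converges I r fs f"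
  and \<nu>: "\<And>k. borel_prob_on (points I) (\<nu> k)" "\<And>k. ergodic_measure (fs k) (\<nu> k)"
  and entropy_lim: "(\<lambda>k. metric_entropy (fs k) (\<nu> k)) \<longlonglongrightarrow> topological_entropy (points I) f"
  and \<mu>: "borel_prob_on (points I) \<mu>" "weak_star_converges (points I) \<nu> \<mu>"
begin

lemma f_maps: "f \<in> points I \<rightarrow> points I" "continuous_on (points I) f" and fs_maps: "fs k \<in> points I \<rightarrow> points I" "continuous_on (points I) (fs k)"
 using f fs by (auto simp: Cr_map_def)

lemma f_lim: "uniform_limit (points I) fs f sequentially"
 and deriv_lim: "uniform_limit (points I) (\<lambda>k. map_deriv I (fs k)) (map_deriv I f) sequentially"
 using conv by (auto simp: Cr_weakly_converges_def)

lemma \<nu>_invariant: "invariant_measure (fs k) (\<nu> k)" using \<nu>(2) by (simp add: ergodic_measure_def)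

lemma \<mu>_invariant: "invariant_measure f \<mu>"
 by (rule weak_star_limit_invariant[OF compact_points f_lim fs_maps(1) f_maps fs_maps(2) \<nu>(1) \<nu>_invariant \<mu>])

lemma system_f: "one_dim_system I r f \<mu>" using r f \<mu>(1) \<mu>_invariant by unfold_locales

lemma ergodic_fs: "one_dim_ergodic I r (fs k) (\<nu> k)" using r fs \<nu> \<nu>_invariant by unfold_locales

lemma system_fs: "one_dim_system I r (fs k) (\<nu> k)" using r fs \<nu> \<nu>_invariant by unfold_locales

lemma map_deriv_uniform_bound:
 obtains R1 where "R1 \<ge> 0" "\<And>k x. x \<in> points I \<Longrightarrow> \<bar>map_deriv I (fs k) x\<bar> \<le> exp R1"
  "\<And>x. x \<in> points I \<Longrightarrow> \<bar>map_deriv I f x\<bar> \<le> exp R1"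
proof -
 obtain C where C: "\<And>k. Cr_norm_le I r C (fs k)" using conv by (auto simp: Cr_weakly_converges_def)
 obtain R where R: "R \<ge> 0" "\<And>x. x \<in> points I \<Longrightarrow> \<bar>map_deriv I f x\<bar> \<le> exp R"
  using one_dim_system.map_deriv_bounded[OF system_f] by blast
 have "nat \<lfloor>r\<rfloor> \<ge> 1" using r by linarith
 then have fsC: "\<bar>map_deriv I (fs k) x\<bar> \<le> C" if "x \<in> points I" for k x
 proof -
  have "\<bar>coord_deriv I 1 (fs k) (inv_into (coord_dom I) (param I) x)\<bar> \<le> C"
  proof -
   have "inv_into (coord_dom I) (param I) x \<in> coord_dom I" using that by (auto simp: points_def intro: inv_into_into)
   then show ?thesis using C[of k] \<open>nat \<lfloor>r\<rfloor> \<ge> 1\<close> unfolding Cr_norm_le_def by auto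
  qed
  then show ?thesis by (simp add: map_deriv_def)
 qed
 show ?thesis
 proof (rule that[of "max R (ln (max C 1))"])
  show "max R (ln (max C 1)) \<ge> 0" using R(1) by simp
  show "\<bar>map_deriv I (fs k) x\<bar> \<le> exp (max R (ln (max C 1)))" if "x \<in> points I" for k x
  proof -
   have "\<bar>map_deriv I (fs k) x\<bar> \<le> exp (ln (max C 1))" using fsC[OF that, of k] by simp
   also have "\<dots> \<le> exp (max R (ln (max C 1)))" by (simp only: exp_le_cancel_iff max.cobounded2)
   finally show ?thesis .
  qed
  show "\<bar>map_deriv I f x\<bar> \<le> exp (max R (ln (max C 1)))" if "x \<in> points I" for x
   using R(2)[OF that] by (rule order_trans) simp
 qed
qed

text \<open>Finiteness comes from the sequence: Ruelle's inequality bounds the entropies of all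
  \<open>\<nu> k\<close> by the common \<open>R1\<close>.\<close>

lemma top_entropy_real:
 obtains h where "topological_entropy (points I) f = ereal h" "growth_rate I f / r < h" "h > 0"
proof -
 obtain R1 where R1: "R1 \<ge> 0" "\<And>k x. x \<in> points I \<Longrightarrow> \<bar>map_deriv I (fs k) x\<bar> \<le> exp R1"
  by (rule map_deriv_uniform_bound) blast
 have "metric_entropy (fs k) (\<nu> k) \<le> ereal R1" for k
 proof -
  interpret one_dim_ergodic I r "fs k" "\<nu> k" by (rule ergodic_fs)
  have "(\<integral>x. log_deriv_cut 0 x \<partial>\<nu> k) \<le> R1" using R1 by (intro log_deriv_cut_integral_bounds) auto
  then have "ereal (max 0 (\<integral>x. log_deriv_cut 0 x \<partial>\<nu> k)) \<le> ereal R1" using R1(1) by simp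
  then show ?thesis using metric_entropy_le_log_deriv_cut[of 0] by (rule order_trans[rotated]) simp
 qed
 then have "topological_entropy (points I) f \<le> ereal R1" using entropy_lim by (intro LIMSEQ_le_const2) auto
 then obtain h where h: "topological_entropy (points I) f = ereal h" using entropy_gap by (cases "topological_entropy (points I) f") auto
 have "growth_rate I f / r < h" using entropy_gap h by simp
 moreover have "growth_rate I f / r \<ge> 0" using growth_rate_nonneg[OF f r] r by simp
 ultimately show ?thesis using that h by simp
qed

lemma eventually_expanding: "eventually (\<lambda>k. expanding_system I r (fs k) (\<nu> k)) sequentially"
proof -
 obtain h where h: "topological_entropy (points I) f = ereal h" "h > 0" by (rule top_entropy_real) blast
 have "eventually (\<lambda>k. 0 < metric_entropy (fs k) (\<nu> k)) sequentially"
  using h entropy_lim by (intro order_tendstoD(1)) auto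
 then show ?thesis
 proof (rule eventually_mono)
  fix k assume pos: "0 < metric_entropy (fs k) (\<nu> k)"
  interpret one_dim_ergodic I r "fs k" "\<nu> k" by (rule ergodic_fs)
  show "expanding_system I r (fs k) (\<nu> k)"
  proof unfold_locales
   fix A :: real assume "0 \<le> A"
   then have "0 < ereal (max 0 (\<integral>x. log_deriv_cut A x \<partial>\<nu> k))"
    using pos metric_entropy_le_log_deriv_cut by (metis order_less_le_trans)
   then show "0 \<le> (\<integral>x. log_deriv_cut A x \<partial>\<nu> k)" by (simp add: less_max_iff_disj)
  qed
 qed
qed

abbreviation "log_cut g A \<equiv> one_dim_system.log_deriv_cut I g A"
abbreviation "rate k x \<equiv> one_dim_system.contraction I (fs k) 0 x"

lemma cut_eq: "log_cut (fs k) A x = ln (max \<bar>map_deriv I (fs k) x\<bar> (exp (- A)))"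
 "log_cut f A x = ln (max \<bar>map_deriv I f x\<bar> (exp (- A)))"
 by (simp_all add: one_dim_system.log_deriv_cut_def[OF system_fs] one_dim_system.log_deriv_cut_def[OF system_f])

text \<open>The truncated logarithm is a continuous function of the derivative, so uniform
  convergence of the derivatives combines with weak convergence of the measures.\<close>

lemma integral_cut_tendsto:
 assumes \<phi>: "continuous_on UNIV (\<phi> :: real \<Rightarrow> real)"
 shows "(\<lambda>k. \<integral>x. \<phi> (log_cut (fs k) A x) \<partial>\<nu> k) \<longlonglongrightarrow> (\<integral>x. \<phi> (log_cut f A x) \<partial>\<mu>)"
proof -
 obtain R1 where R1: "R1 \<ge> 0" "\<And>k x. x \<in> points I \<Longrightarrow> \<bar>map_deriv I (fs k) x\<bar> \<le> exp R1"
  "\<And>x. x \<in> points I \<Longrightarrow> \<bar>map_deriv I f x\<bar> \<le> exp R1" by (rule map_deriv_uniform_bound) blast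
 define \<psi> where "\<psi> d = \<phi> (ln (max \<bar>d\<bar> (exp (- A))))" for d
 have \<psi>: "continuous_on S \<psi>" for S
 proof -
  have "continuous_on S (\<lambda>d. ln (max \<bar>d\<bar> (exp (- A))))" by (intro continuous_intros) (auto simp: max_def)
  then show ?thesis unfolding \<psi>_def by (rule continuous_on_compose2[OF \<phi>]) auto
 qed
 have "uniform_limit (points I) (\<lambda>k x. \<psi> (map_deriv I (fs k) x)) (\<lambda>x. \<psi> (map_deriv I f x)) sequentially"
 proof (rule uniform_limit_compose_continuous[where X = "{- exp R1..exp R1}", OF _ deriv_lim])
  show "map_deriv I (fs k) \<in> points I \<rightarrow> {- exp R1..exp R1}" for k
  proof
   fix x assume "x \<in> points I"
   then show "map_deriv I (fs k) x \<in> {- exp R1..exp R1}" using R1(2)[of x k] by (simp add: abs_le_iff minus_le_iff)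
  qed
  show "map_deriv I f \<in> points I \<rightarrow> {- exp R1..exp R1}"
  proof
   fix x assume "x \<in> points I"
   then show "map_deriv I f x \<in> {- exp R1..exp R1}" using R1(3)[of x] by (simp add: abs_le_iff minus_le_iff)
  qed
 qed (use \<psi> in auto)
 then have "(\<lambda>k. \<integral>x. \<psi> (map_deriv I (fs k) x) \<partial>\<nu> k) \<longlonglongrightarrow> (\<integral>x. \<psi> (map_deriv I f x) \<partial>\<mu>)"
 proof (rule weak_star_uniform_limit[OF compact_points \<nu>(1) \<mu>(2)])
  show "continuous_on (points I) (\<lambda>x. \<psi> (map_deriv I (fs k) x))" for k
   by (rule continuous_on_compose2[OF \<psi>[of UNIV] continuous_on_map_deriv[OF fs r]]) auto
  show "continuous_on (points I) (\<lambda>x. \<psi> (map_deriv I f x))"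
   by (rule continuous_on_compose2[OF \<psi>[of UNIV] continuous_on_map_deriv[OF f r]]) auto
 qed
 then show ?thesis by (simp add: \<psi>_def cut_eq)
qed

text \<open>
 The integral of the contraction rate, truncated at \<open>A\<close>, has a limit as \<open>k\<close> grows which is bounded in
 \<open>A\<close>. So contractions in a window \<open>[a1, a0)\<close> are rare once \<open>a1\<close> is large, whatever \<open>a0\<close>.
\<close>

lemma shallow_integral_small:
 assumes \<eta>: "\<eta> > 0"
 obtains a1 where "a1 \<ge> 2" "\<And>a0. a1 \<le> a0 \<Longrightarrow> eventually (\<lambda>k.
  (\<integral>x. (if a1 \<le> rate k x \<and> rate k x < a0
   then rate k x else 0) \<partial>\<nu> k) \<le> \<eta>) sequentially"
proof -
 obtain R1 where R1: "R1 \<ge> 0" "\<And>k x. x \<in> points I \<Longrightarrow> \<bar>map_deriv I (fs k) x\<bar> \<le> exp R1"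
  by (rule map_deriv_uniform_bound) blast
 define \<tau> where "\<tau> A = (\<integral>x. max 0 (- log_cut f A x) \<partial>\<mu>)" for A
 define \<tau>k where "\<tau>k k A = (\<integral>x. max 0 (- log_cut (fs k) A x) \<partial>\<nu> k)" for k A
 have lim: "(\<lambda>k. \<tau>k k A) \<longlonglongrightarrow> \<tau> A" for A unfolding \<tau>_def \<tau>k_def by (rule integral_cut_tendsto) (intro continuous_intros)
 have cutmin: "AE x in \<nu> k. max 0 (- log_cut (fs k) A x) = max 0 (min (rate k x) A)"
  if "expanding_system I r (fs k) (\<nu> k)" for k A
 proof -
  interpret expanding_system I r "fs k" "\<nu> k" by fact
  show ?thesis using AE_map_deriv_nonzero_0
  proof eventually_elim
   case (elim x)
   then show ?case using contraction_cut[of 0 x A] by simp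
  qed
 qed
 have icut: "integrable (\<nu> k) (\<lambda>x. max 0 (- log_cut (fs k) A x))" if "A \<ge> 0" for k A
 proof -
  interpret one_dim_system I r "fs k" "\<nu> k" by (rule system_fs)
  show ?thesis using log_deriv_cut_integral_bounds(1)[OF that R1(1) R1(2)] by auto
 qed
 have bd: "\<tau> A \<le> R1" if A: "A \<ge> 0" for A
 proof (rule LIMSEQ_le_const2[OF lim])
  obtain N where N: "\<And>k. k \<ge> N \<Longrightarrow> expanding_system I r (fs k) (\<nu> k)"
   using eventually_expanding by (auto simp: eventually_sequentially)
  have "\<tau>k k A \<le> R1" if k: "k \<ge> N" for k
  proof -
   interpret expanding_system I r "fs k" "\<nu> k" by (rule N[OF k])
   have "\<tau>k k A \<le> (\<integral>x. max 0 (contraction 0 x) \<partial>\<nu> k)" unfolding \<tau>k_def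
   proof (rule integral_mono_AE)
    show "AE x in \<nu> k. max 0 (- log_deriv_cut A x) \<le> max 0 (contraction 0 x)"
     using cutmin[OF N[OF k], of A] by eventually_elim auto
   qed (use icut[OF A, of k] integrable_pos_contraction[OF R1(1) R1(2)] in auto)
   also have "\<dots> \<le> R1" using R1 by (intro integral_pos_contraction) auto
   finally show ?thesis .
  qed
  then show "\<exists>N. \<forall>k\<ge>N. \<tau>k k A \<le> R1" by blast
 qed
 define S where "S = (SUP A\<in>{0..}. \<tau> A)"
 have bdd: "bdd_above (\<tau> ` {0..})" using bd by (intro bdd_aboveI2) auto
 have "S - \<eta> / 4 < S" using \<eta> by simp
 then obtain A where A: "A \<ge> 0" "S - \<eta> / 4 < \<tau> A" unfolding S_def by (subst (asm) less_cSUP_iff[OF _ bdd]) auto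
 define b where "b = max A 1"
 have mono: "\<tau> A \<le> \<tau> B" if "A \<le> B" "A \<ge> 0" for A B
 proof -
  interpret one_dim_system I r f \<mu> by (rule system_f)
  obtain R where R: "R \<ge> 0" "\<And>x. x \<in> points I \<Longrightarrow> \<bar>map_deriv I f x\<bar> \<le> exp R" by (rule map_deriv_bounded) blast
  have le: "log_deriv_cut B x \<le> log_deriv_cut A x" for x
   unfolding log_deriv_cut_def using that by (subst ln_le_cancel_iff) (auto simp: less_max_iff_disj max.coboundedI2)
  have i: "integrable \<mu> (log_deriv_cut A)" "integrable \<mu> (log_deriv_cut B)"
   using log_deriv_cut_integral_bounds(1)[OF _ R, of A] log_deriv_cut_integral_bounds(1)[OF _ R, of B] that by auto
  show ?thesis unfolding \<tau>_def
  proof (rule integral_mono)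
   show "max 0 (- log_deriv_cut A x) \<le> max 0 (- log_deriv_cut B x)" for x using le[of x] by (intro max.mono) auto
  qed (use i in auto)
 qed
 show ?thesis
 proof (rule that[of "2 * b"])
  show "2 * b \<ge> 2" by (simp add: b_def)
  fix a0 assume a0: "2 * b \<le> a0"
  have b0: "0 \<le> b" "0 \<le> a0" using a0 by (auto simp: b_def)
  have "\<tau> a0 \<le> S" unfolding S_def using b0 by (intro cSUP_upper bdd) auto
  moreover have "\<tau> A \<le> \<tau> b" using A by (intro mono) (auto simp: b_def)
  ultimately have diff: "\<tau> a0 - \<tau> b < \<eta> / 2" using A \<eta> by linarith
  have "(\<lambda>k. \<tau>k k a0 - \<tau>k k b) \<longlonglongrightarrow> \<tau> a0 - \<tau> b" by (intro tendsto_diff lim)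
  then have "eventually (\<lambda>k. \<tau>k k a0 - \<tau>k k b < \<eta> / 2) sequentially" using diff by (rule order_tendstoD(2))
  then show "eventually (\<lambda>k. (\<integral>x. (if 2 * b \<le> rate k x \<and> rate k x < a0
   then rate k x else 0) \<partial>\<nu> k) \<le> \<eta>) sequentially" using eventually_expanding
  proof eventually_elim
   case (elim k)
   interpret expanding_system I r "fs k" "\<nu> k" by (rule elim(2))
   \<comment> \<open>Above \<open>2 * b\<close> the truncations at \<open>a0\<close> and at
     \<open>b\<close> differ by at least half of the contraction; hence the window begins at twice
     the level \<open>b\<close>.\<close>
   have "(\<integral>x. (if 2 * b \<le> contraction 0 x \<and> contraction 0 x < a0 then contraction 0 x else 0) \<partial>\<nu> k)
    \<le> (\<integral>x. 2 * (max 0 (- log_deriv_cut a0 x) - max 0 (- log_deriv_cut b x)) \<partial>\<nu> k)"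
   proof (rule integral_mono_AE)
    show "AE x in \<nu> k. (if 2 * b \<le> contraction 0 x \<and> contraction 0 x < a0 then contraction 0 x else 0)
     \<le> 2 * (max 0 (- log_deriv_cut a0 x) - max 0 (- log_deriv_cut b x))"
     using cutmin[OF elim(2), of a0] cutmin[OF elim(2), of b]
    proof eventually_elim
     case (elim x)
     show ?case unfolding elim using a0 b0 by (auto simp: max_def min_def)
    qed
    show "integrable (\<nu> k) (\<lambda>x. if 2 * b \<le> contraction 0 x \<and> contraction 0 x < a0 then contraction 0 x else 0)"
     by (rule Bochner_Integration.integrable_bound[OF integrable_pos_contraction[OF R1(1) R1(2)]]) (use b0 in auto)
   qed (use icut[of a0 k] icut[of b k] b0 in auto)
   also have "\<dots> = 2 * (\<tau>k k a0 - \<tau>k k b)" unfolding \<tau>k_def using icut[of a0 k] icut[of b k] b0 by simp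
   finally show ?case using elim(1) by simp
  qed
 qed
qed

text \<open>Uniform continuity of the derivative of \<open>f\<close>, transported to
  \<open>fs k\<close> by uniform convergence, gives one modulus for all large k.\<close>

lemma distortion_uniform:
 assumes \<gamma>: "\<gamma> > 0"
 obtains \<delta> where "\<delta> > 0" "eventually (\<lambda>k. bounded_distortion (coord_dom I) \<delta> a1 \<gamma> (coord_deriv I (Suc 0) (fs k))) sequentially"
proof -
 \<comment> \<open>Three errors \<eta> must stay below half of exp (- a1), so that the derivative
   does not vanish, and below exp (- a1) * (exp \<gamma> - 1), for the ratio.\<close>
 define \<eta> where "\<eta> = exp (- a1) * min (1 / 2) (exp \<gamma> - 1) / 3"
 have \<eta>: "\<eta> > 0" using \<gamma> by (simp add: \<eta>_def)
 have "uniformly_continuous_on (points I) (map_deriv I f)"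
  using continuous_on_map_deriv[OF f r] compact_points by (rule compact_uniformly_continuous)
 then obtain d where d: "d > 0" "\<And>x y. x \<in> points I \<Longrightarrow> y \<in> points I \<Longrightarrow> dist x y < d \<Longrightarrow> dist (map_deriv I f x) (map_deriv I f y) < \<eta>"
  using \<eta> unfolding uniformly_continuous_on_def by (metis dist_commute)
 show ?thesis
 proof (rule that[of "d / 7"])
  show "d / 7 > 0" using d by simp
  show "eventually (\<lambda>k. bounded_distortion (coord_dom I) (d / 7) a1 \<gamma> (coord_deriv I (Suc 0) (fs k))) sequentially"
   using uniform_limitD[OF deriv_lim \<eta>]
  proof (rule eventually_mono, unfold bounded_distortion_def, intro ballI impI)
   fix k s t
   assume close: "\<forall>x\<in>points I. dist (map_deriv I (fs k) x) (map_deriv I f x) < \<eta>"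
    and st: "s \<in> coord_dom I" "t \<in> coord_dom I" "\<bar>s - t\<bar> \<le> d / 7"
   let ?h = "coord_deriv I (Suc 0) (fs k)"
   assume big: "exp (- a1) < \<bar>?h s\<bar>"
   have X: "param I s \<in> points I" "param I t \<in> points I" using st by (auto intro: param_in_points)
   have hs: "?h s = map_deriv I (fs k) (param I s)" "?h t = map_deriv I (fs k) (param I t)"
    using map_deriv_param[OF fs r] st by auto
   have "dist (param I s) (param I t) \<le> 2 * pi * \<bar>s - t\<bar>" by (rule dist_param_le)
   also have "\<dots> \<le> 2 * pi * (d / 7)" using st(3) by (intro mult_left_mono) auto
   also have "\<dots> < d" using d(1) pi_approx by simp
   finally have "dist (map_deriv I f (param I s)) (map_deriv I f (param I t)) < \<eta>" using d(2) X by blast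
   moreover have "dist (?h s) (map_deriv I f (param I s)) < \<eta>" "dist (?h t) (map_deriv I f (param I t)) < \<eta>"
    using close X by (auto simp: hs)
   ultimately have diff: "\<bar>?h s - ?h t\<bar> < 3 * \<eta>" unfolding dist_real_def by linarith
   have e: "exp (- a1) * min (1 / 2) (exp \<gamma> - 1) \<le> exp (- a1) * (1 / 2)"
    "exp (- a1) * min (1 / 2) (exp \<gamma> - 1) \<le> exp (- a1) * (exp \<gamma> - 1)"
    by (rule mult_left_mono[OF min.cobounded1], simp, rule mult_left_mono[OF min.cobounded2], simp)
   then have "3 * \<eta> \<le> exp (- a1) / 2" "3 * \<eta> \<le> exp (- a1) * (exp \<gamma> - 1)" by (simp_all add: \<eta>_def)
   moreover have "exp (- a1) * (exp \<gamma> - 1) \<le> \<bar>?h s\<bar> * (exp \<gamma> - 1)" using big \<gamma> by (intro mult_right_mono) auto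
   moreover have "\<bar>?h s\<bar> * (exp \<gamma> - 1) = exp \<gamma> * \<bar>?h s\<bar> - \<bar>?h s\<bar>" by (simp add: algebra_simps)
   moreover have "exp (- a1) > 0" by simp
   ultimately show "0 < \<bar>?h t\<bar> \<and> \<bar>?h t\<bar> \<le> exp \<gamma> * \<bar>?h s\<bar>" using diff big by linarith
  qed
 qed
qed

text \<open>The role of \<open>H 0\<close> is played by the derivative of \<open>fs k\<close>: one
  derivative less than the map, so the regularity is r - 1, split into an integer part and the
  Hoelder exponent. The bound on the norms makes \<epsilon>1 independent of k.\<close>

lemma cluster_indices:
 obtains \<epsilon>1 :: real where "\<epsilon>1 > 0" "\<And>\<epsilon> k. 0 < \<epsilon> \<Longrightarrow> \<epsilon> \<le> \<epsilon>1 \<Longrightarrow>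
  \<exists>i1 i2. separates_clusters (coord_dom I) \<epsilon> (r - 1) (coord_deriv I (Suc 0) (fs k)) (2 * (nat \<lfloor>r\<rfloor> - 1) + 2) i1 i2"
proof -
 obtain C0 where C0: "\<And>k. Cr_norm_le I r C0 (fs k)" using conv by (auto simp: Cr_weakly_converges_def)
 define C where "C = max C0 0"
 have C: "C \<ge> 0" "C0 \<le> C" by (auto simp: C_def)
 define q where "q = nat \<lfloor>r\<rfloor> - 1"
 define \<theta> where "\<theta> = r - of_int \<lfloor>r\<rfloor>"
 have q1: "nat \<lfloor>r\<rfloor> = Suc q" using r unfolding q_def by linarith
 have "real (nat \<lfloor>r\<rfloor>) = of_int \<lfloor>r\<rfloor>" using r by simp
 then have q\<theta>: "real q + \<theta> = r - 1" unfolding q1 \<theta>_def by simp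
 have \<theta>: "\<theta> \<ge> 0" by (simp add: \<theta>_def)
 have r1: "r - 1 > 0" using r by simp
 define c where "c = exp (- 1) - exp (- 2 :: real)"
 have c: "c > 0" by (simp add: c_def)
 define \<epsilon>1 where "\<epsilon>1 = (c / (C + 1)) powr (1 / (r - 1))"
 have c1: "c / (C + 1) > 0" using c C by simp
 show ?thesis
 proof (rule that[of \<epsilon>1])
  show "\<epsilon>1 > 0" using c1 unfolding \<epsilon>1_def by (subst powr_gt_zero) linarith
  fix \<epsilon> :: real and k
  assume \<epsilon>: "0 < \<epsilon>" "\<epsilon> \<le> \<epsilon>1"
  have "\<epsilon> powr (r - 1) \<le> \<epsilon>1 powr (r - 1)" using \<epsilon> r1 by (intro powr_mono2) auto
  also have "\<dots> = c / (C + 1)"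
  proof -
   have "C + 1 > 0" using C by simp
   then show ?thesis using c r1 by (simp add: \<epsilon>1_def powr_powr)
  qed
  finally have "C * \<epsilon> powr (r - 1) \<le> C * (c / (C + 1))" using C by (intro mult_left_mono) auto
  also have "\<dots> < c" using C c by (simp add: field_simps)
  finally have small: "C * \<epsilon> powr (real q + \<theta>) < exp (- 1) - exp (- 2)" by (simp add: q\<theta> c_def)
  have conv_D: "convex (coord_dom I)" by (cases I) auto
  define H where "H j = coord_deriv I (Suc j) (fs k)" for j
  have der: "(H j has_real_derivative H (Suc j) t) (at t within coord_dom I)" if "j < q" "t \<in> coord_dom I" for j t
   unfolding H_def using that q1 by (intro Cr_map_DERIV[OF fs]) auto
  have hoel: "\<bar>H q s - H q t\<bar> \<le> C * \<bar>s - t\<bar> powr \<theta>" if "s \<in> coord_dom I" "t \<in> coord_dom I" for s t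
  proof -
   have "\<bar>H q s - H q t\<bar> \<le> C0 * \<bar>s - t\<bar> powr \<theta>"
    using C0[of k] that unfolding Cr_norm_le_def top_deriv_hoelder_def H_def q1 \<theta>_def by blast
   also have "\<dots> \<le> C * \<bar>s - t\<bar> powr \<theta>" using C by (intro mult_right_mono) auto
   finally show ?thesis .
  qed
  have q\<theta>0: "real q + \<theta> > 0" using q\<theta> r1 by simp
  obtain i1 i2 where "separates_clusters (coord_dom I) \<epsilon> (real q + \<theta>) (H 0) (2 * q + 2) i1 i2"
   by (rule critical_clusters[where H = H, OF conv_D der hoel \<theta> q\<theta>0 \<epsilon>(1) C(1) small]) (assumption | rule that)+
  then show "\<exists>i1 i2. separates_clusters (coord_dom I) \<epsilon> (r - 1) (coord_deriv I (Suc 0) (fs k)) (2 * (nat \<lfloor>r\<rfloor> - 1) + 2) i1 i2"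
   unfolding q_def[symmetric] q\<theta> H_def by blast
 qed
qed

text \<open>One power \<open>p\<close> realises for \<open>f\<close> a rate below \<open>R\<close>;
  the slack lets the bound pass to all nearby \<open>fs k\<close>.\<close>

lemma growth_bound_uniform:
 assumes "growth_rate I f < R"
 obtains p where "p > 0" "eventually (\<lambda>k. \<forall>x\<in>points I. \<bar>map_deriv I (fs k ^^ p) x\<bar> \<le> exp (real p * R)) sequentially"
proof -
 define R' where "R' = (growth_rate I f + R) / 2"
 have R': "growth_rate I f < R'" "R' < R" using assms by (auto simp: R'_def)
 obtain p where p: "p > 0" "\<And>x. x \<in> points I \<Longrightarrow> \<bar>map_deriv I (f ^^ p) x\<bar> \<le> exp (real p * R')"
  by (rule growth_rate_bound[OF f r R'(1)]) blast
 have "exp (real p * R) - exp (real p * R') > 0" using p(1) R'(2) by simp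
 from uniform_limitD[OF uniform_limit_map_deriv_funpow[OF f fs r f_lim deriv_lim] this]
 have "eventually (\<lambda>k. \<forall>x\<in>points I. \<bar>map_deriv I (fs k ^^ p) x\<bar> \<le> exp (real p * R)) sequentially"
 proof (rule eventually_mono, intro ballI)
  fix k x
  assume "\<forall>x\<in>points I. dist (map_deriv I (fs k ^^ p) x) (map_deriv I (f ^^ p) x) < exp (real p * R) - exp (real p * R')"
   and x: "x \<in> points I"
  then have "dist (map_deriv I (fs k ^^ p) x) (map_deriv I (f ^^ p) x) < exp (real p * R) - exp (real p * R')" by blast
  then show "\<bar>map_deriv I (fs k ^^ p) x\<bar> \<le> exp (real p * R)" using p(2)[OF x] unfolding dist_real_def by linarith
 qed
 then show ?thesis using that p(1) by blast
qed

text \<open>The centres are orbits of \<open>f\<close>, so their number is governed by the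
  topological entropy of \<open>f\<close> although they serve for \<open>fs k\<close>. Half of
  \<epsilon> / 2 is spent on spanning and half on the difference of the iterates.\<close>

lemma block_codes_uniform:
 assumes h: "topological_entropy (points I) f < ereal H" and \<epsilon>: "\<epsilon> > 0" and m0: "m0 \<ge> (0 :: real)"
 obtains m :: nat and E where "m > 0" "m0 \<le> real m" "finite E" "real (card E) \<le> exp (real m * H)"
  "eventually (\<lambda>k. \<forall>x\<in>points I. \<exists>y\<in>E. \<forall>i<m. dist ((fs k ^^ i) x) ((f ^^ i) y) \<le> \<epsilon> / 2) sequentially"
proof -
 have e4: "\<epsilon> / 4 > 0" using \<epsilon> by simp
 obtain M0 :: nat where M0: "m0 \<le> real M0" using real_arch_simple by blast
 have "eventually (\<lambda>n. (\<exists>E. finite E \<and> E \<subseteq> points I \<and> real (card E) \<le> exp (n * H) \<and>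
  (\<forall>x\<in>points I. \<exists>y\<in>E. \<forall>i<n. dist ((f ^^ i) x) ((f ^^ i) y) \<le> \<epsilon> / 4)) \<and> n > M0) sequentially"
  using eventually_spanning_set[OF h e4] eventually_gt_at_top[of M0] by eventually_elim simp
 then obtain m E where m: "m > M0" and E: "finite E" "E \<subseteq> points I" "real (card E) \<le> exp (real m * H)"
  "\<forall>x\<in>points I. \<exists>y\<in>E. \<forall>i<m. dist ((f ^^ i) x) ((f ^^ i) y) \<le> \<epsilon> / 4" by (auto simp: eventually_sequentially)
 have "eventually (\<lambda>k. \<forall>i\<in>{..<m}. \<forall>x\<in>points I. dist ((fs k ^^ i) x) ((f ^^ i) x) < \<epsilon> / 4) sequentially"
  using uniform_limitD[OF uniform_limit_funpow[OF compact_points f_lim fs_maps(1) f_maps] e4]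
  by (intro eventually_ball_finite) auto
 then have "eventually (\<lambda>k. \<forall>x\<in>points I. \<exists>y\<in>E. \<forall>i<m. dist ((fs k ^^ i) x) ((f ^^ i) y) \<le> \<epsilon> / 2) sequentially"
 proof (rule eventually_mono, intro ballI)
  fix k x assume k: "\<forall>i\<in>{..<m}. \<forall>x\<in>points I. dist ((fs k ^^ i) x) ((f ^^ i) x) < \<epsilon> / 4" and x: "x \<in> points I"
  obtain y where y: "y \<in> E" "\<forall>i<m. dist ((f ^^ i) x) ((f ^^ i) y) \<le> \<epsilon> / 4" using E(4) x by blast
  show "\<exists>y\<in>E. \<forall>i<m. dist ((fs k ^^ i) x) ((f ^^ i) y) \<le> \<epsilon> / 2"
  proof (intro bexI[OF _ y(1)] allI impI)
   fix i assume i: "i < m"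
   have "dist ((fs k ^^ i) x) ((f ^^ i) x) < \<epsilon> / 4" "dist ((f ^^ i) x) ((f ^^ i) y) \<le> \<epsilon> / 4" using k y x i by auto
   then show "dist ((fs k ^^ i) x) ((f ^^ i) y) \<le> \<epsilon> / 2"
    using dist_triangle[of "(fs k ^^ i) x" "(f ^^ i) y" "(f ^^ i) x"] by linarith
  qed
 qed
 then show ?thesis using that[of m E] m M0 E by auto
qed

text \<open>The two consequences of rare bad times that can be carried to the limit in k: one
  controls the exponents, the other is preserved under weak limits for partitions with null
  boundary.\<close>

definition near_maximal :: "real \<Rightarrow> real \<Rightarrow> real \<Rightarrow> real \<Rightarrow> nat \<Rightarrow> bool" where
 "near_maximal h c a0 \<epsilon> k \<longleftrightarrow> expanding_system I r (fs k) (\<nu> k) \<and>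
  (\<integral>x. (if a0 \<le> rate k x then rate k x else 0) \<partial>\<nu> k) \<le> c \<and>
  (\<forall>P :: complex \<Rightarrow> nat. simple_function (\<nu> k) P \<longrightarrow>
   (\<forall>x\<in>points I. \<forall>y\<in>points I. P x = P y \<longrightarrow> dist x y < \<epsilon>) \<longrightarrow>
   (\<forall>m>0. h - c \<le> ent (\<nu> k) (names P (fs k) m) / real m))"

text \<open>For given \<gamma> the choices are made in the order \<open>p\<close>,
  \<open>a1\<close>, \<epsilon>, \<open>m\<close>, \<open>a0\<close>. The factor \<open>K\<close> is
  fixed before \<gamma>, so the loss K \<gamma> can be made arbitrarily small.\<close>

lemma eventually_near_maximal:
 assumes h: "topological_entropy (points I) f = ereal h"
 obtains K \<gamma>0 where "K > 0" "\<gamma>0 > 0"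
  "\<And>\<gamma>. 0 < \<gamma> \<Longrightarrow> \<gamma> \<le> \<gamma>0 \<Longrightarrow> \<exists>a0 \<epsilon>. a0 \<ge> 0 \<and> \<epsilon> > 0 \<and> eventually (near_maximal h (K * \<gamma>) a0 \<epsilon>) sequentially"
proof -
 obtain R1 where R1: "R1 \<ge> 0" "\<And>k x. x \<in> points I \<Longrightarrow> \<bar>map_deriv I (fs k) x\<bar> \<le> exp R1"
  by (rule map_deriv_uniform_bound) blast
 define R0 where "R0 = growth_rate I f"
 have R0: "R0 \<ge> 0" unfolding R0_def using f r by (rule growth_rate_nonneg)
 define \<delta> where "\<delta> = (h - R0 / r) / 2"
 have \<delta>: "\<delta> > 0" using entropy_gap h by (simp add: \<delta>_def R0_def)
 have h0: "h > 0" using top_entropy_real h by (metis ereal.inject)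
 \<comment> \<open>Covers both bounds of \<open>entropy_near_maximal\<close>, in which R + \<gamma>
   will be at most R0 + 3.\<close>
 define K where "K = 10 + R1 + 2 * (R0 + 3) * (10 + R1) / \<delta>"
 have KK: "0 \<le> (R0 + 3) * (10 + R1) / \<delta>" using R0 R1 \<delta> by simp
 show ?thesis
 proof (rule that[of K "min 1 (\<delta> / 2)"])
  show "K > 0"
  proof -
   have "K = 10 + R1 + 2 * ((R0 + 3) * (10 + R1) / \<delta>)" by (simp only: K_def times_divide_eq_right mult.assoc)
   then show ?thesis using KK R1(1) by linarith
  qed
  show "min 1 (\<delta> / 2) > 0" using \<delta> by simp
  fix \<gamma> :: real
  assume "0 < \<gamma>" "\<gamma> \<le> min 1 (\<delta> / 2)"
  then have \<gamma>: "0 < \<gamma>" "\<gamma> \<le> 1" "2 * \<gamma> \<le> \<delta>" by auto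
  define R where "R = R0 + 2 * \<gamma>"
  have "growth_rate I f < R" using \<gamma> by (simp add: R_def R0_def)
  then obtain p where p: "p > 0" "eventually (\<lambda>k. \<forall>x\<in>points I. \<bar>map_deriv I (fs k ^^ p) x\<bar> \<le> exp (real p * R)) sequentially"
   by (rule growth_bound_uniform)
  define N1 where "N1 = 2 * (nat \<lfloor>r\<rfloor> - 1) + 2"
  define cc where "cc = 1 / (r - 1) + code_const \<gamma> N1 + 5"
  have "1 / (r - 1) \<ge> 0" using r by simp
  then have cc: "cc > 0" using code_const_nonneg[OF \<gamma>(1,2), of N1] unfolding cc_def by linarith
  have "\<gamma> / cc > 0" using \<gamma> cc by simp
  then obtain a1 where a1: "a1 \<ge> 2" "\<And>a0. a1 \<le> a0 \<Longrightarrow> eventually (\<lambda>k.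
   (\<integral>x. (if a1 \<le> rate k x \<and> rate k x < a0
    then rate k x else 0) \<partial>\<nu> k) \<le> \<gamma> / cc) sequentially" by (rule shallow_integral_small) blast
  obtain d where d: "d > 0" "eventually (\<lambda>k. bounded_distortion (coord_dom I) d a1 \<gamma> (coord_deriv I (Suc 0) (fs k))) sequentially"
   by (rule distortion_uniform[OF \<gamma>(1)])
  obtain \<epsilon>1 :: real where \<epsilon>1: "\<epsilon>1 > 0" "\<And>\<epsilon> k. 0 < \<epsilon> \<Longrightarrow> \<epsilon> \<le> \<epsilon>1 \<Longrightarrow>
   \<exists>i1 i2. separates_clusters (coord_dom I) \<epsilon> (r - 1) (coord_deriv I (Suc 0) (fs k)) N1 i1 i2"
   by (rule cluster_indices[folded N1_def]) (rule that, assumption+)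
  \<comment> \<open>One scale for three purposes: distortion, clusters, and pieces too short to wrap
    around the circle.\<close>
  define \<epsilon> where "\<epsilon> = min (min d \<epsilon>1) (1 / (4 * exp (R1 + 2)))"
  have \<epsilon>: "\<epsilon> > 0" "\<epsilon> \<le> d" "\<epsilon> \<le> \<epsilon>1" using d \<epsilon>1 by (auto simp: \<epsilon>_def)
  have \<epsilon>': "\<epsilon> * exp (R1 + 2) \<le> 1 / 4"
  proof -
   have "\<epsilon> \<le> 1 / (4 * exp (R1 + 2))" by (simp add: \<epsilon>_def)
   then show ?thesis by (simp add: field_simps)
  qed
  define H where "H = h + \<gamma>"
  have H: "topological_entropy (points I) f < ereal H" "H \<ge> 0" using h h0 \<gamma> by (auto simp: H_def)
  have "max 0 (- ln (\<gamma> / 2) / \<gamma>) \<ge> 0" by simp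
  then obtain m :: nat and E where m: "m > 0" "max 0 (- ln (\<gamma> / 2) / \<gamma>) \<le> real m" "finite E" "real (card E) \<le> exp (real m * H)"
   "eventually (\<lambda>k. \<forall>x\<in>points I. \<exists>y\<in>E. \<forall>i<m. dist ((fs k ^^ i) x) ((f ^^ i) y) \<le> \<epsilon> / 2) sequentially"
   by (rule block_codes_uniform[OF H(1) \<epsilon>(1)])
  have m_large: "- ln (\<gamma> / 2) \<le> \<gamma> * real m"
  proof -
   have "- ln (\<gamma> / 2) / \<gamma> \<le> real m" using m(2) by simp
   then show ?thesis using \<gamma>(1) by (simp only: pos_divide_le_eq mult.commute)
  qed
  define c0 where "c0 = 1 + real p * R1 + 1 / (r - 1) + code_const \<gamma> N1"
  have "eventually (\<lambda>a. c0 + 2 * ln (a + 2) \<le> \<gamma> * a) at_top" using \<gamma>(1) by real_asymp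
  then obtain a2 where a2: "\<And>a. a2 \<le> a \<Longrightarrow> c0 + 2 * ln (a + 2) \<le> \<gamma> * a" by (auto simp: eventually_at_top_linorder)
  \<comment> \<open>Large enough for the logarithms in the cost, for half of a deep contraction to
    outweigh the constants, and for interrupted blocks of length \<open>m\<close> to be
    rare.\<close>
  define a0 where "a0 = Max {a2, a1, 3, 2 * (2 + real p * R1), R1 * (real m * (H + \<gamma>)) / \<gamma>}"
  have a0: "a2 \<le> a0" "a1 \<le> a0" "3 \<le> a0" "2 * (2 + real p * R1) \<le> a0" "R1 * (real m * (H + \<gamma>)) / \<gamma> \<le> a0"
   by (auto simp: a0_def)
  have a0_m: "R1 * (real m * (H + \<gamma>)) \<le> \<gamma> * a0" using a0(5) \<gamma>(1) by (simp only: pos_divide_le_eq mult.commute)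
  have "ereal (H - 3 * \<gamma>) < topological_entropy (points I) f" using h \<gamma> by (simp add: H_def)
  then have ent: "eventually (\<lambda>k. ereal (H - 3 * \<gamma>) < metric_entropy (fs k) (\<nu> k)) sequentially"
   using entropy_lim by (intro order_tendstoD(1))
  \<comment> \<open>The entropy gap is 2 \<delta>; half of it absorbs the errors in \<open>R\<close>
    and \<open>H\<close>, by 2 \<gamma> \<le> \<delta>.\<close>
  have gap: "(R + \<gamma>) / r + \<delta> \<le> H"
  proof -
   have "3 * \<gamma> / r \<le> 3 * \<gamma> / 1" using \<gamma> r by (intro divide_left_mono) auto
   moreover have "(R + \<gamma>) / r = R0 / r + 3 * \<gamma> / r" by (simp add: R_def add_divide_distrib[symmetric])
   moreover have "h = R0 / r + 2 * \<delta>"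
   proof -
    have "2 * \<delta> = h - R0 / r" unfolding \<delta>_def by simp
    then show ?thesis by simp
   qed
   ultimately show ?thesis using \<gamma> unfolding H_def by linarith
  qed
  define b where "b = \<gamma> * (10 + R1) / \<delta>"
  have b0: "b \<ge> 0" using \<gamma> R1 \<delta> by (simp add: b_def)
  have Rb: "(R + \<gamma>) * b \<le> \<gamma> * ((R0 + 3) * (10 + R1) / \<delta>)"
  proof -
   have "(R + \<gamma>) * b \<le> (R0 + 3) * b" using b0 \<gamma> by (intro mult_right_mono) (auto simp: R_def)
   then show ?thesis by (simp add: b_def mult_ac)
  qed
  have K\<gamma>: "K * \<gamma> = \<gamma> * (10 + R1) + 2 * (\<gamma> * ((R0 + 3) * (10 + R1) / \<delta>))" by (simp add: K_def algebra_simps)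
  have "eventually (near_maximal h (K * \<gamma>) a0 \<epsilon>) sequentially"
   using eventually_expanding a1(2)[OF a0(2)] d(2) p(2) m(5) ent
  proof eventually_elim
   case (elim k)
   obtain i1 i2 where i: "separates_clusters (coord_dom I) \<epsilon> (r - 1) (coord_deriv I (Suc 0) (fs k)) N1 i1 i2"
    using \<epsilon>1(2)[OF \<epsilon>(1,3)] by blast
   interpret ex: expanding_system I r "fs k" "\<nu> k" by (rule elim(1))
   interpret coded_system I r "fs k" "\<nu> k" \<epsilon> \<gamma> a1 a0 R1 N1 i1 i2 R p
   proof unfold_locales
    show "\<epsilon> > 0" "\<epsilon> * exp (R1 + 2) \<le> 1 / 4" "0 < \<gamma>" "\<gamma> \<le> 1" "2 \<le> a1" "a1 \<le> a0" "2 < a0" "R1 \<ge> 0" "p > 0"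
     "2 * (2 + real p * R1) \<le> a0" using \<epsilon> \<epsilon>' \<gamma> a1(1) a0 R1 p by auto
    show "R \<ge> 0" using R0 \<gamma> by (simp add: R_def)
    show "\<bar>map_deriv I (fs k) x\<bar> \<le> exp R1" if "x \<in> points I" for x using R1(2)[OF that] .
    show "bounded_distortion (coord_dom I) \<epsilon> a1 \<gamma> (coord_deriv I (Suc 0) (fs k))"
     using elim(3) \<epsilon>(2) unfolding bounded_distortion_def by (meson order_trans)
    show "separates_clusters (coord_dom I) \<epsilon> (r - 1) (coord_deriv I (Suc 0) (fs k)) N1 i1 i2" by (rule i)
    show "\<bar>map_deriv I (fs k ^^ p) x\<bar> \<le> exp (real p * R)" if "x \<in> points I" for x using elim(4) that by blast
    show "1 + real p * R1 + 1 / (r - 1) + code_const \<gamma> N1 + 2 * ln (a + 2) \<le> \<gamma> * a" if "a0 \<le> a" for a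
     using a2[of a] that a0(1) unfolding c0_def by simp
    have "cc * (\<integral>x. (if a1 \<le> ex.contraction 0 x \<and> ex.contraction 0 x < a0 then ex.contraction 0 x else 0) \<partial>\<nu> k) \<le> cc * (\<gamma> / cc)"
     using elim(2) cc by (intro mult_left_mono) auto
    then show "(1 / (r - 1) + code_const \<gamma> N1 + 5) *
     (\<integral>x. (if a1 \<le> ex.contraction 0 x \<and> ex.contraction 0 x < a0 then ex.contraction 0 x else 0) \<partial>\<nu> k) \<le> \<gamma>"
     using cc unfolding cc_def[symmetric] by simp
   qed
   have E: "\<exists>y\<in>E. \<forall>i<m. dist ((fs k ^^ i) x) ((f ^^ i) y) \<le> \<epsilon> / 2" if "x \<in> points I" for x using elim(5) that by blast
   have deep: "(\<integral>x. deep_part (ex.contraction 0 x) \<partial>\<nu> k) \<le> 4 * \<gamma> + 2 * (R + \<gamma>) * b"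
    unfolding b_def by (rule entropy_near_maximal(1)[OF m(1,3) E H(2) m(4) m_large a0_m elim(6) \<delta> gap])
   have part: "H - 3 * \<gamma> \<le> ent (\<nu> k) (names P (fs k) m') / real m' + (R + \<gamma>) * b + \<gamma> * (4 + R1)"
    if "simple_function (\<nu> k) P" "\<And>x y. x \<in> points I \<Longrightarrow> y \<in> points I \<Longrightarrow> P x = P y \<Longrightarrow> dist x y < \<epsilon>" "m' > 0"
    for P :: "complex \<Rightarrow> nat" and m'
    unfolding b_def by (rule entropy_near_maximal(2)[OF m(1,3) E H(2) m(4) m_large a0_m elim(6) \<delta> gap that])
   show ?case unfolding near_maximal_def
   proof (intro conjI allI impI)
    show "expanding_system I r (fs k) (\<nu> k)" by (rule elim(1))
    have R1\<gamma>: "0 \<le> \<gamma> * R1" using R1 \<gamma> by simp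
    show "(\<integral>x. deep_part (ex.contraction 0 x) \<partial>\<nu> k) \<le> K * \<gamma>"
    proof -
     have "\<gamma> * (10 + R1) = 10 * \<gamma> + \<gamma> * R1" "2 * (R + \<gamma>) * b = 2 * ((R + \<gamma>) * b)" by (simp_all add: algebra_simps)
     then show ?thesis using deep Rb R1\<gamma> \<gamma>(1) unfolding K\<gamma> by linarith
    qed
    fix P :: "complex \<Rightarrow> nat" and m' :: nat
    assume P: "simple_function (\<nu> k) P" "\<forall>x\<in>points I. \<forall>y\<in>points I. P x = P y \<longrightarrow> dist x y < \<epsilon>" "0 < m'"
    have "0 \<le> \<gamma> * ((R0 + 3) * (10 + R1) / \<delta>)" using KK \<gamma> by (metis less_imp_le mult_nonneg_nonneg)
    moreover have "H - 3 * \<gamma> \<le> ent (\<nu> k) (names P (fs k) m') / real m' + (R + \<gamma>) * b + \<gamma> * (4 + R1)"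
     using P by (intro part) auto
    moreover have "\<gamma> * (10 + R1) = \<gamma> * (4 + R1) + 6 * \<gamma>" by (simp add: algebra_simps)
    ultimately show "h - K * \<gamma> \<le> ent (\<nu> k) (names P (fs k) m') / real m'" using Rb \<gamma> unfolding K\<gamma> H_def by linarith
   qed
  qed
  then show "\<exists>a0 \<epsilon>. a0 \<ge> 0 \<and> \<epsilon> > 0 \<and> eventually (near_maximal h (K * \<gamma>) a0 \<epsilon>) sequentially"
   using a0(3) \<epsilon>(1) by (intro exI[of _ a0] exI[of _ \<epsilon>]) auto
 qed
qed

text \<open>The lower bound for block entropies of \<open>\<nu> k\<close> holds at every fixed block
  length with one scale \<epsilon> for all large k. So k can tend to infinity first and the block
  length afterwards, which is the exchange of limits that upper semicontinuity of the entropy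
  requires.\<close>

lemma limit_max_entropy: "max_entropy_measure (points I) f \<mu>"
proof -
 obtain h where h: "topological_entropy (points I) f = ereal h" by (rule top_entropy_real)
 obtain K \<gamma>0 where K: "K > 0" "\<gamma>0 > 0"
  "\<And>\<gamma>. 0 < \<gamma> \<Longrightarrow> \<gamma> \<le> \<gamma>0 \<Longrightarrow> \<exists>a0 \<epsilon>. a0 \<ge> 0 \<and> \<epsilon> > 0 \<and> eventually (near_maximal h (K * \<gamma>) a0 \<epsilon>) sequentially"
  by (rule eventually_near_maximal[OF h]) (rule that, assumption+)
 interpret mu: one_dim_system I r f \<mu> by (rule system_f)
 have ge: "ereal (h - K * \<gamma>) \<le> metric_entropy f \<mu>" if \<gamma>: "0 < \<gamma>" "\<gamma> \<le> \<gamma>0" for \<gamma>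
 proof -
  obtain a0 \<epsilon> where \<epsilon>: "\<epsilon> > 0" and ev: "eventually (near_maximal h (K * \<gamma>) a0 \<epsilon>) sequentially" using K(3)[OF \<gamma>] by blast
  obtain P :: "complex \<Rightarrow> nat" where P: "simple_function \<mu> P" "\<And>k. simple_function (\<nu> k) P"
   "\<And>x y. x \<in> points I \<Longrightarrow> y \<in> points I \<Longrightarrow> P x = P y \<Longrightarrow> dist x y < \<epsilon>"
   "\<And>m. (\<lambda>k. ent (\<nu> k) (names P (fs k) m)) \<longlonglongrightarrow> ent \<mu> (names P f m)"
   by (rule small_partition_entropy_limit[OF compact_points f_lim fs_maps(1) f_maps fs_maps(2) \<nu>(1) \<mu> \<mu>_invariant \<epsilon>]) blast
  have "h - K * \<gamma> \<le> ent \<mu> (names P f m) / real m" if m: "m > 0" for m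
  proof (rule tendsto_lowerbound)
   show "(\<lambda>k. ent (\<nu> k) (names P (fs k) m) / real m) \<longlonglongrightarrow> ent \<mu> (names P f m) / real m"
    using P(4)[of m] m by (intro tendsto_divide tendsto_const) auto
   show "eventually (\<lambda>k. h - K * \<gamma> \<le> ent (\<nu> k) (names P (fs k) m) / real m) sequentially" using ev
   proof eventually_elim
    case (elim k)
    then show ?case using P(2,3) m unfolding near_maximal_def by blast
   qed
  qed simp
  then have "eventually (\<lambda>m. ereal (h - K * \<gamma>) \<le> ereal (ent \<mu> (names P f m) / real m)) sequentially"
   by (intro eventually_mono[OF eventually_gt_at_top[of 0]]) auto
  then have "ereal (h - K * \<gamma>) \<le> limsup (\<lambda>m. ereal (ent \<mu> (names P f m) / real m))"
   by (intro order_trans[OF Liminf_bounded Liminf_le_Limsup]) auto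
  also have "\<dots> \<le> metric_entropy f \<mu>" using mu.g_measurable P(1) by (rule mu.metric_entropy_ge)
  finally show ?thesis .
 qed
 have "ereal h \<le> metric_entropy f \<mu>"
 proof (rule ereal_le_epsilon2)
  fix e :: real assume e: "0 < e"
  define \<gamma> where "\<gamma> = min \<gamma>0 (e / K)"
  have \<gamma>: "0 < \<gamma>" "\<gamma> \<le> \<gamma>0" "K * \<gamma> \<le> e" using K e by (auto simp: \<gamma>_def min_def field_simps)
  have "ereal h \<le> ereal (h - K * \<gamma>) + ereal e" using \<gamma>(3) by simp
  also have "\<dots> \<le> metric_entropy f \<mu> + ereal e" using ge[OF \<gamma>(1,2)] by (rule add_right_mono)
  finally show "ereal h \<le> metric_entropy f \<mu> + ereal e" .
 qed
 moreover have "metric_entropy f \<mu> \<le> topological_entropy (points I) f"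
  by (rule metric_entropy_le_topological_entropy[OF mu.prob_space_axioms borel_prob_onD(2)[OF \<mu>(1)] points_borel mu.g_measurable mu.g_distr])
 ultimately show ?thesis using h \<mu>(1) \<mu>_invariant by (auto simp: max_entropy_measure_def)
qed

text \<open>The upper bound is the semicontinuity contained in the infimum formula. For the lower
  bound, removing the truncation at \<open>a0\<close> lowers the exponent of \<open>\<nu> k\<close>
  by at most K \<gamma>, while the truncated integrals converge.\<close>

lemma lyapunov_limit: "(\<lambda>k. lyapunov_exponent I (fs k) (\<nu> k)) \<longlonglongrightarrow> lyapunov_exponent I f \<mu>"
proof -
 obtain h where h: "topological_entropy (points I) f = ereal h" by (rule top_entropy_real)
 obtain K \<gamma>0 where K: "K > 0" "\<gamma>0 > 0"
  "\<And>\<gamma>. 0 < \<gamma> \<Longrightarrow> \<gamma> \<le> \<gamma>0 \<Longrightarrow> \<exists>a0 \<epsilon>. a0 \<ge> 0 \<and> \<epsilon> > 0 \<and> eventually (near_maximal h (K * \<gamma>) a0 \<epsilon>) sequentially"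
  by (rule eventually_near_maximal[OF h]) (rule that, assumption+)
 obtain R1 where R1: "R1 \<ge> 0" "\<And>k x. x \<in> points I \<Longrightarrow> \<bar>map_deriv I (fs k) x\<bar> \<le> exp R1"
  "\<And>x. x \<in> points I \<Longrightarrow> \<bar>map_deriv I f x\<bar> \<le> exp R1" by (rule map_deriv_uniform_bound) blast
 interpret mu: one_dim_system I r f \<mu> by (rule system_f)
 let ?L = "lyapunov_exponent I f \<mu>" and ?Lk = "\<lambda>k. lyapunov_exponent I (fs k) (\<nu> k)"
 have lim: "(\<lambda>k. ereal (\<integral>x. log_cut (fs k) A x \<partial>\<nu> k)) \<longlonglongrightarrow> ereal (\<integral>x. log_cut f A x \<partial>\<mu>)" for A
  using integral_cut_tendsto[of "\<lambda>x. x" A] by simp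
 have L: "?L = (INF A::nat. ereal (\<integral>x. log_cut f (real A) x \<partial>\<mu>))" by (rule mu.lyapunov_exponent_eq_INF)
 have Lk: "?Lk k = (INF A::nat. ereal (\<integral>x. log_cut (fs k) (real A) x \<partial>\<nu> k))" for k
  using system_fs by (rule one_dim_system.lyapunov_exponent_eq_INF)
 have "limsup ?Lk \<le> ?L" unfolding L
 proof (rule INF_greatest)
  fix A :: nat
  have "limsup ?Lk \<le> limsup (\<lambda>k. ereal (\<integral>x. log_cut (fs k) (real A) x \<partial>\<nu> k))"
   unfolding Lk by (intro Limsup_mono always_eventually allI INF_lower) auto
  also have "\<dots> = ereal (\<integral>x. log_cut f (real A) x \<partial>\<mu>)" using lim by (rule lim_imp_Limsup[rotated]) simp
  finally show "limsup ?Lk \<le> ereal (\<integral>x. log_cut f (real A) x \<partial>\<mu>)" .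
 qed
 moreover have "?L \<le> liminf ?Lk"
 proof (rule ereal_le_epsilon2)
  fix e :: real assume e: "0 < e"
  define \<gamma> where "\<gamma> = min \<gamma>0 (e / K)"
  have \<gamma>: "0 < \<gamma>" "\<gamma> \<le> \<gamma>0" "K * \<gamma> \<le> e" using K e by (auto simp: \<gamma>_def min_def field_simps)
  obtain a0 \<epsilon> where a0: "a0 \<ge> 0" and ev: "eventually (near_maximal h (K * \<gamma>) a0 \<epsilon>) sequentially"
   using K(3)[OF \<gamma>(1,2)] by blast
  \<comment> \<open>The infimum formula runs over integer truncation levels, so \<open>a0\<close> is
    rounded up.\<close>
  obtain A :: nat where A: "a0 \<le> real A" using real_arch_simple by blast
  have "?L \<le> ereal (\<integral>x. log_cut f (real A) x \<partial>\<mu>)" unfolding L by (rule INF_lower) simp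
  also have "(\<integral>x. log_cut f (real A) x \<partial>\<mu>) \<le> (\<integral>x. log_cut f a0 x \<partial>\<mu>)"
  proof (rule integral_mono)
   show "integrable \<mu> (log_cut f (real A))" "integrable \<mu> (log_cut f a0)"
    using mu.log_deriv_cut_integral_bounds(1)[OF _ R1(1) R1(3)] a0 by auto
   show "log_cut f (real A) x \<le> log_cut f a0 x" for x
    unfolding cut_eq using A by (subst ln_le_cancel_iff) (auto simp: less_max_iff_disj max.coboundedI2)
  qed
  finally have le: "?L \<le> ereal (\<integral>x. log_cut f a0 x \<partial>\<mu>)" by simp
  have "eventually (\<lambda>k. ereal (\<integral>x. log_cut (fs k) a0 x \<partial>\<nu> k) \<le> ?Lk k + ereal e) sequentially" using ev
  proof eventually_elim
   case (elim k)
   interpret expanding_system I r "fs k" "\<nu> k" using elim by (simp add: near_maximal_def)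
   have "(\<integral>x. (if a0 \<le> contraction 0 x then contraction 0 x else 0) \<partial>\<nu> k) \<le> e"
    using elim \<gamma>(3) by (auto simp: near_maximal_def)
   then have "ereal ((\<integral>x. log_deriv_cut a0 x \<partial>\<nu> k) - e) \<le> ?Lk k"
    by (intro order_trans[OF _ lyapunov_exponent_ge[OF R1(1) R1(2) a0]]) auto
   then have "ereal ((\<integral>x. log_deriv_cut a0 x \<partial>\<nu> k) - e) + ereal e \<le> ?Lk k + ereal e" by (rule add_right_mono)
   then show ?case by simp
  qed
  then have "liminf (\<lambda>k. ereal (\<integral>x. log_cut (fs k) a0 x \<partial>\<nu> k)) \<le> liminf (\<lambda>k. ?Lk k + ereal e)" by (rule Liminf_mono)
  also have "liminf (\<lambda>k. ereal (\<integral>x. log_cut (fs k) a0 x \<partial>\<nu> k)) = ereal (\<integral>x. log_cut f a0 x \<partial>\<mu>)"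
   using lim by (rule lim_imp_Liminf[rotated]) simp
  also have "liminf (\<lambda>k. ?Lk k + ereal e) = liminf ?Lk + ereal e" by (rule Liminf_add_ereal_right) auto
  finally show "?L \<le> liminf ?Lk + ereal e" using le by (rule order_trans[rotated])
 qed
 moreover have "liminf ?Lk \<le> limsup ?Lk" by (rule Liminf_le_Limsup) simp
 ultimately show ?thesis by (intro Liminf_eq_Limsup) auto
qed

end

theorem corollary1p6:
 fixes I :: one_dim and r :: real
  and f :: "complex \<Rightarrow> complex" and fs :: "nat \<Rightarrow> complex \<Rightarrow> complex"
  and \<nu> :: "nat \<Rightarrow> complex measure" and \<mu> :: "complex measure"
 assumes "r > 1"
  and "Cr_map I r f"
  and "topological_entropy (points I) f > ereal (growth_rate I f / r)"
  and "\<And>k. Cr_map I r (fs k)"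
  and "Cr_weakly_converges I r fs f"
  and "\<And>k. borel_prob_on (points I) (\<nu> k)"
  and "\<And>k. invariant_measure (fs k) (\<nu> k)"
  and "approximates_in_entropy (points I) fs f \<nu>"
  and "borel_prob_on (points I) \<mu>"
  and "weak_star_converges (points I) \<nu> \<mu>"
 shows "max_entropy_measure (points I) f \<mu> \<and>
  (\<lambda>k. lyapunov_exponent I (fs k) (\<nu> k)) \<longlonglongrightarrow> lyapunov_exponent I f \<mu>"
proof -
 interpret entropy_approximation I r f fs \<nu> \<mu> using assms by unfold_locales (auto simp: approximates_in_entropy_def)
 show ?thesis using limit_max_entropy lyapunov_limit by blast
qed

end
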